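(* Let $\Gamma$ be a split extension of $\Lambda$ by a nilpotent bimodule ${}_\Lambda E_\Lambda$. Let $(T,P)$ be a pair of modules in $\operatorname{mod}\Lambda$ with $P$ projective. Then the following statements are equivalent. (1) $(T\otimes_\Lambda \Gamma_\Gamma,\ P\otimes_\Lambda \Gamma_\Gamma)$ is a support $\tau$-tilting pair in $\operatorname{mod}\Gamma$. (2) $(T,P)$ is a support $\tau$-tilting pair in $\operatorname{mod}\Lambda$ and $$\operatorname{Hom}_\Lambda(T\otimes_\Lambda E,\tau T_\Lambda)=0=\operatorname{Hom}_\Lambda(P,T\otimes_\Lambda E).$$
   Context: All algebras are finite-dimensional basic algebras over an algebraically closed field $k$. For an algebra $\Lambda$, $\operatorname{mod}\Lambda$ is the category of finitely generated right $\Lambda$-modules, $\tau$ is the Auslander–Reiten translation, and $|M|$ is the number of pairwise non-isomorphic indecomposable direct summands of a module $M$. Split-by-nilpotent extension: $\Gamma$ is a split extension of $\Lambda$ by the nilpotent bimodule ${}_\Lambda E_\Lambda$ if there is a split surjective algebra morphism $\Gamma\to\Lambda$ whose kernel $E$ is contained in the radical of $\Gamma$. Via the splitting $\Lambda\to\Gamma$, both $\Gamma$ and $E$ are $\Lambda$-$\Lambda$-bimodules, and $-\otimes_\Lambda\Gamma$ is a functor $\operatorname{mod}\Lambda\to\operatorname{mod}\Gamma$. A module $M\in\operatorname{mod}\Lambda$ is $\tau$-rigid if $\operatorname{Hom}_\Lambda(M,\tau M)=0$. A pair $(M,P)$ in $\operatorname{mod}\Lambda$ with $P$ projective is a $\tau$-rigid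 pair if $M$ is $\tau$-rigid and $\operatorname{Hom}_\Lambda(P,M)=0$; it is a support $\tau$-tilting pair if it is a $\tau$-rigid pair and $|M|+|P|=|\Lambda|$. *)

theory Defs
  imports
    "HOL-Algebra.Algebra"
    "Jordan_Normal_Form.Missing_VectorSpace"
begin

section \<open>Finite-dimensional algebras\<close>

text \<open>
  As in \<open>HOL-Algebra.Module\<close>, the scalar multiplication of a \<open>K\<close>-algebra is the field \<open>smult\<close> of a
  module record whose ring operations are those of the algebra. The library locale \<^locale>\<open>algebra\<close>
  is restricted to commutative algebras.
\<close>

locale fd_algebra = K_vec?: vectorspace K A + alg_ring?: ring A
  for K :: "('k, 'z) ring_scheme" and A :: "('k, 'a, 'y) module_scheme" +
  assumes smult_mult_left:
      "\<lbrakk>c \<in> carrier K; x \<in> carrier A; y \<in> carrier A\<rbrakk> \<Longrightarrow>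
        (c \<odot>\<^bsub>A\<^esub> x) \<otimes>\<^bsub>A\<^esub> y = c \<odot>\<^bsub>A\<^esub> (x \<otimes>\<^bsub>A\<^esub> y)"
    and smult_mult_right:
      "\<lbrakk>c \<in> carrier K; x \<in> carrier A; y \<in> carrier A\<rbrakk> \<Longrightarrow>
        x \<otimes>\<^bsub>A\<^esub> (c \<odot>\<^bsub>A\<^esub> y) = c \<odot>\<^bsub>A\<^esub> (x \<otimes>\<^bsub>A\<^esub> y)"
    and finite_dimensional: "fin_dim"

definition algebra_hom ::
  "('k, 'z) ring_scheme \<Rightarrow> ('k, 'a, 'y) module_scheme \<Rightarrow> ('k, 'b, 'x) module_scheme \<Rightarrow> ('a \<Rightarrow> 'b) set"
  where "algebra_hom K A B =
    {h \<in> ring_hom A B. \<forall>c \<in> carrier K. \<forall>x \<in> carrier A. h (c \<odot>\<^bsub>A\<^esub> x) = c \<odot>\<^bsub>B\<^esub> h x}"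


section \<open>Right modules\<close>

text \<open>As in \<^typ>\<open>('a, 'm) module\<close>, the fields \<open>mult\<close> and \<open>one\<close> carry no meaning for modules.\<close>

record ('a, 'm) right_module = "'m ring" +
  ract :: "['m, 'a] \<Rightarrow> 'm" (infixl \<open>\<star>\<index>\<close> 70)

locale right_module = act?: ring A + grp?: abelian_group M
  for A :: "('a, 'z) ring_scheme" and M :: "('a, 'm, 'y) right_module_scheme" +
  assumes ract_closed: "\<lbrakk>x \<in> carrier M; a \<in> carrier A\<rbrakk> \<Longrightarrow> x \<star>\<^bsub>M\<^esub> a \<in> carrier M"
    and ract_add_left: "\<lbrakk>x \<in> carrier M; y \<in> carrier M; a \<in> carrier A\<rbrakk> \<Longrightarrow>
      (x \<oplus>\<^bsub>M\<^esub> y) \<star>\<^bsub>M\<^esub> a = x \<star>\<^bsub>M\<^esub> a \<oplus>\<^bsub>M\<^esub> y \<star>\<^bsub>M\<^esub> a"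
    and ract_add_right: "\<lbrakk>x \<in> carrier M; a \<in> carrier A; b \<in> carrier A\<rbrakk> \<Longrightarrow>
      x \<star>\<^bsub>M\<^esub> (a \<oplus>\<^bsub>A\<^esub> b) = x \<star>\<^bsub>M\<^esub> a \<oplus>\<^bsub>M\<^esub> x \<star>\<^bsub>M\<^esub> b"
    and ract_assoc: "\<lbrakk>x \<in> carrier M; a \<in> carrier A; b \<in> carrier A\<rbrakk> \<Longrightarrow>
      x \<star>\<^bsub>M\<^esub> (a \<otimes>\<^bsub>A\<^esub> b) = (x \<star>\<^bsub>M\<^esub> a) \<star>\<^bsub>M\<^esub> b"
    and ract_one: "x \<in> carrier M \<Longrightarrow> x \<star>\<^bsub>M\<^esub> \<one>\<^bsub>A\<^esub> = x"

definition right_submodule ::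
  "('a, 'z) ring_scheme \<Rightarrow> ('a, 'm, 'y) right_module_scheme \<Rightarrow> 'm set \<Rightarrow> bool"
  where "right_submodule A M N \<longleftrightarrow>
    subgroup N (add_monoid M) \<and> (\<forall>x \<in> N. \<forall>a \<in> carrier A. x \<star>\<^bsub>M\<^esub> a \<in> N)"

definition fg_right_module ::
  "('a, 'z) ring_scheme \<Rightarrow> ('a, 'm, 'y) right_module_scheme \<Rightarrow> bool"
  where "fg_right_module A M \<longleftrightarrow> right_module A M \<and>
    (\<exists>S. finite S \<and> S \<subseteq> carrier M \<and>
      (\<forall>x \<in> carrier M. \<exists>a \<in> S \<rightarrow> carrier A. x = (\<Oplus>\<^bsub>M\<^esub>s \<in> S. s \<star>\<^bsub>M\<^esub> a s)))"

text \<open>Homomorphisms are extensional, so that distinct elements are distinct maps on the carrier.\<close>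

definition right_hom ::
  "('a, 'z) ring_scheme \<Rightarrow> ('a, 'm, 'x) right_module_scheme \<Rightarrow> ('a, 'n, 'y) right_module_scheme
    \<Rightarrow> ('m \<Rightarrow> 'n) set"
  where "right_hom A M N =
    {f \<in> carrier M \<rightarrow>\<^sub>E carrier N.
      (\<forall>x \<in> carrier M. \<forall>y \<in> carrier M. f (x \<oplus>\<^bsub>M\<^esub> y) = f x \<oplus>\<^bsub>N\<^esub> f y) \<and>
      (\<forall>x \<in> carrier M. \<forall>a \<in> carrier A. f (x \<star>\<^bsub>M\<^esub> a) = f x \<star>\<^bsub>N\<^esub> a)}"

definition hom_zero ::
  "('a, 'z) ring_scheme \<Rightarrow> ('a, 'm, 'x) right_module_scheme \<Rightarrow> ('a, 'n, 'y) right_module_scheme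
    \<Rightarrow> bool"
  where "hom_zero A M N \<longleftrightarrow> right_hom A M N = {\<lambda>x \<in> carrier M. \<zero>\<^bsub>N\<^esub>}"

definition right_iso ::
  "('a, 'z) ring_scheme \<Rightarrow> ('a, 'm, 'x) right_module_scheme \<Rightarrow> ('a, 'n, 'y) right_module_scheme
    \<Rightarrow> bool"
  where "right_iso A M N \<longleftrightarrow> (\<exists>f \<in> right_hom A M N. bij_betw f (carrier M) (carrier N))"

definition regular_right :: "('a, 'z) ring_scheme \<Rightarrow> ('a, 'a) right_module"
  where "regular_right A =
    \<lparr>carrier = carrier A, monoid.mult = (\<otimes>\<^bsub>A\<^esub>), monoid.one = \<one>\<^bsub>A\<^esub>,
     ring.zero = \<zero>\<^bsub>A\<^esub>, ring.add = (\<oplus>\<^bsub>A\<^esub>), ract = (\<otimes>\<^bsub>A\<^esub>)\<rparr>"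


subsection \<open>Direct summands\<close>

definition direct_decomposition ::
  "('a, 'z) ring_scheme \<Rightarrow> ('a, 'm, 'y) right_module_scheme \<Rightarrow> 'm set \<Rightarrow> 'm set \<Rightarrow> bool"
  where "direct_decomposition A M U V \<longleftrightarrow>
    right_submodule A M U \<and> right_submodule A M V \<and>
    U \<inter> V = {\<zero>\<^bsub>M\<^esub>} \<and> U <+>\<^bsub>M\<^esub> V = carrier M"

definition indecomposable ::
  "('a, 'z) ring_scheme \<Rightarrow> ('a, 'm, 'y) right_module_scheme \<Rightarrow> bool"
  where "indecomposable A M \<longleftrightarrow> carrier M \<noteq> {\<zero>\<^bsub>M\<^esub>} \<and>
    (\<forall>U V. direct_decomposition A M U V \<longrightarrow> U = {\<zero>\<^bsub>M\<^esub>} \<or> V = {\<zero>\<^bsub>M\<^esub>})"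

definition indecomposable_summands ::
  "('a, 'z) ring_scheme \<Rightarrow> ('a, 'm, 'y) right_module_scheme \<Rightarrow> 'm set set"
  where "indecomposable_summands A M =
    {U. (\<exists>V. direct_decomposition A M U V) \<and> indecomposable A (M\<lparr>carrier := U\<rparr>)}"

text \<open>
  The number \<open>|M|\<close> of isomorphism classes of indecomposable direct summands of \<open>M\<close>. For finitely
  generated modules over a finite-dimensional algebra the quotient is finite by Krull--Schmidt.
\<close>

definition num_summands ::
  "('a, 'z) ring_scheme \<Rightarrow> ('a, 'm, 'y) right_module_scheme \<Rightarrow> nat"
  where "num_summands A M =
    card (indecomposable_summands A M //
      {(U, V). U \<in> indecomposable_summands A M \<and> V \<in> indecomposable_summands A M \<and>
        right_iso A (M\<lparr>carrier := U\<rparr>) (M\<lparr>carrier := V\<rparr>)})"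


subsection \<open>Basic algebras and the radical\<close>

definition idempotent_elem :: "('a, 'z) ring_scheme \<Rightarrow> 'a \<Rightarrow> bool"
  where "idempotent_elem A e \<longleftrightarrow> e \<in> carrier A \<and> e \<otimes>\<^bsub>A\<^esub> e = e"

definition orthogonal_elems :: "('a, 'z) ring_scheme \<Rightarrow> 'a \<Rightarrow> 'a \<Rightarrow> bool"
  where "orthogonal_elems A e f \<longleftrightarrow> e \<otimes>\<^bsub>A\<^esub> f = \<zero>\<^bsub>A\<^esub> \<and> f \<otimes>\<^bsub>A\<^esub> e = \<zero>\<^bsub>A\<^esub>"

definition primitive_idempotent :: "('a, 'z) ring_scheme \<Rightarrow> 'a \<Rightarrow> bool"
  where "primitive_idempotent A e \<longleftrightarrow> idempotent_elem A e \<and> e \<noteq> \<zero>\<^bsub>A\<^esub> \<and>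
    (\<forall>f g. idempotent_elem A f \<and> idempotent_elem A g \<and> orthogonal_elems A f g \<and> e = f \<oplus>\<^bsub>A\<^esub> g \<longrightarrow>
      f = \<zero>\<^bsub>A\<^esub> \<or> g = \<zero>\<^bsub>A\<^esub>)"

definition complete_primitive_idempotents :: "('a, 'z) ring_scheme \<Rightarrow> 'a set \<Rightarrow> bool"
  where "complete_primitive_idempotents A S \<longleftrightarrow> finite S \<and>
    (\<forall>e \<in> S. primitive_idempotent A e) \<and>
    (\<forall>e \<in> S. \<forall>f \<in> S. e \<noteq> f \<longrightarrow> orthogonal_elems A e f) \<and>
    (\<Oplus>\<^bsub>A\<^esub>e \<in> S. e) = \<one>\<^bsub>A\<^esub>"

definition principal_right :: "('a, 'z) ring_scheme \<Rightarrow> 'a \<Rightarrow> ('a, 'a) right_module"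
  where "principal_right A e = (regular_right A)\<lparr>carrier := (\<lambda>a. e \<otimes>\<^bsub>A\<^esub> a) ` carrier A\<rparr>"

definition basic_algebra :: "('a, 'z) ring_scheme \<Rightarrow> bool"
  where "basic_algebra A \<longleftrightarrow> (\<exists>S. complete_primitive_idempotents A S \<and>
    (\<forall>e \<in> S. \<forall>f \<in> S. e \<noteq> f \<longrightarrow> \<not> right_iso A (principal_right A e) (principal_right A f)))"

definition maximal_right_ideal :: "('a, 'z) ring_scheme \<Rightarrow> 'a set \<Rightarrow> bool"
  where "maximal_right_ideal A I \<longleftrightarrow>
    right_submodule A (regular_right A) I \<and> I \<noteq> carrier A \<and>
    (\<forall>J. right_submodule A (regular_right A) J \<and> I \<subseteq> J \<longrightarrow> J = I \<or> J = carrier A)"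

definition jacobson_radical :: "('a, 'z) ring_scheme \<Rightarrow> 'a set"
  where "jacobson_radical A = carrier A \<inter> \<Inter>{I. maximal_right_ideal A I}"


section \<open>Projective modules and minimal projective presentations\<close>

text \<open>
  Every finitely generated right \<open>A\<close>-module is isomorphic to a quotient of some \<open>A\<^sup>n\<close>, hence to a
  module whose elements are sets of functions \<^typ>\<open>nat \<Rightarrow> 'a\<close>. Quantifying over all objects of
  \<open>mod A\<close> therefore amounts to quantifying over all finitely generated modules on this type.
\<close>

type_synonym 'a fg_elem = "(nat \<Rightarrow> 'a) set"
type_synonym 'a fg_mod = "('a, 'a fg_elem) right_module"

definition projective ::
  "('a, 'z) ring_scheme \<Rightarrow> ('a, 'm, 'y) right_module_scheme \<Rightarrow> bool"
  where "projective A P \<longleftrightarrow> fg_right_module A P \<and>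
    (\<forall>(M :: 'a fg_mod) (N :: 'a fg_mod) g f.
      fg_right_module A M \<and> fg_right_module A N \<and>
      g \<in> right_hom A M N \<and> g ` carrier M = carrier N \<and> f \<in> right_hom A P N \<longrightarrow>
      (\<exists>h \<in> right_hom A P M. \<forall>x \<in> carrier P. g (h x) = f x))"

definition superfluous ::
  "('a, 'z) ring_scheme \<Rightarrow> ('a, 'm, 'y) right_module_scheme \<Rightarrow> 'm set \<Rightarrow> bool"
  where "superfluous A M L \<longleftrightarrow> right_submodule A M L \<and>
    (\<forall>U. right_submodule A M U \<and> L <+>\<^bsub>M\<^esub> U = carrier M \<longrightarrow> U = carrier M)"

definition projective_cover ::
  "('a, 'z) ring_scheme \<Rightarrow> ('a, 'p, 'x) right_module_scheme \<Rightarrow> ('a, 'm, 'y) right_module_scheme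
    \<Rightarrow> ('p \<Rightarrow> 'm) \<Rightarrow> bool"
  where "projective_cover A P M p \<longleftrightarrow>
    projective A P \<and> p \<in> right_hom A P M \<and> p ` carrier P = carrier M \<and>
    superfluous A P (a_kernel P M p)"

text \<open>\<open>P1 \<rightarrow> P0 \<rightarrow> M \<rightarrow> 0\<close> with maps \<open>p1\<close> and \<open>p0\<close>.\<close>

definition minimal_projective_presentation ::
  "('a, 'z) ring_scheme \<Rightarrow> ('a, 'm, 'y) right_module_scheme
    \<Rightarrow> 'a fg_mod \<Rightarrow> ('a fg_elem \<Rightarrow> 'a fg_elem) \<Rightarrow> 'a fg_mod \<Rightarrow> ('a fg_elem \<Rightarrow> 'm) \<Rightarrow> bool"
  where "minimal_projective_presentation A M P1 p1 P0 p0 \<longleftrightarrow>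
    projective_cover A P0 M p0 \<and>
    projective_cover A P1 (P0\<lparr>carrier := a_kernel P0 M p0\<rparr>) p1"


section \<open>The Auslander--Reiten translation\<close>

text \<open>The left \<open>A\<close>-module \<open>Hom\<^sub>A(P, A)\<close>.\<close>

definition hom_to_regular ::
  "('a, 'z) ring_scheme \<Rightarrow> ('a, 'm, 'y) right_module_scheme \<Rightarrow> ('a, 'm \<Rightarrow> 'a) module"
  where "hom_to_regular A P =
    \<lparr>carrier = right_hom A P (regular_right A), monoid.mult = undefined, monoid.one = undefined,
     ring.zero = (\<lambda>x \<in> carrier P. \<zero>\<^bsub>A\<^esub>), ring.add = (\<lambda>f g. \<lambda>x \<in> carrier P. f x \<oplus>\<^bsub>A\<^esub> g x),
     smult = (\<lambda>a f. \<lambda>x \<in> carrier P. a \<otimes>\<^bsub>A\<^esub> f x)\<rparr>"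

definition left_quotient :: "('a, 'm, 'y) module_scheme \<Rightarrow> 'm set \<Rightarrow> ('a, 'm set) module"
  where "left_quotient W N =
    \<lparr>carrier = a_rcosets\<^bsub>W\<^esub> N, monoid.mult = undefined, monoid.one = undefined, ring.zero = N,
     ring.add = (\<lambda>C D. C <+>\<^bsub>W\<^esub> D), smult = (\<lambda>a C. \<Union>x \<in> C. N +>\<^bsub>W\<^esub> (a \<odot>\<^bsub>W\<^esub> x))\<rparr>"

text \<open>The cokernel of \<open>Hom\<^sub>A(p1, A) : Hom\<^sub>A(P0, A) \<rightarrow> Hom\<^sub>A(P1, A)\<close>.\<close>

definition transpose_of ::
  "('a, 'z) ring_scheme \<Rightarrow> ('a, 'm, 'x) right_module_scheme \<Rightarrow> ('m \<Rightarrow> 'n)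
    \<Rightarrow> ('a, 'n, 'y) right_module_scheme \<Rightarrow> ('a, ('m \<Rightarrow> 'a) set) module"
  where "transpose_of A P1 p1 P0 =
    left_quotient (hom_to_regular A P1)
      ((\<lambda>f. compose (carrier P1) f p1) ` right_hom A P0 (regular_right A))"

text \<open>
  The standard duality \<open>D = Hom\<^sub>K(-, K)\<close> from left to right \<open>A\<close>-modules. The scalar \<open>c\<close> of \<open>K\<close>
  acts on a left \<open>A\<close>-module as the element \<open>c \<cdot> 1\<close> of \<open>A\<close>.
\<close>

definition dual_module ::
  "('k, 'w) ring_scheme \<Rightarrow> ('k, 'a, 'z) module_scheme \<Rightarrow> ('a, 'm, 'y) module_scheme
    \<Rightarrow> ('a, 'm \<Rightarrow> 'k) right_module"
  where "dual_module K A W =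
    \<lparr>carrier = {f \<in> carrier W \<rightarrow>\<^sub>E carrier K.
        (\<forall>x \<in> carrier W. \<forall>y \<in> carrier W. f (x \<oplus>\<^bsub>W\<^esub> y) = f x \<oplus>\<^bsub>K\<^esub> f y) \<and>
        (\<forall>c \<in> carrier K. \<forall>x \<in> carrier W. f ((c \<odot>\<^bsub>A\<^esub> \<one>\<^bsub>A\<^esub>) \<odot>\<^bsub>W\<^esub> x) = c \<otimes>\<^bsub>K\<^esub> f x)},
     monoid.mult = undefined, monoid.one = undefined,
     ring.zero = (\<lambda>x \<in> carrier W. \<zero>\<^bsub>K\<^esub>), ring.add = (\<lambda>f g. \<lambda>x \<in> carrier W. f x \<oplus>\<^bsub>K\<^esub> g x),
     ract = (\<lambda>f a. \<lambda>x \<in> carrier W. f (a \<odot>\<^bsub>W\<^esub> x))\<rparr>"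

text \<open>
  \<open>\<tau> M = D Tr M\<close>, computed from a chosen minimal projective presentation; different choices give
  isomorphic modules.
\<close>

definition tau ::
  "('k, 'w) ring_scheme \<Rightarrow> ('k, 'a, 'z) module_scheme \<Rightarrow> ('a, 'm, 'y) right_module_scheme
    \<Rightarrow> ('a, ('a fg_elem \<Rightarrow> 'a) set \<Rightarrow> 'k) right_module"
  where "tau K A M =
    (let (P1, p1, P0, p0) =
       (SOME (P1, p1, P0, p0). minimal_projective_presentation A M P1 p1 P0 p0)
     in dual_module K A (transpose_of A P1 p1 P0))"

definition tau_rigid ::
  "('k, 'w) ring_scheme \<Rightarrow> ('k, 'a, 'z) module_scheme \<Rightarrow> ('a, 'm, 'y) right_module_scheme \<Rightarrow> bool"
  where "tau_rigid K A M \<longleftrightarrow> fg_right_module A M \<and> hom_zero A M (tau K A M)"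

definition tau_rigid_pair ::
  "('k, 'w) ring_scheme \<Rightarrow> ('k, 'a, 'z) module_scheme \<Rightarrow> ('a, 'm, 'x) right_module_scheme
    \<Rightarrow> ('a, 'p, 'y) right_module_scheme \<Rightarrow> bool"
  where "tau_rigid_pair K A M P \<longleftrightarrow> projective A P \<and> tau_rigid K A M \<and> hom_zero A P M"

definition support_tau_tilting_pair ::
  "('k, 'w) ring_scheme \<Rightarrow> ('k, 'a, 'z) module_scheme \<Rightarrow> ('a, 'm, 'x) right_module_scheme
    \<Rightarrow> ('a, 'p, 'y) right_module_scheme \<Rightarrow> bool"
  where "support_tau_tilting_pair K A M P \<longleftrightarrow> tau_rigid_pair K A M P \<and>
    num_summands A M + num_summands A P = num_summands A (regular_right A)"


section \<open>Tensor products\<close>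

text \<open>A bimodule is a right module over the second ring together with a left action of the first.\<close>

record ('b, 'x, 'a) bimodule = "('b, 'x) right_module" +
  lact :: "['a, 'x] \<Rightarrow> 'x"

definition tensor_relators ::
  "('a, 'z) ring_scheme \<Rightarrow> ('a, 'm, 'y) right_module_scheme \<Rightarrow> ('b, 'x, 'a, 'w) bimodule_scheme
    \<Rightarrow> (('m \<times> 'x) \<Rightarrow>\<^sub>0 int) set"
  where "tensor_relators A M B =
    {frag_of (m \<oplus>\<^bsub>M\<^esub> m', x) - frag_of (m, x) - frag_of (m', x) | m m' x.
       m \<in> carrier M \<and> m' \<in> carrier M \<and> x \<in> carrier B} \<union>
    {frag_of (m, x \<oplus>\<^bsub>B\<^esub> x') - frag_of (m, x) - frag_of (m, x') | m x x'.
       m \<in> carrier M \<and> x \<in> carrier B \<and> x' \<in> carrier B} \<union>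
    {frag_of (m \<star>\<^bsub>M\<^esub> a, x) - frag_of (m, lact B a x) | m a x.
       m \<in> carrier M \<and> a \<in> carrier A \<and> x \<in> carrier B}"

text \<open>
  The right module \<open>M \<otimes>\<^sub>A B\<close>: the free abelian group on pairs modulo the balanced biadditivity
  relations, where \<open>b\<close> acts by \<open>(m \<otimes> x) b = m \<otimes> (x b)\<close>.
\<close>

definition tensor ::
  "('a, 'z) ring_scheme \<Rightarrow> ('a, 'm, 'y) right_module_scheme \<Rightarrow> ('b, 'x, 'a, 'w) bimodule_scheme
    \<Rightarrow> ('b, (('m \<times> 'x) \<Rightarrow>\<^sub>0 int) set) right_module"
  where "tensor A M B =
    (let F = free_Abelian_group (carrier M \<times> carrier B);
         R = generate F (tensor_relators A M B);
         Q = F Mod R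
     in \<lparr>carrier = carrier Q, monoid.mult = undefined, monoid.one = undefined,
         ring.zero = monoid.one Q, ring.add = monoid.mult Q,
         ract = (\<lambda>C b. \<Union>c \<in> C. R #>\<^bsub>F\<^esub> frag_extend (\<lambda>(m, x). frag_of (m, x \<star>\<^bsub>B\<^esub> b)) c)\<rparr>)"


section \<open>Split extensions\<close>

text \<open>
  \<open>\<pi> : G \<rightarrow> L\<close> is the split surjection, \<open>\<sigma>\<close> the chosen splitting and the kernel of \<open>\<pi>\<close> is the
  bimodule \<open>E\<close>.
\<close>

definition split_extension ::
  "('k, 'z) ring_scheme \<Rightarrow> ('k, 'a, 'y) module_scheme \<Rightarrow> ('k, 'g, 'x) module_scheme
    \<Rightarrow> ('g \<Rightarrow> 'a) \<Rightarrow> ('a \<Rightarrow> 'g) \<Rightarrow> bool"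
  where "split_extension K L G \<pi> \<sigma> \<longleftrightarrow>
    \<pi> \<in> algebra_hom K G L \<and> \<pi> ` carrier G = carrier L \<and>
    \<sigma> \<in> algebra_hom K L G \<and> (\<forall>a \<in> carrier L. \<pi> (\<sigma> a) = a) \<and>
    a_kernel G L \<pi> \<subseteq> jacobson_radical G"

text \<open>\<open>G\<close> as an \<open>L\<close>-\<open>G\<close>-bimodule and the kernel of \<open>\<pi>\<close> as an \<open>L\<close>-\<open>L\<close>-bimodule.\<close>

definition extension_bimodule ::
  "('g, 'x) ring_scheme \<Rightarrow> ('a \<Rightarrow> 'g) \<Rightarrow> ('g, 'g, 'a) bimodule"
  where "extension_bimodule G \<sigma> =
    \<lparr>carrier = carrier G, monoid.mult = undefined, monoid.one = undefined,
     ring.zero = \<zero>\<^bsub>G\<^esub>, ring.add = (\<oplus>\<^bsub>G\<^esub>),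
     ract = (\<otimes>\<^bsub>G\<^esub>), lact = (\<lambda>a x. \<sigma> a \<otimes>\<^bsub>G\<^esub> x)\<rparr>"

definition kernel_bimodule ::
  "('a, 'y) ring_scheme \<Rightarrow> ('g, 'x) ring_scheme \<Rightarrow> ('g \<Rightarrow> 'a) \<Rightarrow> ('a \<Rightarrow> 'g) \<Rightarrow> ('a, 'g, 'a) bimodule"
  where "kernel_bimodule L G \<pi> \<sigma> =
    \<lparr>carrier = a_kernel G L \<pi>, monoid.mult = undefined, monoid.one = undefined,
     ring.zero = \<zero>\<^bsub>G\<^esub>, ring.add = (\<oplus>\<^bsub>G\<^esub>),
     ract = (\<lambda>x a. x \<otimes>\<^bsub>G\<^esub> \<sigma> a), lact = (\<lambda>a x. \<sigma> a \<otimes>\<^bsub>G\<^esub> x)\<rparr>"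

end

theory Submission
  imports Defs
begin

text \<open>
  Everything is reduced to factorizations. Let \<open>P1 \<rightarrow> P0 \<rightarrow> M \<rightarrow> 0\<close> be a minimal projective presentation
  with first map \<open>p1\<close>. Then \<open>Hom(N, \<tau> M) = 0\<close> if and only if every map \<open>P1 \<rightarrow> N\<close> factors through \<open>p1\<close>:
  \<open>Hom(N, D Tr M)\<close> is dual to \<open>N \<otimes> Tr M\<close>, the cokernel of \<open>Hom(P0, N) \<rightarrow> Hom(P1, N)\<close>. Induction
  \<open>- \<otimes> \<Gamma>\<close> preserves minimal projective presentations, by Nakayama's lemma for \<open>E \<subseteq> rad \<Gamma>\<close>, and is
  left adjoint to restriction along \<open>\<sigma>\<close>. So \<open>Hom(T \<otimes> \<Gamma>, \<tau> (T \<otimes> \<Gamma>)) = 0\<close> says that all maps from \<open>P1\<close>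
  to \<open>T \<otimes> \<Gamma>\<close>, restricted to \<open>\<Lambda>\<close>, factor through \<open>p1\<close>, and this restriction is \<open>T \<oplus> T \<otimes> E\<close>. The same
  adjunction handles \<open>Hom(P \<otimes> \<Gamma>, T \<otimes> \<Gamma>)\<close>. Finally \<open>- \<otimes> \<Gamma>\<close> induces a bijection between the isomorphism
  classes of indecomposable summands of \<open>M\<close> and of \<open>M \<otimes> \<Gamma>\<close>: an endomorphism of \<open>M \<otimes> \<Gamma>\<close> that is the
  identity modulo \<open>E\<close> is invertible, so idempotents lift up to isomorphism of their images.
\<close>

section \<open>Right modules and their homomorphisms\<close>

text \<open>The definitions tie modules to types: \<open>projective\<close> tests lifting only
  against modules of type \<open>'a fg_mod\<close>, and \<open>tau\<close> is computed from a
  presentation that \<open>SOME\<close> picks on that type, while \<open>ind P0\<close> and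
  \<open>ind P1\<close> live on tensor types. Two devices remove the tie. A finite dual basis
  characterizes projectivity without mentioning test modules, so it survives induction and gives
  lifting against surjections of any type. Comparison of minimal presentations then lets
  \<open>Hom(N, \<tau> M) = 0\<close> be tested on any presentation of any type; the test only
  speaks of maps out of \<open>P1\<close> and \<open>P0\<close>, which is what an adjunction can
  transport.

  Dimension enters through \<open>length_function\<close>, a number that grows strictly with
  submodules. It yields finite generation of submodules, maximal submodules and the injectivity of
  surjective endomorphisms; the last upgrades Nakayama's lemma from surjective to invertible.

  The splitting is used twice: \<sigma> makes every \<Gamma>-module a \<Lambda>-module, and
  \<open>g - \<sigma> (\<pi> g)\<close> is a \<Lambda>-bimodule projection of \<Gamma> onto
  \<open>E\<close>, the source of the two conditions on \<open>T \<otimes> E\<close>.\<close>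

context right_module
begin

lemma zero_ract: "a \<in> carrier A \<Longrightarrow> \<zero>\<^bsub>M\<^esub> \<star>\<^bsub>M\<^esub> a = \<zero>\<^bsub>M\<^esub>"
  using ract_add_left[of "\<zero>\<^bsub>M\<^esub>" "\<zero>\<^bsub>M\<^esub>" a] ract_closed[of "\<zero>\<^bsub>M\<^esub>" a]
  by (metis grp.zero_closed grp.l_zero grp.add.l_cancel_one)

lemma ract_zero: "x \<in> carrier M \<Longrightarrow> x \<star>\<^bsub>M\<^esub> \<zero>\<^bsub>A\<^esub> = \<zero>\<^bsub>M\<^esub>"
  using ract_add_right[of x "\<zero>\<^bsub>A\<^esub>" "\<zero>\<^bsub>A\<^esub>"] ract_closed[of x "\<zero>\<^bsub>A\<^esub>"]
  by (metis act.zero_closed act.l_zero grp.add.l_cancel_one)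

lemma ract_minus: "\<lbrakk>x \<in> carrier M; a \<in> carrier A\<rbrakk> \<Longrightarrow> x \<star>\<^bsub>M\<^esub> (\<ominus>\<^bsub>A\<^esub> a) = \<ominus>\<^bsub>M\<^esub> (x \<star>\<^bsub>M\<^esub> a)"
  by (metis act.a_inv_closed act.l_neg grp.minus_equality ract_add_right ract_closed ract_zero)

lemma minus_ract: "\<lbrakk>x \<in> carrier M; a \<in> carrier A\<rbrakk> \<Longrightarrow> (\<ominus>\<^bsub>M\<^esub> x) \<star>\<^bsub>M\<^esub> a = \<ominus>\<^bsub>M\<^esub> (x \<star>\<^bsub>M\<^esub> a)"
  by (metis grp.a_inv_closed grp.l_neg grp.minus_equality ract_add_left ract_closed zero_ract)

text \<open>Negation is the action of a ring element, which lets \<open>right_submoduleI\<close>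
  omit closure under negation.\<close>

lemma a_inv_eq_ract: "x \<in> carrier M \<Longrightarrow> \<ominus>\<^bsub>M\<^esub> x = x \<star>\<^bsub>M\<^esub> (\<ominus>\<^bsub>A\<^esub> \<one>\<^bsub>A\<^esub>)"
  by (simp add: ract_minus ract_one)

lemma finsum_ract:
  assumes "finite S" "f \<in> S \<rightarrow> carrier M" "a \<in> carrier A"
  shows "(\<Oplus>\<^bsub>M\<^esub>s \<in> S. f s) \<star>\<^bsub>M\<^esub> a = (\<Oplus>\<^bsub>M\<^esub>s \<in> S. f s \<star>\<^bsub>M\<^esub> a)"
  using assms
proof (induction S rule: finite_induct)
  case (insert s S)
  then have "f \<in> S \<rightarrow> carrier M" "f s \<in> carrier M" "(\<lambda>s. f s \<star>\<^bsub>M\<^esub> a) \<in> S \<rightarrow> carrier M"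
    by (auto intro: ract_closed)
  then show ?case
    using insert by (simp add: ract_add_left ract_closed)
qed (simp add: zero_ract)

end

section \<open>Differences and finite sums in abelian groups\<close>

lemma (in abelian_group) minus_eq_zero_iff:
  "\<lbrakk>x \<in> carrier G; y \<in> carrier G\<rbrakk> \<Longrightarrow> x \<ominus> y = \<zero> \<longleftrightarrow> x = y"
  by (metis a_minus_def add.inv_closed l_neg minus_equality minus_minus r_neg)

lemma (in abelian_group) finsum_eq_single:
  assumes "finite I" "j \<in> I" "f j \<in> carrier G" "\<And>i. \<lbrakk>i \<in> I; i \<noteq> j\<rbrakk> \<Longrightarrow> f i = \<zero>"
  shows "(\<Oplus>i\<in>I. f i) = f j"
proof -
  have f: "f \<in> I - {j} \<rightarrow> carrier G"
    using assms(4) by auto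
  have "(\<Oplus>i\<in>I. f i) = (\<Oplus>i\<in>insert j (I - {j}). f i)"
    using assms(2) by (simp add: insert_absorb)
  also have "\<dots> = f j \<oplus> (\<Oplus>i\<in>I - {j}. f i)"
    using assms(1,3) f by (subst finsum_insert) auto
  also have "(\<Oplus>i\<in>I - {j}. f i) = (\<Oplus>i\<in>I - {j}. \<zero>)"
    using assms(4) by (intro finsum_cong') auto
  finally show ?thesis
    using assms(3) by simp
qed

lemma (in abelian_group) finsum_swap:
  assumes "finite I" "finite J" "\<And>i j. \<lbrakk>i \<in> I; j \<in> J\<rbrakk> \<Longrightarrow> f i j \<in> carrier G"
  shows "(\<Oplus>i\<in>I. \<Oplus>j\<in>J. f i j) = (\<Oplus>j\<in>J. \<Oplus>i\<in>I. f i j)"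
  using assms(1,3)
proof (induction I rule: finite_induct)
  case (insert i I)
  have "(\<Oplus>k\<in>insert i I. \<Oplus>j\<in>J. f k j) = (\<Oplus>j\<in>J. f i j) \<oplus> (\<Oplus>j\<in>J. \<Oplus>k\<in>I. f k j)"
    using insert by (subst finsum_insert) (auto intro!: finsum_closed)
  also have "\<dots> = (\<Oplus>j\<in>J. f i j \<oplus> (\<Oplus>k\<in>I. f k j))"
    using insert assms(2) by (intro finsum_addf[symmetric]) (auto intro!: finsum_closed)
  also have "\<dots> = (\<Oplus>j\<in>J. \<Oplus>k\<in>insert i I. f k j)"
    using insert by (intro finsum_cong') (auto intro!: finsum_closed add.m_closed)
  finally show ?case .
qed (use assms(2) in simp)

subsection \<open>Submodules\<close>

lemma right_submoduleI:
  assumes "right_module A M" "U \<subseteq> carrier M" "\<zero>\<^bsub>M\<^esub> \<in> U"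
    "\<And>x y. \<lbrakk>x \<in> U; y \<in> U\<rbrakk> \<Longrightarrow> x \<oplus>\<^bsub>M\<^esub> y \<in> U"
    "\<And>x a. \<lbrakk>x \<in> U; a \<in> carrier A\<rbrakk> \<Longrightarrow> x \<star>\<^bsub>M\<^esub> a \<in> U"
  shows "right_submodule A M U"
proof -
  interpret right_module A M by fact
  have "\<ominus>\<^bsub>M\<^esub> x \<in> U" if "x \<in> U" for x
    using that assms(2) assms(5)[OF that, of "\<ominus>\<^bsub>A\<^esub> \<one>\<^bsub>A\<^esub>"] a_inv_eq_ract[of x] by auto
  then have "subgroup U (add_monoid M)"
    by (intro grp.add.subgroupI) (use assms in \<open>auto simp: a_inv_def\<close>)
  then show ?thesis
    using assms(5) by (simp add: right_submodule_def)
qed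

lemma right_submodule_subset: "right_submodule A M U \<Longrightarrow> U \<subseteq> carrier M"
  by (force simp: right_submodule_def dest: subgroup.subset)

lemma right_submodule_zero: "right_submodule A M U \<Longrightarrow> \<zero>\<^bsub>M\<^esub> \<in> U"
  by (auto simp: right_submodule_def dest: subgroup.one_closed)

lemma right_submodule_add:
  "\<lbrakk>right_submodule A M U; x \<in> U; y \<in> U\<rbrakk> \<Longrightarrow> x \<oplus>\<^bsub>M\<^esub> y \<in> U"
  by (auto simp: right_submodule_def dest: subgroup.m_closed)

lemma right_submodule_ract:
  "\<lbrakk>right_submodule A M U; x \<in> U; a \<in> carrier A\<rbrakk> \<Longrightarrow> x \<star>\<^bsub>M\<^esub> a \<in> U"
  by (auto simp: right_submodule_def)

lemma right_submodule_a_inv: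
  "\<lbrakk>right_submodule A M U; x \<in> U\<rbrakk> \<Longrightarrow> \<ominus>\<^bsub>M\<^esub> x \<in> U"
  by (auto simp: right_submodule_def a_inv_def dest: subgroup.m_inv_closed)

lemma right_submodule_minus:
  "\<lbrakk>right_submodule A M U; x \<in> U; y \<in> U\<rbrakk> \<Longrightarrow> x \<ominus>\<^bsub>M\<^esub> y \<in> U"
  by (simp add: a_minus_def right_submodule_add right_submodule_a_inv)

lemma right_submodule_finsum:
  assumes "right_module A M" "right_submodule A M U" "f \<in> S \<rightarrow> U"
  shows "(\<Oplus>\<^bsub>M\<^esub>s \<in> S. f s) \<in> U"
  using assms(3)
proof (induction S rule: infinite_finite_induct)
  case (insert s S)
  interpret right_module A M by fact
  have "f \<in> S \<rightarrow> carrier M" "f s \<in> carrier M"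
    using insert right_submodule_subset[OF assms(2)] by auto
  then show ?case
    using insert by (auto intro: right_submodule_add[OF assms(2)])
next
  \<comment> \<open>A sum over an infinite index set has the default value zero, which lies in every
    submodule.\<close>
  case (infinite S)
  interpret right_module A M by fact
  show ?case
    using infinite by (simp add: finsum_def finprod_def right_submodule_zero[OF assms(2)])
next
  case empty
  interpret right_module A M by fact
  show ?case
    by (simp add: right_submodule_zero[OF assms(2)])
qed

text \<open>Submodules are kept as the same record with a smaller carrier, so the operations agree
  literally and every inclusion is the identity function.\<close>

lemma right_module_submodule:
  assumes "right_module A M" "right_submodule A M U"
  shows "right_module A (M\<lparr>carrier := U\<rparr>)"
proof -
  interpret right_module A M by fact
  have U: "x \<in> carrier M" if "x \<in> U" for x
    using that right_submodule_subset[OF assms(2)] by blast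
  have "abelian_group (M\<lparr>carrier := U\<rparr>)"
  proof (rule abelian_groupI)
    fix x assume "x \<in> carrier (M\<lparr>carrier := U\<rparr>)"
    then show "\<exists>y\<in>carrier (M\<lparr>carrier := U\<rparr>). y \<oplus>\<^bsub>M\<lparr>carrier := U\<rparr>\<^esub> x = \<zero>\<^bsub>M\<lparr>carrier := U\<rparr>\<^esub>"
      using U right_submodule_a_inv[OF assms(2)] grp.l_neg by auto
  qed (use U right_submodule_add[OF assms(2)] right_submodule_zero[OF assms(2)] in
      \<open>auto simp: grp.a_ac\<close>)
  then show ?thesis
    by (intro right_module.intro right_module_axioms.intro)
      (use U right_submodule_ract[OF assms(2)] in
        \<open>auto simp: act.ring_axioms ract_add_left ract_add_right ract_assoc ract_one\<close>)
qed

text \<open>Moves questions about submodules of a submodule into the ambient module, where the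
  length functions live.\<close>

lemma right_submodule_restrict_iff:
  assumes "right_module A M" "right_submodule A M U"
  shows "right_submodule A (M\<lparr>carrier := U\<rparr>) V \<longleftrightarrow> right_submodule A M V \<and> V \<subseteq> U"
proof (intro iffI conjI)
  assume V: "right_submodule A (M\<lparr>carrier := U\<rparr>) V"
  show "V \<subseteq> U"
    using right_submodule_subset[OF V] by simp
  then show "right_submodule A M V"
    using right_submodule_subset[OF assms(2)] right_submodule_zero[OF V]
      right_submodule_add[OF V] right_submodule_ract[OF V]
    by (intro right_submoduleI[OF assms(1)]) auto
next
  assume "right_submodule A M V \<and> V \<subseteq> U"
  then show "right_submodule A (M\<lparr>carrier := U\<rparr>) V"
    by (intro right_submoduleI right_module_submodule assms)
      (auto intro: right_submodule_zero right_submodule_add right_submodule_ract)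
qed

lemma right_submodule_carrier:
  assumes "right_module A M"
  shows "right_submodule A M (carrier M)"
proof -
  interpret right_module A M by fact
  show ?thesis
    by (intro right_submoduleI assms) (auto simp: ract_closed)
qed

lemma right_submodule_zero_set:
  assumes "right_module A M"
  shows "right_submodule A M {\<zero>\<^bsub>M\<^esub>}"
proof -
  interpret right_module A M by fact
  show ?thesis
    by (intro right_submoduleI assms) (auto simp: zero_ract)
qed

lemma set_add_iff: "x \<in> U <+>\<^bsub>M\<^esub> V \<longleftrightarrow> (\<exists>u \<in> U. \<exists>v \<in> V. x = u \<oplus>\<^bsub>M\<^esub> v)"
  by (auto simp: set_add_def')

lemma right_submodule_set_add:
  assumes "right_module A M" "right_submodule A M U" "right_submodule A M V"
  shows "right_submodule A M (U <+>\<^bsub>M\<^esub> V)"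
proof -
  interpret right_module A M by fact
  have U: "x \<in> carrier M" if "x \<in> U" for x
    using that right_submodule_subset[OF assms(2)] by blast
  have V: "x \<in> carrier M" if "x \<in> V" for x
    using that right_submodule_subset[OF assms(3)] by blast
  show ?thesis
  proof (rule right_submoduleI[OF assms(1)])
    show "U <+>\<^bsub>M\<^esub> V \<subseteq> carrier M"
      by (auto simp: set_add_iff U V)
    show "\<zero>\<^bsub>M\<^esub> \<in> U <+>\<^bsub>M\<^esub> V"
      using right_submodule_zero[OF assms(2)] right_submodule_zero[OF assms(3)]
      by (force simp: set_add_iff)
  next
    fix x y assume "x \<in> U <+>\<^bsub>M\<^esub> V" "y \<in> U <+>\<^bsub>M\<^esub> V"
    then obtain u v u' v' where uv: "u \<in> U" "v \<in> V" "u' \<in> U" "v' \<in> V"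
        "x = u \<oplus>\<^bsub>M\<^esub> v" "y = u' \<oplus>\<^bsub>M\<^esub> v'"
      by (auto simp: set_add_iff)
    then have "x \<oplus>\<^bsub>M\<^esub> y = (u \<oplus>\<^bsub>M\<^esub> u') \<oplus>\<^bsub>M\<^esub> (v \<oplus>\<^bsub>M\<^esub> v')"
      by (simp add: U V grp.add.m_ac)
    then show "x \<oplus>\<^bsub>M\<^esub> y \<in> U <+>\<^bsub>M\<^esub> V"
      using right_submodule_add[OF assms(2) uv(1,3)] right_submodule_add[OF assms(3) uv(2,4)]
      unfolding set_add_iff by blast
  next
    fix x a assume "x \<in> U <+>\<^bsub>M\<^esub> V" "a \<in> carrier A"
    then show "x \<star>\<^bsub>M\<^esub> a \<in> U <+>\<^bsub>M\<^esub> V"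
      using right_submodule_ract[OF assms(2)] right_submodule_ract[OF assms(3)]
      by (force simp: set_add_iff U V ract_add_left)
  qed
qed

lemma set_add_upper_left:
  assumes "right_module A M" "right_submodule A M U" "right_submodule A M V"
  shows "U \<subseteq> U <+>\<^bsub>M\<^esub> V"
proof
  interpret right_module A M by fact
  fix x assume "x \<in> U"
  then have "x = x \<oplus>\<^bsub>M\<^esub> \<zero>\<^bsub>M\<^esub>"
    using right_submodule_subset[OF assms(2)] by auto
  then show "x \<in> U <+>\<^bsub>M\<^esub> V"
    using \<open>x \<in> U\<close> right_submodule_zero[OF assms(3)] by (auto simp: set_add_iff)
qed

lemma set_add_upper_right:
  assumes "right_module A M" "right_submodule A M U" "right_submodule A M V"
  shows "V \<subseteq> U <+>\<^bsub>M\<^esub> V"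
proof
  interpret right_module A M by fact
  fix x assume "x \<in> V"
  then have "x = \<zero>\<^bsub>M\<^esub> \<oplus>\<^bsub>M\<^esub> x"
    using right_submodule_subset[OF assms(3)] by auto
  then show "x \<in> U <+>\<^bsub>M\<^esub> V"
    using \<open>x \<in> V\<close> right_submodule_zero[OF assms(2)] by (auto simp: set_add_iff)
qed

subsection \<open>Homomorphisms\<close>

text \<open>In contrast to \<open>right_hom\<close>, the function is arbitrary outside the carrier,
  so composites, sums and inclusions are plain lambda terms. \<open>restrict_in_right_hom\<close>
  and \<open>rmod_hom_of_right_hom\<close> pass between the two notions.\<close>

locale rmod_hom = src?: right_module A M + tgt?: right_module A N
  for A :: "('a, 'z) ring_scheme" and M :: "('a, 'm, 'x) right_module_scheme"
    and N :: "('a, 'n, 'y) right_module_scheme" +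
  fixes f :: "'m \<Rightarrow> 'n"
  assumes hom_closed: "x \<in> carrier M \<Longrightarrow> f x \<in> carrier N"
    and hom_add: "\<lbrakk>x \<in> carrier M; y \<in> carrier M\<rbrakk> \<Longrightarrow> f (x \<oplus>\<^bsub>M\<^esub> y) = f x \<oplus>\<^bsub>N\<^esub> f y"
    and hom_ract: "\<lbrakk>x \<in> carrier M; a \<in> carrier A\<rbrakk> \<Longrightarrow> f (x \<star>\<^bsub>M\<^esub> a) = f x \<star>\<^bsub>N\<^esub> a"
begin

lemma hom_zero: "f \<zero>\<^bsub>M\<^esub> = \<zero>\<^bsub>N\<^esub>"
  by (metis hom_add hom_closed src.grp.zero_closed src.grp.l_zero tgt.grp.add.l_cancel_one)

lemma hom_a_inv: "x \<in> carrier M \<Longrightarrow> f (\<ominus>\<^bsub>M\<^esub> x) = \<ominus>\<^bsub>N\<^esub> f x"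
  by (metis hom_add hom_closed hom_zero src.grp.a_inv_closed src.grp.l_neg tgt.grp.minus_equality)

lemma hom_minus: "\<lbrakk>x \<in> carrier M; y \<in> carrier M\<rbrakk> \<Longrightarrow> f (x \<ominus>\<^bsub>M\<^esub> y) = f x \<ominus>\<^bsub>N\<^esub> f y"
  by (simp add: a_minus_def hom_add hom_a_inv)

lemma hom_finsum:
  assumes "finite S" "g \<in> S \<rightarrow> carrier M"
  shows "f (\<Oplus>\<^bsub>M\<^esub>s \<in> S. g s) = (\<Oplus>\<^bsub>N\<^esub>s \<in> S. f (g s))"
  using assms
proof (induction S rule: finite_induct)
  case (insert s S)
  then have g: "g \<in> S \<rightarrow> carrier M" "g s \<in> carrier M"
    by auto
  have fg: "(\<lambda>s. f (g s)) \<in> S \<rightarrow> carrier N" "f (g s) \<in> carrier N"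
    using g hom_closed by (auto simp: Pi_def)
  show ?case
    by (simp only: src.grp.finsum_insert[OF insert(1,2) g] tgt.grp.finsum_insert[OF insert(1,2) fg]
        hom_add[OF g(2) src.grp.finsum_closed[OF g(1)]] insert(3)[OF g(1)])
qed (simp add: hom_zero)

lemma submodule_image:
  assumes "right_submodule A M U"
  shows "right_submodule A N (f ` U)"
proof (rule right_submoduleI[OF tgt.right_module_axioms])
  have U: "x \<in> carrier M" if "x \<in> U" for x
    using that right_submodule_subset[OF assms] by blast
  show "f ` U \<subseteq> carrier N"
    using U hom_closed by auto
  show "\<zero>\<^bsub>N\<^esub> \<in> f ` U"
    using hom_zero right_submodule_zero[OF assms] by force
  show "x \<oplus>\<^bsub>N\<^esub> y \<in> f ` U" if "x \<in> f ` U" "y \<in> f ` U" for x y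
    using that right_submodule_add[OF assms] by (auto simp: U hom_add[symmetric])
  show "x \<star>\<^bsub>N\<^esub> a \<in> f ` U" if "x \<in> f ` U" "a \<in> carrier A" for x a
    using that right_submodule_ract[OF assms] by (auto simp: U hom_ract[symmetric])
qed

lemma submodule_preimage:
  assumes "right_submodule A N V"
  shows "right_submodule A M {x \<in> carrier M. f x \<in> V}"
  by (rule right_submoduleI[OF src.right_module_axioms])
    (use right_submodule_zero[OF assms] right_submodule_add[OF assms] right_submodule_ract[OF assms]
      in \<open>auto simp: hom_zero hom_add hom_ract src.ract_closed\<close>)

lemma a_kernel_eq: "a_kernel M N f = {x \<in> carrier M. f x = \<zero>\<^bsub>N\<^esub>}"
  by (simp add: a_kernel_def')

lemma submodule_kernel: "right_submodule A M (a_kernel M N f)"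
  using submodule_preimage[OF right_submodule_zero_set[OF tgt.right_module_axioms]]
  by (simp add: a_kernel_eq)

lemma eq_iff_minus_in_kernel:
  "\<lbrakk>x \<in> carrier M; y \<in> carrier M\<rbrakk> \<Longrightarrow> f x = f y \<longleftrightarrow> x \<ominus>\<^bsub>M\<^esub> y \<in> a_kernel M N f"
  using tgt.grp.minus_eq_zero_iff[of "f x" "f y"]
  by (auto simp: a_kernel_eq hom_minus hom_closed)

lemma inj_on_iff_kernel: "inj_on f (carrier M) \<longleftrightarrow> (\<forall>x \<in> carrier M. f x = \<zero>\<^bsub>N\<^esub> \<longrightarrow> x = \<zero>\<^bsub>M\<^esub>)"
proof
  show "inj_on f (carrier M) \<Longrightarrow> \<forall>x \<in> carrier M. f x = \<zero>\<^bsub>N\<^esub> \<longrightarrow> x = \<zero>\<^bsub>M\<^esub>"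
    by (metis hom_zero inj_onD src.grp.zero_closed)
next
  assume *: "\<forall>x \<in> carrier M. f x = \<zero>\<^bsub>N\<^esub> \<longrightarrow> x = \<zero>\<^bsub>M\<^esub>"
  show "inj_on f (carrier M)"
  proof (rule inj_onI)
    fix x y assume "x \<in> carrier M" "y \<in> carrier M" "f x = f y"
    then show "x = y"
      using * eq_iff_minus_in_kernel[of x y] src.grp.minus_eq_zero_iff[of x y]
      by (auto simp: a_kernel_eq)
  qed
qed

end

lemma rmod_homI:
  assumes "right_module A M" "right_module A N"
    "\<And>x. x \<in> carrier M \<Longrightarrow> f x \<in> carrier N"
    "\<And>x y. \<lbrakk>x \<in> carrier M; y \<in> carrier M\<rbrakk> \<Longrightarrow> f (x \<oplus>\<^bsub>M\<^esub> y) = f x \<oplus>\<^bsub>N\<^esub> f y"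
    "\<And>x a. \<lbrakk>x \<in> carrier M; a \<in> carrier A\<rbrakk> \<Longrightarrow> f (x \<star>\<^bsub>M\<^esub> a) = f x \<star>\<^bsub>N\<^esub> a"
  shows "rmod_hom A M N f"
  using assms by (intro rmod_hom.intro rmod_hom_axioms.intro)

lemma rmod_hom_of_right_hom:
  "\<lbrakk>right_module A M; right_module A N; f \<in> right_hom A M N\<rbrakk> \<Longrightarrow> rmod_hom A M N f"
  by (intro rmod_homI) (auto simp: right_hom_def)

lemma (in rmod_hom) restrict_in_right_hom: "restrict f (carrier M) \<in> right_hom A M N"
  by (auto simp: right_hom_def hom_closed hom_add hom_ract src.ract_closed)

lemma rmod_hom_cong:
  assumes "rmod_hom A M N f" "\<And>x. x \<in> carrier M \<Longrightarrow> f x = g x"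
  shows "rmod_hom A M N g"
proof -
  interpret rmod_hom A M N f by fact
  show ?thesis
    by (intro rmod_homI src.right_module_axioms tgt.right_module_axioms)
      (simp_all add: assms(2)[symmetric] hom_closed hom_add hom_ract src.ract_closed)
qed

lemma rmod_hom_comp:
  assumes "rmod_hom A M N f" "rmod_hom A N L g"
  shows "rmod_hom A M L (\<lambda>x. g (f x))"
proof -
  interpret f: rmod_hom A M N f by fact
  interpret g: rmod_hom A N L g by fact
  show ?thesis
    by (intro rmod_homI f.src.right_module_axioms g.tgt.right_module_axioms)
      (simp_all add: f.hom_closed f.hom_add f.hom_ract g.hom_closed g.hom_add g.hom_ract)
qed

lemma rmod_hom_id: "right_module A M \<Longrightarrow> rmod_hom A M M (\<lambda>x. x)"
  by (rule rmod_homI) auto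

lemma rmod_hom_zero:
  assumes "right_module A M" "right_module A N"
  shows "rmod_hom A M N (\<lambda>_. \<zero>\<^bsub>N\<^esub>)"
proof -
  interpret N: right_module A N by fact
  show ?thesis
    by (intro rmod_homI assms) (auto simp: N.zero_ract)
qed

lemma rmod_hom_add:
  assumes "rmod_hom A M N f" "rmod_hom A M N g"
  shows "rmod_hom A M N (\<lambda>x. f x \<oplus>\<^bsub>N\<^esub> g x)"
proof -
  interpret f: rmod_hom A M N f by fact
  interpret g: rmod_hom A M N g by fact
  show ?thesis
    by (intro rmod_homI f.src.right_module_axioms f.tgt.right_module_axioms)
      (auto simp: f.hom_closed f.hom_add f.hom_ract g.hom_closed g.hom_add g.hom_ract
        f.tgt.grp.add.m_ac f.tgt.ract_add_left)
qed

lemma rmod_hom_a_inv: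
  assumes "rmod_hom A M N f"
  shows "rmod_hom A M N (\<lambda>x. \<ominus>\<^bsub>N\<^esub> f x)"
proof -
  interpret f: rmod_hom A M N f by fact
  show ?thesis
  proof (intro rmod_homI f.src.right_module_axioms f.tgt.right_module_axioms)
    fix x a assume "x \<in> carrier M" "a \<in> carrier A"
    then show "\<ominus>\<^bsub>N\<^esub> f (x \<star>\<^bsub>M\<^esub> a) = (\<ominus>\<^bsub>N\<^esub> f x) \<star>\<^bsub>N\<^esub> a"
      by (simp add: f.hom_ract f.hom_closed f.tgt.minus_ract)
  qed (auto simp: f.hom_closed f.hom_add f.tgt.grp.minus_add)
qed

lemma rmod_hom_minus:
  assumes "rmod_hom A M N f" "rmod_hom A M N g"
  shows "rmod_hom A M N (\<lambda>x. f x \<ominus>\<^bsub>N\<^esub> g x)"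
  using rmod_hom_add[OF assms(1) rmod_hom_a_inv[OF assms(2)]] by (simp add: a_minus_def)

lemma rmod_hom_finsum:
  assumes "right_module A M" "right_module A N" "finite S" "\<And>s. s \<in> S \<Longrightarrow> rmod_hom A M N (f s)"
  shows "rmod_hom A M N (\<lambda>x. \<Oplus>\<^bsub>N\<^esub>s \<in> S. f s x)"
  using assms(3,4)
proof (induction S rule: finite_induct)
  case empty
  interpret N: right_module A N by fact
  show ?case
    using rmod_hom_zero[OF assms(1,2)] by simp
next
  case (insert s S)
  interpret N: right_module A N by fact
  have "rmod_hom A M N (\<lambda>x. f s x \<oplus>\<^bsub>N\<^esub> (\<Oplus>\<^bsub>N\<^esub>s \<in> S. f s x))"
    using insert by (intro rmod_hom_add) auto
  moreover have "f s x \<oplus>\<^bsub>N\<^esub> (\<Oplus>\<^bsub>N\<^esub>s \<in> S. f s x) = (\<Oplus>\<^bsub>N\<^esub>s \<in> insert s S. f s x)"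
    if "x \<in> carrier M" for x
    using insert(1,2) rmod_hom.hom_closed[OF insert(4) that]
    by (subst N.grp.finsum_insert) auto
  ultimately show ?case
    by (rule rmod_hom_cong)
qed

lemma rmod_hom_inclusion:
  "\<lbrakk>right_module A M; right_submodule A M U\<rbrakk> \<Longrightarrow> rmod_hom A (M\<lparr>carrier := U\<rparr>) M (\<lambda>x. x)"
  using right_submodule_subset by (intro rmod_homI right_module_submodule) auto

lemma rmod_hom_restrict_domain:
  assumes "rmod_hom A M N f" "right_submodule A M U"
  shows "rmod_hom A (M\<lparr>carrier := U\<rparr>) N f"
  using rmod_hom_comp[OF rmod_hom_inclusion assms(1)] assms
  by (auto simp: rmod_hom_def)

lemma rmod_hom_restrict_codomain:
  assumes "rmod_hom A M N f" "right_submodule A N V" "\<And>x. x \<in> carrier M \<Longrightarrow> f x \<in> V"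
  shows "rmod_hom A M (N\<lparr>carrier := V\<rparr>) f"
proof -
  interpret rmod_hom A M N f by fact
  show ?thesis
    using assms(3)
    by (intro rmod_homI src.right_module_axioms right_module_submodule tgt.right_module_axioms assms(2))
      (auto simp: hom_add hom_ract)
qed

lemma rmod_hom_expand_codomain:
  assumes "right_module A N" "right_submodule A N V" "rmod_hom A M (N\<lparr>carrier := V\<rparr>) f"
  shows "rmod_hom A M N f"
  using rmod_hom_comp[OF assms(3) rmod_hom_inclusion[OF assms(1,2)]] .

lemma rmod_hom_inv_into:
  assumes "rmod_hom A M N f" "bij_betw f (carrier M) (carrier N)"
  shows "rmod_hom A N M (inv_into (carrier M) f)"
proof -
  interpret rmod_hom A M N f by fact
  let ?g = "inv_into (carrier M) f"
  have fg: "f (?g y) = y" and g: "?g y \<in> carrier M" if "y \<in> carrier N" for y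
    using that assms(2) by (simp_all add: bij_betw_inv_into_right bij_betw_imp_surj_on inv_into_into)
  have gf: "?g (f x) = x" if "x \<in> carrier M" for x
    using that assms(2) by (simp add: bij_betw_inv_into_left)
  show ?thesis
  proof (intro rmod_homI tgt.right_module_axioms src.right_module_axioms g)
    fix x y assume "x \<in> carrier N" "y \<in> carrier N"
    then show "?g (x \<oplus>\<^bsub>N\<^esub> y) = ?g x \<oplus>\<^bsub>M\<^esub> ?g y"
      using gf[of "?g x \<oplus>\<^bsub>M\<^esub> ?g y"] by (simp add: hom_add g fg)
  next
    fix x a assume "x \<in> carrier N" "a \<in> carrier A"
    then show "?g (x \<star>\<^bsub>N\<^esub> a) = ?g x \<star>\<^bsub>M\<^esub> a"
      using gf[of "?g x \<star>\<^bsub>M\<^esub> a"] by (simp add: hom_ract g fg src.ract_closed)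
  qed
qed

text \<open>Restricting a map to the carrier makes it extensional without changing its values there;
  from here on vanishing is a pointwise statement.\<close>

lemma hom_zero_iff:
  assumes "right_module A M" "right_module A N"
  shows "hom_zero A M N \<longleftrightarrow> (\<forall>f. rmod_hom A M N f \<longrightarrow> (\<forall>x \<in> carrier M. f x = \<zero>\<^bsub>N\<^esub>))"
proof safe
  fix f x assume *: "hom_zero A M N" "rmod_hom A M N f" "x \<in> carrier M"
  have "restrict f (carrier M) = (\<lambda>x \<in> carrier M. \<zero>\<^bsub>N\<^esub>)"
    using rmod_hom.restrict_in_right_hom[OF *(2)] *(1) by (auto simp: hom_zero_def)
  then show "f x = \<zero>\<^bsub>N\<^esub>"
    using *(3) by (metis restrict_apply')
next
  assume *: "\<forall>f. rmod_hom A M N f \<longrightarrow> (\<forall>x \<in> carrier M. f x = \<zero>\<^bsub>N\<^esub>)"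
  have "f = (\<lambda>x \<in> carrier M. \<zero>\<^bsub>N\<^esub>)" if "f \<in> right_hom A M N" for f
  proof (rule extensionalityI)
    show "f \<in> extensional (carrier M)"
      using that by (auto simp: right_hom_def PiE_def)
    show "(\<lambda>x \<in> carrier M. \<zero>\<^bsub>N\<^esub>) \<in> extensional (carrier M)"
      by simp
  qed (use * rmod_hom_of_right_hom[OF assms that] in auto)
  then have "right_hom A M N \<subseteq> {\<lambda>x \<in> carrier M. \<zero>\<^bsub>N\<^esub>}"
    by blast
  then show "hom_zero A M N"
    unfolding hom_zero_def
    using rmod_hom.restrict_in_right_hom[OF rmod_hom_zero[OF assms]] by blast
qed

lemma right_iso_iff:
  assumes "right_module A M" "right_module A N"
  shows "right_iso A M N \<longleftrightarrow> (\<exists>f. rmod_hom A M N f \<and> bij_betw f (carrier M) (carrier N))"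
proof
  assume "\<exists>f. rmod_hom A M N f \<and> bij_betw f (carrier M) (carrier N)"
  then obtain f where f: "rmod_hom A M N f" "bij_betw f (carrier M) (carrier N)"
    by blast
  show "right_iso A M N"
    unfolding right_iso_def
    by (rule bexI[OF _ rmod_hom.restrict_in_right_hom[OF f(1)]])
      (use f(2) in \<open>simp cong: bij_betw_cong\<close>)
qed (auto simp: right_iso_def intro: rmod_hom_of_right_hom[OF assms])

lemma right_iso_sym:
  assumes "right_module A M" "right_module A N" "right_iso A M N"
  shows "right_iso A N M"
  using assms by (metis right_iso_iff rmod_hom_inv_into bij_betw_inv_into)

lemma right_iso_trans:
  assumes "right_module A M" "right_module A N" "right_module A L"
    "right_iso A M N" "right_iso A N L"
  shows "right_iso A M L"
proof -
  obtain f g where f: "rmod_hom A M N f" "bij_betw f (carrier M) (carrier N)"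
    and g: "rmod_hom A N L g" "bij_betw g (carrier N) (carrier L)"
    using assms by (auto simp: right_iso_iff)
  show ?thesis
    using rmod_hom_comp[OF f(1) g(1)] bij_betw_trans[OF f(2) g(2)] assms(1,3)
    by (auto simp: right_iso_iff comp_def)
qed

lemma right_iso_refl: "right_module A M \<Longrightarrow> right_iso A M M"
  using rmod_hom_id[of A M]
  by (auto simp: right_iso_iff bij_betw_def intro!: exI[of _ "\<lambda>x. x"])

subsection \<open>Transport and restriction of scalars\<close>

text \<open>Carries a module structure along an injection onto a prescribed element type;
  \<open>fg_copy\<close> uses it to reach the type over which \<open>projective\<close>
  quantifies.\<close>

definition transport_module ::
  "('m \<Rightarrow> 'n) \<Rightarrow> ('a, 'm, 'y) right_module_scheme \<Rightarrow> ('a, 'n) right_module"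
  where "transport_module \<phi> M =
    \<lparr>carrier = \<phi> ` carrier M, monoid.mult = undefined, monoid.one = undefined,
     ring.zero = \<phi> \<zero>\<^bsub>M\<^esub>,
     ring.add = (\<lambda>x y. \<phi> (inv_into (carrier M) \<phi> x \<oplus>\<^bsub>M\<^esub> inv_into (carrier M) \<phi> y)),
     ract = (\<lambda>x a. \<phi> (inv_into (carrier M) \<phi> x \<star>\<^bsub>M\<^esub> a))\<rparr>"

lemma transport_module:
  assumes "right_module A M" "inj_on \<phi> (carrier M)"
  shows "right_module A (transport_module \<phi> M)" "rmod_hom A M (transport_module \<phi> M) \<phi>"
    "bij_betw \<phi> (carrier M) (carrier (transport_module \<phi> M))"
proof -
  interpret right_module A M by fact
  let ?N = "transport_module \<phi> M"
  have inv: "inv_into (carrier M) \<phi> (\<phi> x) = x" if "x \<in> carrier M" for x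
    using that assms(2) by simp
  have simps: "\<phi> x \<oplus>\<^bsub>?N\<^esub> \<phi> y = \<phi> (x \<oplus>\<^bsub>M\<^esub> y)" "\<phi> x \<star>\<^bsub>?N\<^esub> a = \<phi> (x \<star>\<^bsub>M\<^esub> a)" 
    if "x \<in> carrier M" "y \<in> carrier M" for x y a
    using that by (simp_all add: transport_module_def inv)
  have car: "carrier ?N = \<phi> ` carrier M" "\<zero>\<^bsub>?N\<^esub> = \<phi> \<zero>\<^bsub>M\<^esub>"
    by (simp_all add: transport_module_def)
  have "abelian_group ?N"
  proof (rule abelian_groupI)
    fix x assume "x \<in> carrier ?N"
    then show "\<exists>y\<in>carrier ?N. y \<oplus>\<^bsub>?N\<^esub> x = \<zero>\<^bsub>?N\<^esub>"
      by (auto simp: car simps intro!: bexI[of _ "\<ominus>\<^bsub>M\<^esub> _"] arg_cong[of _ _ \<phi>] grp.l_neg)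
  qed (auto simp: car simps grp.a_ac)
  then show "right_module A ?N"
    by (intro right_module.intro right_module_axioms.intro act.ring_axioms)
      (auto simp: car simps ract_closed ract_add_left ract_add_right ract_assoc ract_one)
  then show "rmod_hom A M ?N \<phi>"
    by (intro rmod_homI right_module_axioms) (auto simp: car simps)
  show "bij_betw \<phi> (carrier M) (carrier ?N)"
    using assms(2) by (simp add: car bij_betw_def)
qed

text \<open>Serves three ring maps: \<sigma> (restriction from \<Gamma> to \<Lambda>), \<pi>
  (inflation from \<Lambda> to \<Gamma>) and the embedding of the scalars into an algebra.\<close>

definition restrict_scalars ::
  "('b \<Rightarrow> 'a) \<Rightarrow> ('a, 'm, 'y) right_module_scheme \<Rightarrow> ('b, 'm) right_module"
  where "restrict_scalars \<rho> M =
    \<lparr>carrier = carrier M, monoid.mult = undefined, monoid.one = undefined,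
     ring.zero = \<zero>\<^bsub>M\<^esub>, ring.add = (\<oplus>\<^bsub>M\<^esub>), ract = (\<lambda>x b. x \<star>\<^bsub>M\<^esub> \<rho> b)\<rparr>"

lemma restrict_scalars_simps [simp]:
  "carrier (restrict_scalars \<rho> M) = carrier M"
  "\<zero>\<^bsub>restrict_scalars \<rho> M\<^esub> = \<zero>\<^bsub>M\<^esub>"
  "x \<oplus>\<^bsub>restrict_scalars \<rho> M\<^esub> y = x \<oplus>\<^bsub>M\<^esub> y"
  "x \<star>\<^bsub>restrict_scalars \<rho> M\<^esub> b = x \<star>\<^bsub>M\<^esub> \<rho> b"
  by (simp_all add: restrict_scalars_def)

lemma right_module_restrict_scalars:
  assumes "right_module A M" "ring B" "\<rho> \<in> ring_hom B A"
  shows "right_module B (restrict_scalars \<rho> M)"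
proof -
  interpret right_module A M by fact
  have "abelian_group (restrict_scalars \<rho> M)"
    by (rule abelian_groupI) (auto simp: grp.a_ac intro!: bexI[of _ "\<ominus>\<^bsub>M\<^esub> _"] grp.l_neg)
  then show ?thesis
    using ring_hom_closed[OF assms(3)]
    by (intro right_module.intro right_module_axioms.intro assms(2))
      (auto simp: ract_closed ract_add_left ract_add_right ract_assoc ract_one
        ring_hom_add[OF assms(3)] ring_hom_mult[OF assms(3)] ring_hom_one[OF assms(3)])
qed

lemma rmod_hom_restrict_scalars:
  assumes "rmod_hom A M N f" "ring B" "\<rho> \<in> ring_hom B A"
  shows "rmod_hom B (restrict_scalars \<rho> M) (restrict_scalars \<rho> N) f"
proof -
  interpret rmod_hom A M N f by fact
  show ?thesis
    by (intro rmod_homI right_module_restrict_scalars[OF _ assms(2,3)]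
        src.right_module_axioms tgt.right_module_axioms)
      (auto simp: hom_closed hom_add hom_ract ring_hom_closed[OF assms(3)])
qed

lemma right_submodule_restrict_scalars:
  assumes "right_module A M" "right_submodule A M U" "ring B" "\<rho> \<in> ring_hom B A"
  shows "right_submodule B (restrict_scalars \<rho> M) U"
  using right_submodule_subset[OF assms(2)] right_submodule_zero[OF assms(2)]
    right_submodule_add[OF assms(2)] right_submodule_ract[OF assms(2)] ring_hom_closed[OF assms(4)]
  by (intro right_submoduleI right_module_restrict_scalars[OF assms(1,3,4)]) auto

lemma regular_right_simps [simp]:
  "carrier (regular_right A) = carrier A" "\<zero>\<^bsub>regular_right A\<^esub> = \<zero>\<^bsub>A\<^esub>"
  "x \<oplus>\<^bsub>regular_right A\<^esub> y = x \<oplus>\<^bsub>A\<^esub> y" "x \<star>\<^bsub>regular_right A\<^esub> a = x \<otimes>\<^bsub>A\<^esub> a"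
  by (simp_all add: regular_right_def)

lemma right_module_regular:
  assumes "ring A"
  shows "right_module A (regular_right A)"
proof -
  interpret ring A by fact
  have "abelian_group (regular_right A)"
    by (rule abelian_groupI) (auto simp: a_ac intro!: bexI[of _ "\<ominus>\<^bsub>A\<^esub> _"] l_neg)
  then show ?thesis
    by (intro right_module.intro right_module_axioms.intro assms)
      (auto simp: l_distr r_distr m_assoc)
qed

text \<open>Through this map cyclic submodules are images, and right ideals of the form
  \<open>{a. x a \<in> V}\<close> are preimages.\<close>

lemma (in right_module) rmod_hom_orbit:
  "x \<in> carrier M \<Longrightarrow> rmod_hom A (regular_right A) M (\<lambda>a. x \<star>\<^bsub>M\<^esub> a)"
  by (intro rmod_homI right_module_regular act.ring_axioms right_module_axioms)
    (auto simp: ract_closed ract_add_right ract_assoc)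

lemma rmod_hom_source: "rmod_hom A M N f \<Longrightarrow> right_module A M"
  and rmod_hom_target: "rmod_hom A M N f \<Longrightarrow> right_module A N"
  by (simp_all add: rmod_hom_def)

section \<open>Finitely generated modules over finite-dimensional algebras\<close>

text \<open>Phrased through submodules instead of linear combinations: to prove something for all
  elements it suffices to exhibit a submodule, typically a preimage, that contains the
  generators.\<close>

definition generates :: "('a, 'z) ring_scheme \<Rightarrow> ('a, 'm, 'y) right_module_scheme \<Rightarrow> 'm set \<Rightarrow> bool"
  where "generates A M S \<longleftrightarrow>
    S \<subseteq> carrier M \<and> (\<forall>U. right_submodule A M U \<and> S \<subseteq> U \<longrightarrow> U = carrier M)"

lemma generatesD:
  "\<lbrakk>generates A M S; right_submodule A M U; S \<subseteq> U\<rbrakk> \<Longrightarrow> U = carrier M"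
  by (simp add: generates_def)

text \<open>This is where an abstract generating set acquires coefficients: the combinations form a
  submodule containing the family, hence exhaust the module if the family generates.\<close>

lemma right_submodule_combinations:
  assumes "right_module A M" "s \<in> I \<rightarrow> carrier M" "finite I"
  shows "right_submodule A M {\<Oplus>\<^bsub>M\<^esub>i \<in> I. s i \<star>\<^bsub>M\<^esub> b i | b. b \<in> I \<rightarrow> carrier A}" (is "right_submodule A M ?U")
    and "s ` I \<subseteq> {\<Oplus>\<^bsub>M\<^esub>i \<in> I. s i \<star>\<^bsub>M\<^esub> b i | b. b \<in> I \<rightarrow> carrier A}"
proof -
  interpret right_module A M by fact
  have s: "s i \<in> carrier M" if "i \<in> I" for i
    using that assms(2) by auto
  show "right_submodule A M ?U"
  proof (rule right_submoduleI[OF assms(1)])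
    show "?U \<subseteq> carrier M"
      using s by (auto intro!: grp.finsum_closed ract_closed)
    have "(\<Oplus>\<^bsub>M\<^esub>i \<in> I. s i \<star>\<^bsub>M\<^esub> \<zero>\<^bsub>A\<^esub>) = (\<Oplus>\<^bsub>M\<^esub>i \<in> I. \<zero>\<^bsub>M\<^esub>)"
      using s by (intro grp.finsum_cong') (auto simp: ract_zero)
    then show "\<zero>\<^bsub>M\<^esub> \<in> ?U"
      using act.zero_closed by simp (rule exI[of _ "\<lambda>_. \<zero>\<^bsub>A\<^esub>"], simp)
  next
    fix x y assume "x \<in> ?U" "y \<in> ?U"
    then obtain b c where bc: "b \<in> I \<rightarrow> carrier A" "c \<in> I \<rightarrow> carrier A"
      and "x = (\<Oplus>\<^bsub>M\<^esub>i \<in> I. s i \<star>\<^bsub>M\<^esub> b i)" "y = (\<Oplus>\<^bsub>M\<^esub>i \<in> I. s i \<star>\<^bsub>M\<^esub> c i)"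
      by auto
    moreover have "(\<Oplus>\<^bsub>M\<^esub>i \<in> I. s i \<star>\<^bsub>M\<^esub> (b i \<oplus>\<^bsub>A\<^esub> c i)) = (\<Oplus>\<^bsub>M\<^esub>i \<in> I. s i \<star>\<^bsub>M\<^esub> b i \<oplus>\<^bsub>M\<^esub> s i \<star>\<^bsub>M\<^esub> c i)"
      using s bc by (intro grp.finsum_cong') (auto simp: Pi_def ract_closed ract_add_right)
    moreover have "\<dots> = (\<Oplus>\<^bsub>M\<^esub>i \<in> I. s i \<star>\<^bsub>M\<^esub> b i) \<oplus>\<^bsub>M\<^esub> (\<Oplus>\<^bsub>M\<^esub>i \<in> I. s i \<star>\<^bsub>M\<^esub> c i)"
      using s bc by (intro grp.finsum_addf) (auto simp: Pi_def ract_closed)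
    ultimately show "x \<oplus>\<^bsub>M\<^esub> y \<in> ?U"
      by (force intro!: exI[of _ "\<lambda>i. b i \<oplus>\<^bsub>A\<^esub> c i"])
  next
    fix x a assume "x \<in> ?U" and a: "a \<in> carrier A"
    then obtain b where b: "b \<in> I \<rightarrow> carrier A" and "x = (\<Oplus>\<^bsub>M\<^esub>i \<in> I. s i \<star>\<^bsub>M\<^esub> b i)"
      by auto
    moreover have "(\<Oplus>\<^bsub>M\<^esub>i \<in> I. s i \<star>\<^bsub>M\<^esub> b i) \<star>\<^bsub>M\<^esub> a = (\<Oplus>\<^bsub>M\<^esub>i \<in> I. s i \<star>\<^bsub>M\<^esub> (b i \<otimes>\<^bsub>A\<^esub> a))"
    proof -
      have "(\<Oplus>\<^bsub>M\<^esub>i \<in> I. s i \<star>\<^bsub>M\<^esub> b i) \<star>\<^bsub>M\<^esub> a = (\<Oplus>\<^bsub>M\<^esub>i \<in> I. (s i \<star>\<^bsub>M\<^esub> b i) \<star>\<^bsub>M\<^esub> a)"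
        using s b a by (intro finsum_ract assms(3)) (auto simp: Pi_def ract_closed)
      also have "\<dots> = (\<Oplus>\<^bsub>M\<^esub>i \<in> I. s i \<star>\<^bsub>M\<^esub> (b i \<otimes>\<^bsub>A\<^esub> a))"
        using s b a by (intro grp.finsum_cong') (auto simp: Pi_def ract_closed ract_assoc)
      finally show ?thesis .
    qed
    ultimately show "x \<star>\<^bsub>M\<^esub> a \<in> ?U"
      using a by (force intro!: exI[of _ "\<lambda>i. b i \<otimes>\<^bsub>A\<^esub> a"])
  qed
  show "s ` I \<subseteq> ?U"
  proof
    fix x assume "x \<in> s ` I"
    then obtain j where j: "j \<in> I" "x = s j"
      by auto
    let ?b = "\<lambda>i. if i = j then \<one>\<^bsub>A\<^esub> else \<zero>\<^bsub>A\<^esub>"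
    have "(\<Oplus>\<^bsub>M\<^esub>i \<in> I. s i \<star>\<^bsub>M\<^esub> ?b i) = s j \<star>\<^bsub>M\<^esub> ?b j"
      using s j by (intro grp.finsum_eq_single assms(3)) (auto simp: ract_closed ract_zero)
    then have "x = (\<Oplus>\<^bsub>M\<^esub>i \<in> I. s i \<star>\<^bsub>M\<^esub> ?b i)"
      using s j by (simp add: ract_one)
    then show "x \<in> ?U"
      by force
  qed
qed

lemma fg_right_module_iff_generates:
  "fg_right_module A M \<longleftrightarrow> right_module A M \<and> (\<exists>S. finite S \<and> generates A M S)"
proof safe
  assume M: "fg_right_module A M"
  then show "right_module A M"
    by (simp add: fg_right_module_def)
  from M obtain S where S: "finite S" "S \<subseteq> carrier M"
    "\<And>x. x \<in> carrier M \<Longrightarrow> \<exists>a \<in> S \<rightarrow> carrier A. x = (\<Oplus>\<^bsub>M\<^esub>s \<in> S. s \<star>\<^bsub>M\<^esub> a s)"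
    by (auto simp: fg_right_module_def)
  have "U = carrier M" if U: "right_submodule A M U" "S \<subseteq> U" for U
  proof
    show "U \<subseteq> carrier M"
      using right_submodule_subset[OF U(1)] .
    show "carrier M \<subseteq> U"
    proof
      fix x assume "x \<in> carrier M"
      then obtain a where "a \<in> S \<rightarrow> carrier A" "x = (\<Oplus>\<^bsub>M\<^esub>s \<in> S. s \<star>\<^bsub>M\<^esub> a s)"
        using S(3) by blast
      then show "x \<in> U"
        using U(2) by (auto intro!: right_submodule_finsum[OF \<open>right_module A M\<close> U(1)]
            right_submodule_ract[OF U(1)])
    qed
  qed
  then show "\<exists>S. finite S \<and> generates A M S"
    using S(1,2) by (auto simp: generates_def)
next
  fix S assume M: "right_module A M" and S: "finite S" "generates A M S"
  have "(\<lambda>s. s) \<in> S \<rightarrow> carrier M"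
    using S(2) by (auto simp: generates_def)
  note * = right_submodule_combinations[OF M this S(1)]
  have eq: "carrier M = {\<Oplus>\<^bsub>M\<^esub>s \<in> S. s \<star>\<^bsub>M\<^esub> b s | b. b \<in> S \<rightarrow> carrier A}"
    using S(2) * by (simp add: generates_def)
  have "\<forall>x \<in> carrier M. \<exists>b \<in> S \<rightarrow> carrier A. x = (\<Oplus>\<^bsub>M\<^esub>s \<in> S. s \<star>\<^bsub>M\<^esub> b s)"
    unfolding eq by auto
  then show "fg_right_module A M"
    unfolding fg_right_module_def
    by (intro conjI M exI[of _ S] S(1)) (use S(2) in \<open>auto simp: generates_def\<close>)
qed

lemma fg_imp_right_module: "fg_right_module A M \<Longrightarrow> right_module A M"
  by (simp add: fg_right_module_def)

text \<open>Generators are numbered because free modules, dual bases and pivot positions are all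
  indexed by an initial segment of the naturals.\<close>

lemma fg_sequence:
  assumes "fg_right_module A M"
  obtains s and n :: nat where "s \<in> {..<n} \<rightarrow> carrier M"
    "\<forall>x \<in> carrier M. \<exists>b \<in> {..<n} \<rightarrow> carrier A. x = (\<Oplus>\<^bsub>M\<^esub>i \<in> {..<n}. s i \<star>\<^bsub>M\<^esub> b i)"
proof -
  obtain S where S: "finite S" "generates A M S" and M: "right_module A M"
    using assms by (auto simp: fg_right_module_iff_generates)
  obtain n :: nat and s where s: "S = s ` {i. i < n}"
    using finite_imp_nat_seg_image_inj_on[OF S(1)] by blast
  have s': "s \<in> {..<n} \<rightarrow> carrier M" "S = s ` {..<n}"
    using S(2) s by (auto simp: generates_def)
  note * = right_submodule_combinations[OF M s'(1) finite_lessThan]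
  have eq: "carrier M = {\<Oplus>\<^bsub>M\<^esub>i \<in> {..<n}. s i \<star>\<^bsub>M\<^esub> b i | b. b \<in> {..<n} \<rightarrow> carrier A}"
    using S(2) * s'(2) by (simp add: generates_def)
  have "\<forall>x \<in> carrier M. \<exists>b \<in> {..<n} \<rightarrow> carrier A. x = (\<Oplus>\<^bsub>M\<^esub>i \<in> {..<n}. s i \<star>\<^bsub>M\<^esub> b i)"
    unfolding eq by auto
  with that[OF s'(1)] show ?thesis .
qed

lemma fg_image:
  assumes "rmod_hom A M N f" "f ` carrier M = carrier N" "fg_right_module A M"
  shows "fg_right_module A N"
proof -
  interpret rmod_hom A M N f by fact
  obtain S where S: "finite S" "generates A M S"
    using assms(3) by (auto simp: fg_right_module_iff_generates)
  have "generates A N (f ` S)"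
    unfolding generates_def
  proof (intro conjI allI impI)
    show "f ` S \<subseteq> carrier N"
      using S(2) hom_closed by (auto simp: generates_def)
    fix U assume U: "right_submodule A N U \<and> f ` S \<subseteq> U"
    then have "S \<subseteq> {x \<in> carrier M. f x \<in> U}"
      using S(2) by (auto simp: generates_def)
    then have "{x \<in> carrier M. f x \<in> U} = carrier M"
      using generatesD[OF S(2) submodule_preimage] U by blast
    then show "U = carrier N"
    proof -
      have "f x \<in> U" if "x \<in> carrier M" for x
        using that \<open>{x \<in> carrier M. f x \<in> U} = carrier M\<close> by auto
      then have "f ` carrier M \<subseteq> U"
        by auto
      then show ?thesis
        using U right_submodule_subset[of A N U] assms(2) by simp
    qed
  qed
  then show ?thesis
    using S(1) tgt.right_module_axioms by (auto simp: fg_right_module_iff_generates)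
qed

lemma fg_regular:
  assumes "ring A"
  shows "fg_right_module A (regular_right A)"
proof -
  interpret ring A by fact
  have "generates A (regular_right A) {\<one>\<^bsub>A\<^esub>}"
    unfolding generates_def
  proof (intro conjI allI impI)
    fix U assume U: "right_submodule A (regular_right A) U \<and> {\<one>\<^bsub>A\<^esub>} \<subseteq> U"
    have "a \<in> U" if "a \<in> carrier A" for a
      using right_submodule_ract[of A "regular_right A" U "\<one>\<^bsub>A\<^esub>" a] U that by simp
    then show "U = carrier (regular_right A)"
      using right_submodule_subset[of A "regular_right A" U] U by auto
  qed simp
  then show ?thesis
    using right_module_regular[OF assms] by (auto simp: fg_right_module_iff_generates)
qed

subsection \<open>Length functions\<close>

text \<open>A stand-in for dimension: strict monotonicity bounds the length of every strict chain of
  submodules by the value at the whole module.\<close>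

definition length_function ::
  "('a, 'z) ring_scheme \<Rightarrow> ('a, 'm, 'y) right_module_scheme \<Rightarrow> ('m set \<Rightarrow> nat) \<Rightarrow> bool"
  where "length_function A M d \<longleftrightarrow>
    (\<forall>U V. right_submodule A M U \<and> right_submodule A M V \<and> U \<subset> V \<longrightarrow> d U < d V)"

lemma length_functionD:
  "\<lbrakk>length_function A M d; right_submodule A M U; right_submodule A M V; U \<subset> V\<rbrakk> \<Longrightarrow> d U < d V"
  by (auto simp: length_function_def)

lemma length_function_mono:
  "\<lbrakk>length_function A M d; right_submodule A M U; right_submodule A M V; U \<subseteq> V\<rbrakk> \<Longrightarrow> d U \<le> d V"
  by (metis length_functionD less_imp_le order_refl psubsetI)

text \<open>
  Over a field, the pivot positions of a subspace with respect to a generating sequence determine it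
  among the subspaces that contain it, so their number is a length function.
\<close>

lemma fg_field_length_function:
  assumes "field K" "fg_right_module K V"
  shows "\<exists>d. length_function K V d"
proof -
  interpret K: field K by fact
  have V: "right_module K V"
    using assms(2) by (rule fg_imp_right_module)
  interpret V: right_module K V by fact
  obtain s and n :: nat where s: "s \<in> {..<n} \<rightarrow> carrier V"
    and gen: "\<forall>x \<in> carrier V. \<exists>b \<in> {..<n} \<rightarrow> carrier K. x = (\<Oplus>\<^bsub>V\<^esub>i \<in> {..<n}. s i \<star>\<^bsub>V\<^esub> b i)"
    by (rule fg_sequence[OF assms(2)])
  define lc where "lc b k = (\<Oplus>\<^bsub>V\<^esub>i \<in> {..<k}. s i \<star>\<^bsub>V\<^esub> b i)" for b and k :: nat
  have s_in: "s i \<in> carrier V" if "i < n" for i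
    using s that by auto
  have lc_closed: "lc b k \<in> carrier V" if "k \<le> n" "b \<in> {..<k} \<rightarrow> carrier K" for b k
    unfolding lc_def using that s_in
    by (intro V.grp.finsum_closed) (simp add: Pi_def V.ract_closed)
  have lc_Suc: "lc b (Suc k) = lc b k \<oplus>\<^bsub>V\<^esub> s k \<star>\<^bsub>V\<^esub> b k"
    if "k < n" "b \<in> {..<Suc k} \<rightarrow> carrier K" for b k
  proof -
    have "lc b (Suc k) = s k \<star>\<^bsub>V\<^esub> b k \<oplus>\<^bsub>V\<^esub> lc b k"
      unfolding lc_def lessThan_Suc using that s_in
      by (subst V.grp.finsum_insert) (auto intro!: V.ract_closed)
    then show ?thesis
      using that s_in lc_closed[of k b] by (simp add: V.grp.a_comm V.ract_closed Pi_def)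
  qed
  \<comment> \<open>A single identity for addition and scaling; with \<open>b\<close> equal to zero
    it is the rule for multiples, with \<open>a\<close> the negative of a coefficient it is an
    elimination step.\<close>
  have lc_comb: "lc b k \<oplus>\<^bsub>V\<^esub> lc c k \<star>\<^bsub>V\<^esub> a = lc (\<lambda>i. b i \<oplus>\<^bsub>K\<^esub> c i \<otimes>\<^bsub>K\<^esub> a) k"
    if "k \<le> n" "b \<in> {..<k} \<rightarrow> carrier K" "c \<in> {..<k} \<rightarrow> carrier K" "a \<in> carrier K" for a b c k
    using that
  proof (induction k)
    case 0
    then show ?case
      by (simp add: lc_def V.zero_ract)
  next
    case (Suc k)
    have b: "b \<in> {..<k} \<rightarrow> carrier K" "c \<in> {..<k} \<rightarrow> carrier K" "b k \<in> carrier K" "c k \<in> carrier K"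
      using Suc.prems by auto
    have sk: "s k \<in> carrier V"
      using Suc.prems s_in by simp
    have l: "lc b k \<in> carrier V" "lc c k \<in> carrier V"
      using Suc.prems b lc_closed by auto
    have "lc b (Suc k) \<oplus>\<^bsub>V\<^esub> lc c (Suc k) \<star>\<^bsub>V\<^esub> a =
        (lc b k \<oplus>\<^bsub>V\<^esub> lc c k \<star>\<^bsub>V\<^esub> a) \<oplus>\<^bsub>V\<^esub> (s k \<star>\<^bsub>V\<^esub> b k \<oplus>\<^bsub>V\<^esub> s k \<star>\<^bsub>V\<^esub> c k \<star>\<^bsub>V\<^esub> a)"
      using Suc.prems b l sk
      by (simp add: lc_Suc V.ract_add_left V.ract_closed V.grp.a_ac)
    also have "s k \<star>\<^bsub>V\<^esub> b k \<oplus>\<^bsub>V\<^esub> s k \<star>\<^bsub>V\<^esub> c k \<star>\<^bsub>V\<^esub> a = s k \<star>\<^bsub>V\<^esub> (b k \<oplus>\<^bsub>K\<^esub> c k \<otimes>\<^bsub>K\<^esub> a)"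
      using b sk Suc.prems by (simp add: V.ract_add_right V.ract_assoc)
    finally show ?case
      using Suc.IH Suc.prems b by (subst (asm) Suc.IH) (auto simp: lc_Suc Pi_def)
  qed
  \<comment> \<open>\<open>k\<close> is a pivot of \<open>U\<close> if \<open>U\<close> contains a
    vector that can be written with last coefficient one at position \<open>k\<close>. The
    \<open>s i\<close> need not be independent, so this asks only for some such expression.\<close>
  define piv where
    "piv U = {k. k < n \<and> (\<exists>c \<in> {..<k} \<rightarrow> carrier K. s k \<oplus>\<^bsub>V\<^esub> lc c k \<in> U)}" for U
  have fin: "finite (piv U)" for U
    by (rule finite_subset[of _ "{..<n}"]) (auto simp: piv_def)
  have piv_eq: "W \<subseteq> U"
    if U: "right_submodule K V U" and W: "right_submodule K V W" and "U \<subseteq> W" "piv W \<subseteq> piv U" for U W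
  proof -
    \<comment> \<open>Elimination, by induction on the number \<open>k\<close> of generators
      involved: an element of \<open>W\<close> in the span of the first \<open>k\<close> generators
      already lies in \<open>U\<close>.\<close>
    have "\<forall>b \<in> {..<k} \<rightarrow> carrier K. lc b k \<in> W \<longrightarrow> lc b k \<in> U" if "k \<le> n" for k
      using that
    proof (induction k)
      case 0
      then show ?case
        using right_submodule_zero[OF U] by (simp add: lc_def)
    next
      case (Suc k)
      show ?case
      proof (intro ballI impI)
        fix b assume b: "b \<in> {..<Suc k} \<rightarrow> carrier K" and bW: "lc b (Suc k) \<in> W"
        have bk: "b \<in> {..<k} \<rightarrow> carrier K" "b k \<in> carrier K" and sk: "s k \<in> carrier V"
          using b Suc.prems s_in by auto
        have lk: "lc b k \<in> carrier V"
          using Suc.prems bk lc_closed by auto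
        have split: "lc b (Suc k) = lc b k \<oplus>\<^bsub>V\<^esub> s k \<star>\<^bsub>V\<^esub> b k"
          using Suc.prems b lc_Suc by simp
        show "lc b (Suc k) \<in> U"
        proof (cases "b k = \<zero>\<^bsub>K\<^esub>")
          case True
          then have "lc b (Suc k) = lc b k"
            using split sk lk by (simp add: V.ract_zero)
          then show ?thesis
            using Suc bk bW by auto
        next
          case False
          then have inv: "inv\<^bsub>K\<^esub> b k \<in> carrier K" "b k \<otimes>\<^bsub>K\<^esub> inv\<^bsub>K\<^esub> b k = \<one>\<^bsub>K\<^esub>"
            using bk by (auto simp: K.field_Units)
          \<comment> \<open>The coefficients after dividing by \<open>b k\<close>, which exhibit
            \<open>k\<close> as a pivot of \<open>W\<close>. The leading zero is an artefact of
            applying \<open>lc_comb\<close> to the zero family.\<close>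
          let ?c = "\<lambda>i. \<zero>\<^bsub>K\<^esub> \<oplus>\<^bsub>K\<^esub> b i \<otimes>\<^bsub>K\<^esub> inv\<^bsub>K\<^esub> b k"
          have "lc (\<lambda>_. \<zero>\<^bsub>K\<^esub>) k = \<zero>\<^bsub>V\<^esub>"
          proof -
            have "lc (\<lambda>_. \<zero>\<^bsub>K\<^esub>) k = (\<Oplus>\<^bsub>V\<^esub>i \<in> {..<k}. \<zero>\<^bsub>V\<^esub>)"
              unfolding lc_def using Suc.prems s_in
              by (intro V.grp.finsum_cong') (auto simp: V.ract_zero)
            then show ?thesis
              by simp
          qed
          then have "lc b k \<star>\<^bsub>V\<^esub> inv\<^bsub>K\<^esub> b k = lc ?c k"
            using lc_comb[of k "\<lambda>_. \<zero>\<^bsub>K\<^esub>" b "inv\<^bsub>K\<^esub> b k"] Suc.prems bk inv lk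
            by (simp add: V.ract_closed)
          then have "lc b (Suc k) \<star>\<^bsub>V\<^esub> inv\<^bsub>K\<^esub> b k = s k \<oplus>\<^bsub>V\<^esub> lc ?c k"
            using split lk sk bk inv
            by (simp add: V.ract_add_left V.ract_closed V.ract_assoc[symmetric] V.ract_one)
              (metis V.grp.a_comm V.ract_closed)
          then have "s k \<oplus>\<^bsub>V\<^esub> lc ?c k \<in> W"
            using right_submodule_ract[OF W bW inv(1)] by simp
          moreover have "?c \<in> {..<k} \<rightarrow> carrier K"
            using bk inv by (auto simp: Pi_def)
          ultimately have "k \<in> piv W"
            using Suc.prems unfolding piv_def
            by (intro CollectI conjI bexI[of _ ?c]) auto
          then obtain c where c: "c \<in> {..<k} \<rightarrow> carrier K" "s k \<oplus>\<^bsub>V\<^esub> lc c k \<in> U"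
            using \<open>piv W \<subseteq> piv U\<close> unfolding piv_def by blast
          have lck: "lc c k \<in> carrier V"
            using Suc.prems c lc_closed by auto
          \<comment> \<open>\<open>?u\<close> is the pivot vector that \<open>U\<close> supplies at
            position \<open>k\<close>. Subtracting \<open>b k\<close> times it removes the last
            coefficient; the remainder \<open>?w\<close> stays in \<open>W\<close> because
            \<open>U\<close> is contained in \<open>W\<close>, and the induction hypothesis places
            it in \<open>U\<close>.\<close>
          let ?u = "s k \<oplus>\<^bsub>V\<^esub> lc c k" and ?a = "\<ominus>\<^bsub>K\<^esub> b k"
          let ?w = "lc (\<lambda>i. b i \<oplus>\<^bsub>K\<^esub> c i \<otimes>\<^bsub>K\<^esub> ?a) k"
          have u: "?u \<in> carrier V"
            using sk lck by simp
          have w: "?w = lc b k \<oplus>\<^bsub>V\<^esub> lc c k \<star>\<^bsub>V\<^esub> ?a"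
            using lc_comb[of k b c ?a] Suc.prems bk c by simp
          have sum: "lc b (Suc k) = ?w \<oplus>\<^bsub>V\<^esub> ?u \<star>\<^bsub>V\<^esub> b k"
          proof -
            have "?w \<oplus>\<^bsub>V\<^esub> ?u \<star>\<^bsub>V\<^esub> b k =
                (lc b k \<oplus>\<^bsub>V\<^esub> s k \<star>\<^bsub>V\<^esub> b k) \<oplus>\<^bsub>V\<^esub> (\<ominus>\<^bsub>V\<^esub> (lc c k \<star>\<^bsub>V\<^esub> b k) \<oplus>\<^bsub>V\<^esub> lc c k \<star>\<^bsub>V\<^esub> b k)"
              unfolding w using lk lck sk bk
              by (simp add: V.ract_add_left V.ract_minus V.ract_closed V.grp.a_ac)
            then show ?thesis
              using split lk lck sk bk by (simp add: V.grp.l_neg V.ract_closed)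
          qed
          have wv: "?w \<in> carrier V"
            using w lk lck bk by (simp add: V.ract_closed)
          have uU: "?u \<star>\<^bsub>V\<^esub> b k \<in> U"
            using right_submodule_ract[OF U c(2) bk(2)] .
          have "?w = lc b (Suc k) \<ominus>\<^bsub>V\<^esub> ?u \<star>\<^bsub>V\<^esub> b k"
            unfolding sum using wv u bk
            by (simp add: a_minus_def V.grp.a_assoc V.grp.r_neg V.ract_closed)
          then have "?w \<in> W"
            using right_submodule_minus[OF W bW, of "?u \<star>\<^bsub>V\<^esub> b k"] uU \<open>U \<subseteq> W\<close> by auto
          then have "?w \<in> U"
            using Suc.IH[THEN bspec, of "\<lambda>i. b i \<oplus>\<^bsub>K\<^esub> c i \<otimes>\<^bsub>K\<^esub> ?a"] Suc.prems bk c
            by (auto simp: Pi_def)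
          then show ?thesis
            using right_submodule_add[OF U _ uU] sum by simp
        qed
      qed
    qed
    note last = this[OF order_refl]
    show ?thesis
    proof
      fix x assume "x \<in> W"
      then obtain b where "b \<in> {..<n} \<rightarrow> carrier K" "x = lc b n"
        using gen[THEN bspec, of x] right_submodule_subset[OF W] unfolding lc_def by auto
      then show "x \<in> U"
        using last \<open>x \<in> W\<close> by auto
    qed
  qed
  have "card (piv U) < card (piv W)"
    if "right_submodule K V U" "right_submodule K V W" "U \<subset> W" for U W
  proof (rule psubset_card_mono[OF fin])
    have "piv U \<subseteq> piv W"
      using that(3) by (auto simp: piv_def)
    then show "piv U \<subset> piv W"
      using piv_eq[OF that(1,2)] that(3) by blast
  qed
  then show ?thesis
    unfolding length_function_def by (intro exI[of _ "\<lambda>U. card (piv U)"]) blast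
qed

subsection \<open>Finite-dimensional algebras\<close>

text \<open>Gives every right module over the algebra a vector space structure by restriction of
  scalars, in agreement with the way \<open>dual_module\<close> lets scalars act.\<close>

definition scalar_embedding :: "('k, 'a, 'y) module_scheme \<Rightarrow> 'k \<Rightarrow> 'a"
  where "scalar_embedding A c = c \<odot>\<^bsub>A\<^esub> \<one>\<^bsub>A\<^esub>"

lemma fd_algebra_ring: "fd_algebra K A \<Longrightarrow> ring A"
  by (simp add: fd_algebra_def)

lemma fd_algebra_field: "fd_algebra K A \<Longrightarrow> field K"
  by (simp add: fd_algebra_def vectorspace_def)

lemma fd_algebra_scalars_ring: "fd_algebra K A \<Longrightarrow> ring K"
  by (drule fd_algebra_field) (simp add: field_def domain_def cring_def)

lemma scalar_embedding_ring_hom: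
  assumes "fd_algebra K A"
  shows "scalar_embedding A \<in> ring_hom K A"
proof -
  interpret fd_algebra K A by fact
  show ?thesis
    by (intro ring_hom_memI)
      (auto simp: scalar_embedding_def smult_mult_left smult_assoc1 smult_l_distr)
qed

lemma scalar_embedding_commute:
  assumes "fd_algebra K A" "c \<in> carrier K" "a \<in> carrier A"
  shows "a \<otimes>\<^bsub>A\<^esub> scalar_embedding A c = c \<odot>\<^bsub>A\<^esub> a" "scalar_embedding A c \<otimes>\<^bsub>A\<^esub> a = c \<odot>\<^bsub>A\<^esub> a"
proof -
  interpret fd_algebra K A by fact
  show "a \<otimes>\<^bsub>A\<^esub> scalar_embedding A c = c \<odot>\<^bsub>A\<^esub> a" "scalar_embedding A c \<otimes>\<^bsub>A\<^esub> a = c \<odot>\<^bsub>A\<^esub> a"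
    using assms(2,3) by (simp_all add: scalar_embedding_def smult_mult_left smult_mult_right)
qed

lemma right_module_scalars:
  assumes "fd_algebra K A" "right_module A M"
  shows "right_module K (restrict_scalars (scalar_embedding A) M)"
  by (intro right_module_restrict_scalars[OF assms(2)] fd_algebra_scalars_ring[OF assms(1)]
      scalar_embedding_ring_hom[OF assms(1)])

text \<open>The bridge from the finite spanning sets of \<open>fin_dim\<close> to
  \<open>generates\<close>; linear combinations in the sense of the vector space library are
  unfolded only here.\<close>

lemma finite_span_algebra:
  assumes "fd_algebra K A"
  shows "\<exists>B. finite B \<and> generates K (restrict_scalars (scalar_embedding A) (regular_right A)) B"
proof -
  interpret fd_algebra K A by fact
  interpret A: ring A by (rule fd_algebra_ring[OF assms])
  let ?V = "restrict_scalars (scalar_embedding A) (regular_right A)"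
  obtain B where B: "finite B" "B \<subseteq> carrier A" "span B = carrier A"
    using finite_dimensional unfolding fin_dim_def by auto
  have "U = carrier ?V" if U: "right_submodule K ?V U" "B \<subseteq> U" for U
  proof
    show "U \<subseteq> carrier ?V"
      using right_submodule_subset[OF U(1)] .
    have U_zero: "\<zero>\<^bsub>A\<^esub> \<in> U"
      using right_submodule_zero[OF U(1)] by simp
    have U_add: "x \<oplus>\<^bsub>A\<^esub> y \<in> U" if "x \<in> U" "y \<in> U" for x y
      using right_submodule_add[OF U(1) that] by simp
    have U_smult: "c \<odot>\<^bsub>A\<^esub> x \<in> U" if "x \<in> U" "c \<in> carrier K" for x c
      using right_submodule_ract[OF U(1) that] right_submodule_subset[OF U(1)] that
        scalar_embedding_commute(1)[OF assms, of c x] by auto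
    have comb: "lincomb a C \<in> U" if "finite C" "C \<subseteq> B" "a \<in> C \<rightarrow> carrier K" for a C
      using that
    proof (induction C rule: finite_induct)
      case empty
      then show ?case
        by (simp add: lincomb_def U_zero)
    next
      case (insert x C)
      have x: "a x \<in> carrier K" "x \<in> carrier A" "x \<in> U"
        using insert.prems B(2) U(2) by auto
      have "lincomb a (insert x C) = a x \<odot>\<^bsub>A\<^esub> x \<oplus>\<^bsub>A\<^esub> lincomb a C"
        unfolding lincomb_def using insert.hyps insert.prems B(2) x
        by (subst finsum_insert) (auto simp: Pi_def subset_iff)
      then show ?case
        using U_add[OF U_smult[OF x(3,1)]] insert by auto
    qed
    show "carrier ?V \<subseteq> U"
    proof
      fix x assume "x \<in> carrier ?V"
      then have "x \<in> span B"
        using B(3) by simp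
      then show "x \<in> U"
        using comb by (auto simp: span_def)
    qed
  qed
  then show ?thesis
    using B by (auto simp: generates_def)
qed

text \<open>Products of the module generators with a finite spanning set of the algebra span the
  module over the field.\<close>

lemma fg_scalars:
  assumes "fd_algebra K A" "fg_right_module A M"
  shows "fg_right_module K (restrict_scalars (scalar_embedding A) M)"
proof -
  have M: "right_module A M"
    using assms(2) by (rule fg_imp_right_module)
  interpret right_module A M by fact
  let ?V = "restrict_scalars (scalar_embedding A) M"
  let ?R = "restrict_scalars (scalar_embedding A) (regular_right A)"
  obtain B where B: "finite B" "generates K ?R B"
    using finite_span_algebra[OF assms(1)] by blast
  obtain S where S: "finite S" "generates A M S"
    using assms(2) by (auto simp: fg_right_module_iff_generates)
  note K = fd_algebra_scalars_ring[OF assms(1)]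
  note emb = scalar_embedding_ring_hom[OF assms(1)]
  have emb_closed: "scalar_embedding A c \<in> carrier A" if "c \<in> carrier K" for c
    using ring_hom_closed[OF emb that] .
  have B_sub: "B \<subseteq> carrier A" and S_sub: "S \<subseteq> carrier M"
    using B S by (auto simp: generates_def)
  let ?G = "(\<lambda>(s, b). s \<star>\<^bsub>M\<^esub> b) ` (S \<times> B)"
  have "U = carrier ?V" if U: "right_submodule K ?V U" "?G \<subseteq> U" for U
  proof
    show "U \<subseteq> carrier ?V"
      using right_submodule_subset[OF U(1)] .
    have U_in: "x \<in> carrier M" if "x \<in> U" for x
      using right_submodule_subset[OF U(1)] that by auto
    have sub: "s \<star>\<^bsub>M\<^esub> a \<in> U" if s: "s \<in> S" and a: "a \<in> carrier A" for s a
    proof -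
      have s': "s \<in> carrier M"
        using s S_sub by auto
      interpret o: rmod_hom K ?R ?V "\<lambda>a. s \<star>\<^bsub>M\<^esub> a"
        by (intro rmod_hom_restrict_scalars[OF rmod_hom_orbit[OF s'] K emb])
      have "B \<subseteq> {a \<in> carrier ?R. s \<star>\<^bsub>M\<^esub> a \<in> U}"
        using U(2) s B_sub by auto
      then have "{a \<in> carrier ?R. s \<star>\<^bsub>M\<^esub> a \<in> U} = carrier ?R"
        by (rule generatesD[OF B(2) o.submodule_preimage[OF U(1)]])
      then show ?thesis
        using a by auto
    qed
    \<comment> \<open>From a subspace \<open>U\<close> one passes to the elements whose whole orbit
      lies in \<open>U\<close>. They form an \<open>A\<close>-submodule containing \<open>S\<close>,
      hence everything, and acting by one returns to \<open>U\<close>.\<close>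
    have "right_submodule A M {x \<in> carrier M. \<forall>a \<in> carrier A. x \<star>\<^bsub>M\<^esub> a \<in> U}"
    proof (rule right_submoduleI[OF M])
      fix x y assume "x \<in> {x \<in> carrier M. \<forall>a \<in> carrier A. x \<star>\<^bsub>M\<^esub> a \<in> U}"
        "y \<in> {x \<in> carrier M. \<forall>a \<in> carrier A. x \<star>\<^bsub>M\<^esub> a \<in> U}"
      then show "x \<oplus>\<^bsub>M\<^esub> y \<in> {x \<in> carrier M. \<forall>a \<in> carrier A. x \<star>\<^bsub>M\<^esub> a \<in> U}"
        using right_submodule_add[OF U(1)] by (auto simp: ract_add_left)
    qed (use right_submodule_zero[OF U(1)] in \<open>auto simp: zero_ract ract_closed ract_assoc[symmetric]\<close>)
    moreover have "S \<subseteq> {x \<in> carrier M. \<forall>a \<in> carrier A. x \<star>\<^bsub>M\<^esub> a \<in> U}"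
      using sub S_sub by auto
    ultimately have eq: "{x \<in> carrier M. \<forall>a \<in> carrier A. x \<star>\<^bsub>M\<^esub> a \<in> U} = carrier M"
      by (rule generatesD[OF S(2)])
    show "carrier ?V \<subseteq> U"
    proof
      fix x assume "x \<in> carrier ?V"
      then have "x \<in> {x \<in> carrier M. \<forall>a \<in> carrier A. x \<star>\<^bsub>M\<^esub> a \<in> U}"
        unfolding eq by simp
      then have "x \<star>\<^bsub>M\<^esub> \<one>\<^bsub>A\<^esub> \<in> U" "x \<in> carrier M"
        by auto
      then show "x \<in> U"
        by (simp add: ract_one)
    qed
  qed
  moreover have "?G \<subseteq> carrier ?V"
    using B_sub S_sub by (auto intro!: ract_closed)
  ultimately have "generates K ?V ?G"
    unfolding generates_def by auto
  then show ?thesis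
    using B(1) S(1) right_module_scalars[OF assms(1) M]
    by (auto simp: fg_right_module_iff_generates intro!: exI[of _ ?G])
qed

text \<open>Every \<open>A\<close>-submodule is a subspace, so a length function over the field
  restricts to one over the algebra.\<close>

lemma fg_length_function:
  assumes "fd_algebra K A" "fg_right_module A M"
  obtains d where "length_function A M d"
proof -
  have M: "right_module A M"
    using assms(2) by (rule fg_imp_right_module)
  note K = fd_algebra_scalars_ring[OF assms(1)]
  obtain d where d: "length_function K (restrict_scalars (scalar_embedding A) M) d"
    using fg_field_length_function[OF fd_algebra_field[OF assms(1)] fg_scalars[OF assms]] by blast
  have "length_function A M d"
    using d right_submodule_restrict_scalars[OF M _ K scalar_embedding_ring_hom[OF assms(1)]]
    unfolding length_function_def by blast
  then show ?thesis
    by (rule that)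
qed

text \<open>Among the finitely generated submodules of \<open>U\<close> take one of greatest length.
  Adjoining any further element of \<open>U\<close> keeps it finitely generated, so by maximality
  there is no further element.\<close>

lemma fg_submodule:
  assumes "fd_algebra K A" "fg_right_module A M" "right_submodule A M U"
  shows "fg_right_module A (M\<lparr>carrier := U\<rparr>)"
proof -
  have M: "right_module A M"
    using assms(2) by (rule fg_imp_right_module)
  obtain d where d: "length_function A M d"
    by (rule fg_length_function[OF assms(1,2)])
  have MU: "right_module A (M\<lparr>carrier := U\<rparr>)"
    by (rule right_module_submodule[OF M assms(3)])
  \<comment> \<open>The last clause says that \<open>V\<close> is the smallest submodule containing
    the finite set \<open>S\<close>, that is, generated by it.\<close>
  define F where "F = {V. \<exists>S. finite S \<and> right_submodule A M V \<and> V \<subseteq> U \<and> S \<subseteq> V \<and>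
    (\<forall>W. right_submodule A M W \<and> S \<subseteq> W \<longrightarrow> V \<subseteq> W)}"
  have zero: "{\<zero>\<^bsub>M\<^esub>} \<in> F"
    unfolding F_def using right_submodule_zero_set[OF M] right_submodule_zero[of A M]
      right_submodule_zero[OF assms(3)]
    by (auto intro!: exI[of _ "{}"])
  have bound: "d V \<le> d U" if "V \<in> F" for V
    using that length_function_mono[OF d _ assms(3), of V] by (auto simp: F_def)
  obtain V where V: "V \<in> F" and max: "\<And>W. W \<in> F \<Longrightarrow> d W \<le> d V"
    using ex_has_greatest_nat[of "\<lambda>V. V \<in> F" "{\<zero>\<^bsub>M\<^esub>}" d "Suc (d U)"] zero bound
    by (auto simp: less_Suc_eq_le)
  obtain S where S: "finite S" "right_submodule A M V" "V \<subseteq> U" "S \<subseteq> V"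
    "\<And>W. right_submodule A M W \<Longrightarrow> S \<subseteq> W \<Longrightarrow> V \<subseteq> W"
    using V unfolding F_def by auto
  have "U \<subseteq> V"
  proof
    fix x assume x: "x \<in> U"
    interpret M: right_module A M by fact
    have xM: "x \<in> carrier M"
      using x right_submodule_subset[OF assms(3)] by auto
    interpret o: rmod_hom A "regular_right A" M "\<lambda>a. x \<star>\<^bsub>M\<^esub> a"
      by (rule M.rmod_hom_orbit[OF xM])
    let ?X = "(\<lambda>a. x \<star>\<^bsub>M\<^esub> a) ` carrier A"
    have X: "right_submodule A M ?X"
      using o.submodule_image[OF right_submodule_carrier[OF o.src.right_module_axioms]] by simp
    have xX: "x \<in> ?X"
      using M.ract_one[OF xM] by (metis M.act.one_closed image_eqI)
    let ?W = "V <+>\<^bsub>M\<^esub> ?X"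
    have W: "right_submodule A M ?W"
      by (rule right_submodule_set_add[OF M S(2) X])
    have VW: "V \<subseteq> ?W" and xW: "x \<in> ?W"
      using set_add_upper_left[OF M S(2) X] set_add_upper_right[OF M S(2) X] xX by auto
    have WU: "?W \<subseteq> U"
      using S(3) x by (auto simp: set_add_iff
          intro!: right_submodule_add[OF assms(3)] right_submodule_ract[OF assms(3)])
    have "?W \<subseteq> Y" if Y: "right_submodule A M Y" "insert x S \<subseteq> Y" for Y
      using S(5)[OF Y(1)] Y(2) by (auto simp: set_add_iff
          intro!: right_submodule_add[OF Y(1)] right_submodule_ract[OF Y(1)])
    then have "?W \<in> F"
      unfolding F_def using S(1,4) VW xW W WU by (intro CollectI exI[of _ "insert x S"]) auto
    then have "\<not> V \<subset> ?W"
      using max[of ?W] length_functionD[OF d S(2) W] by auto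
    then show "x \<in> V"
      using VW xW by auto
  qed
  then have VU: "V = U"
    using S(3) by auto
  have "generates A (M\<lparr>carrier := U\<rparr>) S"
    unfolding generates_def using S(4,5) VU right_submodule_restrict_iff[OF M assms(3)] by auto
  then show ?thesis
    using S(1) MU by (auto simp: fg_right_module_iff_generates)
qed

text \<open>Let \<open>x\<close> be a nonzero element of the kernel. Since all powers of
  \<open>h\<close> are onto, \<open>x\<close> is the value of \<open>h ^^ n\<close> at some
  \<open>y\<close>, which then lies in the kernel of \<open>h ^^ Suc n\<close> but not in that of
  \<open>h ^^ n\<close>. The kernels would grow strictly forever, against the length
  function.\<close>

lemma surj_endo_inj:
  assumes "fd_algebra K A" "fg_right_module A M" "rmod_hom A M M h" "h ` carrier M = carrier M"
  shows "inj_on h (carrier M)"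
proof -
  interpret rmod_hom A M M h by fact
  obtain d where d: "length_function A M d"
    by (rule fg_length_function[OF assms(1,2)])
  have pow: "rmod_hom A M M (h ^^ n)" for n
  proof (induction n)
    case 0
    then show ?case
      using rmod_hom_id[OF src.right_module_axioms] by simp
  next
    case (Suc n)
    then show ?case
      using rmod_hom_comp[OF Suc assms(3)] by (simp add: comp_def)
  qed
  define k where "k n = {x \<in> carrier M. (h ^^ n) x = \<zero>\<^bsub>M\<^esub>}" for n
  have sub: "right_submodule A M (k n)" for n
    using rmod_hom.submodule_kernel[OF pow] unfolding k_def rmod_hom.a_kernel_eq[OF pow] .
  have surj: "\<exists>y \<in> carrier M. (h ^^ n) y = x" if "x \<in> carrier M" for n x
    using that
  proof (induction n arbitrary: x)
    case (Suc n)
    then obtain y where "y \<in> carrier M" "h y = x"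
      using assms(4) by (metis imageE)
    then show ?case
      using Suc.IH[of y] by auto
  qed auto
  have "x = \<zero>\<^bsub>M\<^esub>" if x: "x \<in> carrier M" "h x = \<zero>\<^bsub>M\<^esub>" for x
  proof (rule ccontr)
    assume nz: "x \<noteq> \<zero>\<^bsub>M\<^esub>"
    have strict: "k n \<subset> k (Suc n)" for n
    proof -
      obtain y where y: "y \<in> carrier M" "(h ^^ n) y = x"
        using surj x(1) by blast
      then have "y \<in> k (Suc n)" "y \<notin> k n"
        using nz x by (auto simp: k_def)
      moreover have "k n \<subseteq> k (Suc n)"
        by (auto simp: k_def hom_zero)
      ultimately show ?thesis
        by blast
    qed
    have "n \<le> d (k n)" for n
    proof (induction n)
      case (Suc n)
      then show ?case
        using length_functionD[OF d sub sub strict, of n] by linarith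
    qed simp
    moreover have "d (k n) \<le> d (carrier M)" for n
      by (rule length_function_mono[OF d sub right_submodule_carrier[OF src.right_module_axioms]])
        (auto simp: k_def)
    ultimately show False
      by (metis le_trans not_less_eq_eq)
  qed
  then show ?thesis
    by (auto simp: inj_on_iff_kernel)
qed

section \<open>Maximal submodules and Nakayama's lemma\<close>

lemma maximal_submodule_exists:
  assumes "fd_algebra K A" "fg_right_module A M" "right_submodule A M U" "U \<noteq> carrier M"
  obtains V where "right_submodule A M V" "U \<subseteq> V" "V \<noteq> carrier M"
    "\<And>W. \<lbrakk>right_submodule A M W; V \<subset> W\<rbrakk> \<Longrightarrow> W = carrier M"
proof -
  have M: "right_module A M"
    using assms(2) by (rule fg_imp_right_module)
  obtain d where d: "length_function A M d"
    by (rule fg_length_function[OF assms(1,2)])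
  let ?P = "\<lambda>V. right_submodule A M V \<and> U \<subseteq> V \<and> V \<noteq> carrier M"
  have "d V < Suc (d (carrier M))" if "?P V" for V
    using that length_function_mono[OF d _ right_submodule_carrier[OF M], of V]
      right_submodule_subset[of A M V] by (auto simp: less_Suc_eq_le)
  then obtain V where V: "?P V" and max: "\<And>W. ?P W \<Longrightarrow> d W \<le> d V"
    using ex_has_greatest_nat[of ?P U d "Suc (d (carrier M))"] assms(3,4) by auto
  show ?thesis
  proof (rule that)
    fix W assume "right_submodule A M W" "V \<subset> W"
    then show "W = carrier M"
      using max[of W] length_functionD[OF d, of V W] V by auto
  qed (use V in auto)
qed

text \<open>The hypothesis \<open>rad\<close> says that \<open>W\<close> lies in the submodule
  generated by \<open>M rad(A)\<close>, without forming that submodule. If \<open>U\<close> were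
  proper, let \<open>V\<close> be maximal over it. For \<open>x\<close> outside \<open>V\<close> the
  right ideal of all \<open>a\<close> with \<open>x a \<in> V\<close> is maximal, because
  \<open>M / V\<close> is simple, and so contains the radical. Hence \<open>M rad(A)\<close> lies in
  \<open>V\<close>, and so do \<open>W\<close> and \<open>W + U\<close>, a contradiction.\<close>

lemma nakayama:
  assumes "fd_algebra K A" "fg_right_module A M"
    and U: "right_submodule A M U" and W: "right_submodule A M W"
    and rad: "\<And>V. \<lbrakk>right_submodule A M V;
      \<And>x e. \<lbrakk>x \<in> carrier M; e \<in> jacobson_radical A\<rbrakk> \<Longrightarrow> x \<star>\<^bsub>M\<^esub> e \<in> V\<rbrakk> \<Longrightarrow> W \<subseteq> V"
    and sum: "W <+>\<^bsub>M\<^esub> U = carrier M"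
  shows "U = carrier M"
proof (rule ccontr)
  assume "U \<noteq> carrier M"
  then obtain V where V: "right_submodule A M V" "U \<subseteq> V" "V \<noteq> carrier M"
    and max: "\<And>W. \<lbrakk>right_submodule A M W; V \<subset> W\<rbrakk> \<Longrightarrow> W = carrier M"
    by (rule maximal_submodule_exists[OF assms(1,2) U]) blast
  have M: "right_module A M"
    using assms(2) by (rule fg_imp_right_module)
  interpret M: right_module A M by fact
  have "x \<star>\<^bsub>M\<^esub> e \<in> V" if x: "x \<in> carrier M" and e: "e \<in> jacobson_radical A" for x e
  proof (cases "x \<in> V")
    case True
    then show ?thesis
      using e right_submodule_ract[OF V(1)] by (auto simp: jacobson_radical_def)
  next
    case False
    interpret o: rmod_hom A "regular_right A" M "\<lambda>a. x \<star>\<^bsub>M\<^esub> a"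
      by (rule M.rmod_hom_orbit[OF x])
    let ?I = "{a \<in> carrier (regular_right A). x \<star>\<^bsub>M\<^esub> a \<in> V}"
    have I: "right_submodule A (regular_right A) ?I"
      by (rule o.submodule_preimage[OF V(1)])
    have "J = carrier A" if J: "right_submodule A (regular_right A) J" "?I \<subseteq> J" "J \<noteq> ?I" for J
    proof -
      obtain b where b: "b \<in> J" "b \<notin> ?I" "b \<in> carrier A"
        using J right_submodule_subset[OF J(1)] by auto
      \<comment> \<open>Maximality of \<open>V\<close> gives \<open>V + x b A = M\<close>. Writing
        \<open>x = v + x b c\<close> puts \<open>1 - b c\<close> into \<open>?I\<close> and thus
        into \<open>J\<close>; since \<open>b c\<close> is in \<open>J\<close> too, so is
        one.\<close>
      let ?X = "(\<lambda>a. (x \<star>\<^bsub>M\<^esub> b) \<star>\<^bsub>M\<^esub> a) ` carrier A"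
      have xb: "x \<star>\<^bsub>M\<^esub> b \<in> carrier M"
        using x b M.ract_closed by blast
      have X: "right_submodule A M ?X"
        using rmod_hom.submodule_image[OF M.rmod_hom_orbit[OF xb]
            right_submodule_carrier[OF o.src.right_module_axioms]] by simp
      have "x \<star>\<^bsub>M\<^esub> b \<in> ?X"
        using M.ract_one[OF xb] by (metis M.act.one_closed image_eqI)
      then have "V \<subset> V <+>\<^bsub>M\<^esub> ?X"
        using set_add_upper_left[OF M V(1) X] set_add_upper_right[OF M V(1) X] b by auto
      then have "V <+>\<^bsub>M\<^esub> ?X = carrier M"
        using max right_submodule_set_add[OF M V(1) X] by blast
      then obtain v c where v: "v \<in> V" "c \<in> carrier A" "x = v \<oplus>\<^bsub>M\<^esub> (x \<star>\<^bsub>M\<^esub> b) \<star>\<^bsub>M\<^esub> c"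
        using x unfolding set_add_iff[symmetric] by (auto simp: set_add_iff dest!: equalityD2[THEN subsetD])
      have vM: "v \<in> carrier M"
        using v right_submodule_subset[OF V(1)] by auto
      have xbc: "(x \<star>\<^bsub>M\<^esub> b) \<star>\<^bsub>M\<^esub> c \<in> carrier M" "b \<otimes>\<^bsub>A\<^esub> c \<in> carrier A"
        using xb v b M.ract_closed by auto
      have "x \<star>\<^bsub>M\<^esub> (\<one>\<^bsub>A\<^esub> \<ominus>\<^bsub>A\<^esub> b \<otimes>\<^bsub>A\<^esub> c) = x \<ominus>\<^bsub>M\<^esub> (x \<star>\<^bsub>M\<^esub> b) \<star>\<^bsub>M\<^esub> c"
        using x b v xbc by (simp add: a_minus_def M.ract_add_right M.ract_minus M.ract_one M.ract_assoc)
      also have "\<dots> = (v \<oplus>\<^bsub>M\<^esub> (x \<star>\<^bsub>M\<^esub> b) \<star>\<^bsub>M\<^esub> c) \<ominus>\<^bsub>M\<^esub> (x \<star>\<^bsub>M\<^esub> b) \<star>\<^bsub>M\<^esub> c"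
        using v(3) by simp
      also have "\<dots> = v"
        using xbc vM by (simp add: a_minus_def M.grp.a_assoc M.grp.r_neg)
      finally have "\<one>\<^bsub>A\<^esub> \<ominus>\<^bsub>A\<^esub> b \<otimes>\<^bsub>A\<^esub> c \<in> ?I"
        using v xbc by simp
      then have 1: "\<one>\<^bsub>A\<^esub> \<ominus>\<^bsub>A\<^esub> b \<otimes>\<^bsub>A\<^esub> c \<in> J"
        using J(2) by auto
      have 2: "b \<otimes>\<^bsub>A\<^esub> c \<in> J"
        using right_submodule_ract[OF J(1) b(1) v(2)] by simp
      have "(\<one>\<^bsub>A\<^esub> \<ominus>\<^bsub>A\<^esub> b \<otimes>\<^bsub>A\<^esub> c) \<oplus>\<^bsub>A\<^esub> b \<otimes>\<^bsub>A\<^esub> c = \<one>\<^bsub>A\<^esub>"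
        using xbc by (simp add: a_minus_def M.act.a_assoc M.act.l_neg)
      then have "\<one>\<^bsub>A\<^esub> \<in> J"
        using right_submodule_add[OF J(1) 1 2] by simp
      then have "a \<in> J" if "a \<in> carrier A" for a
        using right_submodule_ract[OF J(1) _ that, of "\<one>\<^bsub>A\<^esub>"] that by simp
      then show ?thesis
        using right_submodule_subset[OF J(1)] by auto
    qed
    moreover have "?I \<noteq> carrier A"
    proof
      assume "?I = carrier A"
      then have "\<one>\<^bsub>A\<^esub> \<in> ?I"
        by simp
      then show False
        using False x by (simp add: M.ract_one)
    qed
    ultimately have "maximal_right_ideal A ?I"
      unfolding maximal_right_ideal_def using I by blast
    then have "e \<in> ?I"
      using e unfolding jacobson_radical_def by blast
    then show ?thesis
      by simp
  qed
  then have "W \<subseteq> V"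
    using rad[OF V(1)] by blast
  then have "W <+>\<^bsub>M\<^esub> U \<subseteq> V"
    using V(2) by (auto simp: set_add_iff intro!: right_submodule_add[OF V(1)])
  then show False
    using sum V(3) right_submodule_subset[OF V(1)] by blast
qed

section \<open>Projective modules\<close>

text \<open>The data of the dual basis lemma for finitely generated projective modules. It refers to
  no test modules and hence to no particular type, and a functor can be applied to it.\<close>

definition dual_basis :: "('a, 'z) ring_scheme \<Rightarrow> ('a, 'm, 'y) right_module_scheme \<Rightarrow>
    nat \<Rightarrow> (nat \<Rightarrow> 'm) \<Rightarrow> (nat \<Rightarrow> 'm \<Rightarrow> 'a) \<Rightarrow> bool"
  where "dual_basis A P n x \<phi> \<longleftrightarrow> right_module A P \<and> x \<in> {..<n} \<rightarrow> carrier P \<and>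
    (\<forall>i<n. rmod_hom A P (regular_right A) (\<phi> i)) \<and>
    (\<forall>p \<in> carrier P. p = (\<Oplus>\<^bsub>P\<^esub>i\<in>{..<n}. x i \<star>\<^bsub>P\<^esub> \<phi> i p))"

lemma dual_basisD:
  assumes "dual_basis A P n x \<phi>"
  shows "right_module A P" "\<And>i. i < n \<Longrightarrow> x i \<in> carrier P"
    "\<And>i. i < n \<Longrightarrow> rmod_hom A P (regular_right A) (\<phi> i)"
    "\<And>i p. \<lbrakk>i < n; p \<in> carrier P\<rbrakk> \<Longrightarrow> \<phi> i p \<in> carrier A"
    "\<And>p. p \<in> carrier P \<Longrightarrow> (\<Oplus>\<^bsub>P\<^esub>i\<in>{..<n}. x i \<star>\<^bsub>P\<^esub> \<phi> i p) = p"
  using assms rmod_hom.hom_closed[of A P "regular_right A"] by (auto simp: dual_basis_def)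

lemma dual_basis_expansion:
  assumes "dual_basis A P n x \<phi>" "rmod_hom A P N f" "p \<in> carrier P"
  shows "f p = (\<Oplus>\<^bsub>N\<^esub>i\<in>{..<n}. f (x i) \<star>\<^bsub>N\<^esub> \<phi> i p)"
proof -
  interpret f: rmod_hom A P N f by fact
  note D = dual_basisD[OF assms(1)]
  have "f p = f (\<Oplus>\<^bsub>P\<^esub>i\<in>{..<n}. x i \<star>\<^bsub>P\<^esub> \<phi> i p)"
    using D(5)[OF assms(3)] by simp
  also have "\<dots> = (\<Oplus>\<^bsub>N\<^esub>i\<in>{..<n}. f (x i \<star>\<^bsub>P\<^esub> \<phi> i p))"
    using D(2,4) assms(3) by (intro f.hom_finsum) (auto intro!: f.src.ract_closed)
  also have "\<dots> = (\<Oplus>\<^bsub>N\<^esub>i\<in>{..<n}. f (x i) \<star>\<^bsub>N\<^esub> \<phi> i p)"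
    using D(2,4) assms(3) by (intro f.tgt.grp.finsum_cong')
      (auto simp: f.hom_ract intro!: f.tgt.ract_closed f.hom_closed)
  finally show ?thesis .
qed

lemma dual_basis_combination_hom:
  assumes "dual_basis A P n x \<phi>" "right_module A N" "m \<in> {..<n} \<rightarrow> carrier N"
  shows "rmod_hom A P N (\<lambda>p. \<Oplus>\<^bsub>N\<^esub>i\<in>{..<n}. m i \<star>\<^bsub>N\<^esub> \<phi> i p)"
proof (rule rmod_hom_finsum)
  fix i assume "i \<in> {..<n}"
  then have "rmod_hom A P (regular_right A) (\<phi> i)" "m i \<in> carrier N"
    using dual_basisD(3)[OF assms(1)] assms(3) by auto
  then show "rmod_hom A P N (\<lambda>p. m i \<star>\<^bsub>N\<^esub> \<phi> i p)"
    using rmod_hom_comp right_module.rmod_hom_orbit[OF assms(2)] by fast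
qed (use dual_basisD(1)[OF assms(1)] assms(2) in auto)

text \<open>Only the finitely many values \<open>f (x i)\<close> have to be lifted. The functionals
  \<open>\<phi> i\<close> spread any choice of preimages to a homomorphism, so no compatibility
  between the choices has to be checked.\<close>

lemma dual_basis_lift:
  assumes "dual_basis A P n x \<phi>" "rmod_hom A M N g" "g ` carrier M = carrier N" "rmod_hom A P N f"
  shows "\<exists>h. rmod_hom A P M h \<and> (\<forall>p \<in> carrier P. g (h p) = f p)"
proof -
  interpret g: rmod_hom A M N g by fact
  interpret f: rmod_hom A P N f by fact
  note D = dual_basisD[OF assms(1)]
  have "\<exists>y. y \<in> carrier M \<and> g y = f (x i)" if "i < n" for i
    using f.hom_closed[OF D(2)[OF that]] assms(3) by (metis imageE)
  then obtain m where m: "\<And>i. i < n \<Longrightarrow> m i \<in> carrier M \<and> g (m i) = f (x i)"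
    by metis
  let ?h = "\<lambda>p. \<Oplus>\<^bsub>M\<^esub>i\<in>{..<n}. m i \<star>\<^bsub>M\<^esub> \<phi> i p"
  have "g (?h p) = f p" if p: "p \<in> carrier P" for p
  proof -
    have "g (?h p) = (\<Oplus>\<^bsub>N\<^esub>i\<in>{..<n}. g (m i \<star>\<^bsub>M\<^esub> \<phi> i p))"
      using m D(4) p by (intro g.hom_finsum) (auto intro!: g.src.ract_closed)
    also have "\<dots> = (\<Oplus>\<^bsub>N\<^esub>i\<in>{..<n}. f (x i) \<star>\<^bsub>N\<^esub> \<phi> i p)"
      using m D(2,4) p by (intro g.tgt.grp.finsum_cong')
        (auto simp: g.hom_ract intro!: g.tgt.ract_closed f.hom_closed)
    finally show ?thesis
      using dual_basis_expansion[OF assms(1,4) p] by simp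
  qed
  then show ?thesis
    using dual_basis_combination_hom[OF assms(1) g.src.right_module_axioms, of m] m by auto
qed

lemma dual_basis_fg:
  assumes "dual_basis A P n x \<phi>"
  shows "fg_right_module A P"
proof -
  note D = dual_basisD[OF assms]
  have "generates A P (x ` {..<n})"
    unfolding generates_def
  proof (intro conjI allI impI)
    show "x ` {..<n} \<subseteq> carrier P"
      using D(2) by auto
    fix U assume U: "right_submodule A P U \<and> x ` {..<n} \<subseteq> U"
    have "p \<in> U" if p: "p \<in> carrier P" for p
    proof -
      have "(\<Oplus>\<^bsub>P\<^esub>i\<in>{..<n}. x i \<star>\<^bsub>P\<^esub> \<phi> i p) \<in> U"
        using U D(4)[OF _ p] by (intro right_submodule_finsum[OF D(1)])
          (auto intro!: right_submodule_ract[of A P])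
      then show ?thesis
        using D(5)[OF p] by simp
    qed
    then show "U = carrier P"
      using U right_submodule_subset[of A P U] by auto
  qed
  then show ?thesis
    using D(1) by (auto simp: fg_right_module_iff_generates)
qed

text \<open>Direct summands inherit a dual basis by projecting the vectors and restricting the
  functionals. This yields projectivity of the covers built below and the existence of dual
  bases.\<close>

lemma dual_basis_retract:
  assumes "dual_basis A P n x \<phi>" "rmod_hom A P Q r" "rmod_hom A Q P i"
    and "\<forall>q \<in> carrier Q. r (i q) = q"
  shows "dual_basis A Q n (\<lambda>k. r (x k)) (\<lambda>k q. \<phi> k (i q))"
proof -
  interpret r: rmod_hom A P Q r by fact
  interpret i: rmod_hom A Q P i by fact
  note D = dual_basisD[OF assms(1)]
  show ?thesis
    unfolding dual_basis_def
  proof (intro conjI ballI allI impI)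
    show "(\<lambda>k. r (x k)) \<in> {..<n} \<rightarrow> carrier Q"
      using D(2) r.hom_closed by auto
    show "rmod_hom A Q (regular_right A) (\<lambda>q. \<phi> k (i q))" if "k < n" for k
      using rmod_hom_comp[OF assms(3) D(3)[OF that]] .
    show "q = (\<Oplus>\<^bsub>Q\<^esub>k\<in>{..<n}. r (x k) \<star>\<^bsub>Q\<^esub> \<phi> k (i q))" if "q \<in> carrier Q" for q
      using dual_basis_expansion[OF assms(1,2) i.hom_closed[OF that]] assms(4) that by simp
  qed (rule rmod_hom_source[OF assms(3)])
qed

subsection \<open>Free modules\<close>

definition free_right_module :: "('a, 'z) ring_scheme \<Rightarrow> nat \<Rightarrow> ('a, nat \<Rightarrow> 'a) right_module"
  where "free_right_module A n =
    \<lparr>carrier = {..<n} \<rightarrow>\<^sub>E carrier A, monoid.mult = undefined, monoid.one = undefined,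
     ring.zero = (\<lambda>i \<in> {..<n}. \<zero>\<^bsub>A\<^esub>), ring.add = (\<lambda>f g. \<lambda>i \<in> {..<n}. f i \<oplus>\<^bsub>A\<^esub> g i),
     ract = (\<lambda>f a. \<lambda>i \<in> {..<n}. f i \<otimes>\<^bsub>A\<^esub> a)\<rparr>"

lemma free_right_module_simps:
  "carrier (free_right_module A n) = {..<n} \<rightarrow>\<^sub>E carrier A"
  "\<zero>\<^bsub>free_right_module A n\<^esub> = (\<lambda>i \<in> {..<n}. \<zero>\<^bsub>A\<^esub>)"
  "f \<oplus>\<^bsub>free_right_module A n\<^esub> g = (\<lambda>i \<in> {..<n}. f i \<oplus>\<^bsub>A\<^esub> g i)"
  "f \<star>\<^bsub>free_right_module A n\<^esub> a = (\<lambda>i \<in> {..<n}. f i \<otimes>\<^bsub>A\<^esub> a)"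
  by (simp_all add: free_right_module_def)

lemma right_module_free:
  assumes "ring A"
  shows "right_module A (free_right_module A n)"
proof -
  interpret ring A by fact
  have "abelian_group (free_right_module A n)"
  proof (rule abelian_groupI)
    fix f assume f: "f \<in> carrier (free_right_module A n)"
    show "\<exists>g\<in>carrier (free_right_module A n). g \<oplus>\<^bsub>free_right_module A n\<^esub> f = \<zero>\<^bsub>free_right_module A n\<^esub>"
    proof (rule bexI)
      have f': "f i \<in> carrier A" if "i < n" for i
        using f that by (auto simp: free_right_module_simps)
      show "(\<lambda>i \<in> {..<n}. \<ominus>\<^bsub>A\<^esub> f i) \<in> carrier (free_right_module A n)"
        using f' by (auto simp: free_right_module_simps)
      show "(\<lambda>i \<in> {..<n}. \<ominus>\<^bsub>A\<^esub> f i) \<oplus>\<^bsub>free_right_module A n\<^esub> f = \<zero>\<^bsub>free_right_module A n\<^esub>"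
        using f' l_neg by (auto simp: free_right_module_simps intro: restrict_ext)
    qed
  qed (auto simp: free_right_module_simps PiE_iff extensional_def a_ac fun_eq_iff)
  then show ?thesis
    by (intro right_module.intro right_module_axioms.intro assms)
      (auto simp: free_right_module_simps PiE_iff extensional_def fun_eq_iff l_distr r_distr m_assoc)
qed

lemma free_right_module_coordinate:
  assumes "ring A" "i < n"
  shows "rmod_hom A (free_right_module A n) (regular_right A) (\<lambda>f. f i)"
  using assms(2)
  by (intro rmod_homI right_module_free right_module_regular assms(1))
    (auto simp: free_right_module_simps PiE_iff)

lemma free_right_module_dual_basis:
  assumes "ring A"
  shows "dual_basis A (free_right_module A n) n
    (\<lambda>i. \<lambda>j \<in> {..<n}. if j = i then \<one>\<^bsub>A\<^esub> else \<zero>\<^bsub>A\<^esub>) (\<lambda>i f. f i)"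
proof -
  interpret ring A by fact
  let ?F = "free_right_module A n" and ?u = "\<lambda>i. \<lambda>j \<in> {..<n}. if j = i then \<one>\<^bsub>A\<^esub> else \<zero>\<^bsub>A\<^esub>"
  interpret F: right_module A ?F
    by (rule right_module_free[OF assms])
  have u: "?u i \<in> carrier ?F" for i
    by (auto simp: free_right_module_simps)
  have "f = (\<Oplus>\<^bsub>?F\<^esub>i\<in>{..<n}. ?u i \<star>\<^bsub>?F\<^esub> f i)" if f: "f \<in> carrier ?F" for f
  proof (rule extensionalityI)
    have fi: "f i \<in> carrier A" if "i < n" for i
      using f that by (auto simp: free_right_module_simps PiE_iff)
    have terms: "(\<lambda>i. ?u i \<star>\<^bsub>?F\<^esub> f i) \<in> {..<n} \<rightarrow> carrier ?F"
      using u fi by (auto intro!: F.ract_closed)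
    show "f \<in> extensional {..<n}"
      using f by (auto simp: free_right_module_simps PiE_def)
    show "(\<Oplus>\<^bsub>?F\<^esub>i\<in>{..<n}. ?u i \<star>\<^bsub>?F\<^esub> f i) \<in> extensional {..<n}"
      using F.grp.finsum_closed[OF terms] by (auto simp: free_right_module_simps PiE_def)
    fix j assume "j \<in> {..<n}"
    then have j: "j < n"
      by simp
    interpret c: rmod_hom A ?F "regular_right A" "\<lambda>f. f j"
      by (rule free_right_module_coordinate[OF assms j])
    have "(\<Oplus>\<^bsub>?F\<^esub>i\<in>{..<n}. ?u i \<star>\<^bsub>?F\<^esub> f i) j = (\<Oplus>\<^bsub>regular_right A\<^esub>i\<in>{..<n}. (?u i \<star>\<^bsub>?F\<^esub> f i) j)"
      using terms by (intro c.hom_finsum) auto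
    also have "\<dots> = (?u j \<star>\<^bsub>?F\<^esub> f j) j"
      using j fi by (intro c.tgt.grp.finsum_eq_single) (auto simp: free_right_module_simps)
    also have "\<dots> = f j"
      using j fi by (simp add: free_right_module_simps)
    finally show "f j = (\<Oplus>\<^bsub>?F\<^esub>i\<in>{..<n}. ?u i \<star>\<^bsub>?F\<^esub> f i) j"
      by simp
  qed
  then show ?thesis
    using u free_right_module_coordinate[OF assms] F.right_module_axioms
    unfolding dual_basis_def by blast
qed

lemma free_cover:
  assumes "fg_right_module A M"
  obtains n q where "rmod_hom A (free_right_module A n) M q"
    "q ` carrier (free_right_module A n) = carrier M"
proof -
  interpret M: right_module A M
    by (rule fg_imp_right_module[OF assms])
  obtain s and n :: nat where s: "s \<in> {..<n} \<rightarrow> carrier M"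
    and gen: "\<forall>x \<in> carrier M. \<exists>b \<in> {..<n} \<rightarrow> carrier A. x = (\<Oplus>\<^bsub>M\<^esub>i \<in> {..<n}. s i \<star>\<^bsub>M\<^esub> b i)"
    by (rule fg_sequence[OF assms])
  let ?F = "free_right_module A n"
  let ?q = "\<lambda>f. \<Oplus>\<^bsub>M\<^esub>i \<in> {..<n}. s i \<star>\<^bsub>M\<^esub> f i"
  note db = free_right_module_dual_basis[OF M.act.ring_axioms, of n]
  have hom: "rmod_hom A ?F M ?q"
    using dual_basis_combination_hom[OF db M.right_module_axioms s] .
  have "x \<in> ?q ` carrier ?F" if x: "x \<in> carrier M" for x
  proof -
    obtain b where b: "b \<in> {..<n} \<rightarrow> carrier A" "x = ?q b"
      using gen x by blast
    have "?q (restrict b {..<n}) = ?q b"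
      using b s by (intro M.grp.finsum_cong') (auto simp: Pi_def M.ract_closed)
    moreover have "restrict b {..<n} \<in> carrier ?F"
      using b by (auto simp: free_right_module_simps)
    ultimately show ?thesis
      using b(2) by (intro image_eqI[of _ _ "restrict b {..<n}"]) simp_all
  qed
  then have surj: "?q ` carrier ?F = carrier M"
    using rmod_hom.hom_closed[OF hom] by blast
  show ?thesis
    by (rule that[OF hom surj])
qed

text \<open>
  A generating sequence presents the elements of a module as its fibres in the free module; this
  provides an isomorphic copy on the type over which \<open>projective\<close> quantifies.
\<close>

lemma fg_copy:
  fixes A :: "('a, 'z) ring_scheme"
  assumes "fg_right_module A M"
  obtains M' :: "'a fg_mod" and \<phi> where "fg_right_module A M'" "rmod_hom A M M' \<phi>"
    "bij_betw \<phi> (carrier M) (carrier M')"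
proof -
  have M: "right_module A M"
    by (rule fg_imp_right_module[OF assms])
  obtain n q where q: "rmod_hom A (free_right_module A n) M q"
    "q ` carrier (free_right_module A n) = carrier M"
    by (rule free_cover[OF assms])
  define \<phi> where "\<phi> m = {f \<in> carrier (free_right_module A n). q f = m}" for m
  have "inj_on \<phi> (carrier M)"
  proof (rule inj_onI)
    fix m m' assume "m \<in> carrier M" "m' \<in> carrier M" and eq: "\<phi> m = \<phi> m'"
    then have "m \<in> q ` carrier (free_right_module A n)"
      using q(2) by simp
    then obtain f where "f \<in> \<phi> m"
      unfolding \<phi>_def by blast
    then have "f \<in> \<phi> m" "f \<in> \<phi> m'"
      using eq by auto
    then show "m = m'"
      by (simp add: \<phi>_def)
  qed
  note t = transport_module[OF M this]
  have "fg_right_module A (transport_module \<phi> M)"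
    using fg_image[OF t(2) _ assms] t(3) by (simp add: bij_betw_def)
  then show ?thesis
    by (rule that[OF _ t(2,3)])
qed

text \<open>A lift of the identity along a free cover splits the cover, and a retract of a free
  module has a dual basis. As the definition of \<open>projective\<close> admits only test modules
  of type \<open>'a fg_mod\<close>, the free module and \<open>P\<close> are first replaced by
  copies on that type.\<close>

lemma projective_iff_dual_basis:
  fixes A :: "('a, 'z) ring_scheme"
  shows "projective A P \<longleftrightarrow> (\<exists>n x \<phi>. dual_basis A P n x \<phi>)"
proof
  assume P: "projective A P"
  then have fg: "fg_right_module A P"
    by (simp add: projective_def)
  interpret P: right_module A P
    by (rule fg_imp_right_module[OF fg])
  obtain n q where q: "rmod_hom A (free_right_module A n) P q"
    "q ` carrier (free_right_module A n) = carrier P"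
    by (rule free_cover[OF fg])
  let ?F = "free_right_module A n"
  note db = free_right_module_dual_basis[OF P.act.ring_axioms, of n]
  obtain F' :: "'a fg_mod" and \<alpha> where \<alpha>: "fg_right_module A F'" "rmod_hom A ?F F' \<alpha>"
    "bij_betw \<alpha> (carrier ?F) (carrier F')"
    by (rule fg_copy[OF dual_basis_fg[OF db]])
  obtain P' :: "'a fg_mod" and \<beta> where \<beta>: "fg_right_module A P'" "rmod_hom A P P' \<beta>"
    "bij_betw \<beta> (carrier P) (carrier P')"
    by (rule fg_copy[OF fg])
  let ?\<alpha>' = "inv_into (carrier ?F) \<alpha>"
  have \<alpha>': "rmod_hom A F' ?F ?\<alpha>'"
    by (rule rmod_hom_inv_into[OF \<alpha>(2,3)])
  have \<alpha>'_surj: "?\<alpha>' ` carrier F' = carrier ?F"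
    using bij_betw_inv_into[OF \<alpha>(3)] by (simp add: bij_betw_def)
  have g: "rmod_hom A F' P' (\<lambda>y. \<beta> (q (?\<alpha>' y)))"
    by (rule rmod_hom_comp[OF rmod_hom_comp[OF \<alpha>' q(1)] \<beta>(2)])
  have "(\<lambda>y. \<beta> (q (?\<alpha>' y))) ` carrier F' = \<beta> ` q ` ?\<alpha>' ` carrier F'"
    by auto
  also have "\<dots> = carrier P'"
    using \<beta>(3) q(2) \<alpha>'_surj by (simp add: bij_betw_def)
  finally have g_surj: "restrict (\<lambda>y. \<beta> (q (?\<alpha>' y))) (carrier F') ` carrier F' = carrier P'"
    by simp
  \<comment> \<open>The cover is conjugated by the copies \<open>\<alpha>\<close> and
    \<open>\<beta>\<close>, and \<open>\<beta>\<close> itself is lifted; as \<open>\<beta>\<close>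
    is injective this is the same as splitting \<open>q\<close>.\<close>
  obtain h where h: "h \<in> right_hom A P F'"
    "\<forall>x \<in> carrier P. restrict (\<lambda>y. \<beta> (q (?\<alpha>' y))) (carrier F') (h x) = restrict \<beta> (carrier P) x"
    using P \<alpha>(1) \<beta>(1) g_surj rmod_hom.restrict_in_right_hom[OF g]
      rmod_hom.restrict_in_right_hom[OF \<beta>(2)] unfolding projective_def by blast
  have h_hom: "rmod_hom A P F' h"
    by (rule rmod_hom_of_right_hom[OF P.right_module_axioms fg_imp_right_module[OF \<alpha>(1)] h(1)])
  have "q (?\<alpha>' (h x)) = x" if x: "x \<in> carrier P" for x
  proof -
    have "\<beta> (q (?\<alpha>' (h x))) = \<beta> x"
      using bspec[OF h(2) x] x rmod_hom.hom_closed[OF h_hom x] by simp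
    moreover have "q (?\<alpha>' (h x)) \<in> carrier P"
      by (intro rmod_hom.hom_closed[OF q(1)] rmod_hom.hom_closed[OF \<alpha>']
          rmod_hom.hom_closed[OF h_hom] x)
    ultimately show ?thesis
      using \<beta>(3) x by (auto simp: bij_betw_def dest: inj_onD)
  qed
  then have "\<forall>x \<in> carrier P. q (?\<alpha>' (h x)) = x"
    by blast
  then show "\<exists>n x \<phi>. dual_basis A P n x \<phi>"
    using dual_basis_retract[OF db q(1) rmod_hom_comp[OF h_hom \<alpha>']] by blast
next
  assume "\<exists>n x \<phi>. dual_basis A P n x \<phi>"
  then obtain n x \<phi> where db: "dual_basis A P n x \<phi>"
    by blast
  show "projective A P"
    unfolding projective_def
  proof (intro conjI allI impI)
    show "fg_right_module A P"
      by (rule dual_basis_fg[OF db])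
    fix M N :: "'a fg_mod" and g f
    assume *: "fg_right_module A M \<and> fg_right_module A N \<and>
      g \<in> right_hom A M N \<and> g ` carrier M = carrier N \<and> f \<in> right_hom A P N"
    then have g: "rmod_hom A M N g" and f: "rmod_hom A P N f"
      using dual_basisD(1)[OF db] by (auto intro: rmod_hom_of_right_hom fg_imp_right_module)
    then obtain h where h: "rmod_hom A P M h" "\<forall>p \<in> carrier P. g (h p) = f p"
      using dual_basis_lift[OF db g _ f] * by blast
    then show "\<exists>h \<in> right_hom A P M. \<forall>x \<in> carrier P. g (h x) = f x"
      using rmod_hom.restrict_in_right_hom[OF h(1)] by (intro bexI[of _ "restrict h (carrier P)"]) auto
  qed
qed

text \<open>In contrast to the definition of \<open>projective\<close>, the source and target of the
  surjection may be of any type.\<close>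

lemma projective_lift:
  assumes "projective A P" "rmod_hom A M N g" "g ` carrier M = carrier N" "rmod_hom A P N f"
  obtains h where "rmod_hom A P M h" "\<forall>p \<in> carrier P. g (h p) = f p"
proof -
  obtain n x \<phi> where "dual_basis A P n x \<phi>"
    using assms(1) by (auto simp: projective_iff_dual_basis)
  from dual_basis_lift[OF this assms(2-4)] that show ?thesis
    by blast
qed

subsection \<open>Projective covers\<close>

lemma (in rmod_hom) set_add_kernel_iff:
  assumes "f ` carrier M = carrier N" "right_submodule A M U"
  shows "a_kernel M N f <+>\<^bsub>M\<^esub> U = carrier M \<longleftrightarrow> f ` U = carrier N"
proof
  have U: "x \<in> carrier M" if "x \<in> U" for x
    using right_submodule_subset[OF assms(2)] that by auto
  assume sum: "a_kernel M N f <+>\<^bsub>M\<^esub> U = carrier M"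
  have "f x \<in> f ` U" if "x \<in> carrier M" for x
  proof -
    have "x \<in> a_kernel M N f <+>\<^bsub>M\<^esub> U"
      using that sum by simp
    then obtain k u where "k \<in> carrier M" "f k = \<zero>\<^bsub>N\<^esub>" "u \<in> U" "x = k \<oplus>\<^bsub>M\<^esub> u"
      by (auto simp: set_add_iff a_kernel_eq)
    then show ?thesis
      using U by (simp add: hom_add hom_closed)
  qed
  then have "f ` carrier M \<subseteq> f ` U"
    by auto
  then show "f ` U = carrier N"
    using U assms(1) by auto
next
  have U: "x \<in> carrier M" if "x \<in> U" for x
    using right_submodule_subset[OF assms(2)] that by auto
  assume im: "f ` U = carrier N"
  have "x \<in> a_kernel M N f <+>\<^bsub>M\<^esub> U" if x: "x \<in> carrier M" for x
  proof -
    have "f x \<in> f ` U"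
      using hom_closed[OF x] im by simp
    then obtain u where u: "u \<in> U" "f x = f u"
      by blast
    then have "x \<ominus>\<^bsub>M\<^esub> u \<in> a_kernel M N f"
      using eq_iff_minus_in_kernel x U by blast
    moreover have "x = (x \<ominus>\<^bsub>M\<^esub> u) \<oplus>\<^bsub>M\<^esub> u"
      using x u U by (simp add: a_minus_def src.grp.a_assoc src.grp.l_neg)
    ultimately show ?thesis
      using u by (auto simp: set_add_iff)
  qed
  moreover have "a_kernel M N f <+>\<^bsub>M\<^esub> U \<subseteq> carrier M"
    using U by (auto simp: set_add_iff a_kernel_eq)
  ultimately show "a_kernel M N f <+>\<^bsub>M\<^esub> U = carrier M"
    by blast
qed

lemma a_kernel_restrict: "a_kernel M N (restrict f (carrier M)) = a_kernel M N f"
  by (auto simp: a_kernel_def')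

lemma projective_coverI:
  assumes "projective A P" "rmod_hom A P M p" "p ` carrier P = carrier M"
    and "\<And>U. \<lbrakk>right_submodule A P U; p ` U = carrier M\<rbrakk> \<Longrightarrow> U = carrier P"
  shows "projective_cover A P M (restrict p (carrier P))"
proof -
  interpret rmod_hom A P M p by fact
  show ?thesis
    unfolding projective_cover_def superfluous_def a_kernel_restrict
    using assms(1,3,4) restrict_in_right_hom submodule_kernel set_add_kernel_iff[OF assms(3)] by auto
qed

lemma projective_coverD:
  assumes "projective_cover A P M p" "right_module A M"
  shows "projective A P" "rmod_hom A P M p" "p ` carrier P = carrier M"
    "\<And>U. \<lbrakk>right_submodule A P U; p ` U = carrier M\<rbrakk> \<Longrightarrow> U = carrier P"
proof -
  show P: "projective A P" and surj: "p ` carrier P = carrier M"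
    using assms(1) by (simp_all add: projective_cover_def)
  have "right_module A P"
    using P by (auto simp: projective_def intro: fg_imp_right_module)
  then show hom: "rmod_hom A P M p"
    using assms by (auto simp: projective_cover_def intro: rmod_hom_of_right_hom)
  show "\<And>U. \<lbrakk>right_submodule A P U; p ` U = carrier M\<rbrakk> \<Longrightarrow> U = carrier P"
    using assms(1) rmod_hom.set_add_kernel_iff[OF hom surj]
    by (auto simp: projective_cover_def superfluous_def)
qed

text \<open>
  Among the endomorphisms \<open>h\<close> of a free module over \<open>M\<close> choose one with image of minimal length.
  It is injective on its image, which is therefore a direct summand and covers \<open>M\<close> minimally.
\<close>

lemma projective_cover_exists:
  fixes A :: "('k, 'a, 'z) module_scheme"
  assumes "fd_algebra K A" "fg_right_module A M"
  obtains P :: "'a fg_mod" and p where "projective_cover A P M p"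
proof -
  obtain n q where q: "rmod_hom A (free_right_module A n) M q"
    "q ` carrier (free_right_module A n) = carrier M"
    by (rule free_cover[OF assms(2)])
  note free = free_right_module_dual_basis[OF fd_algebra_ring[OF assms(1)], of n]
  obtain Q :: "'a fg_mod" and \<phi> where \<phi>: "fg_right_module A Q"
    "rmod_hom A (free_right_module A n) Q \<phi>" "bij_betw \<phi> (carrier (free_right_module A n)) (carrier Q)"
    by (rule fg_copy[OF dual_basis_fg[OF free]])
  let ?\<phi>' = "inv_into (carrier (free_right_module A n)) \<phi>"
  have \<phi>': "rmod_hom A Q (free_right_module A n) ?\<phi>'"
    by (rule rmod_hom_inv_into[OF \<phi>(2,3)])
  have "\<forall>y \<in> carrier Q. \<phi> (?\<phi>' y) = y"
    using \<phi>(3) by (simp add: bij_betw_inv_into_right)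
  note Q_db = dual_basis_retract[OF free \<phi>(2) \<phi>', OF this]
  have Q_proj: "projective A Q"
    using Q_db by (auto simp: projective_iff_dual_basis)
  have \<phi>'_surj: "?\<phi>' ` carrier Q = carrier (free_right_module A n)"
    using bij_betw_inv_into[OF \<phi>(3)] by (simp add: bij_betw_def)
  define r where "r y = q (?\<phi>' y)" for y
  have r: "rmod_hom A Q M r"
    unfolding r_def by (rule rmod_hom_comp[OF \<phi>' q(1)])
  have "r ` carrier Q = q ` ?\<phi>' ` carrier Q"
    unfolding r_def by (simp only: image_image)
  then have r_surj: "r ` carrier Q = carrier M"
    by (simp only: \<phi>'_surj q(2))
  interpret r: rmod_hom A Q M r by fact
  have Q: "right_module A Q"
    by (rule rmod_hom_source[OF r])
  obtain d where d: "length_function A Q d"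
    by (rule fg_length_function[OF assms(1) \<phi>(1)])
  let ?H = "\<lambda>h. rmod_hom A Q Q h \<and> (\<forall>x \<in> carrier Q. r (h x) = r x)"
  have "?H (\<lambda>x. x)"
    using rmod_hom_id[OF Q] by simp
  then obtain h where h: "?H h" and min: "\<And>k. ?H k \<Longrightarrow> d (h ` carrier Q) \<le> d (k ` carrier Q)"
    using ex_has_least_nat[of ?H "\<lambda>x. x" "\<lambda>h. d (h ` carrier Q)"] by blast
  interpret h: rmod_hom A Q Q h
    using h by simp
  let ?X = "h ` carrier Q"
  have X: "right_submodule A Q ?X"
    by (rule h.submodule_image[OF right_submodule_carrier[OF Q]])
  have X_in: "x \<in> carrier Q" if "x \<in> ?X" for x
    using that h.hom_closed by auto
  have hh: "?H (\<lambda>x. h (h x))"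
    using rmod_hom_comp[of A Q Q h Q h] h h.hom_closed by auto
  have hX_sub: "h ` ?X \<subseteq> ?X"
    using X_in by auto
  have hX: "right_submodule A Q (h ` ?X)"
    by (rule h.submodule_image[OF X])
  have "(\<lambda>x. h (h x)) ` carrier Q = h ` ?X"
    by auto
  \<comment> \<open>The square of \<open>h\<close> is again an endomorphism over \<open>M\<close>,
    with image inside that of \<open>h\<close>. Minimal length forces the two images to
    agree.\<close>
  then have hX_eq: "h ` ?X = ?X"
    using min[OF hh] length_functionD[OF d hX X] hX_sub by fastforce
  let ?P = "Q\<lparr>carrier := ?X\<rparr>"
  have P: "right_module A ?P"
    by (rule right_module_submodule[OF Q X])
  have P_fg: "fg_right_module A ?P"
    by (rule fg_submodule[OF assms(1) \<phi>(1) X])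
  have hP: "rmod_hom A Q ?P h"
    by (rule rmod_hom_restrict_codomain[OF h.rmod_hom_axioms X]) simp
  have hPP: "rmod_hom A ?P ?P h"
    by (rule rmod_hom_restrict_codomain[OF rmod_hom_restrict_domain[OF h.rmod_hom_axioms X] X])
      (use hX_sub in auto)
  have "inj_on h (carrier ?P)"
    by (rule surj_endo_inj[OF assms(1) P_fg hPP]) (use hX_eq in simp)
  then have hP_bij: "bij_betw h (carrier ?P) (carrier ?P)"
    using hX_eq by (simp add: bij_betw_def)
  let ?h' = "inv_into (carrier ?P) h"
  have h': "rmod_hom A ?P ?P ?h'"
    by (rule rmod_hom_inv_into[OF hPP hP_bij])
  \<comment> \<open>On its image \<open>h\<close> is bijective; its inverse there, regarded as a map
    into \<open>Q\<close>, is a section of \<open>h\<close> from \<open>Q\<close> onto the image,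
    which makes the image a retract of \<open>Q\<close>.\<close>
  have h'Q: "rmod_hom A ?P Q ?h'"
    by (rule rmod_hom_expand_codomain[OF Q X h'])
  have "\<forall>x \<in> carrier ?P. h (?h' x) = x"
    using bij_betw_inv_into_right[OF hP_bij] by blast
  then have P_proj: "projective A ?P"
    using dual_basis_retract[OF Q_db hP h'Q] by (auto simp: projective_iff_dual_basis)
  have rP: "rmod_hom A ?P M r"
    by (rule rmod_hom_restrict_domain[OF r X])
  have "r ` ?X = r ` carrier Q"
    using h by (auto simp: image_image)
  then have rP_surj: "r ` carrier ?P = carrier M"
    using r_surj by simp
  have "projective_cover A ?P M (restrict r (carrier ?P))"
  proof (rule projective_coverI[OF P_proj rP rP_surj])
    fix U assume "right_submodule A ?P U" and rU: "r ` U = carrier M"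
    then have U: "right_submodule A Q U" "U \<subseteq> ?X"
      using right_submodule_restrict_iff[OF Q X] by auto
    have rU_hom: "rmod_hom A (Q\<lparr>carrier := U\<rparr>) M r"
      by (rule rmod_hom_restrict_domain[OF r U(1)])
    \<comment> \<open>If \<open>U\<close> already covers \<open>M\<close>, lifting \<open>r\<close>
      through \<open>U\<close> produces a competitor of \<open>h\<close> with image in
      \<open>U\<close>, so \<open>U\<close> cannot be shorter than the image of
      \<open>h\<close>.\<close>
    obtain k where k: "rmod_hom A Q (Q\<lparr>carrier := U\<rparr>) k" "\<forall>x \<in> carrier Q. r (k x) = r x"
      by (rule projective_lift[OF Q_proj rU_hom _ r]) (use rU in auto)
    have kQ: "rmod_hom A Q Q k"
      by (rule rmod_hom_expand_codomain[OF Q U(1) k(1)])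
    have kU: "k ` carrier Q \<subseteq> U"
      using rmod_hom.hom_closed[OF k(1)] by auto
    have "d ?X \<le> d (k ` carrier Q)"
      using min k(2) kQ by blast
    also have "\<dots> \<le> d U"
      by (rule length_function_mono[OF d rmod_hom.submodule_image[OF kQ right_submodule_carrier[OF Q]] U(1) kU])
    finally show "U = carrier ?P"
      using length_functionD[OF d U(1) X] U(2) by (auto simp: psubset_eq)
  qed
  then show ?thesis
    by (rule that)
qed

section \<open>Minimal projective presentations on arbitrary types and their comparison\<close>

definition projective_presentation ::
  "('a, 'z) ring_scheme \<Rightarrow> ('a, 'm, 'y) right_module_scheme
    \<Rightarrow> ('a, 'q, 'w) right_module_scheme \<Rightarrow> ('q \<Rightarrow> 'p) \<Rightarrow> ('a, 'p, 'v) right_module_scheme \<Rightarrow> ('p \<Rightarrow> 'm) \<Rightarrow> bool"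
  where "projective_presentation A M P1 p1 P0 p0 \<longleftrightarrow>
    projective_cover A P0 M p0 \<and> projective_cover A P1 (P0\<lparr>carrier := a_kernel P0 M p0\<rparr>) p1"

text \<open>The two conditions differ only in their types. The freedom in
  \<open>projective_presentation\<close> is what admits \<open>ind P1\<close> and
  \<open>ind P0\<close>, whose elements are classes of formal sums.\<close>

lemma minimal_projective_presentation_eq:
  "minimal_projective_presentation = projective_presentation"
  by (intro ext) (simp add: minimal_projective_presentation_def projective_presentation_def)

lemma projective_presentationD:
  assumes "projective_presentation A M P1 p1 P0 p0" "right_module A M"
  shows "projective_cover A P0 M p0" "projective_cover A P1 (P0\<lparr>carrier := a_kernel P0 M p0\<rparr>) p1"
    "right_module A (P0\<lparr>carrier := a_kernel P0 M p0\<rparr>)" "right_submodule A P0 (a_kernel P0 M p0)"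
    "rmod_hom A P1 P0 p1" "\<And>x. x \<in> carrier P1 \<Longrightarrow> p0 (p1 x) = \<zero>\<^bsub>M\<^esub>"
    "\<And>y. \<lbrakk>y \<in> carrier P0; p0 y = \<zero>\<^bsub>M\<^esub>\<rbrakk> \<Longrightarrow> \<exists>x \<in> carrier P1. p1 x = y"
proof -
  show c: "projective_cover A P0 M p0" "projective_cover A P1 (P0\<lparr>carrier := a_kernel P0 M p0\<rparr>) p1"
    using assms(1) by (simp_all add: projective_presentation_def)
  note D = projective_coverD[OF c(1) assms(2)]
  interpret p0: rmod_hom A P0 M p0
    by (rule D(2))
  show ker: "right_submodule A P0 (a_kernel P0 M p0)"
    by (rule p0.submodule_kernel)
  show K: "right_module A (P0\<lparr>carrier := a_kernel P0 M p0\<rparr>)"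
    by (rule right_module_submodule[OF p0.src.right_module_axioms ker])
  note E = projective_coverD[OF c(2) K]
  show "rmod_hom A P1 P0 p1"
    by (rule rmod_hom_expand_codomain[OF p0.src.right_module_axioms ker E(2)])
  show "p0 (p1 x) = \<zero>\<^bsub>M\<^esub>" if "x \<in> carrier P1" for x
    using rmod_hom.hom_closed[OF E(2) that] by (simp add: p0.a_kernel_eq)
  show "\<exists>x \<in> carrier P1. p1 x = y" if "y \<in> carrier P0" "p0 y = \<zero>\<^bsub>M\<^esub>" for y
  proof -
    have "y \<in> p1 ` carrier P1"
      using E(3) that by (simp add: p0.a_kernel_eq)
    then show ?thesis
      by auto
  qed
qed

lemma projective_presentation_exists:
  fixes A :: "('k, 'a, 'z) module_scheme"
  assumes "fd_algebra K A" "fg_right_module A M"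
  shows "\<exists>(P1 :: 'a fg_mod) p1 (P0 :: 'a fg_mod) p0. projective_presentation A M P1 p1 P0 p0"
proof -
  obtain P0 :: "'a fg_mod" and p0 where p0: "projective_cover A P0 M p0"
    by (rule projective_cover_exists[OF assms])
  note D = projective_coverD[OF p0 fg_imp_right_module[OF assms(2)]]
  have "fg_right_module A (P0\<lparr>carrier := a_kernel P0 M p0\<rparr>)"
    using D(1) by (intro fg_submodule[OF assms(1)] rmod_hom.submodule_kernel[OF D(2)])
      (simp add: projective_def)
  then obtain P1 :: "'a fg_mod" and p1 where
    "projective_cover A P1 (P0\<lparr>carrier := a_kernel P0 M p0\<rparr>) p1"
    by (rule projective_cover_exists[OF assms(1)])
  then show ?thesis
    using p0 unfolding projective_presentation_def by blast
qed

text \<open>The image of \<open>h\<close> still maps onto \<open>M\<close>, so by minimality it is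
  everything; a surjective endomorphism is injective by \<open>surj_endo_inj\<close>. Nothing has to
  be assumed about the composite of \<open>p\<close> and \<open>h\<close> beyond its image.\<close>

lemma projective_cover_endo_bij:
  assumes "fd_algebra K A" "projective_cover A P M p" "right_module A M"
    and "rmod_hom A P P h" "p ` h ` carrier P = carrier M"
  shows "bij_betw h (carrier P) (carrier P)"
proof -
  note D = projective_coverD[OF assms(2,3)]
  have "h ` carrier P = carrier P"
    by (rule D(4)[OF rmod_hom.submodule_image[OF assms(4)
        right_submodule_carrier[OF rmod_hom_source[OF assms(4)]]] assms(5)])
  moreover have "fg_right_module A P"
    using D(1) by (simp add: projective_def)
  ultimately show ?thesis
    using surj_endo_inj[OF assms(1) _ assms(4)] by (simp add: bij_betw_def)
qed

definition factors_through ::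
  "('a, 'z) ring_scheme \<Rightarrow> ('a, 'q, 'w) right_module_scheme \<Rightarrow> ('q \<Rightarrow> 'p) \<Rightarrow>
    ('a, 'p, 'v) right_module_scheme \<Rightarrow> ('a, 'n, 'y) right_module_scheme \<Rightarrow> bool"
  where "factors_through A P1 p1 P0 N \<longleftrightarrow>
    (\<forall>f. rmod_hom A P1 N f \<longrightarrow> (\<exists>g. rmod_hom A P0 N g \<and> (\<forall>x \<in> carrier P1. f x = g (p1 x))))"

text \<open>
  Two minimal presentations of \<open>M\<close> are compared by lifts in both directions; the composites of
  these lifts are automorphisms because the covers are minimal.
\<close>

lemma factors_through_presentation_unique:
  assumes A: "fd_algebra K A" and M: "right_module A M"
    and P: "projective_presentation A M P1 p1 P0 p0"
    and Q: "projective_presentation A M Q1 q1 Q0 q0"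
    and fac: "factors_through A P1 p1 P0 N"
  shows "factors_through A Q1 q1 Q0 N"
  unfolding factors_through_def
proof (intro allI impI)
  fix f assume f: "rmod_hom A Q1 N f"
  note PD = projective_presentationD[OF P M]
  note QD = projective_presentationD[OF Q M]
  note P0 = projective_coverD[OF PD(1) M]
  note Q0 = projective_coverD[OF QD(1) M]
  note P1 = projective_coverD[OF PD(2,3)]
  note Q1 = projective_coverD[OF QD(2,3)]
  interpret p0: rmod_hom A P0 M p0 by (rule P0(2))
  interpret q0: rmod_hom A Q0 M q0 by (rule Q0(2))
  interpret p1: rmod_hom A P1 P0 p1 by (rule PD(5))
  interpret q1: rmod_hom A Q1 Q0 q1 by (rule QD(5))
  obtain a0 where a0: "rmod_hom A P0 Q0 a0" "\<forall>x \<in> carrier P0. q0 (a0 x) = p0 x"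
    by (rule projective_lift[OF P0(1) Q0(2,3) P0(2)])
  obtain b0 where b0: "rmod_hom A Q0 P0 b0" "\<forall>x \<in> carrier Q0. p0 (b0 x) = q0 x"
    by (rule projective_lift[OF Q0(1) P0(2,3) Q0(2)])
  interpret a0: rmod_hom A P0 Q0 a0 by (rule a0(1))
  interpret b0: rmod_hom A Q0 P0 b0 by (rule b0(1))
  have a0p1: "rmod_hom A P1 (Q0\<lparr>carrier := a_kernel Q0 M q0\<rparr>) (\<lambda>x. a0 (p1 x))"
    by (rule rmod_hom_restrict_codomain[OF rmod_hom_comp[OF PD(5) a0(1)] QD(4)])
      (simp add: q0.a_kernel_eq a0 a0.hom_closed p1.hom_closed PD(6))
  obtain a1 where a1: "rmod_hom A P1 Q1 a1" "\<forall>x \<in> carrier P1. q1 (a1 x) = a0 (p1 x)"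
    by (rule projective_lift[OF P1(1) Q1(2,3) a0p1])
  have b0q1: "rmod_hom A Q1 (P0\<lparr>carrier := a_kernel P0 M p0\<rparr>) (\<lambda>x. b0 (q1 x))"
    by (rule rmod_hom_restrict_codomain[OF rmod_hom_comp[OF QD(5) b0(1)] PD(4)])
      (simp add: p0.a_kernel_eq b0 b0.hom_closed q1.hom_closed QD(6))
  obtain b1 where b1: "rmod_hom A Q1 P1 b1" "\<forall>x \<in> carrier Q1. p1 (b1 x) = b0 (q1 x)"
    by (rule projective_lift[OF Q1(1) P1(2,3) b0q1])
  interpret a1: rmod_hom A P1 Q1 a1 by (rule a1(1))
  interpret b1: rmod_hom A Q1 P1 b1 by (rule b1(1))
  let ?c0 = "\<lambda>x. a0 (b0 x)" and ?c1 = "\<lambda>x. a1 (b1 x)"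
  have c0: "rmod_hom A Q0 Q0 ?c0"
    by (rule rmod_hom_comp[OF b0(1) a0(1)])
  have c1: "rmod_hom A Q1 Q1 ?c1"
    by (rule rmod_hom_comp[OF b1(1) a1(1)])
  have q0c0: "q0 (?c0 x) = q0 x" if "x \<in> carrier Q0" for x
    using that a0(2) b0(2) b0.hom_closed by simp
  have "q0 ` ?c0 ` carrier Q0 = q0 ` carrier Q0"
    unfolding image_image by (rule image_cong) (simp_all add: q0c0)
  then have c0_bij: "bij_betw ?c0 (carrier Q0) (carrier Q0)"
    using Q0(3) by (intro projective_cover_endo_bij[OF A QD(1) M c0]) simp
  have q1c1: "q1 (?c1 x) = ?c0 (q1 x)" if "x \<in> carrier Q1" for x
    using that a1(2) b1(2) b1.hom_closed by simp
  \<comment> \<open>An element \<open>y\<close> of the kernel is \<open>?c0 z\<close>; as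
    \<open>?c0\<close> respects \<open>q0\<close>, \<open>z\<close> is in the kernel as well and
    comes from \<open>Q1\<close>. So the composite \<open>?c1\<close> still covers the kernel, which
    makes it bijective.\<close>
  have "a_kernel Q0 M q0 \<subseteq> q1 ` ?c1 ` carrier Q1"
  proof
    fix y assume "y \<in> a_kernel Q0 M q0"
    then have y: "y \<in> carrier Q0" "q0 y = \<zero>\<^bsub>M\<^esub>"
      by (simp_all add: q0.a_kernel_eq)
    then obtain z where z: "z \<in> carrier Q0" "?c0 z = y"
      using c0_bij by (metis bij_betw_def imageE)
    then have "q0 z = \<zero>\<^bsub>M\<^esub>"
      using q0c0[OF z(1)] y(2) by simp
    then obtain x where "x \<in> carrier Q1" "q1 x = z"
      using QD(7) z(1) by blast
    then show "y \<in> q1 ` ?c1 ` carrier Q1"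
      using q1c1[of x] z(2) by (auto intro!: image_eqI[of _ q1 "?c1 x"])
  qed
  moreover have "q1 ` ?c1 ` carrier Q1 \<subseteq> a_kernel Q0 M q0"
    using rmod_hom.hom_closed[OF c1] QD(6) q1.hom_closed by (auto simp: q0.a_kernel_eq)
  ultimately have c1_bij: "bij_betw ?c1 (carrier Q1) (carrier Q1)"
    by (intro projective_cover_endo_bij[OF A QD(2,3) c1]) auto
  have fa1: "rmod_hom A P1 N (\<lambda>x. f (a1 x))"
    by (rule rmod_hom_comp[OF a1(1) f])
  then obtain g where g: "rmod_hom A P0 N g" "\<forall>x \<in> carrier P1. f (a1 x) = g (p1 x)"
    using fac unfolding factors_through_def by blast
  let ?c0' = "inv_into (carrier Q0) ?c0" and ?c1' = "inv_into (carrier Q1) ?c1"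
  have c0': "rmod_hom A Q0 Q0 ?c0'"
    by (rule rmod_hom_inv_into[OF c0 c0_bij])
  have c1': "rmod_hom A Q1 Q1 ?c1'"
    by (rule rmod_hom_inv_into[OF c1 c1_bij])
  \<comment> \<open>With inverses written informally: \<open>f = f a1 b1 c1^-1 = g p1 b1 c1^-1 = g
    b0 q1 c1^-1 = g b0 c0^-1 q1\<close>.\<close>
  have "f x = g (b0 (?c0' (q1 x)))" if x: "x \<in> carrier Q1" for x
  proof -
    let ?y = "?c1' x"
    have y: "?y \<in> carrier Q1" "?c1 ?y = x"
      using rmod_hom.hom_closed[OF c1' x] bij_betw_inv_into_right[OF c1_bij x] by simp_all
    have "f x = g (b0 (q1 ?y))"
      using bspec[OF g(2) b1.hom_closed[OF y(1)]] y bspec[OF b1(2) y(1)] by simp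
    moreover have "q1 x = ?c0 (q1 ?y)"
      using q1c1[OF y(1)] y(2) by simp
    then have "?c0' (q1 x) = q1 ?y"
      using bij_betw_inv_into_left[OF c0_bij q1.hom_closed[OF y(1)]] by simp
    ultimately show ?thesis
      by simp
  qed
  moreover have "rmod_hom A Q0 N (\<lambda>y. g (b0 (?c0' y)))"
    by (rule rmod_hom_comp[OF rmod_hom_comp[OF c0' b0(1)] g(1)])
  ultimately show "\<exists>g. rmod_hom A Q0 N g \<and> (\<forall>x \<in> carrier Q1. f x = g (q1 x))"
    by blast
qed

section \<open>Homomorphisms into the Auslander--Reiten translate\<close>

text \<open>Stated for every record with pointwise operations, because it is applied both to the
  left module \<open>hom_to_regular\<close> and to the vector space
  \<open>hom_space\<close>.\<close>

lemma abelian_group_right_hom: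
  fixes R :: "('p \<Rightarrow> 'n, 'r) ring_scheme"
  assumes "right_module A P" "right_module A N"
    and R: "carrier R = right_hom A P N" "\<zero>\<^bsub>R\<^esub> = (\<lambda>x \<in> carrier P. \<zero>\<^bsub>N\<^esub>)"
      "\<And>f g. f \<oplus>\<^bsub>R\<^esub> g = (\<lambda>x \<in> carrier P. f x \<oplus>\<^bsub>N\<^esub> g x)"
  shows "abelian_group R"
proof (rule abelian_groupI)
  interpret N: right_module A N by fact
  have hom: "rmod_hom A P N f" if "f \<in> carrier R" for f
    using that rmod_hom_of_right_hom[OF assms(1,2)] R(1) by simp
  have cl: "f x \<in> carrier N" if "f \<in> carrier R" "x \<in> carrier P" for f x
    using rmod_hom.hom_closed[OF hom] that .
  have ext: "(\<lambda>x \<in> carrier P. f x) = f" if "f \<in> carrier R" for f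
    using that by (auto simp: R(1) right_hom_def PiE_def extensional_restrict)
  show "f \<oplus>\<^bsub>R\<^esub> g \<in> carrier R" if "f \<in> carrier R" "g \<in> carrier R" for f g
    unfolding R using that by (intro rmod_hom.restrict_in_right_hom rmod_hom_add hom)
  show "\<zero>\<^bsub>R\<^esub> \<in> carrier R"
    unfolding R by (intro rmod_hom.restrict_in_right_hom rmod_hom_zero assms)
  show "f \<oplus>\<^bsub>R\<^esub> g \<oplus>\<^bsub>R\<^esub> h = f \<oplus>\<^bsub>R\<^esub> (g \<oplus>\<^bsub>R\<^esub> h)"
    if "f \<in> carrier R" "g \<in> carrier R" "h \<in> carrier R" for f g h
    unfolding R(3) using that by (auto simp: cl N.grp.a_ac intro!: restrict_ext)
  show "f \<oplus>\<^bsub>R\<^esub> g = g \<oplus>\<^bsub>R\<^esub> f" if "f \<in> carrier R" "g \<in> carrier R" for f g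
    unfolding R(3) using that by (auto simp: cl N.grp.a_ac intro!: restrict_ext)
  show "\<zero>\<^bsub>R\<^esub> \<oplus>\<^bsub>R\<^esub> f = f" if "f \<in> carrier R" for f
  proof -
    have "\<zero>\<^bsub>R\<^esub> \<oplus>\<^bsub>R\<^esub> f = (\<lambda>x \<in> carrier P. f x)"
      unfolding R(2,3) using that by (intro restrict_ext) (simp add: cl)
    then show ?thesis
      using ext that by simp
  qed
  show "\<exists>g\<in>carrier R. g \<oplus>\<^bsub>R\<^esub> f = \<zero>\<^bsub>R\<^esub>" if "f \<in> carrier R" for f
  proof (rule bexI)
    show "(\<lambda>x \<in> carrier P. \<ominus>\<^bsub>N\<^esub> f x) \<in> carrier R"
      unfolding R(1) using that by (intro rmod_hom.restrict_in_right_hom rmod_hom_a_inv hom)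
    show "(\<lambda>x \<in> carrier P. \<ominus>\<^bsub>N\<^esub> f x) \<oplus>\<^bsub>R\<^esub> f = \<zero>\<^bsub>R\<^esub>"
      unfolding R(2,3) using that by (intro restrict_ext) (simp add: cl N.grp.l_neg)
  qed
qed

lemma additive_zero:
  assumes "abelian_group G" "abelian_group L" "f \<zero>\<^bsub>G\<^esub> \<in> carrier L"
    "f (\<zero>\<^bsub>G\<^esub> \<oplus>\<^bsub>G\<^esub> \<zero>\<^bsub>G\<^esub>) = f \<zero>\<^bsub>G\<^esub> \<oplus>\<^bsub>L\<^esub> f \<zero>\<^bsub>G\<^esub>"
  shows "f \<zero>\<^bsub>G\<^esub> = \<zero>\<^bsub>L\<^esub>"
proof -
  interpret G: abelian_group G by fact
  interpret L: abelian_group L by fact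
  show ?thesis
    using assms(3,4) by (simp add: L.add.l_cancel_one)
qed

text \<open>For maps that are additive without being homomorphisms over one ring: evaluation of
  homomorphisms at a point, one argument of a pairing, or the identity between a module and its
  restriction of scalars.\<close>

lemma finsum_additive:
  assumes "abelian_group G" "abelian_group L" "finite S" "g \<in> S \<rightarrow> carrier G"
    and cl: "\<And>x. x \<in> carrier G \<Longrightarrow> f x \<in> carrier L"
    and add: "\<And>x y. \<lbrakk>x \<in> carrier G; y \<in> carrier G\<rbrakk> \<Longrightarrow> f (x \<oplus>\<^bsub>G\<^esub> y) = f x \<oplus>\<^bsub>L\<^esub> f y"
  shows "f (\<Oplus>\<^bsub>G\<^esub>s \<in> S. g s) = (\<Oplus>\<^bsub>L\<^esub>s \<in> S. f (g s))"
  using assms(3,4)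
proof (induction S rule: finite_induct)
  case empty
  interpret G: abelian_group G by fact
  interpret L: abelian_group L by fact
  have "f \<zero>\<^bsub>G\<^esub> = \<zero>\<^bsub>L\<^esub>"
    by (rule additive_zero[where f = f, OF assms(1,2) cl[OF G.zero_closed] add[OF G.zero_closed G.zero_closed]])
  then show ?case
    by simp
next
  case (insert s S)
  interpret G: abelian_group G by fact
  interpret L: abelian_group L by fact
  have g: "g \<in> S \<rightarrow> carrier G" "g s \<in> carrier G"
    using insert.prems by auto
  have fg: "(\<lambda>s. f (g s)) \<in> S \<rightarrow> carrier L" "f (g s) \<in> carrier L"
    using g cl by (auto simp: Pi_def)
  show ?case
    by (simp only: G.finsum_insert[OF insert.hyps g] L.finsum_insert[OF insert.hyps fg]
        add[OF g(2) G.finsum_closed[OF g(1)]] insert.IH[OF g(1)])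
qed

definition hom_space ::
  "('k \<Rightarrow> 'a) \<Rightarrow> ('a, 'z) ring_scheme \<Rightarrow> ('a, 'p, 'x) right_module_scheme \<Rightarrow>
    ('a, 'n, 'y) right_module_scheme \<Rightarrow> ('k, 'p \<Rightarrow> 'n) right_module"
  where "hom_space \<iota> A P N =
    \<lparr>carrier = right_hom A P N, monoid.mult = undefined, monoid.one = undefined,
     ring.zero = (\<lambda>x \<in> carrier P. \<zero>\<^bsub>N\<^esub>), ring.add = (\<lambda>f g. \<lambda>x \<in> carrier P. f x \<oplus>\<^bsub>N\<^esub> g x),
     ract = (\<lambda>f c. \<lambda>x \<in> carrier P. f x \<star>\<^bsub>N\<^esub> \<iota> c)\<rparr>"

lemma hom_space_simps:
  "carrier (hom_space \<iota> A P N) = right_hom A P N"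
  "\<zero>\<^bsub>hom_space \<iota> A P N\<^esub> = (\<lambda>x \<in> carrier P. \<zero>\<^bsub>N\<^esub>)"
  "f \<oplus>\<^bsub>hom_space \<iota> A P N\<^esub> g = (\<lambda>x \<in> carrier P. f x \<oplus>\<^bsub>N\<^esub> g x)"
  "f \<star>\<^bsub>hom_space \<iota> A P N\<^esub> c = (\<lambda>x \<in> carrier P. f x \<star>\<^bsub>N\<^esub> \<iota> c)"
  by (simp_all add: hom_space_def)

text \<open>Centrality of \<open>c\<close> is what keeps \<open>f x c\<close> linear in
  \<open>x\<close>; applied to the elements \<open>c 1\<close> of an algebra it makes Hom spaces
  into vector spaces.\<close>

lemma rmod_hom_ract_central:
  assumes "rmod_hom A P N f" "c \<in> carrier A" "\<And>a. a \<in> carrier A \<Longrightarrow> a \<otimes>\<^bsub>A\<^esub> c = c \<otimes>\<^bsub>A\<^esub> a"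
  shows "rmod_hom A P N (\<lambda>x. f x \<star>\<^bsub>N\<^esub> c)"
proof -
  interpret rmod_hom A P N f by fact
  show ?thesis
  proof (intro rmod_homI src.right_module_axioms tgt.right_module_axioms)
    fix x a assume "x \<in> carrier P" "a \<in> carrier A"
    then show "f (x \<star>\<^bsub>P\<^esub> a) \<star>\<^bsub>N\<^esub> c = f x \<star>\<^bsub>N\<^esub> c \<star>\<^bsub>N\<^esub> a"
      using assms(2) by (simp add: hom_ract hom_closed tgt.ract_assoc[symmetric] assms(3))
  qed (use assms(2) in \<open>auto simp: hom_closed hom_add tgt.ract_add_left tgt.ract_closed\<close>)
qed

lemma right_module_hom_space:
  assumes "right_module A P" "right_module A N" "ring B" "\<iota> \<in> ring_hom B A"
    and central: "\<And>c a. \<lbrakk>c \<in> carrier B; a \<in> carrier A\<rbrakk> \<Longrightarrow> a \<otimes>\<^bsub>A\<^esub> \<iota> c = \<iota> c \<otimes>\<^bsub>A\<^esub> a"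
  shows "right_module B (hom_space \<iota> A P N)"
proof (intro right_module.intro right_module_axioms.intro)
  interpret N: right_module A N by fact
  show "ring B" by fact
  show "abelian_group (hom_space \<iota> A P N)"
    by (rule abelian_group_right_hom[OF assms(1,2)]) (simp_all add: hom_space_simps)
  have \<iota>: "\<iota> c \<in> carrier A" if "c \<in> carrier B" for c
    using ring_hom_closed[OF assms(4) that] .
  have hom: "rmod_hom A P N f" if "f \<in> carrier (hom_space \<iota> A P N)" for f
    using that rmod_hom_of_right_hom[OF assms(1,2)] by (simp add: hom_space_simps)
  have cl: "f x \<in> carrier N" if "f \<in> carrier (hom_space \<iota> A P N)" "x \<in> carrier P" for f x
    using rmod_hom.hom_closed[OF hom] that .
  have ext: "(\<lambda>x \<in> carrier P. f x) = f" if "f \<in> carrier (hom_space \<iota> A P N)" for f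
    using that by (auto simp: hom_space_simps right_hom_def PiE_def extensional_restrict)
  show "f \<star>\<^bsub>hom_space \<iota> A P N\<^esub> c \<in> carrier (hom_space \<iota> A P N)"
    if "f \<in> carrier (hom_space \<iota> A P N)" "c \<in> carrier B" for f c
    unfolding hom_space_simps using that central[OF that(2)]
    by (intro rmod_hom.restrict_in_right_hom rmod_hom_ract_central hom \<iota>) auto
  show "f \<star>\<^bsub>hom_space \<iota> A P N\<^esub> \<one>\<^bsub>B\<^esub> = f" if "f \<in> carrier (hom_space \<iota> A P N)" for f
  proof -
    have "f \<star>\<^bsub>hom_space \<iota> A P N\<^esub> \<one>\<^bsub>B\<^esub> = (\<lambda>x \<in> carrier P. f x)"
      unfolding hom_space_simps ring_hom_one[OF assms(4)] using that
      by (intro restrict_ext) (simp add: cl N.ract_one)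
    then show ?thesis
      using ext that by simp
  qed
qed (use ring_hom_closed[OF assms(4)] rmod_hom.hom_closed[OF rmod_hom_of_right_hom[OF assms(1,2)]] in
    \<open>auto simp: hom_space_simps ring_hom_add[OF assms(4)] ring_hom_mult[OF assms(4)]
      right_module.ract_add_left[OF assms(2)] right_module.ract_add_right[OF assms(2)]
      right_module.ract_assoc[OF assms(2)] intro!: restrict_ext\<close>)

text \<open>By Zorn's lemma there is a subspace \<open>W\<close> maximal among those that contain
  \<open>U\<close> and miss \<open>v\<close>. Then the space is the direct sum of \<open>W\<close>
  and the line through \<open>v\<close>, and the functional is the coordinate along
  \<open>v\<close>.\<close>

lemma separating_functional:
  assumes "field K" "right_module K V" "right_submodule K V U" "v \<in> carrier V" "v \<notin> U"
  obtains l where "rmod_hom K V (regular_right K) l" "\<forall>u \<in> U. l u = \<zero>\<^bsub>K\<^esub>" "l v = \<one>\<^bsub>K\<^esub>"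
proof -
  interpret K: field K by fact
  interpret V: right_module K V by fact
  define F where "F = {W. right_submodule K V W \<and> U \<subseteq> W \<and> v \<notin> W}"
  have "\<exists>W \<in> F. \<forall>S \<in> F. W \<subseteq> S \<longrightarrow> S = W"
  proof (rule subset_Zorn_nonempty)
    show "F \<noteq> {}"
      using assms(3,5) by (auto simp: F_def)
    fix C assume C: "C \<noteq> {}" "subset.chain F C"
    have CF: "S \<in> F" if "S \<in> C" for S
      using C(2) that unfolding subset_chain_def by blast
    have comp: "S \<subseteq> Y \<or> Y \<subseteq> S" if "S \<in> C" "Y \<in> C" for S Y
      using C(2) that unfolding subset_chain_def by blast
    have "right_submodule K V (\<Union>C)"
    proof (rule right_submoduleI[OF assms(2)])
      show "\<Union>C \<subseteq> carrier V"
        using CF right_submodule_subset unfolding F_def by blast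
      show "\<zero>\<^bsub>V\<^esub> \<in> \<Union>C"
        using C(1) CF right_submodule_zero unfolding F_def by blast
      show "x \<oplus>\<^bsub>V\<^esub> y \<in> \<Union>C" if xy: "x \<in> \<Union>C" "y \<in> \<Union>C" for x y
      proof -
        obtain S Y where "S \<in> C" "Y \<in> C" "x \<in> S" "y \<in> Y"
          using xy by blast
        then obtain Z where "Z \<in> C" "x \<in> Z" "y \<in> Z"
          using comp[of S Y] by blast
        then show ?thesis
          using CF right_submodule_add[of K V Z x y] unfolding F_def by blast
      qed
      show "x \<star>\<^bsub>V\<^esub> a \<in> \<Union>C" if xa: "x \<in> \<Union>C" "a \<in> carrier K" for x a
        using xa CF right_submodule_ract[of K V] unfolding F_def by blast
    qed
    then show "\<Union>C \<in> F"
      using C(1) CF unfolding F_def by blast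
  qed
  then obtain W where W: "right_submodule K V W" "U \<subseteq> W" "v \<notin> W"
    and max: "\<And>S. \<lbrakk>right_submodule K V S; U \<subseteq> S; v \<notin> S; W \<subseteq> S\<rbrakk> \<Longrightarrow> S = W"
    by (auto simp: F_def)
  have W_in: "w \<in> carrier V" if "w \<in> W" for w
    using right_submodule_subset[OF W(1)] that by auto
  have uniq: "c = c'" if "c \<in> carrier K" "c' \<in> carrier K" "w \<in> W" "w' \<in> W"
    "w \<oplus>\<^bsub>V\<^esub> v \<star>\<^bsub>V\<^esub> c = w' \<oplus>\<^bsub>V\<^esub> v \<star>\<^bsub>V\<^esub> c'" for c c' w w'
  proof (rule ccontr)
    assume "c \<noteq> c'"
    let ?e = "c \<ominus>\<^bsub>K\<^esub> c'"
    have "?e \<noteq> \<zero>\<^bsub>K\<^esub>" "?e \<in> carrier K"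
      using \<open>c \<noteq> c'\<close> that(1,2) K.minus_eq_zero_iff by auto
    then have inv: "inv\<^bsub>K\<^esub> ?e \<in> carrier K" "?e \<otimes>\<^bsub>K\<^esub> inv\<^bsub>K\<^esub> ?e = \<one>\<^bsub>K\<^esub>"
      by (auto simp: K.field_Units)
    have vc: "v \<star>\<^bsub>V\<^esub> c \<in> carrier V" "v \<star>\<^bsub>V\<^esub> c' \<in> carrier V"
      using that assms(4) V.ract_closed by auto
    have "v \<star>\<^bsub>V\<^esub> ?e = v \<star>\<^bsub>V\<^esub> c \<ominus>\<^bsub>V\<^esub> v \<star>\<^bsub>V\<^esub> c'"
      using that assms(4) by (simp add: a_minus_def V.ract_add_right V.ract_minus)
    also have "v \<star>\<^bsub>V\<^esub> c = (w' \<ominus>\<^bsub>V\<^esub> w) \<oplus>\<^bsub>V\<^esub> v \<star>\<^bsub>V\<^esub> c'"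
    proof -
      have "(w' \<ominus>\<^bsub>V\<^esub> w) \<oplus>\<^bsub>V\<^esub> v \<star>\<^bsub>V\<^esub> c' = (w' \<oplus>\<^bsub>V\<^esub> v \<star>\<^bsub>V\<^esub> c') \<ominus>\<^bsub>V\<^esub> w"
        using that(3,4) W_in vc by (simp add: a_minus_def V.grp.a_ac)
      also have "\<dots> = (w \<oplus>\<^bsub>V\<^esub> v \<star>\<^bsub>V\<^esub> c) \<ominus>\<^bsub>V\<^esub> w"
        using that(5) by simp
      also have "\<dots> = v \<star>\<^bsub>V\<^esub> c"
        using that(3) W_in vc V.grp.r_neg2[of w "v \<star>\<^bsub>V\<^esub> c"]
        by (simp add: a_minus_def V.grp.a_ac V.grp.r_neg1)
      finally show ?thesis ..
    qed
    also have "(w' \<ominus>\<^bsub>V\<^esub> w) \<oplus>\<^bsub>V\<^esub> v \<star>\<^bsub>V\<^esub> c' \<ominus>\<^bsub>V\<^esub> v \<star>\<^bsub>V\<^esub> c' = w' \<ominus>\<^bsub>V\<^esub> w"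
      using that(3,4) W_in vc by (simp add: a_minus_def V.grp.a_assoc V.grp.r_neg)
    finally have "v \<star>\<^bsub>V\<^esub> ?e \<in> W"
      using right_submodule_minus[OF W(1) that(4,3)] by simp
    then have "(v \<star>\<^bsub>V\<^esub> ?e) \<star>\<^bsub>V\<^esub> inv\<^bsub>K\<^esub> ?e \<in> W"
      using inv(1) by (rule right_submodule_ract[OF W(1)])
    then show False
      using W(3) assms(4) inv \<open>?e \<in> carrier K\<close>
      by (simp add: V.ract_assoc[symmetric] V.ract_one)
  qed
  have ex: "\<exists>c \<in> carrier K. \<exists>w \<in> W. x = w \<oplus>\<^bsub>V\<^esub> v \<star>\<^bsub>V\<^esub> c" if x: "x \<in> carrier V" for x
  proof (cases "x \<in> W")
    case True
    then show ?thesis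
      using W_in assms(4) by (intro bexI[of _ "\<zero>\<^bsub>K\<^esub>"] bexI[of _ x]) (auto simp: V.ract_zero)
  next
    case False
    \<comment> \<open>If \<open>x\<close> is outside \<open>W\<close>, then \<open>W + x K\<close>
      is strictly larger than \<open>W\<close> and so contains \<open>v\<close>. In
      \<open>v = w + x c\<close> the scalar \<open>c\<close> is nonzero because \<open>v\<close> is
      not in \<open>W\<close>, and the equation can be solved for \<open>x\<close>.\<close>
    let ?X = "(\<lambda>c. x \<star>\<^bsub>V\<^esub> c) ` carrier K"
    have X: "right_submodule K V ?X"
      using rmod_hom.submodule_image[OF V.rmod_hom_orbit[OF x]
          right_submodule_carrier[OF right_module_regular[OF K.ring_axioms]]] by simp
    have "x \<in> ?X"
      using V.ract_one[OF x] by (metis K.one_closed image_eqI)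
    then have "x \<in> W <+>\<^bsub>V\<^esub> ?X"
      using set_add_upper_right[OF assms(2) W(1) X] by blast
    then have "W <+>\<^bsub>V\<^esub> ?X \<noteq> W"
      using False by blast
    moreover have "W \<subseteq> W <+>\<^bsub>V\<^esub> ?X"
      by (rule set_add_upper_left[OF assms(2) W(1) X])
    ultimately have "v \<in> W <+>\<^bsub>V\<^esub> ?X"
      using max[OF right_submodule_set_add[OF assms(2) W(1) X]] W(2) by blast
    then obtain w c where wc: "w \<in> W" "c \<in> carrier K" "v = w \<oplus>\<^bsub>V\<^esub> x \<star>\<^bsub>V\<^esub> c"
      by (auto simp: set_add_iff)
    have "c \<noteq> \<zero>\<^bsub>K\<^esub>"
      using wc W(3) x W_in by (auto simp: V.ract_zero)
    then have inv: "inv\<^bsub>K\<^esub> c \<in> carrier K" "c \<otimes>\<^bsub>K\<^esub> inv\<^bsub>K\<^esub> c = \<one>\<^bsub>K\<^esub>"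
      using wc(2) by (auto simp: K.field_Units)
    have xc: "x \<star>\<^bsub>V\<^esub> c \<in> carrier V"
      using x wc V.ract_closed by blast
    have w': "w \<star>\<^bsub>V\<^esub> inv\<^bsub>K\<^esub> c \<in> W"
      by (rule right_submodule_ract[OF W(1) wc(1) inv(1)])
    have "v \<star>\<^bsub>V\<^esub> inv\<^bsub>K\<^esub> c = w \<star>\<^bsub>V\<^esub> inv\<^bsub>K\<^esub> c \<oplus>\<^bsub>V\<^esub> (x \<star>\<^bsub>V\<^esub> c) \<star>\<^bsub>V\<^esub> inv\<^bsub>K\<^esub> c"
      using wc inv xc W_in by (simp add: V.ract_add_left)
    also have "(x \<star>\<^bsub>V\<^esub> c) \<star>\<^bsub>V\<^esub> inv\<^bsub>K\<^esub> c = x"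
      using x wc inv by (simp add: V.ract_assoc[symmetric] V.ract_one)
    finally have "x = (\<ominus>\<^bsub>V\<^esub> (w \<star>\<^bsub>V\<^esub> inv\<^bsub>K\<^esub> c)) \<oplus>\<^bsub>V\<^esub> v \<star>\<^bsub>V\<^esub> inv\<^bsub>K\<^esub> c"
      using x W_in[OF w'] by (simp add: V.grp.r_neg1)
    then show ?thesis
      using inv(1) right_submodule_a_inv[OF W(1) w'] by blast
  qed
  define l where "l x = (THE c. c \<in> carrier K \<and> (\<exists>w \<in> W. x = w \<oplus>\<^bsub>V\<^esub> v \<star>\<^bsub>V\<^esub> c))" for x
  have l: "l (w \<oplus>\<^bsub>V\<^esub> v \<star>\<^bsub>V\<^esub> c) = c" if "w \<in> W" "c \<in> carrier K" for w c
    unfolding l_def using that uniq by (intro the_equality) blast+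
  have "rmod_hom K V (regular_right K) l"
  proof (intro rmod_homI assms(2) right_module_regular K.ring_axioms)
    fix x assume "x \<in> carrier V"
    then obtain w c where "w \<in> W" "c \<in> carrier K" "x = w \<oplus>\<^bsub>V\<^esub> v \<star>\<^bsub>V\<^esub> c"
      using ex by blast
    then show "l x \<in> carrier (regular_right K)"
      using l by simp
  next
    fix x y assume "x \<in> carrier V" "y \<in> carrier V"
    then obtain w c w' c' where wc: "w \<in> W" "c \<in> carrier K" "x = w \<oplus>\<^bsub>V\<^esub> v \<star>\<^bsub>V\<^esub> c"
      "w' \<in> W" "c' \<in> carrier K" "y = w' \<oplus>\<^bsub>V\<^esub> v \<star>\<^bsub>V\<^esub> c'"
      using ex by meson
    then have "x \<oplus>\<^bsub>V\<^esub> y = (w \<oplus>\<^bsub>V\<^esub> w') \<oplus>\<^bsub>V\<^esub> v \<star>\<^bsub>V\<^esub> (c \<oplus>\<^bsub>K\<^esub> c')"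
      using assms(4) W_in by (simp add: V.ract_add_right V.grp.a_ac V.ract_closed)
    then show "l (x \<oplus>\<^bsub>V\<^esub> y) = l x \<oplus>\<^bsub>regular_right K\<^esub> l y"
      using wc l right_submodule_add[OF W(1)] by simp
  next
    fix x a assume "x \<in> carrier V" and a: "a \<in> carrier K"
    then obtain w c where wc: "w \<in> W" "c \<in> carrier K" "x = w \<oplus>\<^bsub>V\<^esub> v \<star>\<^bsub>V\<^esub> c"
      using ex by meson
    then have "x \<star>\<^bsub>V\<^esub> a = w \<star>\<^bsub>V\<^esub> a \<oplus>\<^bsub>V\<^esub> v \<star>\<^bsub>V\<^esub> (c \<otimes>\<^bsub>K\<^esub> a)"
      using assms(4) W_in a by (simp add: V.ract_add_left V.ract_assoc V.ract_closed)
    then show "l (x \<star>\<^bsub>V\<^esub> a) = l x \<star>\<^bsub>regular_right K\<^esub> a"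
      using wc l a right_submodule_ract[OF W(1)] by simp
  qed
  moreover have "l u = \<zero>\<^bsub>K\<^esub>" if "u \<in> U" for u
    using l[of u "\<zero>\<^bsub>K\<^esub>"] W(2) W_in[of u] that assms(4) by (auto simp: V.ract_zero)
  moreover have "l v = \<one>\<^bsub>K\<^esub>"
    using l[of "\<zero>\<^bsub>V\<^esub>" "\<one>\<^bsub>K\<^esub>"] right_submodule_zero[OF W(1)] assms(4) by (auto simp: V.ract_one)
  ultimately show ?thesis
    using that by blast
qed

section \<open>The cokernel of \<open>Hom(p1, A)\<close>, its dual, and the pairing with a module
  \<open>N\<close>\<close>

locale transpose_setting =
  fixes K :: "('k, 'w) ring_scheme" and A :: "('k, 'a, 'z) module_scheme"
    and P1 :: "('a, 'q, 'x) right_module_scheme" and p1 :: "'q \<Rightarrow> 'p"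
    and P0 :: "('a, 'p, 'y) right_module_scheme"
  assumes algebra: "fd_algebra K A" and p1: "rmod_hom A P1 P0 p1"
begin

abbreviation "H \<equiv> hom_to_regular A P1"
abbreviation "I \<equiv> (\<lambda>f. compose (carrier P1) f p1) ` right_hom A P0 (regular_right A)"
abbreviation "Tr \<equiv> transpose_of A P1 p1 P0"
abbreviation "D \<equiv> dual_module K A Tr"

sublocale p1: rmod_hom A P1 P0 p1
  by (rule p1)

lemma reg: "right_module A (regular_right A)"
  by (rule right_module_regular[OF p1.src.act.ring_axioms])

lemma H_simps:
  "carrier H = right_hom A P1 (regular_right A)"
  "\<zero>\<^bsub>H\<^esub> = (\<lambda>x \<in> carrier P1. \<zero>\<^bsub>A\<^esub>)"
  "\<phi> \<oplus>\<^bsub>H\<^esub> \<psi> = (\<lambda>x \<in> carrier P1. \<phi> x \<oplus>\<^bsub>A\<^esub> \<psi> x)"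
  "a \<odot>\<^bsub>H\<^esub> \<phi> = (\<lambda>x \<in> carrier P1. a \<otimes>\<^bsub>A\<^esub> \<phi> x)"
  by (simp_all add: hom_to_regular_def)

lemma H_hom: "\<phi> \<in> carrier H \<Longrightarrow> rmod_hom A P1 (regular_right A) \<phi>"
  using rmod_hom_of_right_hom[OF p1.src.right_module_axioms reg] by (simp add: H_simps)

lemma H_closed: "\<lbrakk>\<phi> \<in> carrier H; x \<in> carrier P1\<rbrakk> \<Longrightarrow> \<phi> x \<in> carrier A"
  using rmod_hom.hom_closed[OF H_hom] by fastforce

lemma rmod_hom_left_mult:
  assumes "rmod_hom A P (regular_right A) \<phi>" "a \<in> carrier A"
  shows "rmod_hom A P (regular_right A) (\<lambda>x. a \<otimes>\<^bsub>A\<^esub> \<phi> x)"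
  using rmod_hom_comp[OF assms(1) right_module.rmod_hom_orbit[OF reg, of a]] assms(2) by simp

lemma H_smult_closed: "\<lbrakk>a \<in> carrier A; \<phi> \<in> carrier H\<rbrakk> \<Longrightarrow> a \<odot>\<^bsub>H\<^esub> \<phi> \<in> carrier H"
  unfolding H_simps using rmod_hom.restrict_in_right_hom[OF rmod_hom_left_mult[OF H_hom]]
  by (simp add: H_simps)

lemma abelian_group_H: "abelian_group H"
  by (rule abelian_group_right_hom[OF p1.src.right_module_axioms reg]) (simp_all add: H_simps)

sublocale H: abelian_group H
  by (rule abelian_group_H)

lemma compose_in_H: "rmod_hom A P0 (regular_right A) f \<Longrightarrow> compose (carrier P1) f p1 \<in> carrier H"
  unfolding H_simps compose_def
  by (rule rmod_hom.restrict_in_right_hom[OF rmod_hom_comp[OF p1]])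

lemma abelian_subgroup_I: "abelian_subgroup I H"
proof (rule abelian_subgroupI3)
  let ?G = "hom_to_regular A P0"
  have P0: "right_module A P0"
    by (rule p1.tgt.right_module_axioms)
  have H0: "abelian_group ?G"
    by (rule abelian_group_right_hom[OF P0 reg]) (simp_all add: hom_to_regular_def)
  have "group_hom (add_monoid ?G) (add_monoid H) (\<lambda>f. compose (carrier P1) f p1)"
  proof (intro group_hom.intro group_hom_axioms.intro homI)
    show "group (add_monoid ?G)" "group (add_monoid H)"
      using abelian_group.a_group[OF H0] H.a_group by auto
    show "compose (carrier P1) f p1 \<in> carrier (add_monoid H)" if "f \<in> carrier (add_monoid ?G)" for f
      using that compose_in_H rmod_hom_of_right_hom[OF P0 reg] by (simp add: hom_to_regular_def)
  qed (auto simp: hom_to_regular_def compose_def p1.hom_closed intro!: restrict_ext)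
  from group_hom.img_is_subgroup[OF this]
  show "additive_subgroup I H"
    by (intro additive_subgroup.intro) (simp add: hom_to_regular_def)
qed (rule abelian_group_H)

sublocale I: abelian_subgroup I H
  by (rule abelian_subgroup_I)

lemma I_smult: 
  assumes "i \<in> I" "a \<in> carrier A"
  shows "a \<odot>\<^bsub>H\<^esub> i \<in> I"
proof -
  obtain f where f: "f \<in> right_hom A P0 (regular_right A)" "i = compose (carrier P1) f p1"
    using assms(1) by auto
  let ?f = "\<lambda>y \<in> carrier P0. a \<otimes>\<^bsub>A\<^esub> f y"
  have "?f \<in> right_hom A P0 (regular_right A)"
    using rmod_hom.restrict_in_right_hom[OF rmod_hom_left_mult[OF
        rmod_hom_of_right_hom[OF p1.tgt.right_module_axioms reg f(1)] assms(2)]] .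
  moreover have "a \<odot>\<^bsub>H\<^esub> i = compose (carrier P1) ?f p1"
    unfolding f(2) H_simps compose_def by (rule restrict_ext) (simp add: p1.hom_closed)
  ultimately show ?thesis
    by blast
qed

lemma Tr_simps:
  "carrier Tr = a_rcosets\<^bsub>H\<^esub> I" "C \<oplus>\<^bsub>Tr\<^esub> C' = C <+>\<^bsub>H\<^esub> C'"
  "a \<odot>\<^bsub>Tr\<^esub> C = (\<Union>\<phi> \<in> C. I +>\<^bsub>H\<^esub> (a \<odot>\<^bsub>H\<^esub> \<phi>))"
  by (simp_all add: transpose_of_def left_quotient_def)

lemma coset_in_Tr: "\<phi> \<in> carrier H \<Longrightarrow> I +>\<^bsub>H\<^esub> \<phi> \<in> carrier Tr"
  using H.a_rcosetsI[OF I.a_subset] by (simp add: Tr_simps)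

lemma Tr_cases:
  assumes "C \<in> carrier Tr"
  obtains \<phi> where "\<phi> \<in> carrier H" "C = I +>\<^bsub>H\<^esub> \<phi>"
  using assms by (auto simp: Tr_simps A_RCOSETS_def')

lemma coset_add:
  "\<lbrakk>\<phi> \<in> carrier H; \<psi> \<in> carrier H\<rbrakk> \<Longrightarrow> (I +>\<^bsub>H\<^esub> \<phi>) \<oplus>\<^bsub>Tr\<^esub> (I +>\<^bsub>H\<^esub> \<psi>) = I +>\<^bsub>H\<^esub> (\<phi> \<oplus>\<^bsub>H\<^esub> \<psi>)"
  by (simp add: Tr_simps I.a_rcos_sum)

lemma coset_mem_iff: "\<psi> \<in> I +>\<^bsub>H\<^esub> \<phi> \<longleftrightarrow> (\<exists>i \<in> I. \<psi> = i \<oplus>\<^bsub>H\<^esub> \<phi>)"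
  by (auto simp: a_r_coset_def')

lemma coset_absorb: "\<lbrakk>i \<in> I; \<phi> \<in> carrier H\<rbrakk> \<Longrightarrow> I +>\<^bsub>H\<^esub> (i \<oplus>\<^bsub>H\<^esub> \<phi>) = I +>\<^bsub>H\<^esub> \<phi>"
  using H.a_repr_independence[of "i \<oplus>\<^bsub>H\<^esub> \<phi>" I \<phi>] I.a_subgroup by (auto simp: coset_mem_iff)

lemma coset_self: "\<phi> \<in> carrier H \<Longrightarrow> \<phi> \<in> I +>\<^bsub>H\<^esub> \<phi>"
  by (auto simp: coset_mem_iff intro!: bexI[of _ "\<zero>\<^bsub>H\<^esub>"])

text \<open>The union in \<open>left_quotient\<close> collapses to one coset because
  \<open>I\<close> is stable under left multiplication.\<close>

lemma coset_smult:
  assumes "a \<in> carrier A" "\<phi> \<in> carrier H"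
  shows "a \<odot>\<^bsub>Tr\<^esub> (I +>\<^bsub>H\<^esub> \<phi>) = I +>\<^bsub>H\<^esub> (a \<odot>\<^bsub>H\<^esub> \<phi>)"
proof -
  have "I +>\<^bsub>H\<^esub> (a \<odot>\<^bsub>H\<^esub> \<psi>) = I +>\<^bsub>H\<^esub> (a \<odot>\<^bsub>H\<^esub> \<phi>)" if \<psi>: "\<psi> \<in> I +>\<^bsub>H\<^esub> \<phi>" for \<psi>
  proof -
    obtain i where i: "i \<in> I" "\<psi> = i \<oplus>\<^bsub>H\<^esub> \<phi>"
      using \<psi> by (auto simp: coset_mem_iff)
    have "i \<in> carrier H"
      using i(1) I.a_subset by blast
    then have "a \<odot>\<^bsub>H\<^esub> \<psi> = a \<odot>\<^bsub>H\<^esub> i \<oplus>\<^bsub>H\<^esub> a \<odot>\<^bsub>H\<^esub> \<phi>"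
      using assms i(2) by (auto simp: H_simps(3,4) H_closed p1.src.act.r_distr intro!: restrict_ext)
    then show ?thesis
      using coset_absorb[OF I_smult[OF i(1) assms(1)] H_smult_closed[OF assms]] by simp
  qed
  then show ?thesis
    unfolding Tr_simps by (intro UN_constant_eq[OF coset_self[OF assms(2)]] ballI)
qed

lemma D_simps:
  "\<zero>\<^bsub>D\<^esub> = (\<lambda>C \<in> carrier Tr. \<zero>\<^bsub>K\<^esub>)"
  "F \<oplus>\<^bsub>D\<^esub> G = (\<lambda>C \<in> carrier Tr. F C \<oplus>\<^bsub>K\<^esub> G C)"
  "F \<star>\<^bsub>D\<^esub> a = (\<lambda>C \<in> carrier Tr. F (a \<odot>\<^bsub>Tr\<^esub> C))"
  by (simp_all add: dual_module_def)

text \<open>Expresses linearity on representatives. Afterwards an element of the dual is handled as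
  an additive function on \<open>H\<close> that is constant on cosets of \<open>I\<close>.\<close>

lemma in_D_iff:
  "F \<in> carrier D \<longleftrightarrow> F \<in> carrier Tr \<rightarrow>\<^sub>E carrier K \<and>
    (\<forall>\<phi> \<in> carrier H. \<forall>\<psi> \<in> carrier H. F (I +>\<^bsub>H\<^esub> (\<phi> \<oplus>\<^bsub>H\<^esub> \<psi>)) = F (I +>\<^bsub>H\<^esub> \<phi>) \<oplus>\<^bsub>K\<^esub> F (I +>\<^bsub>H\<^esub> \<psi>)) \<and>
    (\<forall>c \<in> carrier K. \<forall>\<phi> \<in> carrier H.
      F (I +>\<^bsub>H\<^esub> (scalar_embedding A c \<odot>\<^bsub>H\<^esub> \<phi>)) = c \<otimes>\<^bsub>K\<^esub> F (I +>\<^bsub>H\<^esub> \<phi>))"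
proof -
  have emb: "scalar_embedding A c \<in> carrier A" if "c \<in> carrier K" for c
    using ring_hom_closed[OF scalar_embedding_ring_hom[OF algebra] that] .
  have 1: "(\<forall>x \<in> carrier Tr. \<forall>y \<in> carrier Tr. F (x \<oplus>\<^bsub>Tr\<^esub> y) = F x \<oplus>\<^bsub>K\<^esub> F y) \<longleftrightarrow>
    (\<forall>\<phi> \<in> carrier H. \<forall>\<psi> \<in> carrier H. F (I +>\<^bsub>H\<^esub> (\<phi> \<oplus>\<^bsub>H\<^esub> \<psi>)) = F (I +>\<^bsub>H\<^esub> \<phi>) \<oplus>\<^bsub>K\<^esub> F (I +>\<^bsub>H\<^esub> \<psi>))"
    (is "?l \<longleftrightarrow> ?r")
  proof
    assume l: ?l
    show ?r
    proof (intro ballI)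
      fix \<phi> \<psi> assume *: "\<phi> \<in> carrier H" "\<psi> \<in> carrier H"
      show "F (I +>\<^bsub>H\<^esub> (\<phi> \<oplus>\<^bsub>H\<^esub> \<psi>)) = F (I +>\<^bsub>H\<^esub> \<phi>) \<oplus>\<^bsub>K\<^esub> F (I +>\<^bsub>H\<^esub> \<psi>)"
        using bspec[OF bspec[OF l coset_in_Tr[OF *(1)]] coset_in_Tr[OF *(2)]] coset_add[OF *] by simp
    qed
  next
    assume r: ?r
    show ?l
    proof (intro ballI)
      fix x y assume "x \<in> carrier Tr" "y \<in> carrier Tr"
      then obtain \<phi> \<psi> where "\<phi> \<in> carrier H" "x = I +>\<^bsub>H\<^esub> \<phi>" "\<psi> \<in> carrier H" "y = I +>\<^bsub>H\<^esub> \<psi>"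
        using Tr_cases by metis
      then show "F (x \<oplus>\<^bsub>Tr\<^esub> y) = F x \<oplus>\<^bsub>K\<^esub> F y"
        using r by (simp add: coset_add)
    qed
  qed
  have 2: "(\<forall>c \<in> carrier K. \<forall>x \<in> carrier Tr. F ((c \<odot>\<^bsub>A\<^esub> \<one>\<^bsub>A\<^esub>) \<odot>\<^bsub>Tr\<^esub> x) = c \<otimes>\<^bsub>K\<^esub> F x) \<longleftrightarrow>
    (\<forall>c \<in> carrier K. \<forall>\<phi> \<in> carrier H.
      F (I +>\<^bsub>H\<^esub> (scalar_embedding A c \<odot>\<^bsub>H\<^esub> \<phi>)) = c \<otimes>\<^bsub>K\<^esub> F (I +>\<^bsub>H\<^esub> \<phi>))"
    (is "?l \<longleftrightarrow> ?r")
  proof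
    assume l: ?l
    show ?r
    proof (intro ballI)
      fix c \<phi> assume c: "c \<in> carrier K" and \<phi>: "\<phi> \<in> carrier H"
      show "F (I +>\<^bsub>H\<^esub> (scalar_embedding A c \<odot>\<^bsub>H\<^esub> \<phi>)) = c \<otimes>\<^bsub>K\<^esub> F (I +>\<^bsub>H\<^esub> \<phi>)"
        using bspec[OF bspec[OF l c] coset_in_Tr[OF \<phi>]] coset_smult[OF emb[OF c] \<phi>]
        by (simp add: scalar_embedding_def)
    qed
  next
    assume r: ?r
    show ?l
    proof (intro ballI)
      fix c x assume c: "c \<in> carrier K" and "x \<in> carrier Tr"
      then obtain \<phi> where \<phi>: "\<phi> \<in> carrier H" "x = I +>\<^bsub>H\<^esub> \<phi>"
        using Tr_cases by metis
      show "F ((c \<odot>\<^bsub>A\<^esub> \<one>\<^bsub>A\<^esub>) \<odot>\<^bsub>Tr\<^esub> x) = c \<otimes>\<^bsub>K\<^esub> F x"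
        using bspec[OF bspec[OF r c] \<phi>(1)] coset_smult[OF emb[OF c] \<phi>(1)] \<phi>(2)
        by (simp add: scalar_embedding_def)
    qed
  qed
  show ?thesis
    unfolding dual_module_def using 1 2 by simp
qed

text \<open>
  A homomorphism \<open>N \<rightarrow> D Tr\<close> is a balanced pairing of \<open>N\<close> with \<open>Hom(P1, A)\<close>. Expanding \<open>\<phi>\<close> in dual
  bases of \<open>P1\<close> and \<open>P0\<close>, factorizations of the maps \<open>n \<cdot> \<phi>\<close> through \<open>p1\<close> move the pairing to \<open>I\<close>,
  where it vanishes.
\<close>

lemma hom_dual_transpose_zero:
  assumes db1: "dual_basis A P1 n1 x e" and db0: "dual_basis A P0 n0 y e'"
    and N: "right_module A N" and fac: "factors_through A P1 p1 P0 N"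
    and h: "h \<in> right_hom A N D"
  shows "h = (\<lambda>n \<in> carrier N. \<zero>\<^bsub>D\<^esub>)"
proof -
  interpret N: right_module A N by fact
  interpret K: field K by (rule fd_algebra_field[OF algebra])
  have K: "abelian_group K" by (rule K.abelian_group_axioms)
  note D1 = dual_basisD[OF db1] and D0 = dual_basisD[OF db0]
  have hD: "h n \<in> carrier D" if "n \<in> carrier N" for n
    using h that by (auto simp: right_hom_def)
  define b where "b n \<phi> = h n (I +>\<^bsub>H\<^esub> \<phi>)" for n \<phi>
  have b_cl: "b n \<phi> \<in> carrier K" if "n \<in> carrier N" "\<phi> \<in> carrier H" for n \<phi>
    unfolding b_def using hD[OF that(1)] coset_in_Tr[OF that(2)] by (auto simp: in_D_iff)
  have b_add: "b n (\<phi> \<oplus>\<^bsub>H\<^esub> \<psi>) = b n \<phi> \<oplus>\<^bsub>K\<^esub> b n \<psi>"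
    if "n \<in> carrier N" "\<phi> \<in> carrier H" "\<psi> \<in> carrier H" for n \<phi> \<psi>
    unfolding b_def using hD[OF that(1)] that(2,3) by (auto simp: in_D_iff)
  have b_add_left: "b (n \<oplus>\<^bsub>N\<^esub> m) \<phi> = b n \<phi> \<oplus>\<^bsub>K\<^esub> b m \<phi>"
    if "n \<in> carrier N" "m \<in> carrier N" "\<phi> \<in> carrier H" for n m \<phi>
  proof -
    have "h (n \<oplus>\<^bsub>N\<^esub> m) = h n \<oplus>\<^bsub>D\<^esub> h m"
      using h that by (auto simp: right_hom_def)
    then show ?thesis
      using coset_in_Tr[OF that(3)] by (simp add: b_def D_simps)
  qed
  have b_bal: "b (n \<star>\<^bsub>N\<^esub> a) \<phi> = b n (a \<odot>\<^bsub>H\<^esub> \<phi>)"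
    if "n \<in> carrier N" "a \<in> carrier A" "\<phi> \<in> carrier H" for n a \<phi>
  proof -
    have "h (n \<star>\<^bsub>N\<^esub> a) = h n \<star>\<^bsub>D\<^esub> a"
      using h that by (auto simp: right_hom_def)
    then show ?thesis
      using coset_in_Tr[OF that(3)] coset_smult[OF that(2,3)] by (simp add: b_def D_simps)
  qed
  have b_I: "b n i = \<zero>\<^bsub>K\<^esub>" if "n \<in> carrier N" "i \<in> I" for n i
  proof -
    have iH: "i \<in> carrier H"
      using that(2) I.a_subset by blast
    \<comment> \<open>\<open>i\<close> and \<open>i + i\<close> have the same coset, so the value of
      the pairing at \<open>i\<close> equals its own double and is zero.\<close>
    have "I +>\<^bsub>H\<^esub> (i \<oplus>\<^bsub>H\<^esub> i) = I +>\<^bsub>H\<^esub> i"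
      by (rule coset_absorb[OF that(2) iH])
    then have "b n i \<oplus>\<^bsub>K\<^esub> b n i = b n i"
      using b_add[OF that(1) iH iH] by (simp add: b_def)
    then show ?thesis
      using b_cl[OF that(1) iH] by (simp add: K.add.l_cancel_one)
  qed
  define e1 where "e1 i = restrict (e i) (carrier P1)" for i
  have e1: "e1 i \<in> carrier H" if "i < n1" for i
    unfolding e1_def H_simps using rmod_hom.restrict_in_right_hom[OF D1(3)[OF that]] .
  have b_sum: "b n (\<Oplus>\<^bsub>H\<^esub>i\<in>{..<n1}. a i \<odot>\<^bsub>H\<^esub> e1 i) = (\<Oplus>\<^bsub>K\<^esub>i\<in>{..<n1}. b n (a i \<odot>\<^bsub>H\<^esub> e1 i))"
    if "n \<in> carrier N" "\<And>i. i < n1 \<Longrightarrow> a i \<in> carrier A" for n a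
    by (rule finsum_additive[OF abelian_group_H K])
      (use that e1 H_smult_closed b_cl b_add in auto)
  have expand: "\<phi> = (\<Oplus>\<^bsub>H\<^esub>i\<in>{..<n1}. \<phi> (x i) \<odot>\<^bsub>H\<^esub> e1 i)" if \<phi>: "\<phi> \<in> carrier H" for \<phi>
  proof (rule extensionalityI)
    have terms: "(\<lambda>i. \<phi> (x i) \<odot>\<^bsub>H\<^esub> e1 i) \<in> {..<n1} \<rightarrow> carrier H"
      using D1(2) H_closed[OF \<phi>] e1 H_smult_closed by auto
    show "\<phi> \<in> extensional (carrier P1)"
      using \<phi> by (auto simp: H_simps right_hom_def PiE_def)
    show "(\<Oplus>\<^bsub>H\<^esub>i\<in>{..<n1}. \<phi> (x i) \<odot>\<^bsub>H\<^esub> e1 i) \<in> extensional (carrier P1)"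
      using H.finsum_closed[OF terms] by (auto simp: H_simps right_hom_def PiE_def)
    fix p assume p: "p \<in> carrier P1"
    have "(\<Oplus>\<^bsub>H\<^esub>i\<in>{..<n1}. \<phi> (x i) \<odot>\<^bsub>H\<^esub> e1 i) p = (\<Oplus>\<^bsub>regular_right A\<^esub>i\<in>{..<n1}. (\<phi> (x i) \<odot>\<^bsub>H\<^esub> e1 i) p)"
      using terms p H_closed[OF _ p]
      by (intro finsum_additive[OF abelian_group_H]) (auto simp: H_simps(3)
          right_module.axioms(2)[OF reg])
    also have "\<dots> = (\<Oplus>\<^bsub>regular_right A\<^esub>i\<in>{..<n1}. \<phi> (x i) \<star>\<^bsub>regular_right A\<^esub> e i p)"
    proof (rule abelian_monoid.finsum_cong')
      show "abelian_monoid (regular_right A)"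
        using right_module.axioms(2)[OF reg] by (simp add: abelian_group_def)
      show "(\<lambda>i. \<phi> (x i) \<star>\<^bsub>regular_right A\<^esub> e i p) \<in> {..<n1} \<rightarrow> carrier (regular_right A)"
        using D1(2,4) p H_closed[OF \<phi>] by auto
    qed (use p in \<open>auto simp: H_simps(4) e1_def\<close>)
    also have "\<dots> = \<phi> p"
      using dual_basis_expansion[OF db1 H_hom[OF \<phi>] p] by simp
    finally show "\<phi> p = (\<Oplus>\<^bsub>H\<^esub>i\<in>{..<n1}. \<phi> (x i) \<odot>\<^bsub>H\<^esub> e1 i) p" ..
  qed
  have b0: "b n \<phi> = \<zero>\<^bsub>K\<^esub>" if n: "n \<in> carrier N" and \<phi>: "\<phi> \<in> carrier H" for n \<phi>
  proof -
    have xi: "\<phi> (x i) \<in> carrier A" if "i < n1" for i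
      using H_closed[OF \<phi> D1(2)[OF that]] .
    have "rmod_hom A P1 N (\<lambda>p. n \<star>\<^bsub>N\<^esub> \<phi> p)"
      by (rule rmod_hom_comp[OF H_hom[OF \<phi>] N.rmod_hom_orbit[OF n]])
    then obtain g where g: "rmod_hom A P0 N g" "\<forall>p \<in> carrier P1. n \<star>\<^bsub>N\<^esub> \<phi> p = g (p1 p)"
      using fac unfolding factors_through_def by blast
    define m where "m j = g (y j)" for j
    define a where "a j i = e' j (p1 (x i))" for i j
    \<comment> \<open>\<open>c j\<close> is the \<open>j\<close>-th coordinate function of
      \<open>P0\<close> pulled back along \<open>p1\<close>. It lies in \<open>I\<close> by
      construction and its values on the \<open>x i\<close> are the coefficients
      \<open>a j i\<close>.\<close>
    define c where "c j = compose (carrier P1) (restrict (e' j) (carrier P0)) p1" for j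
    have m: "m j \<in> carrier N" if "j < n0" for j
      unfolding m_def using rmod_hom.hom_closed[OF g(1) D0(2)[OF that]] .
    have a: "a j i \<in> carrier A" if "i < n1" "j < n0" for i j
      unfolding a_def using D0(4)[OF that(2) p1.hom_closed[OF D1(2)[OF that(1)]]] .
    have c_I: "c j \<in> I" if "j < n0" for j
      unfolding c_def using rmod_hom.restrict_in_right_hom[OF D0(3)[OF that]] by blast
    have c_H: "c j \<in> carrier H" if "j < n0" for j
      using c_I[OF that] I.a_subset by blast
    have c_x: "c j (x i) = a j i" if "i < n1" "j < n0" for i j
      using D1(2)[OF that(1)] p1.hom_closed by (simp add: c_def compose_def a_def)
    have summand: "b n (\<phi> (x i) \<odot>\<^bsub>H\<^esub> e1 i) = (\<Oplus>\<^bsub>K\<^esub>j\<in>{..<n0}. b (m j) (a j i \<odot>\<^bsub>H\<^esub> e1 i))" if i: "i < n1" for i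
    proof -
      have "b n (\<phi> (x i) \<odot>\<^bsub>H\<^esub> e1 i) = b (n \<star>\<^bsub>N\<^esub> \<phi> (x i)) (e1 i)"
        using b_bal[OF n xi[OF i] e1[OF i]] by simp
      also have "n \<star>\<^bsub>N\<^esub> \<phi> (x i) = (\<Oplus>\<^bsub>N\<^esub>j\<in>{..<n0}. m j \<star>\<^bsub>N\<^esub> a j i)"
        using bspec[OF g(2) D1(2)[OF i]]
          dual_basis_expansion[OF db0 g(1) p1.hom_closed[OF D1(2)[OF i]]] by (simp add: m_def a_def)
      also have "b \<dots> (e1 i) = (\<Oplus>\<^bsub>K\<^esub>j\<in>{..<n0}. b (m j \<star>\<^bsub>N\<^esub> a j i) (e1 i))"
        by (rule finsum_additive[of N K "{..<n0}" "\<lambda>j. m j \<star>\<^bsub>N\<^esub> a j i" "\<lambda>n. b n (e1 i)"])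
          (use m a i e1 b_cl b_add_left N.ract_closed K N.grp.abelian_group_axioms in auto)
      also have "\<dots> = (\<Oplus>\<^bsub>K\<^esub>j\<in>{..<n0}. b (m j) (a j i \<odot>\<^bsub>H\<^esub> e1 i))"
        by (rule K.finsum_cong') (use m a i e1 b_cl b_bal H_smult_closed in auto)
      finally show ?thesis .
    qed
    \<comment> \<open>Balancedness moves \<open>\<phi> (x i)\<close> to the left argument, where the
      factorization expands \<open>n \<phi> (x i)\<close> as the sum of the \<open>m j\<close> times
      \<open>a j i\<close>. Moving \<open>a j i\<close> back to the right and summing over
      \<open>i\<close> first rebuilds \<open>c j\<close>, on which the pairing vanishes.\<close>
    have "b n \<phi> = b n (\<Oplus>\<^bsub>H\<^esub>i\<in>{..<n1}. \<phi> (x i) \<odot>\<^bsub>H\<^esub> e1 i)"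
      using expand[OF \<phi>] by simp
    also have "\<dots> = (\<Oplus>\<^bsub>K\<^esub>i\<in>{..<n1}. b n (\<phi> (x i) \<odot>\<^bsub>H\<^esub> e1 i))"
      by (rule b_sum[OF n xi])
    also have "\<dots> = (\<Oplus>\<^bsub>K\<^esub>i\<in>{..<n1}. \<Oplus>\<^bsub>K\<^esub>j\<in>{..<n0}. b (m j) (a j i \<odot>\<^bsub>H\<^esub> e1 i))"
      by (rule K.finsum_cong')
        (use summand m a e1 b_cl H_smult_closed in \<open>auto intro!: K.finsum_closed\<close>)
    also have "\<dots> = (\<Oplus>\<^bsub>K\<^esub>j\<in>{..<n0}. \<Oplus>\<^bsub>K\<^esub>i\<in>{..<n1}. b (m j) (a j i \<odot>\<^bsub>H\<^esub> e1 i))"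
      by (rule K.finsum_swap) (use m a e1 b_cl H_smult_closed in auto)
    also have "\<dots> = (\<Oplus>\<^bsub>K\<^esub>j\<in>{..<n0}. \<zero>\<^bsub>K\<^esub>)"
    proof (rule K.finsum_cong')
      fix j assume "j \<in> {..<n0}"
      then have j: "j < n0"
        by simp
      have "(\<Oplus>\<^bsub>K\<^esub>i\<in>{..<n1}. b (m j) (a j i \<odot>\<^bsub>H\<^esub> e1 i)) = b (m j) (\<Oplus>\<^bsub>H\<^esub>i\<in>{..<n1}. a j i \<odot>\<^bsub>H\<^esub> e1 i)"
        using b_sum[OF m[OF j], of "a j"] a[OF _ j] by simp
      also have "(\<Oplus>\<^bsub>H\<^esub>i\<in>{..<n1}. a j i \<odot>\<^bsub>H\<^esub> e1 i) = (\<Oplus>\<^bsub>H\<^esub>i\<in>{..<n1}. c j (x i) \<odot>\<^bsub>H\<^esub> e1 i)"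
        by (rule H.finsum_cong') (use a c_x j e1 H_smult_closed in auto)
      also have "\<dots> = c j"
        using expand[OF c_H[OF j]] by simp
      finally show "(\<Oplus>\<^bsub>K\<^esub>i\<in>{..<n1}. b (m j) (a j i \<odot>\<^bsub>H\<^esub> e1 i)) = \<zero>\<^bsub>K\<^esub>"
        using b_I[OF m[OF j] c_I[OF j]] by simp
    qed auto
    finally show ?thesis
      by simp
  qed
  show ?thesis
  proof (rule extensionalityI)
    show "h \<in> extensional (carrier N)"
      using h by (auto simp: right_hom_def PiE_def)
    fix n assume n: "n \<in> carrier N"
    have "h n = \<zero>\<^bsub>D\<^esub>"
    proof (rule extensionalityI)
      show "h n \<in> extensional (carrier Tr)"
        using hD[OF n] by (auto simp: in_D_iff PiE_def)
      show "\<zero>\<^bsub>D\<^esub> \<in> extensional (carrier Tr)"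
        by (simp add: D_simps)
      fix C assume C: "C \<in> carrier Tr"
      then obtain \<phi> where "\<phi> \<in> carrier H" "C = I +>\<^bsub>H\<^esub> \<phi>"
        by (rule Tr_cases)
      then show "h n C = \<zero>\<^bsub>D\<^esub> C"
        using b0[OF n] C by (simp add: D_simps b_def)
    qed
    then show "h n = (\<lambda>n \<in> carrier N. \<zero>\<^bsub>D\<^esub>) n"
      using n by simp
  qed simp
qed

end

context transpose_setting
begin

text \<open>
  A map \<open>f0\<close> that does not factor through \<open>p1\<close> is separated by a linear functional from those that
  do; composing the functional with \<open>(n, \<phi>) \<mapsto> n \<cdot> \<phi>\<close> gives a nonzero homomorphism \<open>N \<rightarrow> D Tr\<close>.
\<close>

lemma factors_through_if_hom_zero:
  assumes db1: "dual_basis A P1 n1 x e" and N: "right_module A N" and zero: "hom_zero A N D"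
  shows "factors_through A P1 p1 P0 N"
  unfolding factors_through_def
proof (intro allI impI, rule ccontr)
  fix f0 assume f0: "rmod_hom A P1 N f0"
    and nofac: "\<not> (\<exists>g. rmod_hom A P0 N g \<and> (\<forall>x \<in> carrier P1. f0 x = g (p1 x)))"
  interpret N: right_module A N by fact
  interpret K: field K by (rule fd_algebra_field[OF algebra])
  note D1 = dual_basisD[OF db1]
  note emb = scalar_embedding_ring_hom[OF algebra]
  have emb_cl: "scalar_embedding A c \<in> carrier A" if "c \<in> carrier K" for c
    using ring_hom_closed[OF emb that] .
  have central: "a \<otimes>\<^bsub>A\<^esub> scalar_embedding A c = scalar_embedding A c \<otimes>\<^bsub>A\<^esub> a"
    if "c \<in> carrier K" "a \<in> carrier A" for c a
    using scalar_embedding_commute[OF algebra that] by simp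
  let ?V = "hom_space (scalar_embedding A) A P1 N"
  let ?Z = "hom_space (scalar_embedding A) A P0 N"
  have V: "right_module K ?V"
    by (rule right_module_hom_space[OF p1.src.right_module_axioms N K.ring_axioms emb])
      (simp add: central)
  have V0: "right_module K ?Z"
    by (rule right_module_hom_space[OF p1.tgt.right_module_axioms N K.ring_axioms emb])
      (simp add: central)
  interpret V: right_module K ?V by (rule V)
  have hom0: "rmod_hom A P0 N g" if "g \<in> carrier ?Z" for g
    using rmod_hom_of_right_hom[OF p1.tgt.right_module_axioms N] that by (simp add: hom_space_simps)
  have pull: "rmod_hom K ?Z ?V (\<lambda>g. compose (carrier P1) g p1)"
  proof (intro rmod_homI V0 V)
    show "compose (carrier P1) g p1 \<in> carrier ?V" if "g \<in> carrier ?Z" for g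
      unfolding hom_space_simps compose_def
      by (rule rmod_hom.restrict_in_right_hom[OF rmod_hom_comp[OF p1 hom0[OF that]]])
  qed (auto simp: hom_space_simps compose_def p1.hom_closed intro!: restrict_ext)
  let ?U = "(\<lambda>g. compose (carrier P1) g p1) ` carrier ?Z"
  have U: "right_submodule K ?V ?U"
    by (rule rmod_hom.submodule_image[OF pull right_submodule_carrier[OF V0]])
  let ?f = "restrict f0 (carrier P1)"
  have f_V: "?f \<in> carrier ?V"
    unfolding hom_space_simps by (rule rmod_hom.restrict_in_right_hom[OF f0])
  have f_U: "?f \<notin> ?U"
  proof
    assume "?f \<in> ?U"
    then obtain g where g: "g \<in> carrier ?Z" "?f = compose (carrier P1) g p1"
      by blast
    have "f0 p = g (p1 p)" if "p \<in> carrier P1" for p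
      using fun_cong[OF g(2), of p] that by (simp add: compose_def)
    then show False
      using nofac hom0[OF g(1)] by blast
  qed
  obtain l where l: "rmod_hom K ?V (regular_right K) l" "\<forall>u \<in> ?U. l u = \<zero>\<^bsub>K\<^esub>" "l ?f = \<one>\<^bsub>K\<^esub>"
    by (rule separating_functional[OF K.field_axioms V U f_V f_U])
  interpret l: rmod_hom K ?V "regular_right K" l by (rule l(1))
  \<comment> \<open>\<open>t n \<phi>\<close> is the map \<open>n \<cdot> \<phi>\<close> from
    \<open>P1\<close> to \<open>N\<close>. For \<phi> in \<open>I\<close> it factors through
    \<open>p1\<close>, so the functional \<open>l\<close> kills it and the pairing descends to
    cosets.\<close>
  define t where "t n \<phi> = (\<lambda>p \<in> carrier P1. n \<star>\<^bsub>N\<^esub> \<phi> p)" for n \<phi>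
  have t_V: "t n \<phi> \<in> carrier ?V" if "n \<in> carrier N" "\<phi> \<in> carrier H" for n \<phi>
    unfolding t_def hom_space_simps
    by (rule rmod_hom.restrict_in_right_hom[OF rmod_hom_comp[OF H_hom[OF that(2)] N.rmod_hom_orbit[OF that(1)]]])
  have t_add: "t n (\<phi> \<oplus>\<^bsub>H\<^esub> \<psi>) = t n \<phi> \<oplus>\<^bsub>?V\<^esub> t n \<psi>"
    if "n \<in> carrier N" "\<phi> \<in> carrier H" "\<psi> \<in> carrier H" for n \<phi> \<psi>
    unfolding t_def hom_space_simps H_simps using that
    by (intro restrict_ext) (simp add: H_closed N.ract_add_right)
  have t_add_left: "t (n \<oplus>\<^bsub>N\<^esub> m) \<phi> = t n \<phi> \<oplus>\<^bsub>?V\<^esub> t m \<phi>"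
    if "n \<in> carrier N" "m \<in> carrier N" "\<phi> \<in> carrier H" for n m \<phi>
    unfolding t_def hom_space_simps using that
    by (intro restrict_ext) (simp add: H_closed N.ract_add_left)
  have t_bal: "t (n \<star>\<^bsub>N\<^esub> a) \<phi> = t n (a \<odot>\<^bsub>H\<^esub> \<phi>)"
    if "n \<in> carrier N" "a \<in> carrier A" "\<phi> \<in> carrier H" for n a \<phi>
    unfolding t_def H_simps using that
    by (intro restrict_ext) (simp add: H_closed N.ract_assoc)
  have t_smult: "t n (scalar_embedding A c \<odot>\<^bsub>H\<^esub> \<phi>) = t n \<phi> \<star>\<^bsub>?V\<^esub> c"
    if "n \<in> carrier N" "c \<in> carrier K" "\<phi> \<in> carrier H" for n c \<phi>
    unfolding t_def hom_space_simps H_simps using that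
    by (intro restrict_ext) (simp add: H_closed N.ract_assoc[symmetric] emb_cl central)
  have t_I: "l (t n i) = \<zero>\<^bsub>K\<^esub>" if that: "n \<in> carrier N" and i: "i \<in> I" for n i
  proof -
    obtain g where g: "g \<in> right_hom A P0 (regular_right A)" "i = compose (carrier P1) g p1"
      using i by blast
    let ?g = "\<lambda>y \<in> carrier P0. n \<star>\<^bsub>N\<^esub> g y"
    have "?g \<in> carrier ?Z"
      unfolding hom_space_simps
      by (rule rmod_hom.restrict_in_right_hom[OF rmod_hom_comp[OF rmod_hom_of_right_hom[OF
          p1.tgt.right_module_axioms reg g(1)] N.rmod_hom_orbit[OF that]]])
    moreover have "t n i = compose (carrier P1) ?g p1"
      unfolding t_def g(2) compose_def by (intro restrict_ext) (simp add: p1.hom_closed)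
    ultimately show ?thesis
      using l(2) by blast
  qed
  define b where "b n \<phi> = l (t n \<phi>)" for n \<phi>
  have b_cl: "b n \<phi> \<in> carrier K" if "n \<in> carrier N" "\<phi> \<in> carrier H" for n \<phi>
    unfolding b_def using l.hom_closed[OF t_V[OF that]] by simp
  have b_add: "b n (\<phi> \<oplus>\<^bsub>H\<^esub> \<psi>) = b n \<phi> \<oplus>\<^bsub>K\<^esub> b n \<psi>"
    if "n \<in> carrier N" "\<phi> \<in> carrier H" "\<psi> \<in> carrier H" for n \<phi> \<psi>
    unfolding b_def t_add[OF that] using l.hom_add[OF t_V[OF that(1,2)] t_V[OF that(1,3)]] by simp
  define r where "r C = (SOME \<phi>. \<phi> \<in> carrier H \<and> C = I +>\<^bsub>H\<^esub> \<phi>)" for C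
  have b_r: "b n (r (I +>\<^bsub>H\<^esub> \<phi>)) = b n \<phi>" if n: "n \<in> carrier N" and \<phi>: "\<phi> \<in> carrier H" for n \<phi>
  proof -
    let ?\<psi> = "r (I +>\<^bsub>H\<^esub> \<phi>)"
    have \<psi>: "?\<psi> \<in> carrier H" "I +>\<^bsub>H\<^esub> \<phi> = I +>\<^bsub>H\<^esub> ?\<psi>"
      using someI[of "\<lambda>\<psi>. \<psi> \<in> carrier H \<and> I +>\<^bsub>H\<^esub> \<phi> = I +>\<^bsub>H\<^esub> \<psi>" \<phi>] \<phi> by (auto simp: r_def)
    have "\<phi> \<in> I +>\<^bsub>H\<^esub> ?\<psi>"
      using coset_self[OF \<phi>] \<psi>(2) by simp
    then obtain i where i: "i \<in> I" "\<phi> = i \<oplus>\<^bsub>H\<^esub> ?\<psi>"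
      by (auto simp: coset_mem_iff)
    have iH: "i \<in> carrier H"
      using i(1) I.a_subset by blast
    have "b n \<phi> = b n i \<oplus>\<^bsub>K\<^esub> b n ?\<psi>"
      using b_add[OF n iH \<psi>(1)] i(2) by simp
    then show ?thesis
      using t_I[OF n i(1)] b_cl[OF n \<psi>(1)] by (simp add: b_def)
  qed
  define h where "h = (\<lambda>n \<in> carrier N. \<lambda>C \<in> carrier Tr. b n (r C))"
  have h_coset: "h n (I +>\<^bsub>H\<^esub> \<phi>) = b n \<phi>" if "n \<in> carrier N" "\<phi> \<in> carrier H" for n \<phi>
    using that b_r coset_in_Tr by (simp add: h_def)
  have h_D: "h n \<in> carrier D" if n: "n \<in> carrier N" for n
    unfolding in_D_iff
  proof (intro conjI ballI)
    show "h n \<in> carrier Tr \<rightarrow>\<^sub>E carrier K"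
    proof (rule PiE_I)
      fix C assume "C \<in> carrier Tr"
      then obtain \<phi> where "\<phi> \<in> carrier H" "C = I +>\<^bsub>H\<^esub> \<phi>"
        by (rule Tr_cases)
      then show "h n C \<in> carrier K"
        using h_coset[OF n] b_cl[OF n] by simp
    qed (use n in \<open>simp add: h_def\<close>)
    show "h n (I +>\<^bsub>H\<^esub> (\<phi> \<oplus>\<^bsub>H\<^esub> \<psi>)) = h n (I +>\<^bsub>H\<^esub> \<phi>) \<oplus>\<^bsub>K\<^esub> h n (I +>\<^bsub>H\<^esub> \<psi>)"
      if "\<phi> \<in> carrier H" "\<psi> \<in> carrier H" for \<phi> \<psi>
      using that by (simp add: h_coset[OF n] b_add[OF n])
    show "h n (I +>\<^bsub>H\<^esub> (scalar_embedding A c \<odot>\<^bsub>H\<^esub> \<phi>)) = c \<otimes>\<^bsub>K\<^esub> h n (I +>\<^bsub>H\<^esub> \<phi>)"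
      if "c \<in> carrier K" "\<phi> \<in> carrier H" for c \<phi>
    proof -
      have "b n (scalar_embedding A c \<odot>\<^bsub>H\<^esub> \<phi>) = b n \<phi> \<otimes>\<^bsub>K\<^esub> c"
        unfolding b_def t_smult[OF n that] using l.hom_ract[OF t_V[OF n that(2)] that(1)] by simp
      then show ?thesis
        using that b_cl[OF n that(2)]
        by (simp add: h_coset[OF n] H_smult_closed emb_cl K.m_comm)
    qed
  qed
  have "h \<in> right_hom A N D"
    unfolding right_hom_def
  proof (intro CollectI conjI ballI)
    show "h \<in> carrier N \<rightarrow>\<^sub>E carrier D"
      using h_D by (intro PiE_I) (simp_all add: h_def)
    fix n assume n: "n \<in> carrier N"
    show "h (n \<oplus>\<^bsub>N\<^esub> m) = h n \<oplus>\<^bsub>D\<^esub> h m" if m: "m \<in> carrier N" for m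
    proof (rule extensionalityI)
      show "h (n \<oplus>\<^bsub>N\<^esub> m) \<in> extensional (carrier Tr)"
        using n m by (simp add: h_def)
      show "h n \<oplus>\<^bsub>D\<^esub> h m \<in> extensional (carrier Tr)"
        by (simp add: D_simps)
      fix C assume C: "C \<in> carrier Tr"
      then obtain \<phi> where \<phi>: "\<phi> \<in> carrier H" "C = I +>\<^bsub>H\<^esub> \<phi>"
        by (rule Tr_cases)
      have "b (n \<oplus>\<^bsub>N\<^esub> m) \<phi> = b n \<phi> \<oplus>\<^bsub>K\<^esub> b m \<phi>"
        unfolding b_def t_add_left[OF n m \<phi>(1)]
        using l.hom_add[OF t_V[OF n \<phi>(1)] t_V[OF m \<phi>(1)]] by simp
      then show "h (n \<oplus>\<^bsub>N\<^esub> m) C = (h n \<oplus>\<^bsub>D\<^esub> h m) C"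
        using C \<phi> n m by (simp add: D_simps h_coset)
    qed
    show "h (n \<star>\<^bsub>N\<^esub> a) = h n \<star>\<^bsub>D\<^esub> a" if a: "a \<in> carrier A" for a
    proof (rule extensionalityI)
      show "h (n \<star>\<^bsub>N\<^esub> a) \<in> extensional (carrier Tr)"
        using n a N.ract_closed by (simp add: h_def)
      show "h n \<star>\<^bsub>D\<^esub> a \<in> extensional (carrier Tr)"
        by (simp add: D_simps)
      fix C assume C: "C \<in> carrier Tr"
      then obtain \<phi> where \<phi>: "\<phi> \<in> carrier H" "C = I +>\<^bsub>H\<^esub> \<phi>"
        by (rule Tr_cases)
      have "b (n \<star>\<^bsub>N\<^esub> a) \<phi> = b n (a \<odot>\<^bsub>H\<^esub> \<phi>)"
        unfolding b_def t_bal[OF n a \<phi>(1)] ..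
      then show "h (n \<star>\<^bsub>N\<^esub> a) C = (h n \<star>\<^bsub>D\<^esub> a) C"
        using C \<phi> n a by (simp add: D_simps h_coset coset_smult H_smult_closed N.ract_closed)
    qed
  qed
  then have h0: "h = (\<lambda>n \<in> carrier N. \<zero>\<^bsub>D\<^esub>)"
    using zero by (simp add: hom_zero_def)
  have b0: "b n \<phi> = \<zero>\<^bsub>K\<^esub>" if "n \<in> carrier N" "\<phi> \<in> carrier H" for n \<phi>
    using h_coset[OF that] h0 that coset_in_Tr by (simp add: D_simps)
  define e1 where "e1 i = restrict (e i) (carrier P1)" for i
  have e1: "e1 i \<in> carrier H" if "i < n1" for i
    unfolding e1_def H_simps using rmod_hom.restrict_in_right_hom[OF D1(3)[OF that]] .
  have fx: "f0 (x i) \<in> carrier N" if "i < n1" for i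
    using rmod_hom.hom_closed[OF f0 D1(2)[OF that]] .
  have terms: "(\<lambda>i. t (f0 (x i)) (e1 i)) \<in> {..<n1} \<rightarrow> carrier ?V"
    using t_V fx e1 by auto
  \<comment> \<open>The dual basis writes \<open>f0\<close> itself as the sum of the maps
    \<open>f0 (x i) \<cdot> e i\<close>. The pairing vanishes on every summand, so
    \<open>l ?f\<close> would be zero instead of one.\<close>
  have "?f = (\<Oplus>\<^bsub>?V\<^esub>i\<in>{..<n1}. t (f0 (x i)) (e1 i))"
  proof (rule extensionalityI)
    show "?f \<in> extensional (carrier P1)"
      by simp
    show "(\<Oplus>\<^bsub>?V\<^esub>i\<in>{..<n1}. t (f0 (x i)) (e1 i)) \<in> extensional (carrier P1)"
      using V.grp.finsum_closed[OF terms] by (auto simp: hom_space_simps right_hom_def PiE_def)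
    fix p assume p: "p \<in> carrier P1"
    have "(\<Oplus>\<^bsub>?V\<^esub>i\<in>{..<n1}. t (f0 (x i)) (e1 i)) p = (\<Oplus>\<^bsub>N\<^esub>i\<in>{..<n1}. t (f0 (x i)) (e1 i) p)"
    proof (rule finsum_additive[OF V.grp.abelian_group_axioms N.grp.abelian_group_axioms])
      show "g p \<in> carrier N" if "g \<in> carrier ?V" for g
        using that p by (auto simp: hom_space_simps right_hom_def)
    qed (use terms p in \<open>auto simp: hom_space_simps\<close>)
    also have "\<dots> = (\<Oplus>\<^bsub>N\<^esub>i\<in>{..<n1}. f0 (x i) \<star>\<^bsub>N\<^esub> e i p)"
      by (rule N.grp.finsum_cong') (use fx D1(4) p N.ract_closed in \<open>auto simp: t_def e1_def\<close>)
    also have "\<dots> = f0 p"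
      using dual_basis_expansion[OF db1 f0 p] by simp
    finally show "?f p = (\<Oplus>\<^bsub>?V\<^esub>i\<in>{..<n1}. t (f0 (x i)) (e1 i)) p"
      using p by simp
  qed
  then have "l ?f = (\<Oplus>\<^bsub>regular_right K\<^esub>i\<in>{..<n1}. b (f0 (x i)) (e1 i))"
    using l.hom_finsum[OF finite_lessThan terms] by (simp add: b_def)
  also have "\<dots> = (\<Oplus>\<^bsub>regular_right K\<^esub>i\<in>{..<n1}. \<zero>\<^bsub>regular_right K\<^esub>)"
    by (rule l.tgt.grp.finsum_cong') (use b0 fx e1 in auto)
  also have "\<dots> = \<zero>\<^bsub>K\<^esub>"
    by simp
  finally show False
    using l(3) by simp
qed

lemma hom_zero_dual_transpose_iff:
  assumes "projective A P1" "projective A P0" "right_module A N"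
  shows "hom_zero A N D \<longleftrightarrow> factors_through A P1 p1 P0 N"
proof
  obtain n1 x e where db1: "dual_basis A P1 n1 x e"
    using assms(1) by (auto simp: projective_iff_dual_basis)
  obtain n0 y e' where db0: "dual_basis A P0 n0 y e'"
    using assms(2) by (auto simp: projective_iff_dual_basis)
  show "factors_through A P1 p1 P0 N" if "hom_zero A N D"
    by (rule factors_through_if_hom_zero[OF db1 assms(3) that])
  assume fac: "factors_through A P1 p1 P0 N"
  interpret N: right_module A N by (rule assms(3))
  interpret K: field K by (rule fd_algebra_field[OF algebra])
  \<comment> \<open>\<open>hom_zero\<close> is an equation between sets of maps, so the zero map has
    to be shown to be a homomorphism. This is done by hand, without first proving that the dual is a
    module as \<open>hom_zero_iff\<close> would require.\<close>
  have 0: "\<zero>\<^bsub>D\<^esub> \<in> carrier D"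
    unfolding in_D_iff D_simps using coset_in_Tr H_smult_closed
      ring_hom_closed[OF scalar_embedding_ring_hom[OF algebra]] by auto
  have smult: "a \<odot>\<^bsub>Tr\<^esub> C \<in> carrier Tr" if "a \<in> carrier A" "C \<in> carrier Tr" for a C
    using that(2) coset_smult[OF that(1)] coset_in_Tr[OF H_smult_closed[OF that(1)]]
    by (metis Tr_cases)
  have "(\<lambda>n \<in> carrier N. \<zero>\<^bsub>D\<^esub>) \<in> right_hom A N D"
    unfolding right_hom_def using 0 N.ract_closed smult
    by (auto simp: D_simps(2,3) intro!: ext) (auto simp: D_simps(1) restrict_def)
  then show "hom_zero A N D"
    using hom_dual_transpose_zero[OF db1 db0 assms(3) fac] unfolding hom_zero_def by blast
qed

end

text \<open>\<open>tau\<close> uses a presentation about which only \<open>someI_ex\<close> gives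
  information. The criterion is proved for that one and carried to any given presentation, of any
  type, by \<open>factors_through_presentation_unique\<close>.\<close>

theorem hom_zero_tau_iff:
  assumes A: "fd_algebra K A" and M: "fg_right_module A M" and N: "right_module A N"
    and P: "projective_presentation A M P1 p1 P0 p0"
  shows "hom_zero A N (tau K A M) \<longleftrightarrow> factors_through A P1 p1 P0 N"
proof -
  have Mm: "right_module A M"
    by (rule fg_imp_right_module[OF M])
  define q where "q = (SOME (P1, p1, P0, p0). minimal_projective_presentation A M P1 p1 P0 p0)"
  obtain Q1 q1 Q0 q0 where q: "q = (Q1, q1, Q0, q0)"
    by (cases q)
  have "\<exists>q. (case q of (P1, p1, P0, p0) \<Rightarrow> minimal_projective_presentation A M P1 p1 P0 p0)"
    using projective_presentation_exists[OF A M] unfolding minimal_projective_presentation_eq by auto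
  then have "case q of (P1, p1, P0, p0) \<Rightarrow> minimal_projective_presentation A M P1 p1 P0 p0"
    unfolding q_def by (rule someI_ex)
  then have Q: "projective_presentation A M Q1 q1 Q0 q0"
    by (simp add: q minimal_projective_presentation_eq)
  have tau: "tau K A M = dual_module K A (transpose_of A Q1 q1 Q0)"
    unfolding tau_def q_def[symmetric] q by simp
  note QD = projective_presentationD[OF Q Mm]
  interpret transpose_setting K A Q1 q1 Q0
    by (intro transpose_setting.intro A QD(5))
  have "hom_zero A N (tau K A M) \<longleftrightarrow> factors_through A Q1 q1 Q0 N"
    unfolding tau
    by (rule hom_zero_dual_transpose_iff[OF projective_coverD(1)[OF QD(2,3)]
        projective_coverD(1)[OF QD(1) Mm] N])
  also have "\<dots> \<longleftrightarrow> factors_through A P1 p1 P0 N"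
    using factors_through_presentation_unique[OF A Mm Q P] factors_through_presentation_unique[OF A Mm P Q]
    by blast
  finally show ?thesis .
qed

section \<open>Tensor products\<close>

locale bimodule = left?: ring A + right?: right_module B Y
  for A :: "('a, 'z) ring_scheme" and B :: "('b, 'y) ring_scheme"
    and Y :: "('b, 'x, 'a, 'w) bimodule_scheme" +
  assumes lact_closed: "\<lbrakk>a \<in> carrier A; x \<in> carrier Y\<rbrakk> \<Longrightarrow> lact Y a x \<in> carrier Y"
    and lact_add: "\<lbrakk>a \<in> carrier A; x \<in> carrier Y; y \<in> carrier Y\<rbrakk> \<Longrightarrow>
      lact Y a (x \<oplus>\<^bsub>Y\<^esub> y) = lact Y a x \<oplus>\<^bsub>Y\<^esub> lact Y a y"
    and lact_ract: "\<lbrakk>a \<in> carrier A; x \<in> carrier Y; b \<in> carrier B\<rbrakk> \<Longrightarrow>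
      lact Y a (x \<star>\<^bsub>Y\<^esub> b) = lact Y a x \<star>\<^bsub>Y\<^esub> b"

definition tens ::
  "('a, 'z) ring_scheme \<Rightarrow> ('a, 'm, 'y) right_module_scheme \<Rightarrow> ('b, 'x, 'a, 'w) bimodule_scheme \<Rightarrow>
    'm \<Rightarrow> 'x \<Rightarrow> (('m \<times> 'x) \<Rightarrow>\<^sub>0 int) set"
  where "tens A M Y m x =
    generate (free_Abelian_group (carrier M \<times> carrier Y)) (tensor_relators A M Y)
      #>\<^bsub>free_Abelian_group (carrier M \<times> carrier Y)\<^esub> frag_of (m, x)"

locale tensor_product = fac1?: right_module A M + fac2?: bimodule A B Y
  for A :: "('a, 'z) ring_scheme" and M :: "('a, 'm, 'u) right_module_scheme"
    and B :: "('b, 'y) ring_scheme" and Y :: "('b, 'x, 'a, 'w) bimodule_scheme"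
begin

abbreviation "FG \<equiv> free_Abelian_group (carrier M \<times> carrier Y)"
abbreviation "Rel \<equiv> generate FG (tensor_relators A M Y)"
abbreviation "T \<equiv> tensor A M Y"
abbreviation tens_infix (infixl "\<otimes>\<^sub>T" 72) where "m \<otimes>\<^sub>T x \<equiv> tens A M Y m x"
abbreviation "cls c \<equiv> Rel #>\<^bsub>FG\<^esub> c"

sublocale FG: comm_group FG
  by (rule abelian_free_Abelian_group)

lemma relators_subset: "tensor_relators A M Y \<subseteq> carrier FG"
proof -
  have "frag_of p + frag_of q \<in> carrier FG" "- frag_of p \<in> carrier FG" "frag_of p \<in> carrier FG"
    if "p \<in> carrier M \<times> carrier Y" "q \<in> carrier M \<times> carrier Y" for p q
    using that FG.m_closed[of "frag_of p" "frag_of q"] FG.inv_closed[of "frag_of p"] by auto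
  moreover have "c - frag_of p \<in> carrier FG" if "c \<in> carrier FG" "p \<in> carrier M \<times> carrier Y" for c p
    using that FG.m_closed[of c "- frag_of p"] FG.inv_closed[of "frag_of p"] by simp
  ultimately show ?thesis
    unfolding tensor_relators_def using fac1.ract_closed lact_closed
    by (auto simp del: carrier_free_Abelian_group_iff frag_of_in_free_Abelian_group)
qed

lemma Rel_subgroup: "subgroup Rel FG"
  by (rule FG.generate_is_subgroup[OF relators_subset])

lemma Rel_add: "\<lbrakk>c \<in> Rel; d \<in> Rel\<rbrakk> \<Longrightarrow> c + d \<in> Rel"
  using subgroup.m_closed[OF Rel_subgroup] by simp

lemma Rel_subset: "Rel \<subseteq> carrier FG"
  by (rule subgroup.subset[OF Rel_subgroup])

lemma cls_eq_iff:
  assumes "c \<in> carrier FG" "d \<in> carrier FG"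
  shows "cls c = cls d \<longleftrightarrow> c - d \<in> Rel"
proof -
  have "cls c = cls d \<longleftrightarrow> c \<in> cls d"
    using FG.repr_independence[OF _ assms(2) Rel_subgroup, of c]
      FG.rcos_self[OF assms(1) Rel_subgroup] by auto
  also have "\<dots> \<longleftrightarrow> (\<exists>r \<in> Rel. c = r + d)"
    by (simp add: r_coset_def)
  also have "\<dots> \<longleftrightarrow> c - d \<in> Rel"
    by (metis add_diff_cancel_right' diff_add_cancel)
  finally show ?thesis .
qed

lemma T_simps:
  "carrier T = {cls c | c. c \<in> carrier FG}" "\<zero>\<^bsub>T\<^esub> = Rel"
  "C \<oplus>\<^bsub>T\<^esub> C' = C <#>\<^bsub>FG\<^esub> C'"
  "C \<star>\<^bsub>T\<^esub> b = (\<Union>c \<in> C. cls (frag_extend (\<lambda>(m, x). frag_of (m, x \<star>\<^bsub>Y\<^esub> b)) c))"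
  by (auto simp: tensor_def Let_def FactGroup_def RCOSETS_def)

lemma cls_in_T: "c \<in> carrier FG \<Longrightarrow> cls c \<in> carrier T"
  by (auto simp: T_simps)

lemma cls_add: "\<lbrakk>c \<in> carrier FG; d \<in> carrier FG\<rbrakk> \<Longrightarrow> cls c \<oplus>\<^bsub>T\<^esub> cls d = cls (c + d)"
  using normal.rcos_sum[OF FG.subgroup_imp_normal[OF Rel_subgroup]] by (simp add: T_simps(3))

lemma cls_zero: "\<zero>\<^bsub>T\<^esub> = cls 0"
  using FG.coset_join2[OF _ Rel_subgroup, of 0] generate.one[of FG "tensor_relators A M Y"]
  by (simp add: T_simps)

lemma T_cases:
  assumes "z \<in> carrier T"
  obtains c where "c \<in> carrier FG" "z = cls c"
  using assms by (auto simp: T_simps)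

lemma abelian_group_T: "abelian_group T"
proof (rule abelian_groupI)
  have add: "c + d \<in> carrier FG" if "c \<in> carrier FG" "d \<in> carrier FG" for c d
    using FG.m_closed[OF that] by simp
  have zero: "0 \<in> carrier FG"
    by simp
  show "u \<oplus>\<^bsub>T\<^esub> v \<in> carrier T" if "u \<in> carrier T" "v \<in> carrier T" for u v
    using that by (elim T_cases) (simp only: cls_add cls_in_T add)
  show "\<zero>\<^bsub>T\<^esub> \<in> carrier T"
    unfolding cls_zero by (rule cls_in_T[OF zero])
  show "u \<oplus>\<^bsub>T\<^esub> v \<oplus>\<^bsub>T\<^esub> w = u \<oplus>\<^bsub>T\<^esub> (v \<oplus>\<^bsub>T\<^esub> w)"
    if "u \<in> carrier T" "v \<in> carrier T" "w \<in> carrier T" for u v w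
    using that by (elim T_cases) (simp only: cls_add add add.assoc)
  show "u \<oplus>\<^bsub>T\<^esub> v = v \<oplus>\<^bsub>T\<^esub> u" if "u \<in> carrier T" "v \<in> carrier T" for u v
    using that by (elim T_cases) (simp only: cls_add add.commute)
  show "\<zero>\<^bsub>T\<^esub> \<oplus>\<^bsub>T\<^esub> u = u" if "u \<in> carrier T" for u
    using that unfolding cls_zero by (elim T_cases) (simp only: cls_add zero add_0)
  show "\<exists>v\<in>carrier T. v \<oplus>\<^bsub>T\<^esub> u = \<zero>\<^bsub>T\<^esub>" if u: "u \<in> carrier T" for u
  proof -
    obtain c where c: "c \<in> carrier FG" "u = cls c"
      by (rule T_cases[OF u])
    have "- c \<in> carrier FG"
      using FG.inv_closed[OF c(1)] c(1) by simp
    then show ?thesis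
      using c cls_add[of "- c" c] cls_in_T[of "- c"] by (auto simp: cls_zero)
  qed
qed

lemma tens_eq_cls: "m \<otimes>\<^sub>T x = cls (frag_of (m, x))"
  by (simp add: tens_def)

lemma tens_closed: "\<lbrakk>m \<in> carrier M; x \<in> carrier Y\<rbrakk> \<Longrightarrow> m \<otimes>\<^sub>T x \<in> carrier T"
  by (simp add: tens_eq_cls cls_in_T)

lemma relator_zero:
  assumes "c \<in> carrier FG" "d \<in> carrier FG" "c - d \<in> tensor_relators A M Y"
  shows "cls c = cls d"
  using assms by (simp add: cls_eq_iff generate.incl)

lemma frag_add_closed: "\<lbrakk>p \<in> carrier M \<times> carrier Y; q \<in> carrier M \<times> carrier Y\<rbrakk> \<Longrightarrow>
    frag_of p + frag_of q \<in> carrier FG"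
  using FG.m_closed[of "frag_of p" "frag_of q"] by simp

lemma tens_add_left:
  assumes "m \<in> carrier M" "m' \<in> carrier M" "x \<in> carrier Y"
  shows "(m \<oplus>\<^bsub>M\<^esub> m') \<otimes>\<^sub>T x = m \<otimes>\<^sub>T x \<oplus>\<^bsub>T\<^esub> m' \<otimes>\<^sub>T x"
proof -
  have "frag_of (m \<oplus>\<^bsub>M\<^esub> m', x) - frag_of (m, x) - frag_of (m', x) \<in> tensor_relators A M Y"
    unfolding tensor_relators_def using assms by blast
  then have "frag_of (m \<oplus>\<^bsub>M\<^esub> m', x) - (frag_of (m, x) + frag_of (m', x)) \<in> tensor_relators A M Y"
    by (simp add: diff_diff_add)
  then have "cls (frag_of (m \<oplus>\<^bsub>M\<^esub> m', x)) = cls (frag_of (m, x) + frag_of (m', x))"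
    using assms by (intro relator_zero frag_add_closed) auto
  then show ?thesis
    using assms by (simp add: tens_eq_cls cls_add)
qed

lemma tens_add_right:
  assumes "m \<in> carrier M" "x \<in> carrier Y" "x' \<in> carrier Y"
  shows "m \<otimes>\<^sub>T (x \<oplus>\<^bsub>Y\<^esub> x') = m \<otimes>\<^sub>T x \<oplus>\<^bsub>T\<^esub> m \<otimes>\<^sub>T x'"
proof -
  have "frag_of (m, x \<oplus>\<^bsub>Y\<^esub> x') - frag_of (m, x) - frag_of (m, x') \<in> tensor_relators A M Y"
    unfolding tensor_relators_def using assms by blast
  then have "frag_of (m, x \<oplus>\<^bsub>Y\<^esub> x') - (frag_of (m, x) + frag_of (m, x')) \<in> tensor_relators A M Y"
    by (simp add: diff_diff_add)
  then have "cls (frag_of (m, x \<oplus>\<^bsub>Y\<^esub> x')) = cls (frag_of (m, x) + frag_of (m, x'))"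
    using assms by (intro relator_zero frag_add_closed) auto
  then show ?thesis
    using assms by (simp add: tens_eq_cls cls_add)
qed

lemma tens_balanced:
  assumes "m \<in> carrier M" "a \<in> carrier A" "x \<in> carrier Y"
  shows "(m \<star>\<^bsub>M\<^esub> a) \<otimes>\<^sub>T x = m \<otimes>\<^sub>T lact Y a x"
proof -
  have "frag_of (m \<star>\<^bsub>M\<^esub> a, x) - frag_of (m, lact Y a x) \<in> tensor_relators A M Y"
    unfolding tensor_relators_def using assms by blast
  then show ?thesis
    unfolding tens_eq_cls using assms fac1.ract_closed lact_closed by (intro relator_zero) auto
qed

text \<open>\<open>free_Abelian_group_induct\<close> builds elements by differences, so the
  predicate is carried for a class and its negative at once. A negated pure tensor is again pure,
  with the sign moved to the left factor, which is why no case for negation remains.\<close>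

lemma tensor_induct [consumes 1, case_names zero tens add]:
  assumes "z \<in> carrier T" "Q \<zero>\<^bsub>T\<^esub>"
    and "\<And>m x. \<lbrakk>m \<in> carrier M; x \<in> carrier Y\<rbrakk> \<Longrightarrow> Q (m \<otimes>\<^sub>T x)"
    and "\<And>u v. \<lbrakk>u \<in> carrier T; v \<in> carrier T; Q u; Q v\<rbrakk> \<Longrightarrow> Q (u \<oplus>\<^bsub>T\<^esub> v)"
  shows "Q z"
proof -
  interpret T: abelian_group T by (rule abelian_group_T)
  have neg: "- c \<in> carrier FG" if "c \<in> carrier FG" for c
    using FG.inv_closed[OF that] that by simp
  have "Q (cls c) \<and> Q (cls (- c))" if "Poly_Mapping.keys c \<subseteq> carrier M \<times> carrier Y" for c
  proof (rule free_Abelian_group_induct[OF that, where P = "\<lambda>c. Q (cls c) \<and> Q (cls (- c))"])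
    show "Q (cls 0) \<and> Q (cls (- 0))"
      using assms(2) by (simp add: cls_zero)
  next
    fix c d assume 2: "Poly_Mapping.keys c \<subseteq> carrier M \<times> carrier Y"
      "Poly_Mapping.keys d \<subseteq> carrier M \<times> carrier Y"
      "Q (cls c) \<and> Q (cls (- c))" "Q (cls d) \<and> Q (cls (- d))"
    then have cd: "c \<in> carrier FG" "d \<in> carrier FG" "- c \<in> carrier FG" "- d \<in> carrier FG"
      using neg by auto
    have "cls (c - d) = cls c \<oplus>\<^bsub>T\<^esub> cls (- d)" "cls (- (c - d)) = cls d \<oplus>\<^bsub>T\<^esub> cls (- c)"
      using cd by (simp_all add: cls_add del: carrier_free_Abelian_group_iff)
    moreover have "Q (cls c \<oplus>\<^bsub>T\<^esub> cls (- d))" "Q (cls d \<oplus>\<^bsub>T\<^esub> cls (- c))"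
      using 2 by (intro assms(4) cls_in_T cd; simp)+
    ultimately show "Q (cls (c - d)) \<and> Q (cls (- (c - d)))"
      by simp
  next
    fix p assume 3: "p \<in> carrier M \<times> carrier Y"
    obtain m x where p: "p = (m, x)" "m \<in> carrier M" "x \<in> carrier Y"
      using 3 by auto
    have mx: "frag_of (m, x) \<in> carrier FG" "- frag_of (m, x) \<in> carrier FG"
      using p neg by auto
    have "(\<ominus>\<^bsub>M\<^esub> m) \<otimes>\<^sub>T x \<oplus>\<^bsub>T\<^esub> m \<otimes>\<^sub>T x = \<zero>\<^bsub>M\<^esub> \<otimes>\<^sub>T x"
      using p by (simp add: tens_add_left[symmetric] fac1.grp.l_neg)
    moreover have "\<zero>\<^bsub>M\<^esub> \<otimes>\<^sub>T x \<oplus>\<^bsub>T\<^esub> \<zero>\<^bsub>M\<^esub> \<otimes>\<^sub>T x = \<zero>\<^bsub>M\<^esub> \<otimes>\<^sub>T x"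
      using p by (simp add: tens_add_left[symmetric])
    then have "\<zero>\<^bsub>M\<^esub> \<otimes>\<^sub>T x = \<zero>\<^bsub>T\<^esub>"
      using p tens_closed by (simp add: T.add.l_cancel_one)
    moreover have "cls (- frag_of (m, x)) \<oplus>\<^bsub>T\<^esub> m \<otimes>\<^sub>T x = \<zero>\<^bsub>T\<^esub>"
      unfolding tens_eq_cls using cls_add[OF mx(2,1)] by (simp add: cls_zero)
    \<comment> \<open>Both sides are additive inverses of the same pure tensor.\<close>
    ultimately have "cls (- frag_of (m, x)) = (\<ominus>\<^bsub>M\<^esub> m) \<otimes>\<^sub>T x"
      using T.minus_equality[of "cls (- frag_of (m, x))" "m \<otimes>\<^sub>T x"]
        T.minus_equality[of "(\<ominus>\<^bsub>M\<^esub> m) \<otimes>\<^sub>T x" "m \<otimes>\<^sub>T x"] tens_closed cls_in_T[OF mx(2)] p by simp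
    then show "Q (cls (frag_of p)) \<and> Q (cls (- frag_of p))"
      using assms(3) p by (simp add: tens_eq_cls[symmetric])
  qed
  then show ?thesis
    using assms(1) by (auto simp: T_simps)
qed

lemma frag_act_closed:
  assumes "b \<in> carrier B" "c \<in> carrier FG"
  shows "frag_extend (\<lambda>(m, x). frag_of (m, x \<star>\<^bsub>Y\<^esub> b)) c \<in> carrier FG"
proof -
  have "(\<Union>p \<in> Poly_Mapping.keys c. Poly_Mapping.keys (case p of (m, x) \<Rightarrow> frag_of (m, x \<star>\<^bsub>Y\<^esub> b))) \<subseteq>
      carrier M \<times> carrier Y"
    using assms fac2.right.ract_closed by auto
  then show ?thesis
    using keys_frag_extend[of "\<lambda>(m, x). frag_of (m, x \<star>\<^bsub>Y\<^esub> b)" c] by simp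
qed

text \<open>Right multiplication sends each relator to a relator of the same kind; for the balancing
  relators this is the compatibility of the two actions on the bimodule. The elements sent into
  \<open>Rel\<close> form a subgroup, so generators suffice.\<close>

lemma frag_act_Rel:
  assumes b: "b \<in> carrier B" and c: "c \<in> Rel"
  shows "frag_extend (\<lambda>(m, x). frag_of (m, x \<star>\<^bsub>Y\<^esub> b)) c \<in> Rel"
proof -
  let ?E = "frag_extend (\<lambda>(m, x). frag_of (m, x \<star>\<^bsub>Y\<^esub> b))"
  have xb: "x \<star>\<^bsub>Y\<^esub> b \<in> carrier Y" if "x \<in> carrier Y" for x
    using fac2.right.ract_closed[OF that b] .
  have inv: "- c \<in> Rel" if "c \<in> Rel" for c
    using subgroup.m_inv_closed[OF Rel_subgroup that] Rel_subset that by auto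
  have sub: "subgroup {c \<in> carrier FG. ?E c \<in> Rel} FG"
  proof (rule FG.subgroupI)
    show "{c \<in> carrier FG. ?E c \<in> Rel} \<noteq> {}"
      using generate.one[of FG "tensor_relators A M Y"] by (intro notI) (auto dest!: equalityD1[THEN subsetD, of _ _ 0])
    show "inv\<^bsub>FG\<^esub> c \<in> {c \<in> carrier FG. ?E c \<in> Rel}" if "c \<in> {c \<in> carrier FG. ?E c \<in> Rel}" for c
      using that FG.inv_closed[of c] inv[of "?E c"] by (auto simp: frag_extend_minus)
    show "c \<otimes>\<^bsub>FG\<^esub> d \<in> {c \<in> carrier FG. ?E c \<in> Rel}"
      if "c \<in> {c \<in> carrier FG. ?E c \<in> Rel}" "d \<in> {c \<in> carrier FG. ?E c \<in> Rel}" for c d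
      using that FG.m_closed[of c d] Rel_add by (auto simp: frag_extend_add)
  qed blast
  have rels: "?E c \<in> tensor_relators A M Y" if rel: "c \<in> tensor_relators A M Y" for c
  proof -
    consider (1) m m' x where "c = frag_of (m \<oplus>\<^bsub>M\<^esub> m', x) - frag_of (m, x) - frag_of (m', x)"
        "m \<in> carrier M" "m' \<in> carrier M" "x \<in> carrier Y"
      | (2) m x x' where "c = frag_of (m, x \<oplus>\<^bsub>Y\<^esub> x') - frag_of (m, x) - frag_of (m, x')"
        "m \<in> carrier M" "x \<in> carrier Y" "x' \<in> carrier Y"
      | (3) m a x where "c = frag_of (m \<star>\<^bsub>M\<^esub> a, x) - frag_of (m, lact Y a x)"
        "m \<in> carrier M" "a \<in> carrier A" "x \<in> carrier Y"
      using rel unfolding tensor_relators_def by blast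
    then show ?thesis
    proof cases
      case 1
      have "?E c = frag_of (m \<oplus>\<^bsub>M\<^esub> m', x \<star>\<^bsub>Y\<^esub> b) - frag_of (m, x \<star>\<^bsub>Y\<^esub> b) - frag_of (m', x \<star>\<^bsub>Y\<^esub> b)"
        by (simp add: 1 frag_extend_diff)
      then show ?thesis
        unfolding tensor_relators_def using 1 xb by blast
    next
      case 2
      have "?E c = frag_of (m, x \<star>\<^bsub>Y\<^esub> b \<oplus>\<^bsub>Y\<^esub> x' \<star>\<^bsub>Y\<^esub> b) - frag_of (m, x \<star>\<^bsub>Y\<^esub> b) - frag_of (m, x' \<star>\<^bsub>Y\<^esub> b)"
        using 2 by (simp add: frag_extend_diff fac2.right.ract_add_left b)
      then show ?thesis
        unfolding tensor_relators_def using 2 xb by blast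
    next
      case 3
      have "?E c = frag_of (m \<star>\<^bsub>M\<^esub> a, x \<star>\<^bsub>Y\<^esub> b) - frag_of (m, lact Y a (x \<star>\<^bsub>Y\<^esub> b))"
        using 3 by (simp add: frag_extend_diff lact_ract b)
      then show ?thesis
        unfolding tensor_relators_def using 3 xb by blast
    qed
  qed
  have "tensor_relators A M Y \<subseteq> {c \<in> carrier FG. ?E c \<in> Rel}"
  proof
    fix c assume c: "c \<in> tensor_relators A M Y"
    show "c \<in> {c \<in> carrier FG. ?E c \<in> Rel}"
      by (rule CollectI, rule conjI[OF subsetD[OF relators_subset c] generate.incl[OF rels[OF c]]])
  qed
  from subsetD[OF FG.generate_subgroup_incl[OF this sub] c]
  show ?thesis
    by (elim CollectE conjE)
qed

text \<open>By \<open>frag_act_Rel\<close> every representative contributes the same class, so the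
  union in the definition of the action is a single coset.\<close>

lemma cls_ract:
  assumes b: "b \<in> carrier B" and c: "c \<in> carrier FG"
  shows "cls c \<star>\<^bsub>T\<^esub> b = cls (frag_extend (\<lambda>(m, x). frag_of (m, x \<star>\<^bsub>Y\<^esub> b)) c)"
proof -
  let ?E = "frag_extend (\<lambda>(m, x). frag_of (m, x \<star>\<^bsub>Y\<^esub> b))"
  have "cls (?E d) = cls (?E c)" if d: "d \<in> cls c" for d
  proof -
    obtain r where r: "r \<in> Rel" "d = r + c"
      using d by (auto simp: r_coset_def)
    have "d \<in> carrier FG"
      using FG.r_coset_subset_G[OF Rel_subset c] d by blast
    then show ?thesis
      using frag_act_closed[OF b] c frag_act_Rel[OF b r(1)] r(2)
      by (simp only: cls_eq_iff) (simp add: frag_extend_add)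
  qed
  then show ?thesis
    unfolding T_simps(4) by (intro UN_constant_eq[OF FG.rcos_self[OF c Rel_subgroup]] ballI)
qed

lemma tens_ract:
  "\<lbrakk>m \<in> carrier M; x \<in> carrier Y; b \<in> carrier B\<rbrakk> \<Longrightarrow> (m \<otimes>\<^sub>T x) \<star>\<^bsub>T\<^esub> b = m \<otimes>\<^sub>T (x \<star>\<^bsub>Y\<^esub> b)"
  using cls_ract[of b "frag_of (m, x)"] by (simp add: tens_eq_cls)

lemma T_ract_closed: "\<lbrakk>z \<in> carrier T; b \<in> carrier B\<rbrakk> \<Longrightarrow> z \<star>\<^bsub>T\<^esub> b \<in> carrier T"
  by (elim T_cases) (simp only: cls_ract cls_in_T frag_act_closed)

lemma T_ract_add:
  assumes "u \<in> carrier T" "v \<in> carrier T" "b \<in> carrier B"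
  shows "(u \<oplus>\<^bsub>T\<^esub> v) \<star>\<^bsub>T\<^esub> b = u \<star>\<^bsub>T\<^esub> b \<oplus>\<^bsub>T\<^esub> v \<star>\<^bsub>T\<^esub> b"
proof -
  obtain c d where c: "c \<in> carrier FG" "u = cls c" and d: "d \<in> carrier FG" "v = cls d"
    using assms(1,2) by (elim T_cases)
  have "c + d \<in> carrier FG"
    using FG.m_closed[OF c(1) d(1)] by simp
  then show ?thesis
    using assms(3) c d by (simp only: cls_add cls_ract frag_act_closed frag_extend_add)
qed

lemma T_ract_zero: "b \<in> carrier B \<Longrightarrow> \<zero>\<^bsub>T\<^esub> \<star>\<^bsub>T\<^esub> b = \<zero>\<^bsub>T\<^esub>"
  unfolding cls_zero by (subst cls_ract) simp_all

lemma right_module_tensor: "right_module B T"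
proof (intro right_module.intro right_module_axioms.intro abelian_group_T fac2.right.act.ring_axioms)
  interpret T: abelian_group T by (rule abelian_group_T)
  show "z \<star>\<^bsub>T\<^esub> (a \<oplus>\<^bsub>B\<^esub> b) = z \<star>\<^bsub>T\<^esub> a \<oplus>\<^bsub>T\<^esub> z \<star>\<^bsub>T\<^esub> b"
    if "z \<in> carrier T" "a \<in> carrier B" "b \<in> carrier B" for z a b
    using that(1)
  proof (induction rule: tensor_induct)
    case (tens m x)
    then show ?case
      using that(2,3) by (simp add: tens_ract fac2.right.ract_add_right fac2.right.ract_closed tens_add_right)
  next
    case (add u v)
    then show ?case
      using that(2,3) by (simp add: T_ract_add T_ract_closed T.a_ac)
  qed (use that in \<open>simp add: T_ract_zero\<close>)
  show "z \<star>\<^bsub>T\<^esub> (a \<otimes>\<^bsub>B\<^esub> b) = z \<star>\<^bsub>T\<^esub> a \<star>\<^bsub>T\<^esub> b"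
    if "z \<in> carrier T" "a \<in> carrier B" "b \<in> carrier B" for z a b
    using that(1)
  proof (induction rule: tensor_induct)
    case (tens m x)
    then show ?case
      using that(2,3) by (simp add: tens_ract fac2.right.ract_assoc fac2.right.ract_closed)
  next
    case (add u v)
    then show ?case
      using that(2,3) by (simp add: T_ract_add T_ract_closed)
  qed (use that in \<open>simp add: T_ract_zero\<close>)
  show "z \<star>\<^bsub>T\<^esub> \<one>\<^bsub>B\<^esub> = z" if "z \<in> carrier T" for z
    using that
  proof (induction rule: tensor_induct)
    case (tens m x)
    then show ?case
      by (simp add: tens_ract fac2.right.ract_one)
  next
    case (add u v)
    then show ?case
      by (simp add: T_ract_add)
  qed (simp add: T_ract_zero)
qed (simp_all add: T_ract_closed T_ract_add)

text \<open>Kept at the level of abelian groups because it is also used between modules over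
  different rings, as for the maps between \<open>tenE M\<close> and \<open>ind M\<close>; linearity
  is checked afterwards by \<open>tensor_induct\<close>.\<close>

lemma tensor_universal:
  assumes Z: "abelian_group Z"
    and cl: "\<And>m x. \<lbrakk>m \<in> carrier M; x \<in> carrier Y\<rbrakk> \<Longrightarrow> \<phi> m x \<in> carrier Z"
    and add_left: "\<And>m m' x. \<lbrakk>m \<in> carrier M; m' \<in> carrier M; x \<in> carrier Y\<rbrakk> \<Longrightarrow>
      \<phi> (m \<oplus>\<^bsub>M\<^esub> m') x = \<phi> m x \<oplus>\<^bsub>Z\<^esub> \<phi> m' x"
    and add_right: "\<And>m x x'. \<lbrakk>m \<in> carrier M; x \<in> carrier Y; x' \<in> carrier Y\<rbrakk> \<Longrightarrow>
      \<phi> m (x \<oplus>\<^bsub>Y\<^esub> x') = \<phi> m x \<oplus>\<^bsub>Z\<^esub> \<phi> m x'"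
    and balanced: "\<And>m a x. \<lbrakk>m \<in> carrier M; a \<in> carrier A; x \<in> carrier Y\<rbrakk> \<Longrightarrow>
      \<phi> (m \<star>\<^bsub>M\<^esub> a) x = \<phi> m (lact Y a x)"
  obtains f where "\<forall>z \<in> carrier T. f z \<in> carrier Z"
    "\<forall>u \<in> carrier T. \<forall>v \<in> carrier T. f (u \<oplus>\<^bsub>T\<^esub> v) = f u \<oplus>\<^bsub>Z\<^esub> f v"
    "\<forall>m \<in> carrier M. \<forall>x \<in> carrier Y. f (m \<otimes>\<^sub>T x) = \<phi> m x"
proof -
  interpret Z: abelian_group Z by fact
  obtain h where h: "h \<in> hom FG (add_monoid Z)"
    "\<And>p. p \<in> carrier M \<times> carrier Y \<Longrightarrow> h (frag_of p) = (\<lambda>(m, x). \<phi> m x) p"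
    by (rule comm_group.free_Abelian_group_universal[OF Z.a_comm_group, of "\<lambda>(m, x). \<phi> m x"
        "carrier M \<times> carrier Y"]) (use cl in auto)
  interpret h: group_hom FG "add_monoid Z" h
    using h(1) Z.a_group by (simp add: group_hom_def group_hom_axioms_def)
  have h_cl: "h c \<in> carrier Z" if "c \<in> carrier FG" for c
    using h.hom_closed[OF that] by simp
  have h_add: "h (c + d) = h c \<oplus>\<^bsub>Z\<^esub> h d" if "c \<in> carrier FG" "d \<in> carrier FG" for c d
    using h.hom_mult[OF that] by simp
  have h_of: "h (frag_of (m, x)) = \<phi> m x" if "m \<in> carrier M" "x \<in> carrier Y" for m x
    using h(2)[of "(m, x)"] that by simp
  have h_diff: "h (c - d) = \<zero>\<^bsub>Z\<^esub>" if "c \<in> carrier FG" "d \<in> carrier FG" "h c = h d" for c d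
  proof -
    have "c - d \<in> carrier FG"
      using FG.m_closed[of c "- d"] FG.inv_closed[of d] that by simp
    then have "h (c - d) \<oplus>\<^bsub>Z\<^esub> h d = h d"
      using h_add[of "c - d" d] that by simp
    then show ?thesis
      using h_cl \<open>c - d \<in> carrier FG\<close> that(2) by simp
  qed
  have "h c = \<zero>\<^bsub>Z\<^esub>" if rel: "c \<in> tensor_relators A M Y" for c
  proof -
    consider (1) m m' x where "c = frag_of (m \<oplus>\<^bsub>M\<^esub> m', x) - frag_of (m, x) - frag_of (m', x)"
        "m \<in> carrier M" "m' \<in> carrier M" "x \<in> carrier Y"
      | (2) m x x' where "c = frag_of (m, x \<oplus>\<^bsub>Y\<^esub> x') - frag_of (m, x) - frag_of (m, x')"
        "m \<in> carrier M" "x \<in> carrier Y" "x' \<in> carrier Y"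
      | (3) m a x where "c = frag_of (m \<star>\<^bsub>M\<^esub> a, x) - frag_of (m, lact Y a x)"
        "m \<in> carrier M" "a \<in> carrier A" "x \<in> carrier Y"
      using rel unfolding tensor_relators_def by blast
    then show ?thesis
    proof cases
      case 1
      then have "h (frag_of (m, x) + frag_of (m', x)) = h (frag_of (m \<oplus>\<^bsub>M\<^esub> m', x))"
        by (subst h_add) (simp_all add: h_of add_left)
      then have "h (frag_of (m \<oplus>\<^bsub>M\<^esub> m', x) - (frag_of (m, x) + frag_of (m', x))) = \<zero>\<^bsub>Z\<^esub>"
        using 1 by (intro h_diff frag_add_closed) auto
      then show ?thesis
        by (simp add: 1 diff_diff_add)
    next
      case 2
      then have "h (frag_of (m, x) + frag_of (m, x')) = h (frag_of (m, x \<oplus>\<^bsub>Y\<^esub> x'))"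
        by (subst h_add) (simp_all add: h_of add_right)
      then have "h (frag_of (m, x \<oplus>\<^bsub>Y\<^esub> x') - (frag_of (m, x) + frag_of (m, x'))) = \<zero>\<^bsub>Z\<^esub>"
        using 2 by (intro h_diff frag_add_closed) auto
      then show ?thesis
        by (simp add: 2 diff_diff_add)
    next
      case 3
      then show ?thesis
        using fac1.ract_closed lact_closed by (auto simp: h_of balanced intro!: h_diff)
    qed
  qed
  then have "tensor_relators A M Y \<subseteq> kernel FG (add_monoid Z) h"
    using subsetD[OF relators_subset] unfolding kernel_def
    by (intro subsetI CollectI conjI) (blast, simp)
  then have Rel_kernel: "Rel \<subseteq> kernel FG (add_monoid Z) h"
    by (rule FG.generate_subgroup_incl[OF _ h.subgroup_kernel])
  \<comment> \<open>The value is read off a chosen representative. Two representatives differ by an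
    element of \<open>Rel\<close>, which \<open>h\<close> sends to zero.\<close>
  define f where "f C = h (SOME c. c \<in> carrier FG \<and> C = cls c)" for C
  have f: "f (cls c) = h c" if c: "c \<in> carrier FG" for c
  proof -
    let ?d = "SOME d. d \<in> carrier FG \<and> cls c = cls d"
    have d: "?d \<in> carrier FG" "cls c = cls ?d"
      using someI[of "\<lambda>d. d \<in> carrier FG \<and> cls c = cls d" c] c by auto
    then have cd: "c - ?d \<in> Rel"
      using cls_eq_iff[OF c] by blast
    then have "h (c - ?d) = \<zero>\<^bsub>Z\<^esub>" "c - ?d \<in> carrier FG"
      using Rel_kernel Rel_subset by (auto simp: kernel_def)
    then have "h c = h ?d"
      using h_add[of "c - ?d" ?d] d(1) h_cl[OF d(1)] by simp
    then show ?thesis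
      by (simp add: f_def)
  qed
  show ?thesis
  proof (rule that)
    show "\<forall>z \<in> carrier T. f z \<in> carrier Z"
      using f h_cl by (auto elim!: T_cases)
    show "\<forall>u \<in> carrier T. \<forall>v \<in> carrier T. f (u \<oplus>\<^bsub>T\<^esub> v) = f u \<oplus>\<^bsub>Z\<^esub> f v"
    proof (intro ballI)
      fix u v assume "u \<in> carrier T" "v \<in> carrier T"
      then obtain c d where "c \<in> carrier FG" "u = cls c" "d \<in> carrier FG" "v = cls d"
        by (elim T_cases)
      then show "f (u \<oplus>\<^bsub>T\<^esub> v) = f u \<oplus>\<^bsub>Z\<^esub> f v"
        using FG.m_closed[of c d] by (simp only: cls_add f h_add mult_free_Abelian_group)
    qed
    show "\<forall>m \<in> carrier M. \<forall>x \<in> carrier Y. f (m \<otimes>\<^sub>T x) = \<phi> m x"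
      using f h_of by (simp add: tens_eq_cls)
  qed
qed

end

section \<open>Split extensions\<close>

lemma (in abelian_group) a_inv_zero: "\<ominus> \<zero> = \<zero>"
  using l_neg[OF zero_closed] by simp

text \<open>The quotient lives on chosen coset representatives, so no new type is needed.\<close>

lemma quotient_module_exists:
  assumes "right_module A M" "right_submodule A M U"
  obtains N :: "('a, 'm) right_module" and f :: "'m \<Rightarrow> 'm" where
    "rmod_hom A M N f" "\<forall>x \<in> carrier M. f x = \<zero>\<^bsub>N\<^esub> \<longleftrightarrow> x \<in> U"
proof -
  interpret right_module A M by fact
  have U: "x \<in> carrier M" if "x \<in> U" for x
    using right_submodule_subset[OF assms(2)] that by auto
  define f where "f x = (SOME y. y \<in> carrier M \<and> x \<ominus>\<^bsub>M\<^esub> y \<in> U)" for x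
  have f: "f x \<in> carrier M" "x \<ominus>\<^bsub>M\<^esub> f x \<in> U" if "x \<in> carrier M" for x
  proof -
    have "x \<in> carrier M \<and> x \<ominus>\<^bsub>M\<^esub> x \<in> U"
      using that right_submodule_zero[OF assms(2)] by (simp add: a_minus_def grp.r_neg)
    then show "f x \<in> carrier M" "x \<ominus>\<^bsub>M\<^esub> f x \<in> U"
      unfolding f_def using someI[of "\<lambda>y. y \<in> carrier M \<and> x \<ominus>\<^bsub>M\<^esub> y \<in> U" x] by blast+
  qed
  have shift: "z \<ominus>\<^bsub>M\<^esub> y \<in> U \<longleftrightarrow> z \<ominus>\<^bsub>M\<^esub> x \<in> U"
    if "x \<in> carrier M" "y \<in> carrier M" "z \<in> carrier M" "x \<ominus>\<^bsub>M\<^esub> y \<in> U" for x y z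
  proof
    assume "z \<ominus>\<^bsub>M\<^esub> y \<in> U"
    then have "(z \<ominus>\<^bsub>M\<^esub> y) \<ominus>\<^bsub>M\<^esub> (x \<ominus>\<^bsub>M\<^esub> y) \<in> U"
      using right_submodule_minus[OF assms(2)] that(4) by blast
    also have "(z \<ominus>\<^bsub>M\<^esub> y) \<ominus>\<^bsub>M\<^esub> (x \<ominus>\<^bsub>M\<^esub> y) = z \<ominus>\<^bsub>M\<^esub> x"
    proof -
      have "(z \<ominus>\<^bsub>M\<^esub> y) \<ominus>\<^bsub>M\<^esub> (x \<ominus>\<^bsub>M\<^esub> y) = (z \<oplus>\<^bsub>M\<^esub> \<ominus>\<^bsub>M\<^esub> x) \<oplus>\<^bsub>M\<^esub> (\<ominus>\<^bsub>M\<^esub> y \<oplus>\<^bsub>M\<^esub> y)"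
        using that(1-3) by (simp add: a_minus_def grp.minus_add grp.a_ac)
      then show ?thesis
        using that(1-3) by (simp add: a_minus_def grp.l_neg)
    qed
    finally show "z \<ominus>\<^bsub>M\<^esub> x \<in> U" .
  next
    assume "z \<ominus>\<^bsub>M\<^esub> x \<in> U"
    then have "(z \<ominus>\<^bsub>M\<^esub> x) \<oplus>\<^bsub>M\<^esub> (x \<ominus>\<^bsub>M\<^esub> y) \<in> U"
      using right_submodule_add[OF assms(2)] that(4) by blast
    also have "(z \<ominus>\<^bsub>M\<^esub> x) \<oplus>\<^bsub>M\<^esub> (x \<ominus>\<^bsub>M\<^esub> y) = z \<ominus>\<^bsub>M\<^esub> y"
    proof -
      have "(z \<ominus>\<^bsub>M\<^esub> x) \<oplus>\<^bsub>M\<^esub> (x \<ominus>\<^bsub>M\<^esub> y) = (z \<oplus>\<^bsub>M\<^esub> \<ominus>\<^bsub>M\<^esub> y) \<oplus>\<^bsub>M\<^esub> (\<ominus>\<^bsub>M\<^esub> x \<oplus>\<^bsub>M\<^esub> x)"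
        using that(1-3) by (simp add: a_minus_def grp.a_ac)
      then show ?thesis
        using that(1-3) by (simp add: a_minus_def grp.l_neg)
    qed
    finally show "z \<ominus>\<^bsub>M\<^esub> y \<in> U" .
  qed
  have minus_sym: "y \<ominus>\<^bsub>M\<^esub> x \<in> U" if "x \<in> carrier M" "y \<in> carrier M" "x \<ominus>\<^bsub>M\<^esub> y \<in> U" for x y
    using right_submodule_a_inv[OF assms(2) that(3)] that(1,2)
    by (simp add: a_minus_def grp.minus_add grp.a_ac)
  \<comment> \<open>Congruent elements satisfy the same selection predicate, so \<open>SOME\<close>
    returns the same representative for both.\<close>
  have f_cong: "f x = f y" if "x \<in> carrier M" "y \<in> carrier M" "x \<ominus>\<^bsub>M\<^esub> y \<in> U" for x y
  proof -
    have "(z \<in> carrier M \<and> x \<ominus>\<^bsub>M\<^esub> z \<in> U) = (z \<in> carrier M \<and> y \<ominus>\<^bsub>M\<^esub> z \<in> U)" for z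
      using shift[of x y z] minus_sym[of _ z] minus_sym[of z] that by blast
    then show ?thesis
      unfolding f_def by simp
  qed
  have f_eqD: "x \<ominus>\<^bsub>M\<^esub> y \<in> U" if "x \<in> carrier M" "y \<in> carrier M" "f x = f y" for x y
    using shift[of y "f y" x] f[OF that(1)] f[OF that(2)] that by simp
  let ?N = "\<lparr>carrier = f ` carrier M, monoid.mult = undefined, monoid.one = undefined,
     ring.zero = f \<zero>\<^bsub>M\<^esub>, ring.add = (\<lambda>x y. f (x \<oplus>\<^bsub>M\<^esub> y)), ract = (\<lambda>x a. f (x \<star>\<^bsub>M\<^esub> a))\<rparr>"
  have add: "f (f x \<oplus>\<^bsub>M\<^esub> f y) = f (x \<oplus>\<^bsub>M\<^esub> y)" if "x \<in> carrier M" "y \<in> carrier M" for x y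
  proof (rule f_cong[symmetric])
    have "(x \<oplus>\<^bsub>M\<^esub> y) \<ominus>\<^bsub>M\<^esub> (f x \<oplus>\<^bsub>M\<^esub> f y) = (x \<ominus>\<^bsub>M\<^esub> f x) \<oplus>\<^bsub>M\<^esub> (y \<ominus>\<^bsub>M\<^esub> f y)"
      using f that by (simp add: a_minus_def grp.minus_add grp.a_ac)
    then show "(x \<oplus>\<^bsub>M\<^esub> y) \<ominus>\<^bsub>M\<^esub> (f x \<oplus>\<^bsub>M\<^esub> f y) \<in> U"
      using right_submodule_add[OF assms(2)] f that by simp
  qed (use f that in auto)
  have act: "f (f x \<star>\<^bsub>M\<^esub> a) = f (x \<star>\<^bsub>M\<^esub> a)" if "x \<in> carrier M" "a \<in> carrier A" for x a
  proof (rule f_cong[symmetric])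
    have "x \<star>\<^bsub>M\<^esub> a \<ominus>\<^bsub>M\<^esub> f x \<star>\<^bsub>M\<^esub> a = (x \<ominus>\<^bsub>M\<^esub> f x) \<star>\<^bsub>M\<^esub> a"
      using f that by (simp add: a_minus_def ract_add_left minus_ract)
    then show "x \<star>\<^bsub>M\<^esub> a \<ominus>\<^bsub>M\<^esub> f x \<star>\<^bsub>M\<^esub> a \<in> U"
      using right_submodule_ract[OF assms(2)] f that by simp
  qed (use f that ract_closed in auto)
  have "abelian_group ?N"
  proof (rule abelian_groupI)
    fix x assume "x \<in> carrier ?N"
    then obtain x' where "x' \<in> carrier M" "x = f x'"
      by auto
    then show "\<exists>y\<in>carrier ?N. y \<oplus>\<^bsub>?N\<^esub> x = \<zero>\<^bsub>?N\<^esub>"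
      by (auto simp: add intro!: bexI[of _ "\<ominus>\<^bsub>M\<^esub> x'"] arg_cong[of _ _ f] grp.l_neg)
  next
    fix x y z assume "x \<in> carrier ?N" "y \<in> carrier ?N" "z \<in> carrier ?N"
    then obtain x' y' z' where "x' \<in> carrier M" "x = f x'" "y' \<in> carrier M" "y = f y'"
      "z' \<in> carrier M" "z = f z'"
      by auto
    then show "x \<oplus>\<^bsub>?N\<^esub> y \<oplus>\<^bsub>?N\<^esub> z = x \<oplus>\<^bsub>?N\<^esub> (y \<oplus>\<^bsub>?N\<^esub> z)"
      by (simp add: add grp.a_assoc)
  next
    fix x y assume "x \<in> carrier ?N" "y \<in> carrier ?N"
    then show "x \<oplus>\<^bsub>?N\<^esub> y = y \<oplus>\<^bsub>?N\<^esub> x"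
      by (auto simp: add grp.a_comm)
  qed (auto simp: add)
  then have N: "right_module A ?N"
    by (intro right_module.intro right_module_axioms.intro act.ring_axioms)
      (auto simp: add act ract_closed ract_add_left ract_add_right ract_assoc ract_one)
  have "rmod_hom A M ?N f"
    by (intro rmod_homI right_module_axioms N) (auto simp: add act)
  moreover have "f x = \<zero>\<^bsub>?N\<^esub> \<longleftrightarrow> x \<in> U" if "x \<in> carrier M" for x
  proof -
    have "x \<ominus>\<^bsub>M\<^esub> \<zero>\<^bsub>M\<^esub> = x"
      using that grp.l_neg[OF grp.zero_closed] by (simp add: a_minus_def)
    then show ?thesis
      using f_cong[OF that grp.zero_closed] f_eqD[OF that grp.zero_closed] by auto
  qed
  ultimately show ?thesis
    using that by blast
qed

locale split_ext =
  fixes K :: "('k, 'z) ring_scheme" and L :: "('k, 'a, 'y) module_scheme"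
    and G :: "('k, 'g, 'x) module_scheme" and \<pi> :: "'g \<Rightarrow> 'a" and \<sigma> :: "'a \<Rightarrow> 'g"
  assumes L: "fd_algebra K L" and G: "fd_algebra K G" and split: "split_extension K L G \<pi> \<sigma>"
begin

lemma ring_L: "ring L" and ring_G: "ring G"
  using L G by (simp_all add: fd_algebra_ring)

sublocale L: ring L by (rule ring_L)
sublocale G: ring G by (rule ring_G)

lemma \<sigma>: "\<sigma> \<in> ring_hom L G" and \<pi>: "\<pi> \<in> ring_hom G L"
  using split by (simp_all add: split_extension_def algebra_hom_def)

lemma \<pi>\<sigma>: "a \<in> carrier L \<Longrightarrow> \<pi> (\<sigma> a) = a"
  using split by (simp add: split_extension_def)

lemma kernel_radical: "\<lbrakk>e \<in> carrier G; \<pi> e = \<zero>\<^bsub>L\<^esub>\<rbrakk> \<Longrightarrow> e \<in> jacobson_radical G"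
  using split by (auto simp: split_extension_def a_kernel_def')

lemmas \<sigma>_closed = ring_hom_closed[OF \<sigma>]
lemmas \<pi>_closed = ring_hom_closed[OF \<pi>]
lemmas hom_simps = ring_hom_add[OF \<sigma>] ring_hom_mult[OF \<sigma>] ring_hom_one[OF \<sigma>]
  ring_hom_add[OF \<pi>] ring_hom_mult[OF \<pi>] ring_hom_one[OF \<pi>]

lemma \<pi>_zero: "\<pi> \<zero>\<^bsub>G\<^esub> = \<zero>\<^bsub>L\<^esub>" and \<sigma>_zero: "\<sigma> \<zero>\<^bsub>L\<^esub> = \<zero>\<^bsub>G\<^esub>"
  using ring_hom_zero[OF \<pi> ring_G ring_L] ring_hom_zero[OF \<sigma> ring_L ring_G] by auto

lemma hom_a_inv:
  "a \<in> carrier L \<Longrightarrow> \<sigma> (\<ominus>\<^bsub>L\<^esub> a) = \<ominus>\<^bsub>G\<^esub> \<sigma> a" "g \<in> carrier G \<Longrightarrow> \<pi> (\<ominus>\<^bsub>G\<^esub> g) = \<ominus>\<^bsub>L\<^esub> \<pi> g"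
  using G.minus_equality[of "\<sigma> (\<ominus>\<^bsub>L\<^esub> a)" "\<sigma> a"] L.minus_equality[of "\<pi> (\<ominus>\<^bsub>G\<^esub> g)" "\<pi> g"]
  by (simp_all add: ring_hom_add[OF \<sigma>, symmetric] ring_hom_add[OF \<pi>, symmetric]
      \<sigma>_closed \<pi>_closed L.l_neg G.l_neg \<sigma>_zero \<pi>_zero)

abbreviation "EB \<equiv> extension_bimodule G \<sigma>"
abbreviation "KB \<equiv> kernel_bimodule L G \<pi> \<sigma>"
abbreviation "ind M \<equiv> tensor L M EB"
abbreviation "tenE M \<equiv> tensor L M KB"

lemma EB_simps [simp]:
  "carrier EB = carrier G" "\<zero>\<^bsub>EB\<^esub> = \<zero>\<^bsub>G\<^esub>" "x \<oplus>\<^bsub>EB\<^esub> y = x \<oplus>\<^bsub>G\<^esub> y" "x \<star>\<^bsub>EB\<^esub> g = x \<otimes>\<^bsub>G\<^esub> g"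
  "lact EB a x = \<sigma> a \<otimes>\<^bsub>G\<^esub> x"
  by (simp_all add: extension_bimodule_def)

lemma KB_simps [simp]:
  "carrier KB = {e \<in> carrier G. \<pi> e = \<zero>\<^bsub>L\<^esub>}" "\<zero>\<^bsub>KB\<^esub> = \<zero>\<^bsub>G\<^esub>" "x \<oplus>\<^bsub>KB\<^esub> y = x \<oplus>\<^bsub>G\<^esub> y"
  "x \<star>\<^bsub>KB\<^esub> a = x \<otimes>\<^bsub>G\<^esub> \<sigma> a" "lact KB a x = \<sigma> a \<otimes>\<^bsub>G\<^esub> x"
  by (simp_all add: kernel_bimodule_def a_kernel_def')

lemma bimodule_EB: "bimodule L G EB"
proof (intro bimodule.intro bimodule_axioms.intro right_module.intro right_module_axioms.intro ring_L ring_G)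
  show "abelian_group EB"
    by (rule abelian_groupI) (auto simp: G.a_ac intro!: bexI[of _ "\<ominus>\<^bsub>G\<^esub> _"] G.l_neg)
qed (auto simp: \<sigma>_closed G.l_distr G.r_distr G.m_assoc)

lemma bimodule_KB: "bimodule L L KB"
proof (intro bimodule.intro bimodule_axioms.intro right_module.intro right_module_axioms.intro ring_L)
  show "abelian_group KB"
  proof (rule abelian_groupI)
    fix x assume "x \<in> carrier KB"
    then show "\<exists>y\<in>carrier KB. y \<oplus>\<^bsub>KB\<^esub> x = \<zero>\<^bsub>KB\<^esub>"
      by (intro bexI[of _ "\<ominus>\<^bsub>G\<^esub> x"]) (auto simp: hom_a_inv G.l_neg)
  qed (auto simp: G.a_ac hom_simps \<pi>_zero)
qed (auto simp: \<sigma>_closed hom_simps \<pi>\<sigma> G.l_distr G.r_distr G.m_assoc)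

lemma tensor_EB: "right_module L M \<Longrightarrow> tensor_product L M G EB"
  by (simp add: tensor_product_def bimodule_EB)

lemma tensor_KB: "right_module L M \<Longrightarrow> tensor_product L M L KB"
  by (simp add: tensor_product_def bimodule_KB)

text \<open>The unit \<open>m \<mapsto> m \<otimes> 1\<close> of the adjunction between induction
  and restriction along \<sigma>.\<close>

definition emb :: "('a, 'm, 'u) right_module_scheme \<Rightarrow> 'm \<Rightarrow> ('m \<times> 'g \<Rightarrow>\<^sub>0 int) set"
  where "emb M m = tens L M EB m \<one>\<^bsub>G\<^esub>"

lemma right_module_ind: "right_module L M \<Longrightarrow> right_module G (ind M)"
  by (rule tensor_product.right_module_tensor[OF tensor_EB])

lemma right_module_ind_restrict: "right_module L M \<Longrightarrow> right_module L (restrict_scalars \<sigma> (ind M))"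
  by (rule right_module_restrict_scalars[OF right_module_ind ring_L \<sigma>])

lemma tens_eq_emb:
  assumes "right_module L M" "m \<in> carrier M" "g \<in> carrier G"
  shows "tens L M EB m g = emb M m \<star>\<^bsub>ind M\<^esub> g"
proof -
  interpret tensor_product L M G EB by (rule tensor_EB[OF assms(1)])
  show ?thesis
    unfolding emb_def using tens_ract[OF assms(2), of "\<one>\<^bsub>G\<^esub>" g] assms(3) by simp
qed

lemma rmod_hom_emb:
  assumes "right_module L M"
  shows "rmod_hom L M (restrict_scalars \<sigma> (ind M)) (emb M)"
proof -
  interpret tensor_product L M G EB by (rule tensor_EB[OF assms])
  show ?thesis
  proof (intro rmod_homI assms right_module_ind_restrict)
    fix m a assume m: "m \<in> carrier M" and a: "a \<in> carrier L"
    have "emb M (m \<star>\<^bsub>M\<^esub> a) = tens L M EB m (\<sigma> a)"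
      unfolding emb_def using tens_balanced[OF m a, of "\<one>\<^bsub>G\<^esub>"] \<sigma>_closed[OF a] by simp
    then show "emb M (m \<star>\<^bsub>M\<^esub> a) = emb M m \<star>\<^bsub>restrict_scalars \<sigma> (ind M)\<^esub> a"
      using tens_eq_emb[OF assms m \<sigma>_closed[OF a]] by simp
  qed (simp_all add: emb_def tens_closed tens_add_left)
qed

lemma emb_closed: "\<lbrakk>right_module L M; m \<in> carrier M\<rbrakk> \<Longrightarrow> emb M m \<in> carrier (ind M)"
  using rmod_hom.hom_closed[OF rmod_hom_emb] by fastforce

text \<open>Every pure tensor is \<open>(m \<otimes> 1) g\<close>. Working with submodules that
  contain the elements \<open>m \<otimes> 1\<close> replaces most inductions over tensors
  below.\<close>

lemma emb_generates:
  assumes "right_module L M" "right_submodule G (ind M) U" "\<And>m. m \<in> carrier M \<Longrightarrow> emb M m \<in> U"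
  shows "U = carrier (ind M)"
proof -
  interpret tensor_product L M G EB by (rule tensor_EB[OF assms(1)])
  have "z \<in> U" if "z \<in> carrier (ind M)" for z
    using that
  proof (induction rule: tensor_induct)
    case zero
    then show ?case
      by (rule right_submodule_zero[OF assms(2)])
  next
    case (tens m x)
    then show ?case
      using tens_eq_emb[OF assms(1)] right_submodule_ract[OF assms(2) assms(3)] by simp
  next
    case (add u v)
    then show ?case
      using right_submodule_add[OF assms(2)] by blast
  qed
  then show ?thesis
    using right_submodule_subset[OF assms(2)] by blast
qed

text \<open>The equalizer of two homomorphisms is a submodule, so \<open>emb_generates\<close>
  applies. This is the uniqueness half of the adjunction and the standard way to verify identities
  between maps out of \<open>ind M\<close>.\<close>

lemma ind_hom_unique:
  assumes "right_module L M" "rmod_hom G (ind M) N f" "rmod_hom G (ind M) N f'"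
    and "\<And>m. m \<in> carrier M \<Longrightarrow> f (emb M m) = f' (emb M m)" and z: "z \<in> carrier (ind M)"
  shows "f z = f' z"
proof -
  interpret f: rmod_hom G "ind M" N f by fact
  interpret f': rmod_hom G "ind M" N f' by fact
  have "{z \<in> carrier (ind M). f z = f' z} = carrier (ind M)"
  proof (rule emb_generates[OF assms(1)])
    show "right_submodule G (ind M) {z \<in> carrier (ind M). f z = f' z}"
      by (rule right_submoduleI[OF f.src.right_module_axioms])
        (auto simp: f.hom_zero f'.hom_zero f.hom_add f'.hom_add f.hom_ract f'.hom_ract f.src.ract_closed)
  qed (use assms(4) emb_closed[OF assms(1)] in auto)
  then show ?thesis
    using z by blast
qed

text \<open>The existence half of the adjunction: \<open>f m \<star> g\<close> is balanced precisely
  because \<open>f\<close> is linear over \<Lambda> acting through \<sigma>.\<close>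

lemma ind_extend:
  assumes M: "right_module L M" and N: "right_module G N"
    and f: "rmod_hom L M (restrict_scalars \<sigma> N) f"
  obtains F where "rmod_hom G (ind M) N F" "\<forall>m \<in> carrier M. F (emb M m) = f m"
proof -
  interpret tensor_product L M G EB by (rule tensor_EB[OF M])
  interpret N: right_module G N by fact
  interpret f: rmod_hom L M "restrict_scalars \<sigma> N" f by fact
  have fN: "f m \<in> carrier N" if "m \<in> carrier M" for m
    using f.hom_closed[OF that] by simp
  obtain F where F: "\<forall>z \<in> carrier (ind M). F z \<in> carrier N"
    "\<forall>u \<in> carrier (ind M). \<forall>v \<in> carrier (ind M). F (u \<oplus>\<^bsub>ind M\<^esub> v) = F u \<oplus>\<^bsub>N\<^esub> F v"
    "\<forall>m \<in> carrier M. \<forall>g \<in> carrier EB. F (tens L M EB m g) = f m \<star>\<^bsub>N\<^esub> g"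
  proof (rule tensor_universal[OF N.grp.abelian_group_axioms, of "\<lambda>m g. f m \<star>\<^bsub>N\<^esub> g"])
    show "f (m \<star>\<^bsub>M\<^esub> a) \<star>\<^bsub>N\<^esub> g = f m \<star>\<^bsub>N\<^esub> lact EB a g"
      if "m \<in> carrier M" "a \<in> carrier L" "g \<in> carrier EB" for m a g
      using that f.hom_ract[OF that(1,2)] by (simp add: fN \<sigma>_closed N.ract_assoc)
    show "f (m \<oplus>\<^bsub>M\<^esub> m') \<star>\<^bsub>N\<^esub> g = f m \<star>\<^bsub>N\<^esub> g \<oplus>\<^bsub>N\<^esub> f m' \<star>\<^bsub>N\<^esub> g"
      if "m \<in> carrier M" "m' \<in> carrier M" "g \<in> carrier EB" for m m' g
      using that f.hom_add[OF that(1,2)] by (simp add: fN N.ract_add_left)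
  qed (auto simp: fN N.ract_closed N.ract_add_right)
  have "F (z \<star>\<^bsub>ind M\<^esub> g) = F z \<star>\<^bsub>N\<^esub> g" if z: "z \<in> carrier (ind M)" and g: "g \<in> carrier G" for z g
    using z
  proof (induction rule: tensor_induct)
    case zero
    have "F \<zero>\<^bsub>ind M\<^esub> = \<zero>\<^bsub>N\<^esub>"
      by (rule additive_zero[where f = F, OF abelian_group_T N.grp.abelian_group_axioms])
        (use F(1,2) abelian_groupE(2)[OF abelian_group_T] in blast)+
    then show ?case
      using g by (simp add: T_ract_zero N.zero_ract)
  next
    case (tens m x)
    then show ?case
      using F(3) g by (simp add: tens_ract fN N.ract_assoc)
  next
    case (add u v)
    then show ?case
      using F(1,2) g by (simp add: T_ract_add T_ract_closed N.ract_add_left)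
  qed
  then have "rmod_hom G (ind M) N F"
    using F by (intro rmod_homI right_module_tensor N) auto
  moreover have "\<forall>m \<in> carrier M. F (emb M m) = f m"
    using F(3) fN N.ract_one by (simp add: emb_def)
  ultimately show ?thesis
    by (rule that)
qed

end

section \<open>Reduction of \<open>ind M\<close> modulo \<open>E\<close>, and Nakayama's lemma for
  induced modules\<close>

context split_ext
begin

text \<open>The reduction \<open>m \<otimes> g \<mapsto> m \<pi>(g)\<close>, a map of
  \<Gamma>-modules when \<open>M\<close> is inflated along \<pi>. \<open>SOME\<close> leaves no
  freedom on the carrier, by \<open>ind_hom_unique\<close>.\<close>

definition ret :: "('a, 'm, 'u) right_module_scheme \<Rightarrow> ('m \<times> 'g \<Rightarrow>\<^sub>0 int) set \<Rightarrow> 'm"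
  where "ret M = (SOME f. rmod_hom G (ind M) (restrict_scalars \<pi> M) f \<and>
    (\<forall>m \<in> carrier M. f (emb M m) = m))"

lemma right_module_pi: "right_module L M \<Longrightarrow> right_module G (restrict_scalars \<pi> M)"
  by (rule right_module_restrict_scalars[OF _ ring_G \<pi>])

lemma ret:
  assumes "right_module L M"
  shows "rmod_hom G (ind M) (restrict_scalars \<pi> M) (ret M)"
    "\<And>m. m \<in> carrier M \<Longrightarrow> ret M (emb M m) = m"
proof -
  let ?N = "restrict_scalars \<pi> M"
  interpret N: right_module L "restrict_scalars \<sigma> ?N"
    by (rule right_module_restrict_scalars[OF right_module_pi[OF assms] ring_L \<sigma>])
  have "rmod_hom L M (restrict_scalars \<sigma> ?N) (\<lambda>m. m)"
    by (intro rmod_homI assms N.right_module_axioms) (auto simp: \<pi>\<sigma>)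
  then obtain F where "rmod_hom G (ind M) ?N F" "\<forall>m \<in> carrier M. F (emb M m) = m"
    by (rule ind_extend[OF assms right_module_pi[OF assms]])
  then have "\<exists>f. rmod_hom G (ind M) ?N f \<and> (\<forall>m \<in> carrier M. f (emb M m) = m)"
    by blast
  then have *: "rmod_hom G (ind M) ?N (ret M) \<and> (\<forall>m \<in> carrier M. ret M (emb M m) = m)"
    unfolding ret_def by (rule someI_ex)
  show "rmod_hom G (ind M) ?N (ret M)" "\<And>m. m \<in> carrier M \<Longrightarrow> ret M (emb M m) = m"
    using * by auto
qed

lemma ret_closed: "\<lbrakk>right_module L M; z \<in> carrier (ind M)\<rbrakk> \<Longrightarrow> ret M z \<in> carrier M"
  using rmod_hom.hom_closed[OF ret(1)] by fastforce

lemma ret_surj: "right_module L M \<Longrightarrow> ret M ` carrier (ind M) = carrier M"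
  using ret(2) ret_closed emb_closed by (metis (no_types, opaque_lifting) image_eqI image_subsetI subsetI subset_antisym)

text \<open>Restricting along \<sigma> undoes the inflation along \<pi> since \<pi> \<sigma> is the
  identity. Thus \<open>ret M\<close> is a \<Lambda>-linear retraction of
  \<open>emb M\<close>.\<close>

lemma ret_hom_L:
  assumes "right_module L M"
  shows "rmod_hom L (restrict_scalars \<sigma> (ind M)) M (ret M)"
proof -
  interpret r: rmod_hom G "ind M" "restrict_scalars \<pi> M" "ret M" by (rule ret(1)[OF assms])
  show ?thesis
  proof (intro rmod_homI assms right_module_ind_restrict)
    show "ret M (x \<star>\<^bsub>restrict_scalars \<sigma> (ind M)\<^esub> a) = ret M x \<star>\<^bsub>M\<^esub> a"
      if "x \<in> carrier (restrict_scalars \<sigma> (ind M))" "a \<in> carrier L" for x a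
      using that r.hom_ract[of x "\<sigma> a"] by (simp add: \<sigma>_closed \<pi>\<sigma>)
  qed (use r.hom_closed r.hom_add in auto)
qed

lemma rmod_hom_pi: "rmod_hom L M N f \<Longrightarrow> rmod_hom G (restrict_scalars \<pi> M) (restrict_scalars \<pi> N) f"
  by (rule rmod_hom_restrict_scalars[OF _ ring_G \<pi>])

text \<open>
  \<open>ind M\<close> is generated by the elements \<open>m \<otimes> 1\<close>, and \<open>m \<otimes> g\<close> differs from \<open>m \<pi>(g) \<otimes> 1\<close> by an
  element of \<open>(ind M) E\<close>.
\<close>

lemma ret_kernel:
  assumes M: "right_module L M" and V: "right_submodule G (ind M) V"
    and E: "\<And>z e. \<lbrakk>z \<in> carrier (ind M); e \<in> jacobson_radical G\<rbrakk> \<Longrightarrow> z \<star>\<^bsub>ind M\<^esub> e \<in> V"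
    and z: "z \<in> carrier (ind M)" "ret M z = \<zero>\<^bsub>M\<^esub>"
  shows "z \<in> V"
proof -
  interpret tensor_product L M G EB by (rule tensor_EB[OF M])
  interpret I: right_module G "ind M" by (rule right_module_ind[OF M])
  interpret r: rmod_hom G "ind M" "restrict_scalars \<pi> M" "ret M" by (rule ret(1)[OF M])
  interpret e: rmod_hom L M "restrict_scalars \<sigma> (ind M)" "emb M" by (rule rmod_hom_emb[OF M])
  \<comment> \<open>The claim is generalized to all \<open>z\<close> so that induction over tensors
    applies; for \<open>z\<close> in the kernel of \<open>ret M\<close> the subtracted term is
    zero.\<close>
  have "z \<ominus>\<^bsub>ind M\<^esub> emb M (ret M z) \<in> V"
    using z(1)
  proof (induction rule: tensor_induct)
    case zero
    have "emb M \<zero>\<^bsub>M\<^esub> = \<zero>\<^bsub>ind M\<^esub>"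
      using e.hom_zero by simp
    then show ?case
      using r.hom_zero right_submodule_zero[OF V]
      by (simp add: a_minus_def I.grp.a_inv_zero)
  next
    case (tens m g)
    then have g: "g \<in> carrier G"
      by simp
    have em: "emb M m \<in> carrier (ind M)"
      using emb_closed[OF M] tens(1) .
    have sp: "\<sigma> (\<pi> g) \<in> carrier G"
      using \<sigma>_closed[OF \<pi>_closed[OF g]] .
    have "ret M (tens L M EB m g) = m \<star>\<^bsub>M\<^esub> \<pi> g"
      using tens_eq_emb[OF M tens(1) g] r.hom_ract[OF em g] ret(2)[OF M tens(1)] by simp
    then have "emb M (ret M (tens L M EB m g)) = emb M m \<star>\<^bsub>ind M\<^esub> \<sigma> (\<pi> g)"
      using e.hom_ract[OF tens(1) \<pi>_closed[OF g]] by simp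
    then have "tens L M EB m g \<ominus>\<^bsub>ind M\<^esub> emb M (ret M (tens L M EB m g)) =
        emb M m \<star>\<^bsub>ind M\<^esub> (g \<ominus>\<^bsub>G\<^esub> \<sigma> (\<pi> g))"
      using tens_eq_emb[OF M tens(1) g] em g sp
      by (simp add: a_minus_def I.ract_add_right I.ract_minus)
    \<comment> \<open>\<pi> sends this difference to zero, so it lies in the kernel of \<pi> and
      thereby in the radical.\<close>
    moreover have "g \<ominus>\<^bsub>G\<^esub> \<sigma> (\<pi> g) \<in> jacobson_radical G"
      using g sp by (intro kernel_radical)
        (simp_all add: a_minus_def hom_simps hom_a_inv \<pi>\<sigma> \<pi>_closed L.r_neg)
    ultimately show ?case
      using E em by simp
  next
    case (add u v)
    have uv: "emb M (ret M u) \<in> carrier (ind M)" "emb M (ret M v) \<in> carrier (ind M)"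
      using add(1,2) ret_closed[OF M] emb_closed[OF M] by auto
    have "emb M (ret M (u \<oplus>\<^bsub>ind M\<^esub> v)) = emb M (ret M u) \<oplus>\<^bsub>ind M\<^esub> emb M (ret M v)"
      using r.hom_add[OF add(1,2)] e.hom_add[OF ret_closed[OF M add(1)] ret_closed[OF M add(2)]] by simp
    then have "(u \<oplus>\<^bsub>ind M\<^esub> v) \<ominus>\<^bsub>ind M\<^esub> emb M (ret M (u \<oplus>\<^bsub>ind M\<^esub> v)) =
        (u \<ominus>\<^bsub>ind M\<^esub> emb M (ret M u)) \<oplus>\<^bsub>ind M\<^esub> (v \<ominus>\<^bsub>ind M\<^esub> emb M (ret M v))"
      using uv add(1,2) by (simp add: a_minus_def I.grp.minus_add I.grp.a_ac)
    then show ?case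
      using right_submodule_add[OF V add(3,4)] by simp
  qed
  moreover have "emb M (ret M z) = \<zero>\<^bsub>ind M\<^esub>"
    using z(2) e.hom_zero by simp
  ultimately show ?thesis
    using z(1) by (simp add: a_minus_def I.grp.a_inv_zero)
qed

lemma fg_ind:
  assumes "fg_right_module L M"
  shows "fg_right_module G (ind M)"
proof -
  have M: "right_module L M"
    by (rule fg_imp_right_module[OF assms])
  obtain S where S: "finite S" "generates L M S"
    using assms by (auto simp: fg_right_module_iff_generates)
  have SM: "S \<subseteq> carrier M"
    using S(2) by (simp add: generates_def)
  have "generates G (ind M) (emb M ` S)"
    unfolding generates_def
  proof (intro conjI allI impI)
    show "emb M ` S \<subseteq> carrier (ind M)"
      using SM emb_closed[OF M] by auto
    fix U assume U: "right_submodule G (ind M) U \<and> emb M ` S \<subseteq> U"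
    have "right_submodule L (restrict_scalars \<sigma> (ind M)) U"
      using U by (intro right_submodule_restrict_scalars[OF right_module_ind[OF M] _ ring_L \<sigma>]) simp
    then have "{m \<in> carrier M. emb M m \<in> U} = carrier M"
      using SM U by (intro generatesD[OF S(2)] rmod_hom.submodule_preimage[OF rmod_hom_emb[OF M]]) auto
    then show "U = carrier (ind M)"
      using U by (intro emb_generates[OF M]) auto
  qed
  then show ?thesis
    using S(1) right_module_ind[OF M] by (auto simp: fg_right_module_iff_generates)
qed

text \<open>A submodule that maps onto \<open>M\<close> together with the kernel of
  \<open>ret M\<close> spans \<open>ind M\<close>, and by \<open>ret_kernel\<close> that kernel lies
  in \<open>(ind M) rad(\<Gamma>)\<close>.\<close>

lemma ind_nakayama:
  assumes "fg_right_module L M" "right_submodule G (ind M) U" "ret M ` U = carrier M"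
  shows "U = carrier (ind M)"
proof -
  have M: "right_module L M"
    by (rule fg_imp_right_module[OF assms(1)])
  interpret r: rmod_hom G "ind M" "restrict_scalars \<pi> M" "ret M" by (rule ret(1)[OF M])
  have "a_kernel (ind M) (restrict_scalars \<pi> M) (ret M) <+>\<^bsub>ind M\<^esub> U = carrier (ind M)"
    using assms(3) ret_surj[OF M] by (subst r.set_add_kernel_iff[OF _ assms(2)]) simp_all
  then show ?thesis
    by (rule nakayama[OF G fg_ind[OF assms(1)] assms(2) r.submodule_kernel, rotated])
      (use ret_kernel[OF M] in \<open>auto simp: r.a_kernel_eq\<close>)
qed

text \<open>The image of \<open>h\<close> still maps onto \<open>M\<close>, so Nakayama makes
  \<open>h\<close> surjective and \<open>surj_endo_inj\<close> makes it injective. The lifting of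
  idempotents rests on this.\<close>

lemma ind_endo_bij:
  assumes "fg_right_module L M" "rmod_hom G (ind M) (ind M) h"
    and "\<And>z. z \<in> carrier (ind M) \<Longrightarrow> ret M (h z) = ret M z"
  shows "bij_betw h (carrier (ind M)) (carrier (ind M))"
proof -
  have M: "right_module L M"
    by (rule fg_imp_right_module[OF assms(1)])
  have "ret M ` h ` carrier (ind M) = ret M ` carrier (ind M)"
    unfolding image_image by (rule image_cong) (simp_all add: assms(3))
  then have "h ` carrier (ind M) = carrier (ind M)"
    using ret_surj[OF M] by (intro ind_nakayama[OF assms(1)]
        rmod_hom.submodule_image[OF assms(2) right_submodule_carrier[OF right_module_ind[OF M]]]) simp
  then show ?thesis
    using surj_endo_inj[OF G fg_ind[OF assms(1)] assms(2)] by (simp add: bij_betw_def)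
qed

subsection \<open>Functoriality\<close>

text \<open>Functoriality of induction together with naturality of \<open>emb\<close> and
  \<open>ret\<close>.\<close>

lemma ind_map_exists:
  assumes "rmod_hom L M N f"
  obtains F where "rmod_hom G (ind M) (ind N) F" "\<forall>m \<in> carrier M. F (emb M m) = emb N (f m)"
    "\<forall>z \<in> carrier (ind M). ret N (F z) = f (ret M z)"
proof -
  note M = rmod_hom_source[OF assms] and N = rmod_hom_target[OF assms]
  obtain F where F: "rmod_hom G (ind M) (ind N) F" "\<forall>m \<in> carrier M. F (emb M m) = emb N (f m)"
    by (rule ind_extend[OF M right_module_ind[OF N] rmod_hom_comp[OF assms rmod_hom_emb[OF N]]])
  have "ret N (F z) = f (ret M z)" if "z \<in> carrier (ind M)" for z
    by (rule ind_hom_unique[OF M rmod_hom_comp[OF F(1) ret(1)[OF N]]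
        rmod_hom_comp[OF ret(1)[OF M] rmod_hom_pi[OF assms]] _ that])
      (use F(2) ret(2)[OF N] ret(2)[OF M] rmod_hom.hom_closed[OF assms] in simp)
  then show ?thesis
    using that F by blast
qed

text \<open>The dual basis is induced: vectors \<open>x i \<otimes> 1\<close>, and functionals
  extending the \<sigma>-images of the \<open>\<phi> i\<close>. Its expansion formula compares two
  endomorphisms of \<open>ind P\<close>, so it need only be checked on elements
  \<open>p \<otimes> 1\<close>.\<close>

lemma projective_ind:
  assumes "projective L P"
  shows "projective G (ind P)"
proof -
  obtain n x \<phi> where db: "dual_basis L P n x \<phi>"
    using assms by (auto simp: projective_iff_dual_basis)
  note D = dual_basisD[OF db]
  have reg: "right_module G (regular_right G)"
    by (rule right_module_regular[OF ring_G])
  interpret \<sigma>reg: right_module L "restrict_scalars \<sigma> (regular_right G)"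
    by (rule right_module_restrict_scalars[OF reg ring_L \<sigma>])
  interpret I: right_module G "ind P" by (rule right_module_ind[OF D(1)])
  have "\<exists>\<Phi>. rmod_hom G (ind P) (regular_right G) \<Phi> \<and> (\<forall>p \<in> carrier P. \<Phi> (emb P p) = \<sigma> (\<phi> i p))"
    if i: "i < n" for i
  proof -
    have "rmod_hom L (regular_right L) (restrict_scalars \<sigma> (regular_right G)) \<sigma>"
      by (intro rmod_homI right_module_regular ring_L \<sigma>reg.right_module_axioms)
        (auto simp: hom_simps \<sigma>_closed)
    then show ?thesis
      using ind_extend[OF D(1) reg rmod_hom_comp[OF D(3)[OF i]]] by metis
  qed
  then obtain \<Phi> where \<Phi>: "\<And>i. i < n \<Longrightarrow> rmod_hom G (ind P) (regular_right G) (\<Phi> i)"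
    "\<And>i p. \<lbrakk>i < n; p \<in> carrier P\<rbrakk> \<Longrightarrow> \<Phi> i (emb P p) = \<sigma> (\<phi> i p)"
    by metis
  interpret e: rmod_hom L P "restrict_scalars \<sigma> (ind P)" "emb P" by (rule rmod_hom_emb[OF D(1)])
  have ex: "emb P (x i) \<in> carrier (ind P)" if "i < n" for i
    using emb_closed[OF D(1) D(2)[OF that]] .
  have "(\<Oplus>\<^bsub>ind P\<^esub>i\<in>{..<n}. emb P (x i) \<star>\<^bsub>ind P\<^esub> \<Phi> i z) = z" if z: "z \<in> carrier (ind P)" for z
  proof (rule ind_hom_unique[OF D(1) _ rmod_hom_id[OF I.right_module_axioms] _ z])
    show "rmod_hom G (ind P) (ind P) (\<lambda>z. \<Oplus>\<^bsub>ind P\<^esub>i\<in>{..<n}. emb P (x i) \<star>\<^bsub>ind P\<^esub> \<Phi> i z)"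
      by (rule rmod_hom_finsum[OF I.right_module_axioms I.right_module_axioms])
        (auto intro!: rmod_hom_comp[OF \<Phi>(1)] I.rmod_hom_orbit ex)
    fix p assume p: "p \<in> carrier P"
    have "emb P p = emb P (\<Oplus>\<^bsub>P\<^esub>i\<in>{..<n}. x i \<star>\<^bsub>P\<^esub> \<phi> i p)"
      using D(5)[OF p] by simp
    also have "\<dots> = (\<Oplus>\<^bsub>restrict_scalars \<sigma> (ind P)\<^esub>i\<in>{..<n}. emb P (x i \<star>\<^bsub>P\<^esub> \<phi> i p))"
      using D(2,4) p by (intro e.hom_finsum) (auto intro!: e.src.ract_closed)
    \<comment> \<open>The same sum, but \<open>finsum\<close> refers to the record: the restricted
      module and \<open>ind P\<close> have to be identified explicitly.\<close>
    also have "\<dots> = (\<Oplus>\<^bsub>ind P\<^esub>i\<in>{..<n}. emb P (x i \<star>\<^bsub>P\<^esub> \<phi> i p))"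
      by (rule finsum_additive[of "restrict_scalars \<sigma> (ind P)" "ind P" "{..<n}" _ "\<lambda>z. z"])
        (use D(2,4) p e.tgt.grp.abelian_group_axioms I.grp.abelian_group_axioms
          in \<open>auto intro!: e.src.ract_closed emb_closed[OF D(1)]\<close>)
    also have "\<dots> = (\<Oplus>\<^bsub>ind P\<^esub>i\<in>{..<n}. emb P (x i) \<star>\<^bsub>ind P\<^esub> \<Phi> i (emb P p))"
    proof (rule I.grp.finsum_cong')
      show "emb P (x i \<star>\<^bsub>P\<^esub> \<phi> i p) = emb P (x i) \<star>\<^bsub>ind P\<^esub> \<Phi> i (emb P p)" if "i \<in> {..<n}" for i
        using that e.hom_ract[OF D(2) D(4)[OF _ p], of i i] \<Phi>(2)[OF _ p, of i] by simp
      show "(\<lambda>i. emb P (x i) \<star>\<^bsub>ind P\<^esub> \<Phi> i (emb P p)) \<in> {..<n} \<rightarrow> carrier (ind P)"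
        using ex rmod_hom.hom_closed[OF \<Phi>(1) emb_closed[OF D(1) p]] I.ract_closed by auto
    qed simp
    finally show "(\<Oplus>\<^bsub>ind P\<^esub>i\<in>{..<n}. emb P (x i) \<star>\<^bsub>ind P\<^esub> \<Phi> i (emb P p)) = emb P p" ..
  qed
  then have "dual_basis G (ind P) n (\<lambda>i. emb P (x i)) \<Phi>"
    unfolding dual_basis_def using I.right_module_axioms ex \<Phi>(1) by auto
  then show ?thesis
    by (auto simp: projective_iff_dual_basis)
qed

lemma ind_surj:
  assumes "rmod_hom L M N f" "f ` carrier M = carrier N"
    and F: "rmod_hom G (ind M) (ind N) F" "\<forall>m \<in> carrier M. F (emb M m) = emb N (f m)"
  shows "F ` carrier (ind M) = carrier (ind N)"
proof (rule emb_generates[OF rmod_hom_target[OF assms(1)]])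
  note M = rmod_hom_source[OF assms(1)]
  show "right_submodule G (ind N) (F ` carrier (ind M))"
    by (rule rmod_hom.submodule_image[OF F(1) right_submodule_carrier[OF right_module_ind[OF M]]])
  fix n assume "n \<in> carrier N"
  then have "n \<in> f ` carrier M"
    using assms(2) by simp
  then obtain m where "m \<in> carrier M" "n = f m"
    by blast
  then show "emb N n \<in> F ` carrier (ind M)"
    using F(2) emb_closed[OF M] by (intro image_eqI[of _ F "emb M m"]) auto
qed

text \<open>Right exactness from the adjunction, without inspecting relations. Let \<open>k\<close>
  be the quotient map of \<open>ind N\<close> by the image of \<open>F\<close>. Then
  \<open>k\<close> after \<open>emb N\<close> kills the kernel of \<open>g\<close>, descends to
  \<open>Q\<close> and extends to a map \<open>C\<close> on \<open>ind Q\<close> that satisfies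
  \<open>C H = k\<close>. So \<open>H z = 0\<close> implies \<open>k z = 0\<close>.\<close>

lemma ind_exact:
  fixes N :: "('a, 'n, 'u) right_module_scheme"
  assumes f: "rmod_hom L M N f" and g: "rmod_hom L N Q g" "g ` carrier N = carrier Q"
    and exact: "\<forall>y \<in> carrier N. g y = \<zero>\<^bsub>Q\<^esub> \<longrightarrow> (\<exists>x \<in> carrier M. f x = y)"
    and F: "rmod_hom G (ind M) (ind N) F" "\<forall>m \<in> carrier M. F (emb M m) = emb N (f m)"
    and H: "rmod_hom G (ind N) (ind Q) H" "\<forall>y \<in> carrier N. H (emb N y) = emb Q (g y)"
    and z: "z \<in> carrier (ind N)" "H z = \<zero>\<^bsub>ind Q\<^esub>"
  shows "z \<in> F ` carrier (ind M)"
proof -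
  note M = rmod_hom_source[OF f] and N = rmod_hom_target[OF f] and Q = rmod_hom_target[OF g(1)]
  interpret g: rmod_hom L N Q g by (rule g(1))
  interpret eN: rmod_hom L N "restrict_scalars \<sigma> (ind N)" "emb N" by (rule rmod_hom_emb[OF N])
  let ?U = "F ` carrier (ind M)"
  have U: "right_submodule G (ind N) ?U"
    by (rule rmod_hom.submodule_image[OF F(1) right_submodule_carrier[OF right_module_ind[OF M]]])
  obtain Y :: "('g, ('n \<times> 'g \<Rightarrow>\<^sub>0 int) set) right_module" and k where k: "rmod_hom G (ind N) Y k" "\<forall>x \<in> carrier (ind N). k x = \<zero>\<^bsub>Y\<^esub> \<longleftrightarrow> x \<in> ?U"
    by (rule quotient_module_exists[OF right_module_ind[OF N] U])
  interpret k: rmod_hom G "ind N" Y k by (rule k(1))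
  have Y: "right_module G Y"
    by (rule rmod_hom_target[OF k(1)])
  \<comment> \<open>A set-theoretic section of \<open>g\<close>. The composite \<open>h\<close> is
    nevertheless linear because, by \<open>hg\<close>, it does not depend on the choice of
    preimages.\<close>
  define s where "s q = (SOME y. y \<in> carrier N \<and> g y = q)" for q
  have s: "s q \<in> carrier N" "g (s q) = q" if "q \<in> carrier Q" for q
  proof -
    have "q \<in> g ` carrier N"
      using that g(2) by simp
    then have "\<exists>y. y \<in> carrier N \<and> g y = q"
      by blast
    then have "s q \<in> carrier N \<and> g (s q) = q"
      unfolding s_def by (rule someI_ex)
    then show "s q \<in> carrier N" "g (s q) = q"
      by auto
  qed
  define h where "h q = k (emb N (s q))" for q
  have ke: "rmod_hom L N (restrict_scalars \<sigma> Y) (\<lambda>y. k (emb N y))"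
    by (rule rmod_hom_comp[OF rmod_hom_emb[OF N] rmod_hom_restrict_scalars[OF k(1) ring_L \<sigma>]])
  interpret ke: rmod_hom L N "restrict_scalars \<sigma> Y" "\<lambda>y. k (emb N y)" by (rule ke)
  have ke_zero: "k (emb N y) = \<zero>\<^bsub>Y\<^esub>" if y: "y \<in> carrier N" "g y = \<zero>\<^bsub>Q\<^esub>" for y
  proof -
    obtain x where x: "x \<in> carrier M" "f x = y"
      using exact y by blast
    then have "emb N y \<in> ?U"
      using F(2) emb_closed[OF M x(1)] by (intro image_eqI[of _ F "emb M x"]) auto
    then show ?thesis
      using k(2) emb_closed[OF N y(1)] by blast
  qed
  have hg: "h (g y) = k (emb N y)" if y: "y \<in> carrier N" for y
  proof -
    have gy: "g y \<in> carrier Q"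
      using g.hom_closed[OF y] .
    have "y \<ominus>\<^bsub>N\<^esub> s (g y) \<in> carrier N"
      using y s(1)[OF gy] by simp
    moreover have "g (y \<ominus>\<^bsub>N\<^esub> s (g y)) = \<zero>\<^bsub>Q\<^esub>"
      using g.hom_minus[OF y s(1)[OF gy]] s(2)[OF gy] g.tgt.grp.minus_eq_zero_iff[OF gy gy] by simp
    ultimately have "k (emb N (y \<ominus>\<^bsub>N\<^esub> s (g y))) = \<zero>\<^bsub>Y\<^esub>"
      by (rule ke_zero)
    then have "k (emb N y) = k (emb N (s (g y)))"
      using ke.eq_iff_minus_in_kernel[OF y s(1)[OF gy]] \<open>y \<ominus>\<^bsub>N\<^esub> s (g y) \<in> carrier N\<close>
      by (simp add: ke.a_kernel_eq)
    then show ?thesis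
      by (simp add: h_def)
  qed
  have "rmod_hom L Q (restrict_scalars \<sigma> Y) h"
  proof (intro rmod_homI Q ke.tgt.right_module_axioms)
    fix q assume q: "q \<in> carrier Q"
    show "h q \<in> carrier (restrict_scalars \<sigma> Y)"
      unfolding h_def using ke.hom_closed[OF s(1)[OF q]] .
    show "h (q \<oplus>\<^bsub>Q\<^esub> q') = h q \<oplus>\<^bsub>restrict_scalars \<sigma> Y\<^esub> h q'" if q': "q' \<in> carrier Q" for q'
      using hg[of "s q \<oplus>\<^bsub>N\<^esub> s q'"] ke.hom_add[OF s(1)[OF q] s(1)[OF q']] s[OF q] s[OF q']
      by (simp add: g.hom_add h_def)
    show "h (q \<star>\<^bsub>Q\<^esub> a) = h q \<star>\<^bsub>restrict_scalars \<sigma> Y\<^esub> a" if a: "a \<in> carrier L" for a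
      using hg[of "s q \<star>\<^bsub>N\<^esub> a"] ke.hom_ract[OF s(1)[OF q] a] s[OF q] a g.src.ract_closed
      by (simp add: g.hom_ract h_def)
  qed
  then obtain C where C: "rmod_hom G (ind Q) Y C" "\<forall>q \<in> carrier Q. C (emb Q q) = h q"
    by (rule ind_extend[OF Q Y])
  have "C (H z) = k z"
    by (rule ind_hom_unique[OF N rmod_hom_comp[OF H(1) C(1)] k(1) _ z(1)])
      (use H(2) C(2) g.hom_closed hg in simp)
  then have "k z = \<zero>\<^bsub>Y\<^esub>"
    using z(2) rmod_hom.hom_zero[OF C(1)] by simp
  then show ?thesis
    using k(2) z(1) by blast
qed

end

section \<open>Factorization and vanishing of maps into a direct sum\<close>

lemma factors_through_retract:
  assumes i: "rmod_hom A N' N i" and r: "rmod_hom A N N' r"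
    and id: "\<And>x. x \<in> carrier N' \<Longrightarrow> r (i x) = x" and fac: "factors_through A P1 p1 P0 N"
  shows "factors_through A P1 p1 P0 N'"
  unfolding factors_through_def
proof (intro allI impI)
  fix f assume f: "rmod_hom A P1 N' f"
  obtain g where g: "rmod_hom A P0 N g" "\<forall>x \<in> carrier P1. i (f x) = g (p1 x)"
    using fac rmod_hom_comp[OF f i] unfolding factors_through_def by blast
  have "\<forall>x \<in> carrier P1. f x = r (g (p1 x))"
    using g(2) id rmod_hom.hom_closed[OF f] by metis
  then show "\<exists>g. rmod_hom A P0 N' g \<and> (\<forall>x \<in> carrier P1. f x = g (p1 x))"
    using rmod_hom_comp[OF g(1) r] by blast
qed

text \<open>The components of a map into \<open>N\<close> are factored separately and added again.
  The sum is given by inclusions and projections because that is how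
  \<open>ind_decomposition\<close> produces it.\<close>

lemma factors_through_direct_sum:
  assumes f1: "rmod_hom A N1 N i1" and r1: "rmod_hom A N N1 r1" and f2: "rmod_hom A N2 N i2"
    and r2: "rmod_hom A N N2 r2"
    and id1: "\<And>x. x \<in> carrier N1 \<Longrightarrow> r1 (i1 x) = x" and id2: "\<And>x. x \<in> carrier N2 \<Longrightarrow> r2 (i2 x) = x"
    and sum: "\<And>x. x \<in> carrier N \<Longrightarrow> x = i1 (r1 x) \<oplus>\<^bsub>N\<^esub> i2 (r2 x)"
  shows "factors_through A P1 p1 P0 N \<longleftrightarrow> factors_through A P1 p1 P0 N1 \<and> factors_through A P1 p1 P0 N2"
proof (intro iffI conjI)
  assume fac: "factors_through A P1 p1 P0 N1 \<and> factors_through A P1 p1 P0 N2"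
  show "factors_through A P1 p1 P0 N"
    unfolding factors_through_def
  proof (intro allI impI)
    fix f assume f: "rmod_hom A P1 N f"
    obtain g1 where g1: "rmod_hom A P0 N1 g1" "\<forall>x \<in> carrier P1. r1 (f x) = g1 (p1 x)"
      using fac rmod_hom_comp[OF f r1] unfolding factors_through_def by blast
    obtain g2 where g2: "rmod_hom A P0 N2 g2" "\<forall>x \<in> carrier P1. r2 (f x) = g2 (p1 x)"
      using fac rmod_hom_comp[OF f r2] unfolding factors_through_def by blast
    have "f x = i1 (g1 (p1 x)) \<oplus>\<^bsub>N\<^esub> i2 (g2 (p1 x))" if "x \<in> carrier P1" for x
      using sum[OF rmod_hom.hom_closed[OF f that]] bspec[OF g1(2) that] bspec[OF g2(2) that] by simp
    then show "\<exists>g. rmod_hom A P0 N g \<and> (\<forall>x \<in> carrier P1. f x = g (p1 x))"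
      using rmod_hom_add[OF rmod_hom_comp[OF g1(1) f1] rmod_hom_comp[OF g2(1) f2]] by blast
  qed
qed (blast intro: factors_through_retract[OF f1 r1 id1] factors_through_retract[OF f2 r2 id2])+

lemma hom_zero_retract:
  assumes i: "rmod_hom A N' N i" and r: "rmod_hom A N N' r"
    and id: "\<And>x. x \<in> carrier N' \<Longrightarrow> r (i x) = x" and P: "right_module A P" and zero: "hom_zero A P N"
  shows "hom_zero A P N'"
  unfolding hom_zero_iff[OF P rmod_hom_source[OF i]]
proof (intro allI impI ballI)
  fix f x assume f: "rmod_hom A P N' f" and x: "x \<in> carrier P"
  have "i (f x) = \<zero>\<^bsub>N\<^esub>"
    using zero rmod_hom_comp[OF f i] x unfolding hom_zero_iff[OF P rmod_hom_target[OF i]] by blast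
  then show "f x = \<zero>\<^bsub>N'\<^esub>"
    using id[OF rmod_hom.hom_closed[OF f x]] rmod_hom.hom_zero[OF r] by simp
qed

lemma hom_zero_direct_sum:
  assumes f1: "rmod_hom A N1 N i1" and r1: "rmod_hom A N N1 r1" and f2: "rmod_hom A N2 N i2"
    and r2: "rmod_hom A N N2 r2"
    and id1: "\<And>x. x \<in> carrier N1 \<Longrightarrow> r1 (i1 x) = x" and id2: "\<And>x. x \<in> carrier N2 \<Longrightarrow> r2 (i2 x) = x"
    and sum: "\<And>x. x \<in> carrier N \<Longrightarrow> x = i1 (r1 x) \<oplus>\<^bsub>N\<^esub> i2 (r2 x)"
    and P: "right_module A P"
  shows "hom_zero A P N \<longleftrightarrow> hom_zero A P N1 \<and> hom_zero A P N2"
proof (intro iffI conjI)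
  interpret N: right_module A N by (rule rmod_hom_target[OF f1])
  assume zero: "hom_zero A P N1 \<and> hom_zero A P N2"
  show "hom_zero A P N"
    unfolding hom_zero_iff[OF P rmod_hom_target[OF f1]]
  proof (intro allI impI ballI)
    fix f x assume f: "rmod_hom A P N f" and x: "x \<in> carrier P"
    have "r1 (f x) = \<zero>\<^bsub>N1\<^esub>" "r2 (f x) = \<zero>\<^bsub>N2\<^esub>"
      using zero rmod_hom_comp[OF f r1] rmod_hom_comp[OF f r2] x
      unfolding hom_zero_iff[OF P rmod_hom_source[OF f1]] hom_zero_iff[OF P rmod_hom_source[OF f2]]
      by blast+
    then show "f x = \<zero>\<^bsub>N\<^esub>"
      using sum[OF rmod_hom.hom_closed[OF f x]] rmod_hom.hom_zero[OF f1] rmod_hom.hom_zero[OF f2] by simp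
  qed
qed (blast intro: hom_zero_retract[OF f1 r1 id1 P] hom_zero_retract[OF f2 r2 id2 P])+

section \<open>Induced presentations, the adjunction criteria, and \<open>ind M\<close> as a
  \<Lambda>-module\<close>

context split_ext
begin

text \<open>Covering and exactness follow from right exactness. For minimality, if \<open>U\<close>
  covers the target over \<Gamma>, its reduction under \<open>ret\<close> covers the target over
  \<Lambda>, hence is all of the projective by minimality there; \<open>ind_nakayama\<close> lifts
  this back to \<open>U\<close>.\<close>

lemma projective_presentation_ind:
  assumes M: "fg_right_module L M" and P: "projective_presentation L M P1 p1 P0 p0"
  obtains F1 F0 where "projective_presentation G (ind M) (ind P1) F1 (ind P0) F0"
    "\<forall>x \<in> carrier P1. F1 (emb P1 x) = emb P0 (p1 x)" "rmod_hom G (ind P1) (ind P0) F1"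
proof -
  have Mm: "right_module L M"
    by (rule fg_imp_right_module[OF M])
  note PD = projective_presentationD[OF P Mm]
  note C0 = projective_coverD[OF PD(1) Mm]
  note C1 = projective_coverD[OF PD(2,3)]
  note P0 = rmod_hom_source[OF C0(2)] and P1 = rmod_hom_source[OF C1(2)]
  have fgP0: "fg_right_module L P0" and fgP1: "fg_right_module L P1"
    using C0(1) C1(1) by (simp_all add: projective_def)
  interpret p0: rmod_hom L P0 M p0 by (rule C0(2))
  obtain F0 where F0: "rmod_hom G (ind P0) (ind M) F0" "\<forall>y \<in> carrier P0. F0 (emb P0 y) = emb M (p0 y)"
    "\<forall>z \<in> carrier (ind P0). ret M (F0 z) = p0 (ret P0 z)"
    by (rule ind_map_exists[OF C0(2)])
  obtain F1 where F1: "rmod_hom G (ind P1) (ind P0) F1" "\<forall>x \<in> carrier P1. F1 (emb P1 x) = emb P0 (p1 x)"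
    "\<forall>z \<in> carrier (ind P1). ret P0 (F1 z) = p1 (ret P1 z)"
    by (rule ind_map_exists[OF PD(5)])
  interpret F0: rmod_hom G "ind P0" "ind M" F0 by (rule F0(1))
  interpret F1: rmod_hom G "ind P1" "ind P0" F1 by (rule F1(1))
  have F0_surj: "F0 ` carrier (ind P0) = carrier (ind M)"
    by (rule ind_surj[OF C0(2,3) F0(1,2)])
  have cov0: "projective_cover G (ind P0) (ind M) (restrict F0 (carrier (ind P0)))"
  proof (rule projective_coverI[OF projective_ind[OF C0(1)] F0(1) F0_surj])
    fix U assume U: "right_submodule G (ind P0) U" and FU: "F0 ` U = carrier (ind M)"
    have "right_submodule L P0 (ret P0 ` U)"
      by (rule rmod_hom.submodule_image[OF ret_hom_L[OF P0]
          right_submodule_restrict_scalars[OF right_module_ind[OF P0] U ring_L \<sigma>]])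
    moreover have "p0 ` ret P0 ` U = ret M ` F0 ` U"
      unfolding image_image using F0(3) right_submodule_subset[OF U] by (intro image_cong) auto
    then have "p0 ` ret P0 ` U = carrier M"
      using FU ret_surj[OF Mm] by simp
    ultimately have "ret P0 ` U = carrier P0"
      by (rule C0(4))
    then show "U = carrier (ind P0)"
      by (rule ind_nakayama[OF fgP0 U])
  qed
  let ?N = "a_kernel (ind P0) (ind M) F0"
  have N: "right_submodule G (ind P0) ?N"
    by (rule F0.submodule_kernel)
  have NN: "right_module G ((ind P0)\<lparr>carrier := ?N\<rparr>)"
    by (rule right_module_submodule[OF F0.src.right_module_axioms N])
  \<comment> \<open>Both sides are homomorphisms on \<open>ind P1\<close>, so the vanishing is
    inherited from the composite of \<open>p1\<close> and \<open>p0\<close> on elements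
    \<open>x \<otimes> 1\<close>.\<close>
  have "F0 (F1 z) = \<zero>\<^bsub>ind M\<^esub>" if z: "z \<in> carrier (ind P1)" for z
  proof (rule ind_hom_unique[OF P1 rmod_hom_comp[OF F1(1) F0(1)]
        rmod_hom_zero[OF F1.src.right_module_axioms F0.tgt.right_module_axioms] _ z])
    fix x assume x: "x \<in> carrier P1"
    have "emb M \<zero>\<^bsub>M\<^esub> = \<zero>\<^bsub>ind M\<^esub>"
      using rmod_hom.hom_zero[OF rmod_hom_emb[OF Mm]] by simp
    then show "F0 (F1 (emb P1 x)) = \<zero>\<^bsub>ind M\<^esub>"
      using x F1(2) F0(2) rmod_hom.hom_closed[OF PD(5) x] PD(6)[OF x] by simp
  qed
  then have F1N: "F1 z \<in> ?N" if "z \<in> carrier (ind P1)" for z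
    using that F1.hom_closed by (simp add: F0.a_kernel_eq)
  have F1_hom: "rmod_hom G (ind P1) ((ind P0)\<lparr>carrier := ?N\<rparr>) F1"
    by (rule rmod_hom_restrict_codomain[OF F1(1) N F1N])
  have F1_surj: "F1 ` carrier (ind P1) = carrier ((ind P0)\<lparr>carrier := ?N\<rparr>)"
  proof
    show "F1 ` carrier (ind P1) \<subseteq> carrier ((ind P0)\<lparr>carrier := ?N\<rparr>)"
      using F1N by auto
    have exact: "\<forall>y \<in> carrier P0. p0 y = \<zero>\<^bsub>M\<^esub> \<longrightarrow> (\<exists>x \<in> carrier P1. p1 x = y)"
      using PD(7) by blast
    show "carrier ((ind P0)\<lparr>carrier := ?N\<rparr>) \<subseteq> F1 ` carrier (ind P1)"
    proof
      fix z assume "z \<in> carrier ((ind P0)\<lparr>carrier := ?N\<rparr>)"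
      then have "z \<in> carrier (ind P0)" "F0 z = \<zero>\<^bsub>ind M\<^esub>"
        by (simp_all add: F0.a_kernel_eq)
      then show "z \<in> F1 ` carrier (ind P1)"
        by (rule ind_exact[OF PD(5) C0(2,3) exact F1(1,2) F0(1,2)])
    qed
  qed
  have cov1: "projective_cover G (ind P1) ((ind P0)\<lparr>carrier := ?N\<rparr>) (restrict F1 (carrier (ind P1)))"
  proof (rule projective_coverI[OF projective_ind[OF C1(1)] F1_hom F1_surj])
    fix U assume U: "right_submodule G (ind P1) U" and FU: "F1 ` U = carrier ((ind P0)\<lparr>carrier := ?N\<rparr>)"
    have retU: "right_submodule L P1 (ret P1 ` U)"
      by (rule rmod_hom.submodule_image[OF ret_hom_L[OF P1]
          right_submodule_restrict_scalars[OF right_module_ind[OF P1] U ring_L \<sigma>]])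
    have "p1 ` ret P1 ` U = ret P0 ` F1 ` U"
      unfolding image_image using F1(3) right_submodule_subset[OF U] by (intro image_cong) auto
    also have "\<dots> = ret P0 ` ?N"
      using FU by simp
    \<comment> \<open>The second cover needs the reduction of the kernel of \<open>F0\<close> to be
      the whole kernel of \<open>p0\<close>: it lands there by naturality of \<open>ret\<close>, and
      \<open>emb\<close> lifts every element back.\<close>
    also have "\<dots> = a_kernel P0 M p0"
    proof
      show "ret P0 ` ?N \<subseteq> a_kernel P0 M p0"
      proof
        fix y assume "y \<in> ret P0 ` ?N"
        then obtain z where z: "z \<in> carrier (ind P0)" "F0 z = \<zero>\<^bsub>ind M\<^esub>" "y = ret P0 z"
          by (auto simp: F0.a_kernel_eq)
        then have "p0 y = ret M \<zero>\<^bsub>ind M\<^esub>"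
          using F0(3) by force
        then show "y \<in> a_kernel P0 M p0"
          using z ret_closed[OF P0 z(1)] rmod_hom.hom_zero[OF ret(1)[OF Mm]]
          by (simp add: p0.a_kernel_eq)
      qed
      show "a_kernel P0 M p0 \<subseteq> ret P0 ` ?N"
      proof
        fix y assume "y \<in> a_kernel P0 M p0"
        then have y: "y \<in> carrier P0" "p0 y = \<zero>\<^bsub>M\<^esub>"
          by (simp_all add: p0.a_kernel_eq)
        have "emb M \<zero>\<^bsub>M\<^esub> = \<zero>\<^bsub>ind M\<^esub>"
          using rmod_hom.hom_zero[OF rmod_hom_emb[OF Mm]] by simp
        then have "emb P0 y \<in> ?N"
          using y F0(2) emb_closed[OF P0] by (simp add: F0.a_kernel_eq)
        then show "y \<in> ret P0 ` ?N"
          using ret(2)[OF P0 y(1)] by (intro image_eqI[of _ _ "emb P0 y"]) simp_all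
      qed
    qed
    finally have "p1 ` ret P1 ` U = carrier (P0\<lparr>carrier := a_kernel P0 M p0\<rparr>)"
      by simp
    then have "ret P1 ` U = carrier P1"
      by (rule C1(4)[OF retU])
    then show "U = carrier (ind P1)"
      by (rule ind_nakayama[OF fgP1 U])
  qed
  let ?F1 = "restrict F1 (carrier (ind P1))" and ?F0 = "restrict F0 (carrier (ind P0))"
  show ?thesis
  proof (rule that)
    show "projective_presentation G (ind M) (ind P1) ?F1 (ind P0) ?F0"
      using cov0 cov1 by (simp add: projective_presentation_def a_kernel_restrict)
    show "\<forall>x \<in> carrier P1. ?F1 (emb P1 x) = emb P0 (p1 x)"
      using F1(2) emb_closed[OF P1] by simp
    show "rmod_hom G (ind P1) (ind P0) ?F1"
      by (rule rmod_hom_cong[OF F1(1)]) simp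
  qed
qed

text \<open>Under the adjunction maps \<open>ind P1 \<rightarrow> N\<close> correspond to maps
  \<open>P1 \<rightarrow> N\<close>, likewise for \<open>P0\<close>, and composition with
  \<open>F1\<close> corresponds to composition with \<open>p1\<close> because \<open>F1\<close>
  extends it.\<close>

lemma factors_through_ind_iff:
  assumes p1: "rmod_hom L P1 P0 p1" and N: "right_module G N"
    and F1: "rmod_hom G (ind P1) (ind P0) F1" "\<forall>x \<in> carrier P1. F1 (emb P1 x) = emb P0 (p1 x)"
  shows "factors_through G (ind P1) F1 (ind P0) N \<longleftrightarrow> factors_through L P1 p1 P0 (restrict_scalars \<sigma> N)"
proof
  note P1 = rmod_hom_source[OF p1] and P0 = rmod_hom_target[OF p1]
  assume fac: "factors_through G (ind P1) F1 (ind P0) N"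
  show "factors_through L P1 p1 P0 (restrict_scalars \<sigma> N)"
    unfolding factors_through_def
  proof (intro allI impI)
    fix f assume "rmod_hom L P1 (restrict_scalars \<sigma> N) f"
    then obtain F where F: "rmod_hom G (ind P1) N F" "\<forall>x \<in> carrier P1. F (emb P1 x) = f x"
      by (rule ind_extend[OF P1 N])
    then obtain H where H: "rmod_hom G (ind P0) N H" "\<forall>z \<in> carrier (ind P1). F z = H (F1 z)"
      using fac unfolding factors_through_def by blast
    have "\<forall>x \<in> carrier P1. f x = H (emb P0 (p1 x))"
      using F(2) H(2) F1(2) emb_closed[OF P1] by auto
    moreover have "rmod_hom L P0 (restrict_scalars \<sigma> N) (\<lambda>y. H (emb P0 y))"
      by (rule rmod_hom_comp[OF rmod_hom_emb[OF P0] rmod_hom_restrict_scalars[OF H(1) ring_L \<sigma>]])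
    ultimately show "\<exists>g. rmod_hom L P0 (restrict_scalars \<sigma> N) g \<and> (\<forall>x \<in> carrier P1. f x = g (p1 x))"
      by blast
  qed
next
  note P1 = rmod_hom_source[OF p1] and P0 = rmod_hom_target[OF p1]
  assume fac: "factors_through L P1 p1 P0 (restrict_scalars \<sigma> N)"
  show "factors_through G (ind P1) F1 (ind P0) N"
    unfolding factors_through_def
  proof (intro allI impI)
    fix F assume F: "rmod_hom G (ind P1) N F"
    have "rmod_hom L P1 (restrict_scalars \<sigma> N) (\<lambda>x. F (emb P1 x))"
      by (rule rmod_hom_comp[OF rmod_hom_emb[OF P1] rmod_hom_restrict_scalars[OF F ring_L \<sigma>]])
    then obtain g where g: "rmod_hom L P0 (restrict_scalars \<sigma> N) g"
      "\<forall>x \<in> carrier P1. F (emb P1 x) = g (p1 x)"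
      using fac unfolding factors_through_def by blast
    obtain H where H: "rmod_hom G (ind P0) N H" "\<forall>y \<in> carrier P0. H (emb P0 y) = g y"
      by (rule ind_extend[OF P0 N g(1)])
    have "\<forall>z \<in> carrier (ind P1). F z = H (F1 z)"
    proof
      fix z assume z: "z \<in> carrier (ind P1)"
      show "F z = H (F1 z)"
        by (rule ind_hom_unique[OF P1 F rmod_hom_comp[OF F1(1) H(1)] _ z])
          (use g(2) H(2) F1(2) rmod_hom.hom_closed[OF p1] in simp)
    qed
    then show "\<exists>g. rmod_hom G (ind P0) N g \<and> (\<forall>z \<in> carrier (ind P1). F z = g (F1 z))"
      using H(1) by blast
  qed
qed

text \<open>The adjunction bijection sends the zero map to the zero map.\<close>

lemma hom_zero_ind_iff:
  assumes P: "right_module L P" and N: "right_module G N"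
  shows "hom_zero G (ind P) N \<longleftrightarrow> hom_zero L P (restrict_scalars \<sigma> N)"
  unfolding hom_zero_iff[OF right_module_ind[OF P] N]
    hom_zero_iff[OF P right_module_restrict_scalars[OF N ring_L \<sigma>]]
proof (intro iffI allI impI ballI)
  fix f x assume zero: "\<forall>F. rmod_hom G (ind P) N F \<longrightarrow> (\<forall>z \<in> carrier (ind P). F z = \<zero>\<^bsub>N\<^esub>)"
    and f: "rmod_hom L P (restrict_scalars \<sigma> N) f" and x: "x \<in> carrier P"
  obtain F where F: "rmod_hom G (ind P) N F" "\<forall>x \<in> carrier P. F (emb P x) = f x"
    by (rule ind_extend[OF P N f])
  then have "F (emb P x) = \<zero>\<^bsub>N\<^esub>"
    using zero emb_closed[OF P x] by blast
  then show "f x = \<zero>\<^bsub>restrict_scalars \<sigma> N\<^esub>"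
    using F(2) x by simp
next
  fix F z assume zero: "\<forall>f. rmod_hom L P (restrict_scalars \<sigma> N) f \<longrightarrow>
      (\<forall>x \<in> carrier P. f x = \<zero>\<^bsub>restrict_scalars \<sigma> N\<^esub>)"
    and F: "rmod_hom G (ind P) N F" and z: "z \<in> carrier (ind P)"
  have "rmod_hom L P (restrict_scalars \<sigma> N) (\<lambda>x. F (emb P x))"
    by (rule rmod_hom_comp[OF rmod_hom_emb[OF P] rmod_hom_restrict_scalars[OF F ring_L \<sigma>]])
  then have *: "F (emb P x) = \<zero>\<^bsub>N\<^esub>" if "x \<in> carrier P" for x
    using zero that by fastforce
  show "F z = \<zero>\<^bsub>N\<^esub>"
    by (rule ind_hom_unique[OF P F rmod_hom_zero[OF right_module_ind[OF P] N] * z])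
qed

lemma right_module_tenE: "right_module L M \<Longrightarrow> right_module L (tenE M)"
  by (rule tensor_product.right_module_tensor[OF tensor_KB])

text \<open>
  As a bimodule over \<open>L\<close>, the algebra \<open>G\<close> is the direct sum of \<open>L\<close> and the kernel, via
  \<open>g \<mapsto> (\<pi> g, g - \<sigma> (\<pi> g))\<close>.
\<close>

lemma ind_decomposition:
  assumes M: "right_module L M"
  obtains i r where "rmod_hom L (tenE M) (restrict_scalars \<sigma> (ind M)) i"
    "rmod_hom L (restrict_scalars \<sigma> (ind M)) (tenE M) r"
    "\<forall>y \<in> carrier (tenE M). r (i y) = y"
    "\<forall>z \<in> carrier (ind M). z = emb M (ret M z) \<oplus>\<^bsub>ind M\<^esub> i (r z)"
proof -
  interpret I: right_module G "ind M" by (rule right_module_ind[OF M])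
  interpret E: right_module L "tenE M" by (rule right_module_tenE[OF M])
  interpret Ir: right_module L "restrict_scalars \<sigma> (ind M)" by (rule right_module_ind_restrict[OF M])
  interpret M: right_module L M by (rule M)
  interpret tG: tensor_product L M G EB by (rule tensor_EB[OF M])
  interpret tE: tensor_product L M L KB by (rule tensor_KB[OF M])
  note tG = tensor_EB[OF M] and tE = tensor_KB[OF M]
  let ?g = "\<lambda>m g. tens L M EB m g" and ?e = "\<lambda>m e. tens L M KB m e"
  note g_closed = tensor_product.tens_closed[OF tG] and e_closed = tensor_product.tens_closed[OF tE]
  \<comment> \<open>\<open>i\<close> comes from the inclusion of the kernel into \<Gamma>. The
    universal property gives additivity only; compatibility with the actions is the later claim
    \<open>i_act\<close>.\<close>
  obtain i where i: "\<forall>y \<in> carrier (tenE M). i y \<in> carrier (ind M)"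
    "\<forall>u \<in> carrier (tenE M). \<forall>v \<in> carrier (tenE M). i (u \<oplus>\<^bsub>tenE M\<^esub> v) = i u \<oplus>\<^bsub>ind M\<^esub> i v"
    "\<forall>m \<in> carrier M. \<forall>e \<in> carrier KB. i (?e m e) = ?g m e"
  proof (rule tensor_product.tensor_universal[OF tE I.grp.abelian_group_axioms, of ?g])
    show "?g (m \<star>\<^bsub>M\<^esub> a) e = ?g m (lact KB a e)"
      if "m \<in> carrier M" "a \<in> carrier L" "e \<in> carrier KB" for m a e
      using tensor_product.tens_balanced[OF tG that(1,2), of e] that by simp
    show "?g (m \<oplus>\<^bsub>M\<^esub> m') e = ?g m e \<oplus>\<^bsub>ind M\<^esub> ?g m' e"
      if "m \<in> carrier M" "m' \<in> carrier M" "e \<in> carrier KB" for m m' e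
      using tensor_product.tens_add_left[OF tG that(1,2), of e] that by simp
    show "?g m (e \<oplus>\<^bsub>KB\<^esub> e') = ?g m e \<oplus>\<^bsub>ind M\<^esub> ?g m e'"
      if "m \<in> carrier M" "e \<in> carrier KB" "e' \<in> carrier KB" for m e e'
      using tensor_product.tens_add_right[OF tG that(1), of e e'] that by simp
  qed (auto intro!: g_closed)
  \<comment> \<open>The projection of \<Gamma> onto the kernel along the subalgebra
    \<sigma>(\<Lambda>). It commutes with \<Lambda> on both sides: the left side makes the induced
    map \<open>r\<close> balanced, the right side makes it linear.\<close>
  define k where "k g = g \<ominus>\<^bsub>G\<^esub> \<sigma> (\<pi> g)" for g
  have sp: "\<sigma> (\<pi> g) \<in> carrier G" if "g \<in> carrier G" for g
    using \<sigma>_closed[OF \<pi>_closed[OF that]] .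
  have k_closed: "k g \<in> carrier KB" if "g \<in> carrier G" for g
    using that sp[OF that] unfolding k_def
    by (simp add: a_minus_def hom_simps hom_a_inv \<pi>\<sigma> \<pi>_closed L.r_neg)
  have k_add: "k (g \<oplus>\<^bsub>G\<^esub> h) = k g \<oplus>\<^bsub>KB\<^esub> k h" if "g \<in> carrier G" "h \<in> carrier G" for g h
    using that sp \<pi>_closed \<sigma>_closed by (simp add: k_def a_minus_def hom_simps G.minus_add G.a_ac)
  have k_left: "k (\<sigma> a \<otimes>\<^bsub>G\<^esub> g) = lact KB a (k g)" if "a \<in> carrier L" "g \<in> carrier G" for a g
    using that sp \<pi>_closed \<sigma>_closed
    by (simp add: k_def a_minus_def hom_simps \<pi>\<sigma> G.r_distr G.r_minus)
  have k_right: "k (g \<otimes>\<^bsub>G\<^esub> \<sigma> a) = k g \<star>\<^bsub>KB\<^esub> a" if "a \<in> carrier L" "g \<in> carrier G" for a g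
    using that sp \<pi>_closed \<sigma>_closed
    by (simp add: k_def a_minus_def hom_simps \<pi>\<sigma> G.l_distr G.l_minus)
  have k_id: "k e = e" if "e \<in> carrier KB" for e
    using that by (simp add: k_def a_minus_def \<sigma>_zero G.a_inv_zero)
  obtain r where r: "\<forall>z \<in> carrier (ind M). r z \<in> carrier (tenE M)"
    "\<forall>u \<in> carrier (ind M). \<forall>v \<in> carrier (ind M). r (u \<oplus>\<^bsub>ind M\<^esub> v) = r u \<oplus>\<^bsub>tenE M\<^esub> r v"
    "\<forall>m \<in> carrier M. \<forall>g \<in> carrier EB. r (?g m g) = ?e m (k g)"
  proof (rule tensor_product.tensor_universal[OF tG E.grp.abelian_group_axioms, of "\<lambda>m g. ?e m (k g)"])
    show "?e m (k g) \<in> carrier (tenE M)" if "m \<in> carrier M" "g \<in> carrier EB" for m g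
      using e_closed[OF that(1) k_closed] that by simp
    show "?e (m \<star>\<^bsub>M\<^esub> a) (k g) = ?e m (k (lact EB a g))"
      if "m \<in> carrier M" "a \<in> carrier L" "g \<in> carrier EB" for m a g
      using tensor_product.tens_balanced[OF tE that(1,2) k_closed[of g]] that k_left[of a g] by simp
    show "?e (m \<oplus>\<^bsub>M\<^esub> m') (k g) = ?e m (k g) \<oplus>\<^bsub>tenE M\<^esub> ?e m' (k g)"
      if "m \<in> carrier M" "m' \<in> carrier M" "g \<in> carrier EB" for m m' g
      using tensor_product.tens_add_left[OF tE that(1,2) k_closed[of g]] that by simp
    show "?e m (k (g \<oplus>\<^bsub>EB\<^esub> h)) = ?e m (k g) \<oplus>\<^bsub>tenE M\<^esub> ?e m (k h)"
      if "m \<in> carrier M" "g \<in> carrier EB" "h \<in> carrier EB" for m g h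
      using tensor_product.tens_add_right[OF tE that(1) k_closed[of g] k_closed[of h]] that k_add[of g h]
      by simp
  qed
  have i0: "i \<zero>\<^bsub>tenE M\<^esub> = \<zero>\<^bsub>ind M\<^esub>"
    by (rule additive_zero[where f = i, OF E.grp.abelian_group_axioms I.grp.abelian_group_axioms])
      (use i(1,2) E.grp.zero_closed in blast)+
  have r0: "r \<zero>\<^bsub>ind M\<^esub> = \<zero>\<^bsub>tenE M\<^esub>"
    by (rule additive_zero[where f = r, OF I.grp.abelian_group_axioms E.grp.abelian_group_axioms])
      (use r(1,2) I.grp.zero_closed in blast)+
  have i_act: "i (y \<star>\<^bsub>tenE M\<^esub> a) = i y \<star>\<^bsub>ind M\<^esub> \<sigma> a" if y: "y \<in> carrier (tenE M)" and a: "a \<in> carrier L" for y a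
    using y
  proof (induction rule: tE.tensor_induct)
    case zero
    then show ?case
      using a by (simp add: i0 E.zero_ract I.zero_ract \<sigma>_closed)
  next
    case (tens m e)
    then show ?case
      using a i(3) tE.tens_ract[OF tens a] tG.tens_ract[OF tens(1), of e "\<sigma> a"]
      by (simp add: \<sigma>_closed hom_simps \<pi>\<sigma>)
  next
    case (add u v)
    then show ?case
      using a i(1,2) by (simp add: E.ract_add_left I.ract_add_left E.ract_closed \<sigma>_closed)
  qed
  have r_act: "r (z \<star>\<^bsub>ind M\<^esub> \<sigma> a) = r z \<star>\<^bsub>tenE M\<^esub> a" if z: "z \<in> carrier (ind M)" and a: "a \<in> carrier L" for z a
    using z
  proof (induction rule: tG.tensor_induct)
    case zero
    then show ?case
      using a by (simp add: r0 E.zero_ract I.zero_ract \<sigma>_closed)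
  next
    case (tens m g)
    then have g: "g \<in> carrier G"
      by simp
    show ?case
      using tens a r(3) tG.tens_ract[OF tens \<sigma>_closed[OF a]] tE.tens_ract[OF tens(1) k_closed[OF g] a]
        k_right[OF a g] g by (simp add: \<sigma>_closed)
  next
    case (add u v)
    then show ?case
      using a r(1,2) by (simp add: E.ract_add_left I.ract_add_left I.ract_closed \<sigma>_closed)
  qed
  have ri: "r (i y) = y" if "y \<in> carrier (tenE M)" for y
    using that
  proof (induction rule: tE.tensor_induct)
    case zero
    then show ?case
      by (simp add: i0 r0)
  next
    case (tens m e)
    then show ?case
      using i(3) r(3) k_id by simp
  next
    case (add u v)
    then show ?case
      using i(1,2) r(2) by simp
  qed
  interpret re: rmod_hom L "restrict_scalars \<sigma> (ind M)" M "ret M" by (rule ret_hom_L[OF M])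
  interpret em: rmod_hom L M "restrict_scalars \<sigma> (ind M)" "emb M" by (rule rmod_hom_emb[OF M])
  interpret rt: rmod_hom G "ind M" "restrict_scalars \<pi> M" "ret M" by (rule ret(1)[OF M])
  \<comment> \<open>On a pure tensor this is the identity
    \<open>g = \<sigma> (\<pi> g) + k g\<close> in the right factor.\<close>
  have dec: "z = emb M (ret M z) \<oplus>\<^bsub>ind M\<^esub> i (r z)" if "z \<in> carrier (ind M)" for z
    using that
  proof (induction rule: tG.tensor_induct)
    case zero
    then show ?case
      using re.hom_zero em.hom_zero by (simp add: i0 r0)
  next
    case (tens m g)
    then have g: "g \<in> carrier G"
      by simp
    have m: "m \<in> carrier M"
      by (rule tens(1))
    have "ret M (?g m g) = m \<star>\<^bsub>M\<^esub> \<pi> g"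
      using tens_eq_emb[OF M m g] rt.hom_ract[OF emb_closed[OF M m] g] ret(2)[OF M m] by simp
    then have "emb M (ret M (?g m g)) = ?g m (\<sigma> (\<pi> g))"
      using em.hom_ract[OF m \<pi>_closed[OF g]] tens_eq_emb[OF M m sp[OF g]] by simp
    moreover have "i (r (?g m g)) = ?g m (k g)"
      using r(3) i(3) m g k_closed[OF g] by simp
    moreover have "?g m (\<sigma> (\<pi> g)) \<oplus>\<^bsub>ind M\<^esub> ?g m (k g) = ?g m (\<sigma> (\<pi> g) \<oplus>\<^bsub>G\<^esub> k g)"
      using tG.tens_add_right[OF m, of "\<sigma> (\<pi> g)" "k g"] sp[OF g] k_closed[OF g] by simp
    moreover have "\<sigma> (\<pi> g) \<oplus>\<^bsub>G\<^esub> k g = g"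
      using g sp[OF g] by (simp add: k_def a_minus_def G.a_lcomm[of "\<sigma> (\<pi> g)" g] G.r_neg)
    ultimately show ?case
      by simp
  next
    case (add u v)
    have cl: "emb M (ret M u) \<in> carrier (ind M)" "emb M (ret M v) \<in> carrier (ind M)"
      "i (r u) \<in> carrier (ind M)" "i (r v) \<in> carrier (ind M)"
      using add(1,2) ret_closed[OF M] emb_closed[OF M] i(1) r(1) by auto
    have "emb M (ret M (u \<oplus>\<^bsub>ind M\<^esub> v)) = emb M (ret M u) \<oplus>\<^bsub>ind M\<^esub> emb M (ret M v)"
      using rt.hom_add[OF add(1,2)] em.hom_add[OF ret_closed[OF M add(1)] ret_closed[OF M add(2)]] by simp
    moreover have "i (r (u \<oplus>\<^bsub>ind M\<^esub> v)) = i (r u) \<oplus>\<^bsub>ind M\<^esub> i (r v)"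
      using add(1,2) i(2) r(1,2) by simp
    ultimately have "emb M (ret M (u \<oplus>\<^bsub>ind M\<^esub> v)) \<oplus>\<^bsub>ind M\<^esub> i (r (u \<oplus>\<^bsub>ind M\<^esub> v)) =
        (emb M (ret M u) \<oplus>\<^bsub>ind M\<^esub> i (r u)) \<oplus>\<^bsub>ind M\<^esub> (emb M (ret M v) \<oplus>\<^bsub>ind M\<^esub> i (r v))"
      using cl by (simp add: I.grp.a_ac)
    then show ?case
      using add(3,4) by simp
  qed
  show ?thesis
  proof (rule that)
    show "rmod_hom L (tenE M) (restrict_scalars \<sigma> (ind M)) i"
      using i(1,2) i_act by (intro rmod_homI E.right_module_axioms right_module_ind_restrict[OF M]) auto
    show "rmod_hom L (restrict_scalars \<sigma> (ind M)) (tenE M) r"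
      using r(1,2) r_act by (intro rmod_homI E.right_module_axioms right_module_ind_restrict[OF M]) auto
  qed (use ri dec in auto)
qed

lemma factors_through_ind_target_iff:
  assumes M: "right_module L M"
  shows "factors_through L P1 p1 P0 (restrict_scalars \<sigma> (ind M)) \<longleftrightarrow>
    factors_through L P1 p1 P0 M \<and> factors_through L P1 p1 P0 (tenE M)"
proof -
  obtain i r where ir: "rmod_hom L (tenE M) (restrict_scalars \<sigma> (ind M)) i"
    "rmod_hom L (restrict_scalars \<sigma> (ind M)) (tenE M) r"
    "\<forall>y \<in> carrier (tenE M). r (i y) = y"
    "\<forall>z \<in> carrier (ind M). z = emb M (ret M z) \<oplus>\<^bsub>ind M\<^esub> i (r z)"
    by (rule ind_decomposition[OF M])
  show ?thesis
    by (rule factors_through_direct_sum[OF rmod_hom_emb[OF M] ret_hom_L[OF M] ir(1,2)])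
      (use ret(2)[OF M] ir(3,4) in auto)
qed

lemma hom_zero_ind_target_iff:
  assumes M: "right_module L M" and P: "right_module L P"
  shows "hom_zero L P (restrict_scalars \<sigma> (ind M)) \<longleftrightarrow> hom_zero L P M \<and> hom_zero L P (tenE M)"
proof -
  obtain i r where ir: "rmod_hom L (tenE M) (restrict_scalars \<sigma> (ind M)) i"
    "rmod_hom L (restrict_scalars \<sigma> (ind M)) (tenE M) r"
    "\<forall>y \<in> carrier (tenE M). r (i y) = y"
    "\<forall>z \<in> carrier (ind M). z = emb M (ret M z) \<oplus>\<^bsub>ind M\<^esub> i (r z)"
    by (rule ind_decomposition[OF M])
  show ?thesis
    by (rule hom_zero_direct_sum[OF rmod_hom_emb[OF M] ret_hom_L[OF M] ir(1,2) _ _ _ P])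
      (use ret(2)[OF M] ir(3,4) in auto)
qed

text \<open>One presentation of \<open>M\<close> and its induced presentation test all three
  vanishing conditions, so the claim is a statement about factoring maps from \<open>P1\<close>
  through \<open>p1\<close> into the two \<Lambda>-summands of \<open>ind M\<close>.\<close>

lemma hom_zero_tau_ind_iff:
  assumes M: "fg_right_module L M"
  shows "hom_zero G (ind M) (tau K G (ind M)) \<longleftrightarrow>
    hom_zero L M (tau K L M) \<and> hom_zero L (tenE M) (tau K L M)"
proof -
  have Mm: "right_module L M"
    by (rule fg_imp_right_module[OF M])
  obtain P1 :: "'a fg_mod" and p1 and P0 :: "'a fg_mod" and p0 where
    P: "projective_presentation L M P1 p1 P0 p0"
    using projective_presentation_exists[OF L M] by blast
  obtain F1 F0 where F: "projective_presentation G (ind M) (ind P1) F1 (ind P0) F0"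
    "\<forall>x \<in> carrier P1. F1 (emb P1 x) = emb P0 (p1 x)" "rmod_hom G (ind P1) (ind P0) F1"
    by (rule projective_presentation_ind[OF M P])
  have p1: "rmod_hom L P1 P0 p1"
    by (rule projective_presentationD(5)[OF P Mm])
  show ?thesis
    unfolding hom_zero_tau_iff[OF G fg_ind[OF M] right_module_ind[OF Mm] F(1)]
      hom_zero_tau_iff[OF L M Mm P] hom_zero_tau_iff[OF L M right_module_tenE[OF Mm] P]
      factors_through_ind_iff[OF p1 right_module_ind[OF Mm] F(3,2)]
    by (rule factors_through_ind_target_iff[OF Mm])
qed

end

section \<open>Counting indecomposable summands\<close>

text \<open>\<open>g\<close> need only be a bijection up to equivalence. This is the situation for
  induction, where the summand of \<open>ind M\<close> attached to a summand of \<open>M\<close> is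
  determined only up to isomorphism.\<close>

lemma card_quotient_eq:
  assumes r: "equiv A r" and s: "equiv B s"
    and g: "g \<in> A \<rightarrow> B" "\<And>a a'. \<lbrakk>a \<in> A; a' \<in> A\<rbrakk> \<Longrightarrow> (a, a') \<in> r \<longleftrightarrow> (g a, g a') \<in> s"
    and surj: "\<And>b. b \<in> B \<Longrightarrow> \<exists>a \<in> A. (g a, b) \<in> s"
  shows "card (A // r) = card (B // s)"
proof (rule bij_betw_same_card)
  have img: "s `` (g ` (r `` {a})) = s `` {g a}" if a: "a \<in> A" for a
  proof
    show "s `` {g a} \<subseteq> s `` (g ` (r `` {a}))"
      using equiv_class_self[OF r a] by auto
    show "s `` (g ` (r `` {a})) \<subseteq> s `` {g a}"
    proof
      fix b assume "b \<in> s `` (g ` (r `` {a}))"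
      then obtain a' where "(a, a') \<in> r" "(g a', b) \<in> s"
        by auto
      moreover have "a' \<in> A"
        using r calculation(1) by (auto simp: equiv_def refl_on_def)
      ultimately show "b \<in> s `` {g a}"
        using g(2)[OF a] s by (auto simp: equiv_def dest: transD)
    qed
  qed
  show "bij_betw (\<lambda>C. s `` (g ` C)) (A // r) (B // s)"
    unfolding bij_betw_def
  proof
    show "inj_on (\<lambda>C. s `` (g ` C)) (A // r)"
    proof (rule inj_onI)
      fix C C' assume "C \<in> A // r" "C' \<in> A // r" and eq: "s `` (g ` C) = s `` (g ` C')"
      then obtain a a' where a: "a \<in> A" "C = r `` {a}" "a' \<in> A" "C' = r `` {a'}"
        by (auto elim!: quotientE)
      then have "s `` {g a} = s `` {g a'}"
        using eq img by simp
      then have "(g a, g a') \<in> s"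
        using eq_equiv_class[OF _ s] g(1) a(3) by auto
      then have "(a, a') \<in> r"
        using g(2) a by blast
      then show "C = C'"
        using equiv_class_eq[OF r] a by simp
    qed
    show "(\<lambda>C. s `` (g ` C)) ` (A // r) = B // s"
    proof
      show "(\<lambda>C. s `` (g ` C)) ` (A // r) \<subseteq> B // s"
        using img g(1) by (auto elim!: quotientE intro!: quotientI)
      show "B // s \<subseteq> (\<lambda>C. s `` (g ` C)) ` (A // r)"
      proof
        fix D assume "D \<in> B // s"
        then obtain b where b: "b \<in> B" "D = s `` {b}"
          by (auto elim!: quotientE)
        obtain a where a: "a \<in> A" "(g a, b) \<in> s"
          using surj b(1) by blast
        then have "D = s `` {g a}"
          using equiv_class_eq[OF s] b(2) by simp
        then show "D \<in> (\<lambda>C. s `` (g ` C)) ` (A // r)"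
          using img[OF a(1)] quotientI[OF a(1), of r] by auto
      qed
    qed
  qed
qed

text \<open>Records a direct summand by an idempotent projection instead of a complement: maps, in
  contrast to subsets, can be transported by induction and reduction.\<close>

definition summand :: "('a, 'z) ring_scheme \<Rightarrow> ('a, 'm, 'y) right_module_scheme \<Rightarrow> 'm set \<Rightarrow> ('m \<Rightarrow> 'm) \<Rightarrow> bool"
  where "summand A M U p \<longleftrightarrow> right_submodule A M U \<and> rmod_hom A M M p \<and>
    (\<forall>x \<in> carrier M. p x \<in> U) \<and> (\<forall>u \<in> U. p u = u)"

lemma summandD:
  assumes "summand A M U p"
  shows "right_submodule A M U" "rmod_hom A M M p" "\<And>x. x \<in> carrier M \<Longrightarrow> p x \<in> U"
    "\<And>u. u \<in> U \<Longrightarrow> p u = u" "\<And>u. u \<in> U \<Longrightarrow> u \<in> carrier M"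
    "rmod_hom A M (M\<lparr>carrier := U\<rparr>) p" "rmod_hom A (M\<lparr>carrier := U\<rparr>) M (\<lambda>x. x)"
    "right_module A (M\<lparr>carrier := U\<rparr>)" "right_module A M"
proof -
  show U: "right_submodule A M U" and p: "rmod_hom A M M p" and "\<And>x. x \<in> carrier M \<Longrightarrow> p x \<in> U"
    "\<And>u. u \<in> U \<Longrightarrow> p u = u"
    using assms by (simp_all add: summand_def)
  show M: "right_module A M"
    by (rule rmod_hom_source[OF p])
  show "\<And>u. u \<in> U \<Longrightarrow> u \<in> carrier M"
    using right_submodule_subset[OF U] by blast
  show "rmod_hom A M (M\<lparr>carrier := U\<rparr>) p"
    using assms by (intro rmod_hom_restrict_codomain[OF p U]) (simp add: summand_def)
  show "rmod_hom A (M\<lparr>carrier := U\<rparr>) M (\<lambda>x. x)"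
    by (rule rmod_hom_inclusion[OF M U])
  show "right_module A (M\<lparr>carrier := U\<rparr>)"
    by (rule right_module_submodule[OF M U])
qed

lemma summand_idempotent:
  assumes "rmod_hom A M M p" "\<And>x. x \<in> carrier M \<Longrightarrow> p (p x) = p x"
  shows "summand A M (p ` carrier M) p"
  unfolding summand_def using assms
  by (auto intro!: rmod_hom.submodule_image[OF assms(1)] right_submodule_carrier rmod_hom_source)

text \<open>The projection reads off the component in \<open>U\<close>, which is well defined since
  \<open>U\<close> and \<open>V\<close> meet only in zero. Conversely the kernel of the projection
  is a complement.\<close>

lemma direct_decomposition_iff_summand:
  assumes M: "right_module A M"
  shows "(\<exists>V. direct_decomposition A M U V) \<longleftrightarrow> (\<exists>p. summand A M U p)"
proof
  interpret M: right_module A M by fact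
  assume "\<exists>V. direct_decomposition A M U V"
  then obtain V where U: "right_submodule A M U" and V: "right_submodule A M V"
    and int: "U \<inter> V = {\<zero>\<^bsub>M\<^esub>}" and sum: "U <+>\<^bsub>M\<^esub> V = carrier M"
    by (auto simp: direct_decomposition_def)
  have cl: "x \<in> carrier M" if "x \<in> U \<or> x \<in> V" for x
    using that right_submodule_subset[OF U] right_submodule_subset[OF V] by blast
  have uniq: "u = u'" if "u \<in> U" "u' \<in> U" "v \<in> V" "v' \<in> V" "u \<oplus>\<^bsub>M\<^esub> v = u' \<oplus>\<^bsub>M\<^esub> v'" for u u' v v'
  proof -
    have uv: "u \<in> carrier M" "u' \<in> carrier M" "v \<in> carrier M" "v' \<in> carrier M"
      using that cl by auto
    have "u \<ominus>\<^bsub>M\<^esub> u' = (u \<oplus>\<^bsub>M\<^esub> v) \<ominus>\<^bsub>M\<^esub> (u' \<oplus>\<^bsub>M\<^esub> v)"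
    proof -
      have "(u \<oplus>\<^bsub>M\<^esub> v) \<ominus>\<^bsub>M\<^esub> (u' \<oplus>\<^bsub>M\<^esub> v) = (u \<oplus>\<^bsub>M\<^esub> \<ominus>\<^bsub>M\<^esub> u') \<oplus>\<^bsub>M\<^esub> (v \<oplus>\<^bsub>M\<^esub> \<ominus>\<^bsub>M\<^esub> v)"
        using uv by (simp add: a_minus_def M.grp.minus_add M.grp.a_ac)
      then show ?thesis
        using uv by (simp add: a_minus_def M.grp.r_neg)
    qed
    also have "\<dots> = (u' \<oplus>\<^bsub>M\<^esub> v') \<ominus>\<^bsub>M\<^esub> (u' \<oplus>\<^bsub>M\<^esub> v)"
      using that(5) by simp
    also have "\<dots> = v' \<ominus>\<^bsub>M\<^esub> v"
    proof -
      have "(u' \<oplus>\<^bsub>M\<^esub> v') \<ominus>\<^bsub>M\<^esub> (u' \<oplus>\<^bsub>M\<^esub> v) = (v' \<oplus>\<^bsub>M\<^esub> \<ominus>\<^bsub>M\<^esub> v) \<oplus>\<^bsub>M\<^esub> (u' \<oplus>\<^bsub>M\<^esub> \<ominus>\<^bsub>M\<^esub> u')"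
        using uv by (simp add: a_minus_def M.grp.minus_add M.grp.a_ac)
      then show ?thesis
        using uv by (simp add: a_minus_def M.grp.r_neg)
    qed
    finally have "u \<ominus>\<^bsub>M\<^esub> u' = v' \<ominus>\<^bsub>M\<^esub> v" .
    then have "u \<ominus>\<^bsub>M\<^esub> u' \<in> U \<inter> V"
      using right_submodule_minus[OF U that(1,2)] right_submodule_minus[OF V that(4,3)] by simp
    then show ?thesis
      using int M.grp.minus_eq_zero_iff[OF uv(1,2)] by auto
  qed
  have ex: "\<exists>u \<in> U. \<exists>v \<in> V. x = u \<oplus>\<^bsub>M\<^esub> v" if "x \<in> carrier M" for x
    using that unfolding sum[symmetric] set_add_iff .
  define p where "p x = (THE u. u \<in> U \<and> (\<exists>v \<in> V. x = u \<oplus>\<^bsub>M\<^esub> v))" for x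
  have p: "p (u \<oplus>\<^bsub>M\<^esub> v) = u" if "u \<in> U" "v \<in> V" for u v
    unfolding p_def using that uniq by (intro the_equality) blast+
  have "rmod_hom A M M p"
  proof (intro rmod_homI M)
    fix x assume x: "x \<in> carrier M"
    obtain u v where uv: "u \<in> U" "v \<in> V" "x = u \<oplus>\<^bsub>M\<^esub> v"
      using ex[OF x] by blast
    then show "p x \<in> carrier M"
      using p cl by simp
    show "p (x \<oplus>\<^bsub>M\<^esub> y) = p x \<oplus>\<^bsub>M\<^esub> p y" if y: "y \<in> carrier M" for y
    proof -
      obtain u' v' where uv': "u' \<in> U" "v' \<in> V" "y = u' \<oplus>\<^bsub>M\<^esub> v'"
        using ex[OF y] by blast
      then have "x \<oplus>\<^bsub>M\<^esub> y = (u \<oplus>\<^bsub>M\<^esub> u') \<oplus>\<^bsub>M\<^esub> (v \<oplus>\<^bsub>M\<^esub> v')"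
        using uv cl by (simp add: M.grp.a_ac)
      then show ?thesis
        using p uv uv' right_submodule_add[OF U] right_submodule_add[OF V] by simp
    qed
    show "p (x \<star>\<^bsub>M\<^esub> a) = p x \<star>\<^bsub>M\<^esub> a" if a: "a \<in> carrier A" for a
    proof -
      have "x \<star>\<^bsub>M\<^esub> a = u \<star>\<^bsub>M\<^esub> a \<oplus>\<^bsub>M\<^esub> v \<star>\<^bsub>M\<^esub> a"
        using uv cl a by (simp add: M.ract_add_left)
      then show ?thesis
        using p uv a right_submodule_ract[OF U] right_submodule_ract[OF V] by simp
    qed
  qed
  moreover have "p x \<in> U" if "x \<in> carrier M" for x
    using ex[OF that] p by auto
  moreover have "p u = u" if "u \<in> U" for u
    using p[OF that right_submodule_zero[OF V]] cl that by simp
  ultimately show "\<exists>p. summand A M U p"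
    using U by (auto simp: summand_def)
next
  interpret M: right_module A M by fact
  assume "\<exists>p. summand A M U p"
  then obtain p where p: "summand A M U p"
    by blast
  note D = summandD[OF p]
  interpret p: rmod_hom A M M p by (rule D(2))
  have "U \<inter> a_kernel M M p = {\<zero>\<^bsub>M\<^esub>}"
    using D(4) right_submodule_zero[OF D(1)] by (auto simp: p.a_kernel_eq p.hom_zero)
  moreover have "U <+>\<^bsub>M\<^esub> a_kernel M M p = carrier M"
  proof
    show "U <+>\<^bsub>M\<^esub> a_kernel M M p \<subseteq> carrier M"
      using D(5) by (auto simp: set_add_iff p.a_kernel_eq)
    show "carrier M \<subseteq> U <+>\<^bsub>M\<^esub> a_kernel M M p"
    proof
      fix x assume x: "x \<in> carrier M"
      have "x = p x \<oplus>\<^bsub>M\<^esub> (x \<ominus>\<^bsub>M\<^esub> p x)"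
        using x p.hom_closed[OF x] by (simp add: a_minus_def M.grp.a_lcomm M.grp.r_neg)
      moreover have "x \<ominus>\<^bsub>M\<^esub> p x \<in> a_kernel M M p"
        using p.eq_iff_minus_in_kernel[OF x p.hom_closed[OF x]] D(4)[OF D(3)[OF x]] by simp
      ultimately show "x \<in> U <+>\<^bsub>M\<^esub> a_kernel M M p"
        using D(3)[OF x] by (auto simp: set_add_iff)
    qed
  qed
  ultimately show "\<exists>V. direct_decomposition A M U V"
    using D(1) p.submodule_kernel by (auto simp: direct_decomposition_def)
qed

text \<open>The summands of a decomposition are the image and the kernel of an idempotent, so
  indecomposability says that zero and the identity are the only idempotents. Endomorphisms are
  easier to compare across \<pi> than submodules.\<close>

lemma indecomposable_iff:
  assumes M: "right_module A M"
  shows "indecomposable A M \<longleftrightarrow> carrier M \<noteq> {\<zero>\<^bsub>M\<^esub>} \<and>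
    (\<forall>p. rmod_hom A M M p \<and> (\<forall>x \<in> carrier M. p (p x) = p x) \<longrightarrow>
      (\<forall>x \<in> carrier M. p x = \<zero>\<^bsub>M\<^esub>) \<or> (\<forall>x \<in> carrier M. p x = x))"
proof (intro iffI conjI allI impI)
  interpret M: right_module A M by fact
  assume ind: "indecomposable A M"
  then show "carrier M \<noteq> {\<zero>\<^bsub>M\<^esub>}"
    by (simp add: indecomposable_def)
  fix p assume p: "rmod_hom A M M p \<and> (\<forall>x \<in> carrier M. p (p x) = p x)"
  interpret p: rmod_hom A M M p using p by simp
  have s: "summand A M (p ` carrier M) p"
    using p by (intro summand_idempotent) auto
  then obtain V where V: "direct_decomposition A M (p ` carrier M) V"
    using direct_decomposition_iff_summand[OF M] by blast
  then consider "p ` carrier M = {\<zero>\<^bsub>M\<^esub>}" | "V = {\<zero>\<^bsub>M\<^esub>}"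
    using ind unfolding indecomposable_def by blast
  then show "(\<forall>x \<in> carrier M. p x = \<zero>\<^bsub>M\<^esub>) \<or> (\<forall>x \<in> carrier M. p x = x)"
  proof cases
    case 1
    then show ?thesis
      by blast
  next
    case 2
    have "x \<in> p ` carrier M" if x: "x \<in> carrier M" for x
    proof -
      have "x \<in> p ` carrier M <+>\<^bsub>M\<^esub> V"
        using V x by (simp add: direct_decomposition_def)
      then show ?thesis
        using 2 p.hom_closed by (auto simp: set_add_iff)
    qed
    then have "\<forall>x \<in> carrier M. p x = x"
      using p by fastforce
    then show ?thesis ..
  qed
next
  interpret M: right_module A M by fact
  assume *: "carrier M \<noteq> {\<zero>\<^bsub>M\<^esub>} \<and>
    (\<forall>p. rmod_hom A M M p \<and> (\<forall>x \<in> carrier M. p (p x) = p x) \<longrightarrow>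
      (\<forall>x \<in> carrier M. p x = \<zero>\<^bsub>M\<^esub>) \<or> (\<forall>x \<in> carrier M. p x = x))"
  show "indecomposable A M"
    unfolding indecomposable_def
  proof (intro conjI allI impI)
    show "carrier M \<noteq> {\<zero>\<^bsub>M\<^esub>}"
      using * by simp
    fix U V assume UV: "direct_decomposition A M U V"
    then obtain p where p: "summand A M U p"
      using direct_decomposition_iff_summand[OF M] by blast
    note D = summandD[OF p]
    have V: "right_submodule A M V" "U \<inter> V = {\<zero>\<^bsub>M\<^esub>}"
      using UV by (simp_all add: direct_decomposition_def)
    have "\<forall>x \<in> carrier M. p (p x) = p x"
      using D(3,4) by blast
    then consider "\<forall>x \<in> carrier M. p x = \<zero>\<^bsub>M\<^esub>" | "\<forall>x \<in> carrier M. p x = x"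
      using * D(2) by blast
    then show "U = {\<zero>\<^bsub>M\<^esub>} \<or> V = {\<zero>\<^bsub>M\<^esub>}"
    proof cases
      case 1
      have "u = \<zero>\<^bsub>M\<^esub>" if "u \<in> U" for u
        using D(4)[OF that] bspec[OF 1 D(5)[OF that]] by simp
      then have "U = {\<zero>\<^bsub>M\<^esub>}"
        using right_submodule_zero[OF D(1)] by blast
      then show ?thesis ..
    next
      case 2
      have "v \<in> U" if "v \<in> V" for v
      proof -
        have v: "v \<in> carrier M"
          using right_submodule_subset[OF V(1)] that by blast
        then show ?thesis
          using D(3)[OF v] bspec[OF 2 v] by simp
      qed
      then have "V \<subseteq> U"
        by blast
      then show ?thesis
        using V(2) by blast
    qed
  qed
qed

lemma indecomposable_iso:
  assumes f: "rmod_hom A M N f" "bij_betw f (carrier M) (carrier N)" and ind: "indecomposable A M"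
  shows "indecomposable A N"
proof -
  note M = rmod_hom_source[OF f(1)] and N = rmod_hom_target[OF f(1)]
  let ?g = "inv_into (carrier M) f"
  have g: "rmod_hom A N M ?g"
    by (rule rmod_hom_inv_into[OF f])
  interpret f: rmod_hom A M N f by (rule f(1))
  interpret g: rmod_hom A N M ?g by (rule g)
  have fg: "f (?g y) = y" if "y \<in> carrier N" for y
    by (rule bij_betw_inv_into_right[OF f(2) that])
  have gf: "?g (f x) = x" if "x \<in> carrier M" for x
    by (rule bij_betw_inv_into_left[OF f(2) that])
  have *: "(\<forall>x \<in> carrier M. p x = \<zero>\<^bsub>M\<^esub>) \<or> (\<forall>x \<in> carrier M. p x = x)"
    if "rmod_hom A M M p" "\<forall>x \<in> carrier M. p (p x) = p x" for p
    using ind that unfolding indecomposable_iff[OF M] by blast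
  show ?thesis
    unfolding indecomposable_iff[OF N]
  proof (intro conjI allI impI notI)
    assume zero: "carrier N = {\<zero>\<^bsub>N\<^esub>}"
    have "x = \<zero>\<^bsub>M\<^esub>" if "x \<in> carrier M" for x
      using gf[OF that] f.hom_closed[OF that] zero g.hom_zero by auto
    then have "carrier M = {\<zero>\<^bsub>M\<^esub>}"
      using f.src.grp.zero_closed by blast
    then show False
      using ind by (simp add: indecomposable_def)
  next
    fix p assume p: "rmod_hom A N N p \<and> (\<forall>y \<in> carrier N. p (p y) = p y)"
    interpret p: rmod_hom A N N p using p by simp
    have "rmod_hom A M M (\<lambda>x. ?g (p (f x)))"
      by (rule rmod_hom_comp[OF rmod_hom_comp[OF f(1) p.rmod_hom_axioms] g])
    moreover have "\<forall>x \<in> carrier M. ?g (p (f (?g (p (f x))))) = ?g (p (f x))"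
      using p fg p.hom_closed f.hom_closed by simp
    ultimately consider "\<forall>x \<in> carrier M. ?g (p (f x)) = \<zero>\<^bsub>M\<^esub>" | "\<forall>x \<in> carrier M. ?g (p (f x)) = x"
      using *[of "\<lambda>x. ?g (p (f x))"] by blast
    then show "(\<forall>y \<in> carrier N. p y = \<zero>\<^bsub>N\<^esub>) \<or> (\<forall>y \<in> carrier N. p y = y)"
    proof cases
      case 1
      have "p y = \<zero>\<^bsub>N\<^esub>" if y: "y \<in> carrier N" for y
      proof -
        have "?g (p y) = \<zero>\<^bsub>M\<^esub>"
          using bspec[OF 1 g.hom_closed[OF y]] unfolding fg[OF y] .
        then have "f (?g (p y)) = \<zero>\<^bsub>N\<^esub>"
          by (simp only: f.hom_zero)
        then show ?thesis
          unfolding fg[OF p.hom_closed[OF y]] .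
      qed
      then show ?thesis
        by blast
    next
      case 2
      have "p y = y" if y: "y \<in> carrier N" for y
      proof -
        have "?g (p y) = ?g y"
          using bspec[OF 2 g.hom_closed[OF y]] unfolding fg[OF y] .
        then have "f (?g (p y)) = f (?g y)"
          by (rule arg_cong)
        then show ?thesis
          unfolding fg[OF p.hom_closed[OF y]] fg[OF y] .
      qed
      then show ?thesis
        by blast
    qed
  qed
qed

lemma indecomposable_summands_iff:
  assumes "right_module A M"
  shows "U \<in> indecomposable_summands A M \<longleftrightarrow>
    (\<exists>p. summand A M U p) \<and> indecomposable A (M\<lparr>carrier := U\<rparr>)"
  using direct_decomposition_iff_summand[OF assms, of U] by (auto simp: indecomposable_summands_def)

lemma equiv_right_iso_summands:
  assumes "right_module A M"
  shows "equiv (indecomposable_summands A M)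
    {(U, V). U \<in> indecomposable_summands A M \<and> V \<in> indecomposable_summands A M \<and>
        right_iso A (M\<lparr>carrier := U\<rparr>) (M\<lparr>carrier := V\<rparr>)}"
proof -
  have mod: "right_module A (M\<lparr>carrier := U\<rparr>)" if "U \<in> indecomposable_summands A M" for U
    using that summandD(8) unfolding indecomposable_summands_iff[OF assms] by blast
  show ?thesis
    by (rule equivI) (auto simp: refl_on_def sym_def trans_def mod right_iso_refl
      intro: right_iso_sym[OF mod mod] right_iso_trans[OF mod mod mod])
qed

lemma num_summands_eqI:
  assumes M: "right_module A M" and N: "right_module B N"
    and g: "\<And>U. U \<in> indecomposable_summands A M \<Longrightarrow> g U \<in> indecomposable_summands B N"
    and iso: "\<And>U V. \<lbrakk>U \<in> indecomposable_summands A M; V \<in> indecomposable_summands A M\<rbrakk> \<Longrightarrow>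
      right_iso A (M\<lparr>carrier := U\<rparr>) (M\<lparr>carrier := V\<rparr>) \<longleftrightarrow>
      right_iso B (N\<lparr>carrier := g U\<rparr>) (N\<lparr>carrier := g V\<rparr>)"
    and surj: "\<And>W. W \<in> indecomposable_summands B N \<Longrightarrow>
      \<exists>U \<in> indecomposable_summands A M. right_iso B (N\<lparr>carrier := g U\<rparr>) (N\<lparr>carrier := W\<rparr>)"
  shows "num_summands A M = num_summands B N"
  unfolding num_summands_def
proof (rule card_quotient_eq[OF equiv_right_iso_summands[OF M] equiv_right_iso_summands[OF N], of g])
  show "g \<in> indecomposable_summands A M \<rightarrow> indecomposable_summands B N"
    using g by blast
qed (use g iso surj in auto)

text \<open>Required because \<open>ind (regular_right L)\<close> is only isomorphic to the regular
  module of \<Gamma>, on a different type.\<close>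

lemma num_summands_iso:
  assumes "right_module A M" "right_module A N" "right_iso A M N"
  shows "num_summands A M = num_summands A N"
proof -
  obtain f where f: "rmod_hom A M N f" "bij_betw f (carrier M) (carrier N)"
    using assms by (auto simp: right_iso_iff)
  let ?h = "inv_into (carrier M) f"
  have h: "rmod_hom A N M ?h" "bij_betw ?h (carrier N) (carrier M)"
    by (rule rmod_hom_inv_into[OF f], rule bij_betw_inv_into[OF f(2)])
  have hf: "?h (f x) = x" if "x \<in> carrier M" for x
    by (rule bij_betw_inv_into_left[OF f(2) that])
  have fh: "f (?h y) = y" if "y \<in> carrier N" for y
    by (rule bij_betw_inv_into_right[OF f(2) that])
  \<comment> \<open>Stated for arbitrary modules and types so that it applies to the isomorphism and
    to its inverse.\<close>
  have *: "f ` U \<in> indecomposable_summands A N \<and> right_iso A (M\<lparr>carrier := U\<rparr>) (N\<lparr>carrier := f ` U\<rparr>)"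
    if M: "right_module A M" and N: "right_module A N" and f: "rmod_hom A M N f"
      and h: "rmod_hom A N M h" and hf: "\<And>x. x \<in> carrier M \<Longrightarrow> h (f x) = x"
      and fh: "\<And>y. y \<in> carrier N \<Longrightarrow> f (h y) = y"
      and U: "U \<in> indecomposable_summands A M"
    for M :: "('a, 'm, 'u) right_module_scheme" and N :: "('a, 'n, 'v) right_module_scheme" and f h U
  proof -
    interpret f: rmod_hom A M N f by fact
    interpret h: rmod_hom A N M h by fact
    obtain p where p: "summand A M U p" and ind: "indecomposable A (M\<lparr>carrier := U\<rparr>)"
      using U unfolding indecomposable_summands_iff[OF M] by blast
    note D = summandD[OF p]
    have fU: "right_submodule A N (f ` U)"
      by (rule f.submodule_image[OF D(1)])
    have s: "summand A N (f ` U) (\<lambda>y. f (p (h y)))"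
      unfolding summand_def using fU rmod_hom_comp[OF rmod_hom_comp[OF h D(2)] f] D(3,4,5) hf h.hom_closed
      by auto
    have fres: "rmod_hom A (M\<lparr>carrier := U\<rparr>) (N\<lparr>carrier := f ` U\<rparr>) f"
      by (rule rmod_hom_restrict_codomain[OF rmod_hom_restrict_domain[OF f D(1)] fU]) simp
    have bij: "bij_betw f (carrier (M\<lparr>carrier := U\<rparr>)) (carrier (N\<lparr>carrier := f ` U\<rparr>))"
      using D(5) hf by (auto simp: bij_betw_def intro!: inj_on_inverseI[of _ h])
    show ?thesis
      unfolding indecomposable_summands_iff[OF N]
      using s indecomposable_iso[OF fres bij ind] right_iso_iff[OF D(8) summandD(8)[OF s]] fres bij by blast
  qed
  have f_sum: "f ` U \<in> indecomposable_summands A N \<and> right_iso A (M\<lparr>carrier := U\<rparr>) (N\<lparr>carrier := f ` U\<rparr>)"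
    if "U \<in> indecomposable_summands A M" for U
    by (rule *[OF assms(1,2) f(1) h(1) hf fh that])
  have h_sum: "?h ` W \<in> indecomposable_summands A M \<and> right_iso A (N\<lparr>carrier := W\<rparr>) (M\<lparr>carrier := ?h ` W\<rparr>)"
    if "W \<in> indecomposable_summands A N" for W
    by (rule *[OF assms(2,1) h(1) f(1) fh hf that])
  have modM: "right_module A (M\<lparr>carrier := U\<rparr>)" if "U \<in> indecomposable_summands A M" for U
    using that summandD(8) unfolding indecomposable_summands_iff[OF assms(1)] by blast
  have modN: "right_module A (N\<lparr>carrier := U\<rparr>)" if "U \<in> indecomposable_summands A N" for U
    using that summandD(8) unfolding indecomposable_summands_iff[OF assms(2)] by blast
  show ?thesis
  proof (rule num_summands_eqI[OF assms(1,2), of "\<lambda>U. f ` U"])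
    show "f ` U \<in> indecomposable_summands A N" if "U \<in> indecomposable_summands A M" for U
      using f_sum[OF that] by blast
    show "right_iso A (M\<lparr>carrier := U\<rparr>) (M\<lparr>carrier := V\<rparr>) \<longleftrightarrow>
        right_iso A (N\<lparr>carrier := f ` U\<rparr>) (N\<lparr>carrier := f ` V\<rparr>)"
      if U: "U \<in> indecomposable_summands A M" and V: "V \<in> indecomposable_summands A M" for U V
    proof -
      note fU = f_sum[OF U] and fV = f_sum[OF V]
      note mods = modM[OF U] modM[OF V] modN[OF conjunct1[OF fU]] modN[OF conjunct1[OF fV]]
      show ?thesis
        using right_iso_trans right_iso_sym fU fV mods by meson
    qed
    show "\<exists>U \<in> indecomposable_summands A M. right_iso A (N\<lparr>carrier := f ` U\<rparr>) (N\<lparr>carrier := W\<rparr>)"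
      if W: "W \<in> indecomposable_summands A N" for W
    proof -
      have "f ` ?h ` W = W"
        using fh W summandD(5) unfolding indecomposable_summands_iff[OF assms(2)] by force
      then show ?thesis
        using h_sum[OF W] right_iso_refl[OF modN[OF W]] by (intro bexI[of _ "?h ` W"]) auto
    qed
  qed
qed

section \<open>Summands of \<open>M\<close> and summands of \<open>ind M\<close>\<close>

context split_ext
begin

text \<open>Reduction modulo \<open>E\<close> applied to a map \<open>F\<close>. The second claim
  says that \<open>ret\<close> intertwines \<open>F\<close> with the induced map, so reducing
  respects composition: shadows of idempotents are idempotent and shadows of inverses are
  inverse.\<close>

lemma ind_hom_shadow:
  assumes M: "right_module L M" and N: "right_module L N" and F: "rmod_hom G (ind M) (ind N) F"
  shows "rmod_hom L M N (\<lambda>m. ret N (F (emb M m)))"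
    "\<And>z. z \<in> carrier (ind M) \<Longrightarrow> ret N (F z) = ret N (F (emb M (ret M z)))"
proof -
  show hom: "rmod_hom L M N (\<lambda>m. ret N (F (emb M m)))"
    by (rule rmod_hom_comp[OF rmod_hom_comp[OF rmod_hom_emb[OF M]
        rmod_hom_restrict_scalars[OF F ring_L \<sigma>]] ret_hom_L[OF N]])
  show "ret N (F z) = ret N (F (emb M (ret M z)))" if z: "z \<in> carrier (ind M)" for z
    by (rule ind_hom_unique[OF M rmod_hom_comp[OF F ret(1)[OF N]]
        rmod_hom_comp[OF ret(1)[OF M] rmod_hom_pi[OF hom]] _ z])
      (use ret(2)[OF M] in simp)
qed

text \<open>
  An idempotent endomorphism of \<open>ind M\<close> induces one of \<open>M\<close>, and by Nakayama's lemma it is trivial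
  if the induced one is.
\<close>

lemma indecomposable_ind:
  assumes M: "fg_right_module L M" and ind: "indecomposable L M"
  shows "indecomposable G (ind M)"
proof -
  have Mm: "right_module L M"
    by (rule fg_imp_right_module[OF M])
  interpret I: right_module G "ind M" by (rule right_module_ind[OF Mm])
  interpret r: rmod_hom G "ind M" "restrict_scalars \<pi> M" "ret M" by (rule ret(1)[OF Mm])
  show ?thesis
    unfolding indecomposable_iff[OF I.right_module_axioms]
  proof (intro conjI allI impI notI)
    assume zero: "carrier (ind M) = {\<zero>\<^bsub>ind M\<^esub>}"
    have "carrier M = ret M ` carrier (ind M)"
      using ret_surj[OF Mm] by simp
    also have "\<dots> = {\<zero>\<^bsub>M\<^esub>}"
      unfolding zero using r.hom_zero by simp
    finally show False
      using ind by (simp add: indecomposable_def)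
  next
    fix e assume e: "rmod_hom G (ind M) (ind M) e \<and> (\<forall>z \<in> carrier (ind M). e (e z) = e z)"
    interpret e: rmod_hom G "ind M" "ind M" e using e by simp
    have ee: "e (e z) = e z" if "z \<in> carrier (ind M)" for z
      using e that by blast
    let ?f = "\<lambda>m. ret M (e (emb M m))"
    note sh = ind_hom_shadow[OF Mm Mm e.rmod_hom_axioms]
    have "\<forall>m \<in> carrier M. ?f (?f m) = ?f m"
      using sh(2)[OF e.hom_closed[OF emb_closed[OF Mm]]] ee[OF emb_closed[OF Mm]] by simp
    then consider "\<forall>m \<in> carrier M. ?f m = \<zero>\<^bsub>M\<^esub>" | "\<forall>m \<in> carrier M. ?f m = m"
      using ind sh(1) unfolding indecomposable_iff[OF Mm] by blast
    then show "(\<forall>z \<in> carrier (ind M). e z = \<zero>\<^bsub>ind M\<^esub>) \<or> (\<forall>z \<in> carrier (ind M). e z = z)"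
    proof cases
      case 1
      have re: "ret M (e z) = \<zero>\<^bsub>M\<^esub>" if z: "z \<in> carrier (ind M)" for z
        using sh(2)[OF z] 1 ret_closed[OF Mm z] by simp
      \<comment> \<open>The shadow of \<open>e\<close> is zero, so \<open>1 - e\<close> induces the
        identity and is bijective. Every \<open>z\<close> is then \<open>y - e y\<close>, which
        \<open>e\<close> annihilates.\<close>
      let ?h = "\<lambda>z. z \<ominus>\<^bsub>ind M\<^esub> e z"
      have h: "rmod_hom G (ind M) (ind M) ?h"
        by (rule rmod_hom_minus[OF rmod_hom_id[OF I.right_module_axioms] e.rmod_hom_axioms])
      have "ret M (?h z) = ret M z" if z: "z \<in> carrier (ind M)" for z
      proof -
        have "ret M (?h z) = ret M z \<oplus>\<^bsub>M\<^esub> \<zero>\<^bsub>M\<^esub>"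
          using r.hom_add[OF z I.grp.a_inv_closed[OF e.hom_closed[OF z]]] re[OF I.grp.a_inv_closed[OF z]] z
          by (simp add: a_minus_def e.hom_a_inv[symmetric])
        then show ?thesis
          using ret_closed[OF Mm z] Mm by (simp add: right_module_def abelian_group_def abelian_monoid.r_zero)
      qed
      then have bij: "bij_betw ?h (carrier (ind M)) (carrier (ind M))"
        by (rule ind_endo_bij[OF M h])
      have "e z = \<zero>\<^bsub>ind M\<^esub>" if z: "z \<in> carrier (ind M)" for z
      proof -
        have "z \<in> ?h ` carrier (ind M)"
          using bij_betw_imp_surj_on[OF bij] z by simp
        then obtain y where y: "y \<in> carrier (ind M)" "z = ?h y"
          by blast
        have "e (?h y) = e y \<ominus>\<^bsub>ind M\<^esub> e (e y)"
          by (rule e.hom_minus[OF y(1) e.hom_closed[OF y(1)]])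
        then show ?thesis
          using y ee[OF y(1)] e.hom_closed[OF y(1)] by (simp add: a_minus_def I.grp.r_neg)
      qed
      then show ?thesis
        by blast
    next
      case 2
      have "ret M (e z) = ret M z" if z: "z \<in> carrier (ind M)" for z
        using sh(2)[OF z] 2 ret_closed[OF Mm z] by simp
      then have bij: "bij_betw e (carrier (ind M)) (carrier (ind M))"
        by (rule ind_endo_bij[OF M e.rmod_hom_axioms])
      \<comment> \<open>An injective idempotent is the identity, since
        \<open>e (e z) = e z\<close>.\<close>
      have "e z = z" if z: "z \<in> carrier (ind M)" for z
        by (rule inj_onD[OF bij_betw_imp_inj_on[OF bij] ee[OF z] e.hom_closed[OF z] z])
      then show ?thesis
        by blast
    qed
  qed
qed

text \<open>One direction is functoriality, where inverse identities are checked on elements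
  \<open>m \<otimes> 1\<close>. In the other, an isomorphism and its inverse have mutually inverse
  shadows. Hence induction is injective on isomorphism classes.\<close>

lemma ind_iso_iff:
  assumes M: "right_module L M" and N: "right_module L N"
  shows "right_iso G (ind M) (ind N) \<longleftrightarrow> right_iso L M N"
proof
  assume "right_iso L M N"
  then obtain f where f: "rmod_hom L M N f" "bij_betw f (carrier M) (carrier N)"
    using right_iso_iff[OF M N] by blast
  let ?g = "inv_into (carrier M) f"
  have g: "rmod_hom L N M ?g"
    by (rule rmod_hom_inv_into[OF f])
  obtain F where F: "rmod_hom G (ind M) (ind N) F" "\<forall>m \<in> carrier M. F (emb M m) = emb N (f m)"
    by (rule ind_map_exists[OF f(1)])
  obtain H where H: "rmod_hom G (ind N) (ind M) H" "\<forall>n \<in> carrier N. H (emb N n) = emb M (?g n)"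
    by (rule ind_map_exists[OF g])
  have "H (F z) = z" if z: "z \<in> carrier (ind M)" for z
    by (rule ind_hom_unique[OF M rmod_hom_comp[OF F(1) H(1)] rmod_hom_id[OF right_module_ind[OF M]] _ z])
      (use F(2) H(2) rmod_hom.hom_closed[OF f(1)] bij_betw_inv_into_left[OF f(2)] in simp)
  moreover have "F (H z) = z" if z: "z \<in> carrier (ind N)" for z
    by (rule ind_hom_unique[OF N rmod_hom_comp[OF H(1) F(1)] rmod_hom_id[OF right_module_ind[OF N]] _ z])
      (use F(2) H(2) rmod_hom.hom_closed[OF g] bij_betw_inv_into_right[OF f(2)] in simp)
  ultimately have "bij_betw F (carrier (ind M)) (carrier (ind N))"
    using rmod_hom.hom_closed[OF F(1)] rmod_hom.hom_closed[OF H(1)]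
    by (intro bij_betw_byWitness[where f' = H]) auto
  then show "right_iso G (ind M) (ind N)"
    using F(1) right_iso_iff[OF right_module_ind[OF M] right_module_ind[OF N]] by blast
next
  assume "right_iso G (ind M) (ind N)"
  then obtain F where F: "rmod_hom G (ind M) (ind N) F" "bij_betw F (carrier (ind M)) (carrier (ind N))"
    using right_iso_iff[OF right_module_ind[OF M] right_module_ind[OF N]] by blast
  let ?H = "inv_into (carrier (ind M)) F"
  have H: "rmod_hom G (ind N) (ind M) ?H"
    by (rule rmod_hom_inv_into[OF F])
  note sF = ind_hom_shadow[OF M N F(1)] and sH = ind_hom_shadow[OF N M H]
  let ?f = "\<lambda>m. ret N (F (emb M m))" and ?h = "\<lambda>n. ret M (?H (emb N n))"
  have "?h (?f m) = m" if m: "m \<in> carrier M" for m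
  proof -
    have "F (emb M m) \<in> carrier (ind N)"
      by (rule rmod_hom.hom_closed[OF F(1) emb_closed[OF M m]])
    then have "?h (?f m) = ret M (?H (F (emb M m)))"
      using sH(2) by simp
    then show ?thesis
      using bij_betw_inv_into_left[OF F(2) emb_closed[OF M m]] ret(2)[OF M m] by simp
  qed
  moreover have "?f (?h n) = n" if n: "n \<in> carrier N" for n
  proof -
    have "?H (emb N n) \<in> carrier (ind M)"
      by (rule rmod_hom.hom_closed[OF H emb_closed[OF N n]])
    then have "?f (?h n) = ret N (F (?H (emb N n)))"
      using sF(2) by simp
    then show ?thesis
      using bij_betw_inv_into_right[OF F(2) emb_closed[OF N n]] ret(2)[OF N n] by simp
  qed
  ultimately have "bij_betw ?f (carrier M) (carrier N)"
    using rmod_hom.hom_closed[OF sF(1)] rmod_hom.hom_closed[OF sH(1)]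
    by (intro bij_betw_byWitness[where f' = ?h]) auto
  then show "right_iso L M N"
    using sF(1) right_iso_iff[OF M N] by blast
qed

text \<open>\<open>ind V\<close> is not a subset of \<open>ind M\<close>, so the summand is its
  image under the induced inclusion \<open>J\<close>; the induced projection \<open>R\<close> splits
  \<open>J\<close>.\<close>

lemma ind_summand:
  assumes M: "right_module L M" and p: "summand L M V p"
  obtains U P where "summand G (ind M) U P" "right_iso G (ind (M\<lparr>carrier := V\<rparr>)) ((ind M)\<lparr>carrier := U\<rparr>)"
proof -
  note D = summandD[OF p]
  let ?V = "M\<lparr>carrier := V\<rparr>"
  obtain J where J: "rmod_hom G (ind ?V) (ind M) J" "\<forall>v \<in> carrier ?V. J (emb ?V v) = emb M v"
    by (rule ind_map_exists[OF D(7)])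
  obtain R where R: "rmod_hom G (ind M) (ind ?V) R" "\<forall>m \<in> carrier M. R (emb M m) = emb ?V (p m)"
    by (rule ind_map_exists[OF D(6)])
  have RJ: "R (J z) = z" if z: "z \<in> carrier (ind ?V)" for z
    by (rule ind_hom_unique[OF D(8) rmod_hom_comp[OF J(1) R(1)] rmod_hom_id[OF right_module_ind[OF D(8)]] _ z])
      (use J(2) R(2) D(4,5) in simp)
  let ?U = "J ` carrier (ind ?V)"
  have U: "right_submodule G (ind M) ?U"
    by (rule rmod_hom.submodule_image[OF J(1) right_submodule_carrier[OF right_module_ind[OF D(8)]]])
  have s: "summand G (ind M) ?U (\<lambda>z. J (R z))"
    unfolding summand_def using U rmod_hom_comp[OF R(1) J(1)] rmod_hom.hom_closed[OF R(1)] RJ by auto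
  have "rmod_hom G (ind ?V) ((ind M)\<lparr>carrier := ?U\<rparr>) J"
    by (rule rmod_hom_restrict_codomain[OF J(1) U]) simp
  moreover have "bij_betw J (carrier (ind ?V)) (carrier ((ind M)\<lparr>carrier := ?U\<rparr>))"
    using RJ by (auto simp: bij_betw_def intro!: inj_on_inverseI[of _ R])
  ultimately have "right_iso G (ind ?V) ((ind M)\<lparr>carrier := ?U\<rparr>)"
    using right_iso_iff[OF right_module_ind[OF D(8)] summandD(8)[OF s]] by blast
  then show ?thesis
    by (rule that[OF s])
qed

text \<open>
  Conversely, let \<open>e\<close> be the projection onto a summand \<open>U\<close> of \<open>ind M\<close> and \<open>V\<close> the image of the
  idempotent that \<open>e\<close> induces on \<open>M\<close>. Then \<open>U\<close> is the image of \<open>ind V\<close> under \<open>e\<close>, because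
  \<open>e J R e + (1 - e)\<close> is the identity modulo the kernel of \<open>ret M\<close> and hence invertible.
\<close>

lemma summand_ind:
  assumes M: "fg_right_module L M" and e: "summand G (ind M) U e"
  obtains V p where "summand L M V p" "right_iso G (ind (M\<lparr>carrier := V\<rparr>)) ((ind M)\<lparr>carrier := U\<rparr>)"
proof -
  have Mm: "right_module L M"
    by (rule fg_imp_right_module[OF M])
  note E = summandD[OF e]
  interpret I: right_module G "ind M" by (rule right_module_ind[OF Mm])
  interpret e: rmod_hom G "ind M" "ind M" e by (rule E(2))
  interpret r: rmod_hom G "ind M" "restrict_scalars \<pi> M" "ret M" by (rule ret(1)[OF Mm])
  have ee: "e (e z) = e z" if "z \<in> carrier (ind M)" for z
    using E(3,4) that by blast
  define p where "p m = ret M (e (emb M m))" for m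
  note sh = ind_hom_shadow[OF Mm Mm E(2), folded p_def]
  interpret p: rmod_hom L M M p using sh(1) by (simp add: p_def[abs_def])
  have pp: "p (p m) = p m" if m: "m \<in> carrier M" for m
  proof -
    have "ret M (e (e (emb M m))) = p (ret M (e (emb M m)))"
      by (rule sh(2)[OF e.hom_closed[OF emb_closed[OF Mm m]]])
    then show ?thesis
      using ee[OF emb_closed[OF Mm m]] by (simp add: p_def)
  qed
  let ?V = "p ` carrier M"
  have s: "summand L M ?V p"
    by (rule summand_idempotent[OF p.rmod_hom_axioms pp])
  note D = summandD[OF s]
  let ?W = "M\<lparr>carrier := ?V\<rparr>"
  have fgW: "fg_right_module L ?W"
    by (rule fg_submodule[OF L M D(1)])
  obtain J where J: "rmod_hom G (ind ?W) (ind M) J" "\<forall>v \<in> carrier ?W. J (emb ?W v) = emb M v"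
    "\<forall>z \<in> carrier (ind ?W). ret M (J z) = ret ?W z"
    by (rule ind_map_exists[OF D(7)])
  obtain R where R: "rmod_hom G (ind M) (ind ?W) R" "\<forall>m \<in> carrier M. R (emb M m) = emb ?W (p m)"
    "\<forall>z \<in> carrier (ind M). ret ?W (R z) = p (ret M z)"
    by (rule ind_map_exists[OF D(6)])
  interpret J: rmod_hom G "ind ?W" "ind M" J by (rule J(1))
  interpret R: rmod_hom G "ind M" "ind ?W" R by (rule R(1))
  have retW: "ret ?W z \<in> ?V" if "z \<in> carrier (ind ?W)" for z
    using ret_closed[OF D(8) that] by simp
  \<comment> \<open>A map of \<open>ind V\<close> into itself through \<open>U\<close>. On
    \<open>V\<close> its shadow is \<open>p\<close>, which is the identity there, so it is bijective
    and in particular \<open>e J\<close> is injective.\<close>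
  let ?c = "\<lambda>z. R (e (J z))"
  have c: "rmod_hom G (ind ?W) (ind ?W) ?c"
    by (rule rmod_hom_comp[OF rmod_hom_comp[OF J(1) E(2)] R(1)])
  have "ret ?W (?c z) = ret ?W z" if z: "z \<in> carrier (ind ?W)" for z
  proof -
    have "ret ?W (?c z) = p (ret M (e (J z)))"
      using R(3) e.hom_closed[OF J.hom_closed[OF z]] by blast
    also have "\<dots> = p (p (ret M (J z)))"
      using sh(2)[OF J.hom_closed[OF z]] by (simp add: p_def)
    also have "\<dots> = ret ?W z"
      using J(3) z D(4)[OF retW[OF z]] by simp
    finally show ?thesis .
  qed
  then have c_bij: "bij_betw ?c (carrier (ind ?W)) (carrier (ind ?W))"
    by (rule ind_endo_bij[OF fgW c])
  have inj: "inj_on (\<lambda>z. e (J z)) (carrier (ind ?W))"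
    using bij_betw_imp_inj_on[OF c_bij] by (auto simp: inj_on_def)
  let ?h = "\<lambda>z. e (J (R (e z))) \<oplus>\<^bsub>ind M\<^esub> (z \<ominus>\<^bsub>ind M\<^esub> e z)"
  have h: "rmod_hom G (ind M) (ind M) ?h"
    by (rule rmod_hom_add[OF rmod_hom_comp[OF rmod_hom_comp[OF rmod_hom_comp[OF E(2) R(1)] J(1)] E(2)]
        rmod_hom_minus[OF rmod_hom_id[OF I.right_module_axioms] E(2)]])
  have "ret M (?h z) = ret M z" if z: "z \<in> carrier (ind M)" for z
  proof -
    have ez: "e z \<in> carrier (ind M)" and JR: "J (R (e z)) \<in> carrier (ind M)"
      using e.hom_closed[OF z] J.hom_closed[OF R.hom_closed] by auto
    have q: "ret M z \<in> carrier M"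
      by (rule ret_closed[OF Mm z])
    have rez: "ret M (e z) = p (ret M z)"
      using sh(2)[OF z] by (simp add: p_def)
    have "ret M (e (J (R (e z)))) = p (ret M (J (R (e z))))"
      using sh(2)[OF JR] by (simp add: p_def)
    also have "ret M (J (R (e z))) = p (ret M (e z))"
      using J(3) R(3) R.hom_closed[OF ez] ez by simp
    finally have 1: "ret M (e (J (R (e z)))) = p (ret M z)"
      using rez pp[OF q] pp[OF p.hom_closed[OF q]] by simp
    have "ret M (?h z) = ret M (e (J (R (e z)))) \<oplus>\<^bsub>M\<^esub> (ret M z \<oplus>\<^bsub>M\<^esub> ret M (\<ominus>\<^bsub>ind M\<^esub> e z))"
      using r.hom_add[OF e.hom_closed[OF JR], of "z \<ominus>\<^bsub>ind M\<^esub> e z"]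
        r.hom_add[OF z I.grp.a_inv_closed[OF ez]] z ez by (simp add: a_minus_def)
    moreover have "ret M (\<ominus>\<^bsub>ind M\<^esub> e z) = p (\<ominus>\<^bsub>M\<^esub> ret M z)"
    proof -
      have "ret M (\<ominus>\<^bsub>ind M\<^esub> e z) = ret M (e (\<ominus>\<^bsub>ind M\<^esub> z))"
        using e.hom_a_inv[OF z] by simp
      also have "\<dots> = p (ret M (\<ominus>\<^bsub>ind M\<^esub> z))"
        using sh(2)[OF I.grp.a_inv_closed[OF z]] by (simp add: p_def)
      also have "ret M (\<ominus>\<^bsub>ind M\<^esub> z) = \<ominus>\<^bsub>M\<^esub> ret M z"
      proof -
        have "ret M (\<ominus>\<^bsub>ind M\<^esub> z) \<oplus>\<^bsub>M\<^esub> ret M z = \<zero>\<^bsub>M\<^esub>"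
          using r.hom_add[OF I.grp.a_inv_closed[OF z] z] r.hom_zero z by (simp add: I.grp.l_neg)
        then show ?thesis
          using p.src.grp.minus_equality ret_closed[OF Mm] I.grp.a_inv_closed[OF z] z by simp
      qed
      finally show ?thesis .
    qed
    ultimately show ?thesis
      using 1 q p.hom_closed[OF q] p.hom_a_inv[OF q]
      by (simp add: p.src.grp.a_lcomm p.src.grp.r_neg)
  qed
  then have h_bij: "bij_betw ?h (carrier (ind M)) (carrier (ind M))"
    by (rule ind_endo_bij[OF M h])
  have img: "(\<lambda>z. e (J z)) ` carrier (ind ?W) = U"
  proof
    show "(\<lambda>z. e (J z)) ` carrier (ind ?W) \<subseteq> U"
      using E(3) J.hom_closed by auto
    show "U \<subseteq> (\<lambda>z. e (J z)) ` carrier (ind ?W)"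
    proof
      fix u assume u: "u \<in> U"
      have "u \<in> ?h ` carrier (ind M)"
        using bij_betw_imp_surj_on[OF h_bij] E(5)[OF u] by simp
      then obtain z where z: "z \<in> carrier (ind M)" "u = ?h z"
        by blast
      have ez: "e z \<in> carrier (ind M)" and JR: "J (R (e z)) \<in> carrier (ind M)"
        using e.hom_closed[OF z(1)] J.hom_closed[OF R.hom_closed] by auto
      \<comment> \<open>Applying \<open>e\<close>, which fixes \<open>u\<close>, removes the part
        \<open>z - e z\<close> and leaves \<open>u\<close> in the image of
        \<open>e J\<close>.\<close>
      have "u = e (?h z)"
        using E(4)[OF u] z(2) by simp
      also have "\<dots> = e (e (J (R (e z)))) \<oplus>\<^bsub>ind M\<^esub> (e z \<ominus>\<^bsub>ind M\<^esub> e (e z))"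
        using e.hom_add[OF e.hom_closed[OF JR], of "z \<ominus>\<^bsub>ind M\<^esub> e z"] e.hom_minus[OF z(1) ez] z(1) ez
        by simp
      also have "\<dots> = e (J (R (e z)))"
        using ee[OF JR] ee[OF z(1)] ez e.hom_closed[OF JR] by (simp add: a_minus_def I.grp.r_neg)
      finally show "u \<in> (\<lambda>z. e (J z)) ` carrier (ind ?W)"
        using R.hom_closed[OF ez] by blast
    qed
  qed
  have "rmod_hom G (ind ?W) ((ind M)\<lparr>carrier := U\<rparr>) (\<lambda>z. e (J z))"
    by (rule rmod_hom_comp[OF J(1) E(6)])
  moreover have "bij_betw (\<lambda>z. e (J z)) (carrier (ind ?W)) (carrier ((ind M)\<lparr>carrier := U\<rparr>))"
    using inj img by (simp add: bij_betw_def)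
  ultimately have "right_iso G (ind ?W) ((ind M)\<lparr>carrier := U\<rparr>)"
    using right_iso_iff[OF right_module_ind[OF D(8)] E(8)] by blast
  then show ?thesis
    by (rule that[OF s])
qed

text \<open>An idempotent of \<open>M\<close> induces an idempotent of \<open>ind M\<close>. If the
  induced one is zero or the identity, comparing its values on \<open>m \<otimes> 1\<close> through
  \<open>ret\<close> shows the same for the original.\<close>

lemma indecomposable_of_ind:
  assumes M: "right_module L M" and ind: "indecomposable G (ind M)"
  shows "indecomposable L M"
  unfolding indecomposable_iff[OF M]
proof (intro conjI allI impI notI)
  interpret I: right_module G "ind M" by (rule right_module_ind[OF M])
  assume zero: "carrier M = {\<zero>\<^bsub>M\<^esub>}"
  have "carrier (ind M) = {\<zero>\<^bsub>ind M\<^esub>}"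
  proof (rule emb_generates[OF M right_submodule_zero_set[OF I.right_module_axioms], symmetric])
    fix m assume "m \<in> carrier M"
    then show "emb M m \<in> {\<zero>\<^bsub>ind M\<^esub>}"
      using zero rmod_hom.hom_zero[OF rmod_hom_emb[OF M]] by simp
  qed
  then show False
    using ind by (simp add: indecomposable_def)
next
  fix p assume p: "rmod_hom L M M p \<and> (\<forall>m \<in> carrier M. p (p m) = p m)"
  then have hom: "rmod_hom L M M p"
    by simp
  have p_closed: "p m \<in> carrier M" if "m \<in> carrier M" for m
    by (rule rmod_hom.hom_closed[OF hom that])
  obtain F where F: "rmod_hom G (ind M) (ind M) F" "\<forall>m \<in> carrier M. F (emb M m) = emb M (p m)"
    by (rule ind_map_exists[OF hom])
  have "\<forall>z \<in> carrier (ind M). F (F z) = F z"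
  proof
    fix z assume z: "z \<in> carrier (ind M)"
    show "F (F z) = F z"
      by (rule ind_hom_unique[OF M rmod_hom_comp[OF F(1) F(1)] F(1) _ z]) (use F(2) p p_closed in simp)
  qed
  then consider "\<forall>z \<in> carrier (ind M). F z = \<zero>\<^bsub>ind M\<^esub>" | "\<forall>z \<in> carrier (ind M). F z = z"
    using ind F(1) unfolding indecomposable_iff[OF right_module_ind[OF M]] by blast
  then show "(\<forall>m \<in> carrier M. p m = \<zero>\<^bsub>M\<^esub>) \<or> (\<forall>m \<in> carrier M. p m = m)"
  proof cases
    case 1
    have "p m = \<zero>\<^bsub>M\<^esub>" if m: "m \<in> carrier M" for m
      using bspec[OF 1 emb_closed[OF M m]] bspec[OF F(2) m] ret(2)[OF M p_closed[OF m]]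
        rmod_hom.hom_zero[OF ret(1)[OF M]] by simp
    then show ?thesis
      by blast
  next
    case 2
    have "p m = m" if m: "m \<in> carrier M" for m
      using bspec[OF 2 emb_closed[OF M m]] bspec[OF F(2) m] ret(2)[OF M p_closed[OF m]] ret(2)[OF M m]
      by simp
    then show ?thesis
      by blast
  qed
qed

text \<open>Each indecomposable summand \<open>V\<close> is sent to a chosen summand of
  \<open>ind M\<close> isomorphic to \<open>ind V\<close>. \<open>ind_iso_iff\<close> makes this
  respect and reflect isomorphism, and \<open>summand_ind\<close> together with
  \<open>indecomposable_of_ind\<close> makes it hit every class.\<close>

theorem num_summands_ind:
  assumes M: "fg_right_module L M"
  shows "num_summands L M = num_summands G (ind M)"
proof -
  have Mm: "right_module L M"
    by (rule fg_imp_right_module[OF M])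
  note I = right_module_ind[OF Mm]
  let ?S = "indecomposable_summands L M" and ?T = "indecomposable_summands G (ind M)"
  have modL: "right_module L (M\<lparr>carrier := V\<rparr>)" if "V \<in> ?S" for V
    using that summandD(8) unfolding indecomposable_summands_iff[OF Mm] by blast
  have modG: "right_module G ((ind M)\<lparr>carrier := U\<rparr>)" if "U \<in> ?T" for U
    using that summandD(8) unfolding indecomposable_summands_iff[OF I] by blast
  \<comment> \<open>The isomorphisms used run between tensor types of different modules, so
    indecomposability is transferred for arbitrary element types.\<close>
  have transfer: "indecomposable G N'"
    if iso: "right_iso G N N'" and ind: "indecomposable G N"
      and N: "right_module G N" "right_module G N'"
    for N :: "('g, 'n, 'u) right_module_scheme" and N' :: "('g, 'o, 'v) right_module_scheme"
  proof -
    obtain f where "rmod_hom G N N' f" "bij_betw f (carrier N) (carrier N')"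
      using right_iso_iff[OF N] iso by blast
    then show ?thesis
      by (rule indecomposable_iso[OF _ _ ind])
  qed
  have ex: "\<exists>U \<in> ?T. right_iso G (ind (M\<lparr>carrier := V\<rparr>)) ((ind M)\<lparr>carrier := U\<rparr>)" if V: "V \<in> ?S" for V
  proof -
    obtain p where p: "summand L M V p" and ind: "indecomposable L (M\<lparr>carrier := V\<rparr>)"
      using V unfolding indecomposable_summands_iff[OF Mm] by blast
    obtain U P where U: "summand G (ind M) U P"
      "right_iso G (ind (M\<lparr>carrier := V\<rparr>)) ((ind M)\<lparr>carrier := U\<rparr>)"
      by (rule ind_summand[OF Mm p])
    have "indecomposable G (ind (M\<lparr>carrier := V\<rparr>))"
      by (rule indecomposable_ind[OF fg_submodule[OF L M summandD(1)[OF p]] ind])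
    then have "indecomposable G ((ind M)\<lparr>carrier := U\<rparr>)"
      by (rule transfer[OF U(2) _ right_module_ind[OF modL[OF V]] summandD(8)[OF U(1)]])
    then have "U \<in> ?T"
      using U(1) by (auto simp: indecomposable_summands_iff[OF I])
    then show ?thesis
      using U(2) by (rule bexI[rotated])
  qed
  define g where "g V = (SOME U. U \<in> ?T \<and> right_iso G (ind (M\<lparr>carrier := V\<rparr>)) ((ind M)\<lparr>carrier := U\<rparr>))" for V
  have g: "g V \<in> ?T" "right_iso G (ind (M\<lparr>carrier := V\<rparr>)) ((ind M)\<lparr>carrier := g V\<rparr>)" if V: "V \<in> ?S" for V
  proof -
    have "\<exists>U. U \<in> ?T \<and> right_iso G (ind (M\<lparr>carrier := V\<rparr>)) ((ind M)\<lparr>carrier := U\<rparr>)"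
      using ex[OF V] by blast
    then have "g V \<in> ?T \<and> right_iso G (ind (M\<lparr>carrier := V\<rparr>)) ((ind M)\<lparr>carrier := g V\<rparr>)"
      unfolding g_def by (rule someI_ex)
    then show "g V \<in> ?T" "right_iso G (ind (M\<lparr>carrier := V\<rparr>)) ((ind M)\<lparr>carrier := g V\<rparr>)"
      by auto
  qed
  show ?thesis
  proof (rule num_summands_eqI[OF Mm I, of g])
    show "g V \<in> ?T" if "V \<in> ?S" for V
      by (rule g(1)[OF that])
    show "right_iso L (M\<lparr>carrier := V\<rparr>) (M\<lparr>carrier := W\<rparr>) \<longleftrightarrow>
        right_iso G ((ind M)\<lparr>carrier := g V\<rparr>) ((ind M)\<lparr>carrier := g W\<rparr>)"
      if V: "V \<in> ?S" and W: "W \<in> ?S" for V W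
    proof -
      note mods = right_module_ind[OF modL[OF V]] right_module_ind[OF modL[OF W]]
        modG[OF g(1)[OF V]] modG[OF g(1)[OF W]]
      have "right_iso G (ind (M\<lparr>carrier := V\<rparr>)) (ind (M\<lparr>carrier := W\<rparr>)) \<longleftrightarrow>
          right_iso G ((ind M)\<lparr>carrier := g V\<rparr>) ((ind M)\<lparr>carrier := g W\<rparr>)"
        using right_iso_trans right_iso_sym g(2)[OF V] g(2)[OF W] mods by meson
      then show ?thesis
        using ind_iso_iff[OF modL[OF V] modL[OF W]] by simp
    qed
    show "\<exists>V \<in> ?S. right_iso G ((ind M)\<lparr>carrier := g V\<rparr>) ((ind M)\<lparr>carrier := U\<rparr>)" if U: "U \<in> ?T" for U
    proof -
      obtain e where e: "summand G (ind M) U e" and ind: "indecomposable G ((ind M)\<lparr>carrier := U\<rparr>)"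
        using U unfolding indecomposable_summands_iff[OF I] by blast
      obtain V p where V: "summand L M V p"
        "right_iso G (ind (M\<lparr>carrier := V\<rparr>)) ((ind M)\<lparr>carrier := U\<rparr>)"
        by (rule summand_ind[OF M e])
      note VM = summandD(8)[OF V(1)]
      have "indecomposable G (ind (M\<lparr>carrier := V\<rparr>))"
        by (rule transfer[OF right_iso_sym[OF right_module_ind[OF VM] modG[OF U] V(2)] ind
            modG[OF U] right_module_ind[OF VM]])
      then have VS: "V \<in> ?S"
        using V(1) indecomposable_of_ind[OF VM] unfolding indecomposable_summands_iff[OF Mm] by blast
      have "right_iso G ((ind M)\<lparr>carrier := g V\<rparr>) ((ind M)\<lparr>carrier := U\<rparr>)"
        by (rule right_iso_trans[OF modG[OF g(1)[OF VS]] right_module_ind[OF VM] modG[OF U]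
            right_iso_sym[OF right_module_ind[OF VM] modG[OF g(1)[OF VS]] g(2)[OF VS]] V(2)])
      then show ?thesis
        using VS by blast
    qed
  qed
qed

text \<open>The isomorphism is \<open>a \<otimes> g \<mapsto> \<sigma>(a) g\<close>, with inverse
  \<open>g \<mapsto> 1 \<otimes> g\<close>.\<close>

lemma ind_regular_iso: "right_iso G (ind (regular_right L)) (regular_right G)"
proof -
  note reg_L = right_module_regular[OF ring_L] and reg_G = right_module_regular[OF ring_G]
  interpret I: right_module G "ind (regular_right L)" by (rule right_module_ind[OF reg_L])
  let ?e = "emb (regular_right L)"
  have e1: "?e \<one>\<^bsub>L\<^esub> \<in> carrier (ind (regular_right L))"
    by (rule emb_closed[OF reg_L]) simp
  have "rmod_hom L (regular_right L) (restrict_scalars \<sigma> (regular_right G)) \<sigma>"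
    by (intro rmod_homI reg_L right_module_restrict_scalars[OF reg_G ring_L \<sigma>])
      (auto simp: hom_simps \<sigma>_closed)
  then obtain F where F: "rmod_hom G (ind (regular_right L)) (regular_right G) F"
    "\<forall>a \<in> carrier (regular_right L). F (?e a) = \<sigma> a"
    by (rule ind_extend[OF reg_L reg_G])
  let ?H = "\<lambda>g. ?e \<one>\<^bsub>L\<^esub> \<star>\<^bsub>ind (regular_right L)\<^esub> g"
  have H: "rmod_hom G (regular_right G) (ind (regular_right L)) ?H"
    by (rule I.rmod_hom_orbit[OF e1])
  have "?H (F z) = z" if z: "z \<in> carrier (ind (regular_right L))" for z
  proof (rule ind_hom_unique[OF reg_L rmod_hom_comp[OF F(1) H] rmod_hom_id[OF I.right_module_axioms] _ z])
    fix a assume a: "a \<in> carrier (regular_right L)"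
    have "F (?e a) = \<sigma> a"
      using F(2) a by blast
    moreover have "?e a = ?H (\<sigma> a)"
      using rmod_hom.hom_ract[OF rmod_hom_emb[OF reg_L], of "\<one>\<^bsub>L\<^esub>" a] a by simp
    ultimately show "?H (F (?e a)) = ?e a"
      by (simp only:)
  qed
  moreover have "F (?H g) = g" if g: "g \<in> carrier G" for g
    using rmod_hom.hom_ract[OF F(1) e1 g] bspec[OF F(2), of "\<one>\<^bsub>L\<^esub>"] g by (simp add: hom_simps)
  ultimately have "bij_betw F (carrier (ind (regular_right L))) (carrier (regular_right G))"
    using rmod_hom.hom_closed[OF F(1)] rmod_hom.hom_closed[OF H]
    by (intro bij_betw_byWitness[where f' = ?H]) auto
  then show ?thesis
    using F(1) right_iso_iff[OF I.right_module_axioms reg_G] by blast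
qed

text \<open>Both algebras have the same number of indecomposable projectives, so the counting
  condition has the same right-hand side on both sides of the equivalence.\<close>

lemma num_summands_regular: "num_summands L (regular_right L) = num_summands G (regular_right G)"
  using num_summands_ind[OF fg_regular[OF ring_L]]
    num_summands_iso[OF right_module_ind[OF right_module_regular[OF ring_L]]
      right_module_regular[OF ring_G] ind_regular_iso] by simp

text \<open>The definition is compared clause by clause: rigidity contributes the condition on
  \<open>Hom(T \<otimes> E, \<tau> T)\<close>, vanishing of \<open>Hom(P, T)\<close> contributes
  that on \<open>Hom(P, T \<otimes> E)\<close>, and the count of summands is unchanged by
  induction.\<close>

theorem support_tau_tilting_pair_ind_iff:
  assumes T: "fg_right_module L T" and P: "fg_right_module L P" "projective L P"
  shows "support_tau_tilting_pair K G (ind T) (ind P) \<longleftrightarrow>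
    support_tau_tilting_pair K L T P \<and> hom_zero L (tenE T) (tau K L T) \<and> hom_zero L P (tenE T)"
proof -
  note Tm = fg_imp_right_module[OF T] and Pm = fg_imp_right_module[OF P(1)]
  have "hom_zero G (ind P) (ind T) \<longleftrightarrow> hom_zero L P T \<and> hom_zero L P (tenE T)"
    using hom_zero_ind_iff[OF Pm right_module_ind[OF Tm]] hom_zero_ind_target_iff[OF Tm Pm] by simp
  then show ?thesis
    unfolding support_tau_tilting_pair_def tau_rigid_pair_def tau_rigid_def
    using T P projective_ind[OF P(2)] fg_ind[OF T] hom_zero_tau_ind_iff[OF T]
      num_summands_ind[OF T] num_summands_ind[OF P(1)] num_summands_regular by auto
qed

end

theorem theorem1p1:
  fixes K :: "'k ring"
    and \<Lambda> :: "('k, 'a) module"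
    and \<Gamma> :: "('k, 'g) module"
    and \<pi> :: "'g \<Rightarrow> 'a"
    and \<sigma> :: "'a \<Rightarrow> 'g"
    and T :: "('a, 't) right_module"
    and P :: "('a, 'p) right_module"
  assumes "algebraically_closed K"
    and "fd_algebra K \<Lambda>" and "basic_algebra \<Lambda>"
    and "fd_algebra K \<Gamma>" and "basic_algebra \<Gamma>"
    and "split_extension K \<Lambda> \<Gamma> \<pi> \<sigma>"
    and "fg_right_module \<Lambda> T"
    and "fg_right_module \<Lambda> P" and "projective \<Lambda> P"
  shows "support_tau_tilting_pair K \<Gamma>
            (tensor \<Lambda> T (extension_bimodule \<Gamma> \<sigma>)) (tensor \<Lambda> P (extension_bimodule \<Gamma> \<sigma>))
         \<longleftrightarrow>
         support_tau_tilting_pair K \<Lambda> T P \<and>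
         hom_zero \<Lambda> (tensor \<Lambda> T (kernel_bimodule \<Lambda> \<Gamma> \<pi> \<sigma>)) (tau K \<Lambda> T) \<and>
         hom_zero \<Lambda> P (tensor \<Lambda> T (kernel_bimodule \<Lambda> \<Gamma> \<pi> \<sigma>))"
proof -
  interpret split_ext K \<Lambda> \<Gamma> \<pi> \<sigma>
    by (intro split_ext.intro assms(2,4,6))
  show ?thesis
    by (rule support_tau_tilting_pair_ind_iff[OF assms(7-9)])
qed

end
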